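(* Let $d\ge2$ and let $f:\mathbb R\to\mathbb R$ be an analytic function with positive radius of convergence (at $0$) and such that $f(0)=0$. 1) For any smooth solution $u$ of $\Delta u=f(u)$ on $B(0,1)\subset\mathbb R^d$, there exist $0<r_0<1$, a solution $u_L$ of $\Delta u_L=0$ and an analytic function $g$ on $B(0,r_0)$ such that $u$ can be written $$u=u_L+|x|^2g\quad\text{on }B(0,r_0).\qquad (F)$$ 2) Reciprocally, for any bounded solution $u_L$ of $\Delta u_L=0$ on $B(0,1)$ with $u_L(0)=0$, there exist $0<r_0\le1$ and a unique small analytic solution $u$ of $\Delta u=f(u)$ on $B(0,r_0)$ such that $(F)$ holds for some $g$ analytic on $B(0,r_0)$. Moreover, the map $u_L\mapsto u$ is injective.
   Context: "Unique small solution" means: there exists $\varepsilon>0$ such that $u$ is the unique solution (with the stated property) in the ball of radius $\varepsilon$ centered at $0$ of the space $\mathcal Z^0_{s,r_0}$ defined as follows, for a fixed $s>\frac d2+\frac32$. $P_\ell$ is the $L^2(\mathbb S^{d-1})$-orthogonal projection onto spherical harmonics of degree $\ell\in\mathbb N$, $\langle\ell\rangle=\sqrt{1+\ell^2}$; $u(r\,\cdot)$ denotes $y\mapsto u(ry)$ on $\mathbb S^{d-1}$. For $0<r\le1$, $Z^0_{s,r}$ is the completion of finite linear combinations of spherical harmonics for $\|v\|_{Z^0_{s,r}}=\big(\sum_{\ell\ge0}\langle\ell\rangle^{2s}r^{-2\ell}\|P_\ell v\|_{L^2}^2\big)^{1/2}$. $\mathcal Z^0_{s,r_0}$ is the set of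 $u$ on $\overline{B(0,r_0)}$ such that for all $0<r\le r_0$, $u(r\,\cdot)\in Z^0_{s,r/r_0}$, $(\partial_ru)(r\,\cdot)\in Z^0_{s-1,r/r_0}$, $\rho\mapsto u(\rho\,\cdot)$ is in $\mathscr C((0,r],Z^0_{s,r/r_0})\cap\mathscr C^1((0,r],Z^0_{s-1,r/r_0})$, with finite norm $\|u\|_{\mathcal Z^0_{s,r_0}}=r_0^{\frac{d-2}2}\sup_{0<r\le r_0}\big(\|u(r\,\cdot)\|_{Z^0_{s,r/r_0}}+\|(\tfrac{d-2}2u+r\partial_ru)(r\,\cdot)\|_{Z^0_{s-1,r/r_0}}\big)$. *)

theory Defs
  imports "HOL-Analysis.Analysis"
begin

section \<open>Differential operators and regularity on $\mathbb{R}^d$\<close>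

definition partial_deriv :: "'n::finite \<Rightarrow> (real^'n \<Rightarrow> real) \<Rightarrow> real^'n \<Rightarrow> real" where
  "partial_deriv i u x = frechet_derivative u (at x) (axis i 1)"

definition laplacian :: "(real^'n::finite \<Rightarrow> real) \<Rightarrow> real^'n \<Rightarrow> real" where
  "laplacian u x = (\<Sum>i\<in>UNIV. partial_deriv i (partial_deriv i u) x)"

text \<open>The next two notions are only meant for open sets \<open>S\<close>.\<close>

primrec Ck_on :: "nat \<Rightarrow> (real^'n::finite) set \<Rightarrow> (real^'n \<Rightarrow> real) \<Rightarrow> bool" where
  "Ck_on 0 S u \<longleftrightarrow> continuous_on S u"
| "Ck_on (Suc k) S u \<longleftrightarrow>
     (\<forall>x\<in>S. u differentiable at x) \<and> (\<forall>i. Ck_on k S (partial_deriv i u))"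

definition smooth_on :: "(real^'n::finite) set \<Rightarrow> (real^'n \<Rightarrow> real) \<Rightarrow> bool" where
  "smooth_on S u \<longleftrightarrow> (\<forall>k. Ck_on k S u)"

definition harmonic_on :: "(real^'n::finite) set \<Rightarrow> (real^'n \<Rightarrow> real) \<Rightarrow> bool" where
  "harmonic_on S u \<longleftrightarrow> Ck_on 2 S u \<and> (\<forall>x\<in>S. laplacian u x = 0)"

definition monomial :: "('n::finite \<Rightarrow> nat) \<Rightarrow> real^'n \<Rightarrow> real" where
  "monomial \<alpha> x = (\<Prod>i\<in>UNIV. (x $ i) ^ \<alpha> i)"

definition analytic_real :: "(real \<Rightarrow> real) \<Rightarrow> bool" where
  "analytic_real f \<longleftrightarrow>
     (\<forall>t\<^sub>0. \<exists>c::nat \<Rightarrow> real. \<exists>\<rho>>0. \<forall>t. \<bar>t - t\<^sub>0\<bar> < \<rho> \<longrightarrow> (\<lambda>n. c n * (t - t\<^sub>0) ^ n) sums f t)"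

definition real_analytic_on :: "(real^'n::finite) set \<Rightarrow> (real^'n \<Rightarrow> real) \<Rightarrow> bool" where
  "real_analytic_on S u \<longleftrightarrow>
     (\<forall>x\<^sub>0\<in>S. \<exists>c::('n \<Rightarrow> nat) \<Rightarrow> real. \<exists>\<rho>>0. \<forall>x\<in>ball x\<^sub>0 \<rho>.
        ((\<lambda>\<alpha>. c \<alpha> * monomial \<alpha> (x - x\<^sub>0)) has_sum u x) UNIV)"


section \<open>Spherical harmonics\<close>

text \<open>Surface measure on the unit sphere, through polar coordinates:
  \<open>\<sigma>(A) = d |{t y | y \<in> A, 0 < t < 1}|\<close>.\<close>

definition sphere_measure :: "(real^'n::finite) measure" where
  "sphere_measure =
     distr (scale_measure (of_nat CARD('n)) (restrict_space lborel (ball 0 1 - {0})))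
       (restrict_space borel (sphere 0 1)) sgn"

definition L2_sphere :: "(real^'n::finite \<Rightarrow> real) set" where
  "L2_sphere = {v. v \<in> borel_measurable sphere_measure \<and> integrable sphere_measure (\<lambda>y. (v y)\<^sup>2)}"

definition L2_sphere_norm :: "(real^'n::finite \<Rightarrow> real) \<Rightarrow> real" where
  "L2_sphere_norm v = sqrt (\<integral>y. (v y)\<^sup>2 \<partial>sphere_measure)"

text \<open>A spherical harmonic is represented by its unique extension to a homogeneous harmonic
  polynomial on the whole space; below it is only evaluated on the sphere.\<close>

definition spherical_harmonics :: "nat \<Rightarrow> (real^'n::finite \<Rightarrow> real) set" where
  "spherical_harmonics l =
     {Y. (\<exists>c. Y = (\<lambda>x. \<Sum>\<alpha> | (\<Sum>i\<in>UNIV. \<alpha> i) = l. c \<alpha> * monomial \<alpha> x)) \<and> (\<forall>x. laplacian Y x = 0)}"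

definition harmonic_combinations :: "(real^'n::finite \<Rightarrow> real) set" where
  "harmonic_combinations =
     {v. \<exists>N H. (\<forall>l. H l \<in> spherical_harmonics l) \<and> v = (\<lambda>y. \<Sum>l\<le>(N::nat). H l y)}"

text \<open>The orthogonal projection in $L^2$ of the sphere onto spherical harmonics of degree \<open>l\<close>.\<close>

definition sph_proj :: "nat \<Rightarrow> (real^'n::finite \<Rightarrow> real) \<Rightarrow> real^'n \<Rightarrow> real" where
  "sph_proj l v =
     (THE Y. Y \<in> spherical_harmonics l \<and>
        (\<forall>W\<in>spherical_harmonics l. (\<integral>y. (v y - Y y) * W y \<partial>sphere_measure) = 0))"


section \<open>The spaces \<open>Z\<^sup>0\<^sub>s\<^sub>,\<^sub>r\<close> on the sphere\<close>

definition Z_term :: "real \<Rightarrow> real \<Rightarrow> (real^'n::finite \<Rightarrow> real) \<Rightarrow> nat \<Rightarrow> real" where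
  "Z_term s r v l =
     sqrt (1 + (real l)\<^sup>2) powr (2 * s) / r ^ (2 * l) * (L2_sphere_norm (sph_proj l v))\<^sup>2"

definition Z_norm :: "real \<Rightarrow> real \<Rightarrow> (real^'n::finite \<Rightarrow> real) \<Rightarrow> real" where
  "Z_norm s r v = sqrt (\<Sum>l. Z_term s r v l)"

text \<open>For \<open>s \<ge> 0\<close> and \<open>0 < r \<le> 1\<close> the norm dominates the $L^2$ norm, so the completion of the
  finite combinations of spherical harmonics is realised as a space of (representatives of)
  $L^2$ functions. The summability condition says that the norm of \<open>v - Y n\<close> is finite, since
  a divergent \<^const>\<open>suminf\<close> has no meaningful value.\<close>

definition Z_space :: "real \<Rightarrow> real \<Rightarrow> (real^'n::finite \<Rightarrow> real) set" where
  "Z_space s r =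
     {v \<in> L2_sphere. \<exists>Y. (\<forall>n. Y n \<in> harmonic_combinations) \<and>
        (\<forall>n. summable (Z_term s r (\<lambda>y. v y - Y n y))) \<and>
        (\<lambda>n. Z_norm s r (\<lambda>y. v y - Y n y)) \<longlonglongrightarrow> 0}"

text \<open>Continuous curves, and continuously differentiable curves \<open>F\<close> with derivative \<open>F'\<close>, with
  values in \<open>Z\<^sup>0\<^sub>s\<^sub>,\<^sub>r\<close>.\<close>

definition Z_continuous_on ::
    "real \<Rightarrow> real \<Rightarrow> real set \<Rightarrow> (real \<Rightarrow> real^'n::finite \<Rightarrow> real) \<Rightarrow> bool" where
  "Z_continuous_on s r I F \<longleftrightarrow>
     (\<forall>t\<in>I. F t \<in> Z_space s r) \<and>
     (\<forall>t\<in>I. ((\<lambda>\<tau>. Z_norm s r (\<lambda>y. F \<tau> y - F t y)) \<longlongrightarrow> 0) (at t within I))"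

definition Z_C1_on ::
    "real \<Rightarrow> real \<Rightarrow> real set \<Rightarrow> (real \<Rightarrow> real^'n::finite \<Rightarrow> real) \<Rightarrow>
      (real \<Rightarrow> real^'n \<Rightarrow> real) \<Rightarrow> bool" where
  "Z_C1_on s r I F F' \<longleftrightarrow>
     Z_continuous_on s r I F \<and> Z_continuous_on s r I F' \<and>
     (\<forall>t\<in>I. ((\<lambda>\<tau>. Z_norm s r (\<lambda>y. (F \<tau> y - F t y) / (\<tau> - t) - F' t y)) \<longlongrightarrow> 0) (at t within I))"


section \<open>The space on the ball of radius \<open>r\<^sub>0\<close>\<close>

text \<open>Since \<open>u\<close> is only given on the closed ball, the radial derivative is one-sided on its boundary.\<close>

definition radial_deriv :: "real \<Rightarrow> (real^'n::finite \<Rightarrow> real) \<Rightarrow> real^'n \<Rightarrow> real" where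
  "radial_deriv r\<^sub>0 u x = vector_derivative (\<lambda>\<rho>. u (\<rho> *\<^sub>R sgn x)) (at (norm x) within {0<..r\<^sub>0})"

definition Zball_slice_norm :: "real \<Rightarrow> real \<Rightarrow> (real^'n::finite \<Rightarrow> real) \<Rightarrow> real \<Rightarrow> real" where
  "Zball_slice_norm s r\<^sub>0 u r =
     Z_norm s (r / r\<^sub>0) (\<lambda>y. u (r *\<^sub>R y)) +
     Z_norm (s - 1) (r / r\<^sub>0)
       (\<lambda>y. (real CARD('n) - 2) / 2 * u (r *\<^sub>R y) + r * radial_deriv r\<^sub>0 u (r *\<^sub>R y))"

definition Zball_norm :: "real \<Rightarrow> real \<Rightarrow> (real^'n::finite \<Rightarrow> real) \<Rightarrow> real" where
  "Zball_norm s r\<^sub>0 u =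
     r\<^sub>0 powr ((real CARD('n) - 2) / 2) * (SUP r\<in>{0<..r\<^sub>0}. Zball_slice_norm s r\<^sub>0 u r)"

definition Zball_space :: "real \<Rightarrow> real \<Rightarrow> (real^'n::finite \<Rightarrow> real) set" where
  "Zball_space s r\<^sub>0 =
     {u. (\<forall>r\<in>{0<..r\<^sub>0}.
            (\<lambda>y. u (r *\<^sub>R y)) \<in> Z_space s (r / r\<^sub>0) \<and>
            (\<lambda>y. radial_deriv r\<^sub>0 u (r *\<^sub>R y)) \<in> Z_space (s - 1) (r / r\<^sub>0) \<and>
            Z_continuous_on s (r / r\<^sub>0) {0<..r} (\<lambda>\<rho> y. u (\<rho> *\<^sub>R y)) \<and>
            Z_C1_on (s - 1) (r / r\<^sub>0) {0<..r}
              (\<lambda>\<rho> y. u (\<rho> *\<^sub>R y)) (\<lambda>\<rho> y. radial_deriv r\<^sub>0 u (\<rho> *\<^sub>R y))) \<and>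
         bdd_above (Zball_slice_norm s r\<^sub>0 u ` {0<..r\<^sub>0})}"


section \<open>Analytic solutions with prescribed harmonic part\<close>

text \<open>The decomposition (F): \<open>u = u\<^sub>L + |x|\<^sup>2 g\<close> on the ball of radius \<open>r\<^sub>0\<close>, with \<open>g\<close> analytic.\<close>

definition decomposes ::
    "real \<Rightarrow> (real^'n::finite \<Rightarrow> real) \<Rightarrow> (real^'n \<Rightarrow> real) \<Rightarrow> bool" where
  "decomposes r\<^sub>0 u u\<^sub>L \<longleftrightarrow>
     (\<exists>g. real_analytic_on (ball 0 r\<^sub>0) g \<and> (\<forall>x\<in>ball 0 r\<^sub>0. u x = u\<^sub>L x + (norm x)\<^sup>2 * g x))"

definition analytic_solution ::
    "(real \<Rightarrow> real) \<Rightarrow> (real^'n::finite \<Rightarrow> real) \<Rightarrow> real \<Rightarrow> (real^'n \<Rightarrow> real) \<Rightarrow> bool" where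
  "analytic_solution f u\<^sub>L r\<^sub>0 u \<longleftrightarrow>
     real_analytic_on (ball 0 r\<^sub>0) u \<and>
     (\<forall>x\<in>ball 0 r\<^sub>0. laplacian u x = f (u x)) \<and>
     decomposes r\<^sub>0 u u\<^sub>L"

text \<open>Uniqueness is uniqueness as a function on the open ball and, on the boundary sphere, as an
  element of $L^2$: a member of \<^const>\<open>Zball_space\<close> is only determined up to null sets there.\<close>

definition unique_small_solution ::
    "(real \<Rightarrow> real) \<Rightarrow> real \<Rightarrow> (real^'n::finite \<Rightarrow> real) \<Rightarrow> real \<Rightarrow> (real^'n \<Rightarrow> real) \<Rightarrow> bool" where
  "unique_small_solution f s u\<^sub>L r\<^sub>0 u \<longleftrightarrow>
     (\<exists>\<epsilon>>0.
        u \<in> Zball_space s r\<^sub>0 \<and> Zball_norm s r\<^sub>0 u < \<epsilon> \<and> analytic_solution f u\<^sub>L r\<^sub>0 u \<and>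
        (\<forall>v. v \<in> Zball_space s r\<^sub>0 \<and> Zball_norm s r\<^sub>0 v < \<epsilon> \<and> analytic_solution f u\<^sub>L r\<^sub>0 v \<longrightarrow>
           (\<forall>x\<in>ball 0 r\<^sub>0. v x = u x) \<and>
           (AE y in sphere_measure. v (r\<^sub>0 *\<^sub>R y) = u (r\<^sub>0 *\<^sub>R y))))"

end

theory Submission
  imports Defs "HOL-Library.Function_Algebras" "HOL-Computational_Algebra.Polynomial"
begin

text \<open>Fischer's decomposition drives the argument: on formal power series the map \<open>v \<mapsto> \<Delta>(|x|\<^sup>2 v)\<close> is
  bijective, and the solution operator \<open>q \<mapsto> |x|\<^sup>2 v\<close> of \<open>\<Delta>(|x|\<^sup>2 v) = q\<close> is bounded in the Bombieri norm of each
  degree. An analytic solution of \<open>\<Delta>u = f(u)\<close> with harmonic part \<open>u\<^sub>L\<close> is therefore a fixed point of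
  \<open>u = u\<^sub>L + |x|\<^sup>2 v\<close>, \<open>\<Delta>(|x|\<^sup>2 v) = f(u)\<close>, whose coefficients are determined recursively and converge by
  a majorant argument, since the Bombieri norm is submultiplicative. Conversely a smooth solution is analytic: the
  maximum principle on half balls gives interior gradient estimates, and applying them to iterated
  directional derivatives on shrinking balls gives factorial bounds.

  In the spaces on the sphere only the terms of degree at least \<open>l\<close> of a power series contribute to its
  projection onto spherical harmonics of degree \<open>l\<close>, by orthogonality, and this gains the factor \<open>r\<^sup>l\<close> that the
  weights ask for. Orthogonality itself comes from rotation invariance, which makes
  \<open>x\<^sub>i \<partial>\<^sub>j F - x\<^sub>j \<partial>\<^sub>i F\<close> have mean zero. Smallness plays no role in the uniqueness: two
  solutions with the same \<open>u\<^sub>L\<close> agree on the open ball, and continuity up to the boundary as curves in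
  \<open>Z\<^sup>0\<^sub>s\<close> makes all their projections agree on the boundary sphere, which suffices by Stone-Weierstrass.\<close>

section \<open>Formal power series in several variables\<close>

text \<open>Sums of absolute values of coefficients suit convergence and differentiation, but
  inverting v \<mapsto> \<Delta>(|x|^2 v) mixes all monomials of one degree, and such sums do not
  control it directly. In the Fischer inner product multiplication by |x|^2 is adjoint to the
  Laplacian, so the commutator of the two operators yields invertibility and bound at once. Passing
  between the two kinds of norm costs a geometric factor in the degree, that is, a fixed shrinking
  of the radius, which is free because only some radius is asked for. The same device pays for the
  weights of the sphere spaces: a series converging absolutely on the cube of half side \<rho> is
  used on the ball of radius \<rho>/4 only, and the spare powers of 1/4 absorb all polynomial
  factors in the degree. In the regularity proof the nonlinearity couples derivatives of all orders;
  weights 1/(k+1)^2, which are stable under convolution up to a constant, keep the constants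
  independent of the order.\<close>

abbreviation mdeg :: "('n::finite \<Rightarrow> nat) \<Rightarrow> nat" where
  "mdeg \<alpha> \<equiv> sum \<alpha> UNIV"

definition idx :: "nat \<Rightarrow> ('n::finite \<Rightarrow> nat) set" where
  "idx k = {\<alpha>. mdeg \<alpha> = k}"

definition mfact :: "('n::finite \<Rightarrow> nat) \<Rightarrow> real" where
  "mfact \<alpha> = (\<Prod>i\<in>UNIV. fact (\<alpha> i))"

text \<open>A power series is represented by its coefficient family. \<open>pd\<close>,
  \<open>xmul\<close>, \<open>lap\<close> and \<open>rsq\<close> are the actions on coefficients of
  a partial derivative, of multiplication by a coordinate, of the Laplacian and of multiplication by
  |x|^2.\<close>

definition pd :: "'n \<Rightarrow> (('n \<Rightarrow> nat) \<Rightarrow> real) \<Rightarrow> ('n \<Rightarrow> nat) \<Rightarrow> real" where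
  "pd i c \<alpha> = real (Suc (\<alpha> i)) * c (\<alpha>(i := Suc (\<alpha> i)))"

definition xmul :: "'n \<Rightarrow> (('n \<Rightarrow> nat) \<Rightarrow> real) \<Rightarrow> ('n \<Rightarrow> nat) \<Rightarrow> real" where
  "xmul i c \<alpha> = (if \<alpha> i = 0 then 0 else c (\<alpha>(i := \<alpha> i - 1)))"

definition lap :: "(('n::finite \<Rightarrow> nat) \<Rightarrow> real) \<Rightarrow> ('n \<Rightarrow> nat) \<Rightarrow> real" where
  "lap c \<alpha> = (\<Sum>i\<in>UNIV. pd i (pd i c) \<alpha>)"

definition rsq :: "(('n::finite \<Rightarrow> nat) \<Rightarrow> real) \<Rightarrow> ('n \<Rightarrow> nat) \<Rightarrow> real" where
  "rsq c \<alpha> = (\<Sum>i\<in>UNIV. xmul i (xmul i c) \<alpha>)"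

text \<open>The Fischer inner product of the parts of degree \<open>k\<close>: pairing p with q
  amounts to applying the constant-coefficient operator p(D) to q.\<close>

definition ip :: "nat \<Rightarrow> (('n::finite \<Rightarrow> nat) \<Rightarrow> real) \<Rightarrow> (('n \<Rightarrow> nat) \<Rightarrow> real) \<Rightarrow> real" where
  "ip k c d = (\<Sum>\<alpha>\<in>idx k. mfact \<alpha> * c \<alpha> * d \<alpha>)"

section \<open>The Fischer inner product and its commutation relations\<close>

lemma le_mdeg: "\<alpha> i \<le> mdeg \<alpha>" for \<alpha> :: "'n::finite \<Rightarrow> nat"
  by (rule member_le_sum) auto

lemma finite_le_fun [simp]: "finite {\<alpha>. \<alpha> \<le> (\<gamma> :: 'n::finite \<Rightarrow> nat)}"
proof -
  have "{\<alpha>. \<alpha> \<le> \<gamma>} = PiE UNIV (\<lambda>i. {..\<gamma> i})"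
    by (auto simp: le_fun_def PiE_def Pi_def)
  then show ?thesis by (simp add: finite_PiE)
qed

lemma finite_idx [simp]: "finite (idx k :: ('n::finite \<Rightarrow> nat) set)"
proof (rule finite_subset)
  show "idx k \<subseteq> {\<alpha>. \<alpha> \<le> (\<lambda>i::'n. k)}"
    using le_mdeg by (auto simp: idx_def le_fun_def)
qed simp

lemma mdeg_upd_Suc: "mdeg (\<alpha>(i := Suc (\<alpha> i))) = Suc (mdeg \<alpha>)" for \<alpha> :: "'n::finite \<Rightarrow> nat"
proof -
  have "mdeg (\<alpha>(i := Suc (\<alpha> i))) = Suc (\<alpha> i) + sum \<alpha> (UNIV - {i})"
    by (subst sum.remove[of _ i]) auto
  also have "\<dots> = Suc (mdeg \<alpha>)" by (subst (2) sum.remove[of _ i]) auto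
  finally show ?thesis .
qed

lemma upd_Suc_idx [simp]: "\<alpha>(i := Suc (\<alpha> i)) \<in> idx (Suc k) \<longleftrightarrow> \<alpha> \<in> idx k"
  by (simp add: idx_def mdeg_upd_Suc del: fun_upd_apply)

lemma mfact_upd_Suc: "mfact (\<alpha>(i := Suc (\<alpha> i))) = real (Suc (\<alpha> i)) * mfact \<alpha>"
proof -
  have "mfact (\<alpha>(i := Suc (\<alpha> i))) = fact (Suc (\<alpha> i)) * (\<Prod>j\<in>UNIV - {i}. fact (\<alpha> j))"
    unfolding mfact_def by (subst prod.remove[of _ i]) auto
  also have "\<dots> = real (Suc (\<alpha> i)) * mfact \<alpha>"
    unfolding mfact_def by (subst (2) prod.remove[of _ i]) auto
  finally show ?thesis .
qed

lemma mfact_pos [simp]: "mfact \<alpha> > 0"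
  by (simp add: mfact_def prod_pos)

text \<open>Raising one exponent multiplies \<open>mfact\<close> by exactly the factor that
  differentiation produces, so differentiation and multiplication by the coordinate are adjoint;
  indices with exponent 0 are killed by \<open>xmul\<close>.\<close>

lemma ip_pd: "ip k (pd i c) d = ip (Suc k) c (xmul i d)"
proof -
  let ?g = "\<lambda>\<alpha>::'a \<Rightarrow> nat. \<alpha>(i := Suc (\<alpha> i))"
  have inj: "inj_on ?g (idx k)"
    by (rule inj_on_inverseI[where g = "\<lambda>\<alpha>. \<alpha>(i := \<alpha> i - 1)"]) auto
  have img: "?g ` idx k = {\<alpha> \<in> idx (Suc k). \<alpha> i \<noteq> 0}" (is "_ = ?R")
  proof (intro equalityI subsetI)
    fix \<alpha> :: "'a \<Rightarrow> nat" assume a: "\<alpha> \<in> ?R"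
    have eq: "\<alpha> = ?g (\<alpha>(i := \<alpha> i - 1))" using a by auto
    from a have "?g (\<alpha>(i := \<alpha> i - 1)) \<in> idx (Suc k)" by (subst eq[symmetric]) simp
    then have "\<alpha>(i := \<alpha> i - 1) \<in> idx k" by (subst (asm) upd_Suc_idx)
    with eq show "\<alpha> \<in> ?g ` idx k" by blast
  qed auto
  have "ip (Suc k) c (xmul i d) = (\<Sum>\<alpha>\<in>{\<alpha> \<in> idx (Suc k). \<alpha> i \<noteq> 0}. mfact \<alpha> * c \<alpha> * xmul i d \<alpha>)"
    unfolding ip_def by (rule sum.mono_neutral_right) (auto simp: xmul_def)
  also have "\<dots> = (\<Sum>\<alpha>\<in>idx k. mfact (?g \<alpha>) * c (?g \<alpha>) * xmul i d (?g \<alpha>))"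
    unfolding img[symmetric] by (subst sum.reindex[OF inj]) (simp add: o_def)
  also have "\<dots> = ip k (pd i c) d"
    unfolding ip_def
    by (rule sum.cong) (auto simp: mfact_upd_Suc xmul_def pd_def simp del: of_nat_Suc)
  finally show ?thesis by simp
qed

lemma ip_commute: "ip k c d = ip k d c"
  by (simp add: ip_def mult_ac)

lemma ip_lap: "ip k (lap c) d = ip (k + 2) c (rsq d)"
proof -
  have "ip k (lap c) d = (\<Sum>i\<in>UNIV. ip k (pd i (pd i c)) d)"
    unfolding ip_def lap_def
    by (subst sum.swap) (simp add: sum_distrib_left sum_distrib_right mult_ac)
  also have "\<dots> = (\<Sum>i\<in>UNIV. ip (k + 2) c (xmul i (xmul i d)))"
    by (simp add: ip_pd)
  also have "\<dots> = ip (k + 2) c (rsq d)"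
    unfolding ip_def rsq_def
    by (subst sum.swap) (simp add: sum_distrib_left sum_distrib_right mult_ac)
  finally show ?thesis .
qed

text \<open>The canonical commutation relation, from which \<open>lap_rsq\<close> is
  computed.\<close>

lemma pd_xmul: "pd i (xmul j c) \<alpha> = xmul j (pd i c) \<alpha> + (if i = j then c \<alpha> else 0)"
proof (cases "i = j")
  case True
  then show ?thesis
    by (cases "\<alpha> j") (auto simp: pd_def xmul_def fun_upd_idem algebra_simps)
next
  case False
  then show ?thesis by (auto simp: pd_def xmul_def fun_upd_twist)
qed

lemma pd_add: "pd i (\<lambda>\<alpha>. c \<alpha> + d \<alpha>) = (\<lambda>\<alpha>. pd i c \<alpha> + pd i d \<alpha>)"
  by (auto simp: pd_def algebra_simps)

lemma xmul_add: "xmul i (\<lambda>\<alpha>. c \<alpha> + d \<alpha>) = (\<lambda>\<alpha>. xmul i c \<alpha> + xmul i d \<alpha>)"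
  by (auto simp: xmul_def)

text \<open>Euler's identity for homogeneous polynomials, on coefficients.\<close>

lemma sum_xmul_pd: "(\<Sum>i\<in>UNIV. xmul i (pd i c) \<alpha>) = real (mdeg \<alpha>) * c \<alpha>"
proof -
  have "xmul i (pd i c) \<alpha> = real (\<alpha> i) * c \<alpha>" for i
    by (cases "\<alpha> i") (auto simp: xmul_def pd_def fun_upd_idem)
  then show ?thesis by (simp add: sum_distrib_right)
qed

lemma pd_pd_xmul_xmul:
  "pd i (pd i (xmul j (xmul j c))) \<alpha> = xmul j (xmul j (pd i (pd i c))) \<alpha>
     + (if i = j then 4 * xmul i (pd i c) \<alpha> + 2 * c \<alpha> else 0)"
proof (cases "i = j")
  case False
  have "pd i (xmul j c) = xmul j (pd i c)" for c using False by (auto simp: pd_xmul)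
  with False show ?thesis by simp
next
  case True
  have p: "pd i (xmul i c) = (\<lambda>\<alpha>. xmul i (pd i c) \<alpha> + c \<alpha>)" for c by (auto simp: pd_xmul)
  have s: "pd i (\<lambda>\<alpha>. 2 * c \<alpha>) = (\<lambda>\<alpha>. 2 * pd i c \<alpha>)" for c by (auto simp: pd_def)
  show ?thesis unfolding True[symmetric] by (simp add: p pd_add xmul_add s)
qed

text \<open>Moving a second derivative past the square of the same coordinate leaves 4 x_i
  \<partial>_i + 2; summed over i this is four times the Euler operator plus 2n.\<close>

lemma lap_rsq: "lap (rsq c) \<alpha> = rsq (lap c) \<alpha> + real (2 * CARD('n) + 4 * mdeg \<alpha>) * c \<alpha>"
  for c :: "('n::finite \<Rightarrow> nat) \<Rightarrow> real"
proof -
  have pds: "pd i (\<lambda>\<alpha>. \<Sum>j\<in>UNIV. g j \<alpha>) = (\<lambda>\<alpha>. \<Sum>j\<in>UNIV. pd i (g j) \<alpha>)" for i :: 'n and g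
    by (auto simp: pd_def sum_distrib_left)
  have xms: "xmul i (\<lambda>\<alpha>. \<Sum>j\<in>UNIV. g j \<alpha>) = (\<lambda>\<alpha>. \<Sum>j\<in>UNIV. xmul i (g j) \<alpha>)" for i :: 'n
    and g :: "'n \<Rightarrow> ('n \<Rightarrow> nat) \<Rightarrow> real"
    by (auto simp: xmul_def)
  have "lap (rsq c) \<alpha> = (\<Sum>i\<in>UNIV. \<Sum>j\<in>UNIV. pd i (pd i (xmul j (xmul j c))) \<alpha>)"
    unfolding lap_def rsq_def[abs_def] by (simp add: pds)
  also have "\<dots> = (\<Sum>i\<in>UNIV. \<Sum>j\<in>UNIV. xmul j (xmul j (pd i (pd i c))) \<alpha>)
     + (\<Sum>i\<in>UNIV. 4 * xmul i (pd i c) \<alpha> + 2 * c \<alpha>)"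
    by (simp add: pd_pd_xmul_xmul sum.distrib)
  also have "(\<Sum>i\<in>UNIV. \<Sum>j\<in>UNIV. xmul j (xmul j (pd i (pd i c))) \<alpha>) = rsq (lap c) \<alpha>"
    unfolding rsq_def lap_def[abs_def] by (subst sum.swap) (simp add: xms)
  also have "(\<Sum>i\<in>UNIV. 4 * xmul i (pd i c) \<alpha> + 2 * c \<alpha>) = 4 * (real (mdeg \<alpha>) * c \<alpha>) + 2 * CARD('n) * c \<alpha>"
    by (simp add: sum.distrib sum_distrib_left[symmetric] sum_xmul_pd)
  finally show ?thesis by (simp add: algebra_simps)
qed

lemma ip_self_nonneg: "ip k c c \<ge> 0"
  unfolding ip_def by (rule sum_nonneg) (simp add: less_imp_le mult.assoc)

lemma ip_self_eq_0: "ip k c c = 0 \<longleftrightarrow> (\<forall>\<alpha>\<in>idx k. c \<alpha> = 0)"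
  unfolding ip_def
  by (subst sum_nonneg_eq_0_iff) (auto simp: less_imp_le mult.assoc less_imp_neq[OF mfact_pos, symmetric])

lemma ip_cong: "(\<And>\<alpha>. \<alpha> \<in> idx k \<Longrightarrow> c \<alpha> = c' \<alpha>) \<Longrightarrow> (\<And>\<alpha>. \<alpha> \<in> idx k \<Longrightarrow> d \<alpha> = d' \<alpha>) \<Longrightarrow> ip k c d = ip k c' d'"
  unfolding ip_def by (rule sum.cong) auto

lemma ip_rsq_self: "ip (k + 2) (rsq v) (rsq v) \<ge> real (2 * CARD('n) + 4 * k) * ip k v v"
  for v :: "('n::finite \<Rightarrow> nat) \<Rightarrow> real"
proof -
  have "ip (k + 2) (rsq v) (rsq v) = ip k (lap (rsq v)) v" by (simp add: ip_lap)
  also have "\<dots> = ip k (\<lambda>\<alpha>. rsq (lap v) \<alpha>) v + real (2 * CARD('n) + 4 * k) * ip k v v"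
    unfolding ip_def sum_distrib_left sum.distrib[symmetric]
    by (rule sum.cong) (auto simp: lap_rsq idx_def algebra_simps)
  also have "ip k (\<lambda>\<alpha>. rsq (lap v) \<alpha>) v \<ge> 0"
  proof (cases "k < 2")
    case True
    have "rsq (lap v) \<alpha> = 0" if "\<alpha> \<in> idx k" for \<alpha>
    proof -
      have "\<alpha> i \<le> 1" for i
        using le_mdeg[of \<alpha> i] that True by (simp add: idx_def)
      then have "xmul i (xmul i (lap v)) \<alpha> = 0" for i
        by (simp add: xmul_def)
      then show ?thesis by (simp add: rsq_def)
    qed
    then show ?thesis by (simp add: ip_def)
  next
    case False
    then have k: "k = (k - 2) + 2" by simp
    have "ip k (rsq (lap v)) v = ip (k - 2) (lap v) (lap v)"
      by (subst k, subst ip_commute, subst ip_lap[symmetric]) simp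
    then show ?thesis using ip_self_nonneg[of "k - 2" "lap v"] by simp
  qed
  ultimately show ?thesis by linarith
qed

lemma xmul_cong: "(\<And>\<beta>. \<beta> \<in> idx k \<Longrightarrow> c \<beta> = d \<beta>) \<Longrightarrow> \<alpha> \<in> idx (Suc k) \<Longrightarrow> xmul i c \<alpha> = xmul i d \<alpha>"
  for c :: "('n::finite \<Rightarrow> nat) \<Rightarrow> real"
proof (cases "\<alpha> i = 0")
  case False
  assume eq: "\<And>\<beta>. \<beta> \<in> idx k \<Longrightarrow> c \<beta> = d \<beta>" and a: "\<alpha> \<in> idx (Suc k)"
  have "\<alpha> = (\<alpha>(i := \<alpha> i - 1))(i := Suc ((\<alpha>(i := \<alpha> i - 1)) i))" using False by auto
  with a have "\<alpha>(i := \<alpha> i - 1) \<in> idx k" using upd_Suc_idx by metis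
  then show ?thesis using eq by (simp add: xmul_def)
qed (simp add: xmul_def)

lemma rsq_cong: "(\<And>\<beta>. \<beta> \<in> idx k \<Longrightarrow> c \<beta> = d \<beta>) \<Longrightarrow> \<alpha> \<in> idx (k + 2) \<Longrightarrow> rsq c \<alpha> = rsq d \<alpha>"
  unfolding rsq_def
  by (intro sum.cong refl xmul_cong[of "Suc k"] xmul_cong[of k]) auto

lemma lap_cong: "(\<And>\<beta>. \<beta> \<in> idx (k + 2) \<Longrightarrow> c \<beta> = d \<beta>) \<Longrightarrow> \<alpha> \<in> idx k \<Longrightarrow> lap c \<alpha> = lap d \<alpha>"
proof -
  assume eq: "\<And>\<beta>. \<beta> \<in> idx (k + 2) \<Longrightarrow> c \<beta> = d \<beta>" and a: "\<alpha> \<in> idx k"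
  have "pd i (pd i c) \<alpha> = pd i (pd i d) \<alpha>" for i
  proof -
    have "\<alpha>(i := Suc (\<alpha> i)) \<in> idx (Suc k)" using a upd_Suc_idx by blast
    then have "(\<alpha>(i := Suc (\<alpha> i)))(i := Suc ((\<alpha>(i := Suc (\<alpha> i))) i)) \<in> idx (k + 2)"
      by (metis upd_Suc_idx add_2_eq_Suc')
    then show ?thesis unfolding pd_def using eq by metis
  qed
  then show ?thesis by (simp add: lap_def)
qed

lemma rsq_low: "\<alpha> \<in> idx k \<Longrightarrow> k < 2 \<Longrightarrow> rsq c \<alpha> = 0"
proof -
  assume a: "\<alpha> \<in> idx k" "k < 2"
  have "\<alpha> i \<le> 1" for i
    using le_mdeg[of \<alpha> i] a by (simp add: idx_def)
  then have "xmul i (xmul i c) \<alpha> = 0" for i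
    by (simp add: xmul_def)
  then show ?thesis by (simp add: rsq_def)
qed

lemma pd_diff: "pd i (\<lambda>\<alpha>. c \<alpha> - d \<alpha>) = (\<lambda>\<alpha>. pd i c \<alpha> - pd i d \<alpha>)"
  by (auto simp: pd_def algebra_simps)

lemma pd_scale: "pd i (\<lambda>\<alpha>. a * c \<alpha>) = (\<lambda>\<alpha>. a * pd i c \<alpha>)"
  by (auto simp: pd_def algebra_simps)

lemma xmul_diff: "xmul i (\<lambda>\<alpha>. c \<alpha> - d \<alpha>) = (\<lambda>\<alpha>. xmul i c \<alpha> - xmul i d \<alpha>)"
  by (auto simp: xmul_def)

lemma lap_diff: "lap (\<lambda>\<alpha>. c \<alpha> - d \<alpha>) = (\<lambda>\<alpha>. lap c \<alpha> - lap d \<alpha>)"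
  unfolding lap_def[abs_def] by (simp add: pd_diff sum_subtractf)

lemma lap_add: "lap (\<lambda>\<alpha>. c \<alpha> + d \<alpha>) = (\<lambda>\<alpha>. lap c \<alpha> + lap d \<alpha>)"
  unfolding lap_def[abs_def] by (simp add: pd_add sum.distrib)

lemma lap_scale: "lap (\<lambda>\<alpha>. a * c \<alpha>) = (\<lambda>\<alpha>. a * lap c \<alpha>)"
  unfolding lap_def[abs_def] by (simp add: pd_scale sum_distrib_left)

lemma rsq_diff: "rsq (\<lambda>\<alpha>. c \<alpha> - d \<alpha>) = (\<lambda>\<alpha>. rsq c \<alpha> - rsq d \<alpha>)"
  unfolding rsq_def[abs_def] by (simp add: xmul_diff sum_subtractf)

text \<open>The commutation relation \<open>lap_rsq\<close> reduces the equation in degree \<open>k + 2\<close> for \<open>v\<close> to the one in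
  degree \<open>k\<close> for the Laplacian of \<open>v\<close>, with a larger constant.\<close>

lemma resolvent_exists:
  fixes q :: "('n::finite \<Rightarrow> nat) \<Rightarrow> real"
  assumes "\<mu> > 0"
  shows "\<exists>v. \<forall>\<alpha>\<in>idx k. \<mu> * v \<alpha> + rsq (lap v) \<alpha> = q \<alpha>"
  using assms
proof (induction k arbitrary: \<mu> q rule: less_induct)
  case (less k)
  show ?case
  proof (cases "k < 2")
    case True
    with less.prems show ?thesis
      by (intro exI[of _ "\<lambda>\<alpha>. q \<alpha> / \<mu>"]) (auto simp: rsq_low)
  next
    case False
    define m where "m = k - 2"
    have k: "k = m + 2" using False by (simp add: m_def)
    define C where "C = real (2 * CARD('n) + 4 * m)"
    have C: "C \<ge> 0" by (simp add: C_def)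
    obtain z where z: "\<And>\<alpha>. \<alpha> \<in> idx m \<Longrightarrow> (\<mu> + C) * z \<alpha> + rsq (lap z) \<alpha> = lap q \<alpha>"
      using less.IH[of m "\<mu> + C" "lap q"] less.prems C k by auto
    define v where "v = (\<lambda>\<alpha>. inverse \<mu> * (q \<alpha> - rsq z \<alpha>))"
    have lv: "lap v \<alpha> = z \<alpha>" if "\<alpha> \<in> idx m" for \<alpha>
    proof -
      have "lap v \<alpha> = inverse \<mu> * (lap q \<alpha> - (rsq (lap z) \<alpha> + C * z \<alpha>))"
        using that by (simp add: v_def lap_scale lap_diff lap_rsq idx_def C_def del: of_nat_sum)
      also have "\<dots> = z \<alpha>" using z[OF that] less.prems by (simp add: field_simps)
      finally show ?thesis .
    qed
    have "\<mu> * v \<alpha> + rsq (lap v) \<alpha> = q \<alpha>" if "\<alpha> \<in> idx k" for \<alpha>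
    proof -
      have "rsq (lap v) \<alpha> = rsq z \<alpha>" using rsq_cong[of m "lap v" z \<alpha>] lv that k by blast
      moreover have "\<mu> * v \<alpha> = q \<alpha> - rsq z \<alpha>" using less.prems by (simp add: v_def)
      ultimately show ?thesis by simp
    qed
    then show ?thesis by blast
  qed
qed

text \<open>By \<open>lap_rsq\<close>, the degree k part of the equation is the resolvent equation
  with \<mu> = 2n + 4k. The degrees do not interact, so the solutions of the separate degrees are
  glued together.\<close>

lemma lap_rsq_surj:
  fixes q :: "('n::finite \<Rightarrow> nat) \<Rightarrow> real"
  shows "\<exists>v. lap (rsq v) = q"
proof -
  have "\<exists>v. \<forall>\<alpha>\<in>idx k. real (2 * CARD('n) + 4 * k) * v \<alpha> + rsq (lap v) \<alpha> = q \<alpha>" for k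
    by (rule resolvent_exists) (simp add: add_pos_nonneg)
  then obtain V where V: "\<And>k \<alpha>. \<alpha> \<in> idx k \<Longrightarrow> real (2 * CARD('n) + 4 * k) * V k \<alpha> + rsq (lap (V k)) \<alpha> = q \<alpha>"
    by metis
  define v where "v = (\<lambda>\<alpha>. V (mdeg \<alpha>) \<alpha>)"
  have "lap (rsq v) \<alpha> = q \<alpha>" for \<alpha>
  proof -
    define k where "k = mdeg \<alpha>"
    have a: "\<alpha> \<in> idx k" by (simp add: idx_def k_def)
    have "v \<beta> = V k \<beta>" if "\<beta> \<in> idx k" for \<beta> using that by (simp add: v_def idx_def)
    then have "rsq v \<beta> = rsq (V k) \<beta>" if "\<beta> \<in> idx (k + 2)" for \<beta> using that rsq_cong by blast
    then have "lap (rsq v) \<alpha> = lap (rsq (V k)) \<alpha>" using a lap_cong by blast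
    also have "\<dots> = q \<alpha>" using V[OF a] by (simp add: lap_rsq k_def)
    finally show ?thesis .
  qed
  then show ?thesis by blast
qed

text \<open>The choice is harmless, as \<open>lap_rsq_inj\<close> shows. The solution of the Poisson
  equation with source \<open>q\<close> that is divisible by |x|^2 is
  \<open>rsq (ilap q)\<close>.\<close>

definition ilap :: "(('n::finite \<Rightarrow> nat) \<Rightarrow> real) \<Rightarrow> ('n \<Rightarrow> nat) \<Rightarrow> real" where
  "ilap q = (SOME v. lap (rsq v) = q)"

lemma lap_rsq_ilap [simp]: "lap (rsq (ilap q)) = q"
  unfolding ilap_def using lap_rsq_surj by (rule someI_ex)

text \<open>The inner product of \<open>rsq d\<close> with itself is that of
  \<open>lap (rsq d)\<close> with \<open>d\<close>, so \<open>ip_rsq_self\<close> is a quantitative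
  form of injectivity. Only one degree of the images is compared, as the recursions on the degree
  below require.\<close>

lemma lap_rsq_inj:
  fixes v w :: "('n::finite \<Rightarrow> nat) \<Rightarrow> real"
  assumes "\<And>\<alpha>. \<alpha> \<in> idx k \<Longrightarrow> lap (rsq v) \<alpha> = lap (rsq w) \<alpha>" and "\<alpha> \<in> idx k"
  shows "v \<alpha> = w \<alpha>"
proof -
  define d where "d = (\<lambda>\<alpha>. v \<alpha> - w \<alpha>)"
  have "ip (k + 2) (rsq d) (rsq d) = ip k (lap (rsq d)) d" by (simp add: ip_lap)
  also have "\<dots> = 0"
    unfolding ip_def by (rule sum.neutral) (simp add: d_def rsq_diff lap_diff assms)
  finally have "real (2 * CARD('n) + 4 * k) * ip k d d \<le> 0"
    using ip_rsq_self[where k = k and v = d] by simp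
  then have "ip k d d \<le> 0"
    by (rule mult_left_le_imp_le[of _ _ 0, simplified]) (simp add: add_pos_nonneg)
  then have "ip k d d = 0" using ip_self_nonneg[of k d] by simp
  then show ?thesis using assms(2) by (auto simp: ip_self_eq_0 d_def)
qed

lemma card_ge_1: "real CARD('n::finite) \<ge> 1"
  by (simp add: Suc_leI)

lemma ip_Cauchy_Schwarz: "(ip k c d)\<^sup>2 \<le> ip k c c * ip k d d"
proof -
  have "(ip k c d)\<^sup>2 = (\<Sum>\<alpha>\<in>idx k. (sqrt (mfact \<alpha>) * c \<alpha>) * (sqrt (mfact \<alpha>) * d \<alpha>))\<^sup>2"
    unfolding ip_def
    by (intro arg_cong[where f = "\<lambda>x. x\<^sup>2"] sum.cong refl)
       (use mfact_pos in \<open>simp add: less_imp_le algebra_simps\<close>)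
  also have "\<dots> \<le> (\<Sum>\<alpha>\<in>idx k. (sqrt (mfact \<alpha>) * c \<alpha>)\<^sup>2) * (\<Sum>\<alpha>\<in>idx k. (sqrt (mfact \<alpha>) * d \<alpha>)\<^sup>2)"
    by (rule Cauchy_Schwarz_ineq_sum)
  also have "\<dots> = ip k c c * ip k d d"
    unfolding ip_def by (simp add: power_mult_distrib less_imp_le) (simp add: power2_eq_square mult.assoc)
  finally show ?thesis .
qed

text \<open>In degree k + 2, \<open>rsq v\<close> is the orthogonal projection of \<open>c\<close>
  onto the multiples of |x|^2: the difference has vanishing Laplacian and is therefore orthogonal to
  the range of \<open>rsq\<close>. The second bound follows from \<open>ip_rsq_self\<close>, as 2n +
  4k \<ge> 1.\<close>

lemma ip_self_rsq_le:
  fixes c v :: "('n::finite \<Rightarrow> nat) \<Rightarrow> real"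
  assumes "\<And>\<alpha>. \<alpha> \<in> idx k \<Longrightarrow> lap (rsq v) \<alpha> = lap c \<alpha>"
  shows "ip (k + 2) (rsq v) (rsq v) \<le> ip (k + 2) c c" "ip k v v \<le> ip (k + 2) c c"
proof -
  define W where "W = ip (k + 2) (rsq v) (rsq v)"
  have W0: "W \<ge> 0" by (simp add: W_def ip_self_nonneg)
  have "W = ip k (lap (rsq v)) v" by (simp add: W_def ip_lap)
  also have "\<dots> = ip k (lap c) v" by (rule ip_cong) (use assms in auto)
  also have "\<dots> = ip (k + 2) c (rsq v)" by (simp add: ip_lap)
  finally have "W\<^sup>2 \<le> ip (k + 2) c c * W"
    using ip_Cauchy_Schwarz[of "k + 2" c "rsq v"] by (simp add: W_def)
  then have le: "W \<le> ip (k + 2) c c"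
    using W0 ip_self_nonneg[of "k + 2" c] by (cases "W = 0") (auto simp: power2_eq_square)
  then show "ip (k + 2) (rsq v) (rsq v) \<le> ip (k + 2) c c" by (simp add: W_def)
  have "1 * ip k v v \<le> real (2 * CARD('n) + 4 * k) * ip k v v"
    by (rule mult_right_mono) (use card_ge_1[where 'n = 'n] in \<open>simp_all add: ip_self_nonneg, linarith\<close>)
  also have "\<dots> \<le> W" unfolding W_def by (rule ip_rsq_self)
  finally show "ip k v v \<le> ip (k + 2) c c" using le by simp
qed

text \<open>Cauchy-Schwarz bounds the square of the left side by the right side times
  \<open>ip k v v\<close>, and \<open>ip_self_rsq_le\<close> bounds the latter by the left side
  again.\<close>

lemma ip_rsq_le:
  fixes v :: "('n::finite \<Rightarrow> nat) \<Rightarrow> real"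
  shows "ip (k + 2) (rsq v) (rsq v) \<le> ip k (lap (rsq v)) (lap (rsq v))"
proof -
  define W where "W = ip (k + 2) (rsq v) (rsq v)"
  define Q where "Q = ip k (lap (rsq v)) (lap (rsq v))"
  have W0: "W \<ge> 0" and Q0: "Q \<ge> 0" by (simp_all add: W_def Q_def ip_self_nonneg)
  have V: "ip k v v \<le> W"
    unfolding W_def by (rule ip_self_rsq_le(2)) simp
  have "W = ip k (lap (rsq v)) v" by (simp add: W_def ip_lap)
  then have "W\<^sup>2 \<le> Q * ip k v v"
    using ip_Cauchy_Schwarz[of k "lap (rsq v)" v] by (simp add: Q_def)
  also have "\<dots> \<le> Q * W" using V Q0 by (rule mult_left_mono)
  finally have "W \<le> Q" using W0 Q0 by (cases "W = 0") (auto simp: power2_eq_square)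
  then show ?thesis by (simp add: W_def Q_def)
qed

section \<open>The Bombieri norm and products of power series\<close>

definition cmul :: "(('n::finite \<Rightarrow> nat) \<Rightarrow> real) \<Rightarrow> (('n \<Rightarrow> nat) \<Rightarrow> real) \<Rightarrow> ('n \<Rightarrow> nat) \<Rightarrow> real" where
  "cmul c d \<gamma> = (\<Sum>\<alpha> | \<alpha> \<le> \<gamma>. c \<alpha> * d (\<gamma> - \<alpha>))"

text \<open>The Bombieri norm: the Fischer norm divided by the square root of k!, the normalisation
  for which \<open>bn_cmul_piece\<close> has constant 1. Writing it as an \<open>L2_set\<close>
  provides the triangle inequality.\<close>

definition bn :: "nat \<Rightarrow> (('n::finite \<Rightarrow> nat) \<Rightarrow> real) \<Rightarrow> real" where
  "bn k c = L2_set (\<lambda>\<alpha>. sqrt (mfact \<alpha> / fact k) * c \<alpha>) (idx k)"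

lemma bn_eq: "bn k c = sqrt (ip k c c / fact k)"
  unfolding bn_def L2_set_def ip_def
  by (simp add: power_mult_distrib less_imp_le sum_divide_distrib) (simp add: power2_eq_square mult.assoc)

lemma bn_nonneg [simp]: "bn k c \<ge> 0"
  by (simp add: bn_def)

lemma bn_add: "bn k (\<lambda>\<alpha>. c \<alpha> + d \<alpha>) \<le> bn k c + bn k d"
  unfolding bn_def distrib_left by (rule L2_set_triangle_ineq)

lemma bn_cong: "(\<And>\<alpha>. \<alpha> \<in> idx k \<Longrightarrow> c \<alpha> = d \<alpha>) \<Longrightarrow> bn k c = bn k d"
  unfolding bn_eq using ip_cong[of k c d c d] by simp

lemma bn_scale: "bn k (\<lambda>\<alpha>. a * c \<alpha>) = \<bar>a\<bar> * bn k c"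
proof -
  have "ip k (\<lambda>\<alpha>. a * c \<alpha>) (\<lambda>\<alpha>. a * c \<alpha>) = a\<^sup>2 * ip k c c"
    by (simp add: ip_def sum_distrib_left power2_eq_square mult_ac)
  then show ?thesis by (simp add: bn_eq real_sqrt_mult flip: times_divide_eq_right)
qed

lemma bn_0: "(\<And>\<alpha>. \<alpha> \<in> idx k \<Longrightarrow> c \<alpha> = 0) \<Longrightarrow> bn k c = 0"
  unfolding bn_eq ip_def by simp

lemma bn_sum: "finite A \<Longrightarrow> bn k (\<lambda>\<alpha>. \<Sum>j\<in>A. c j \<alpha>) \<le> (\<Sum>j\<in>A. bn k (c j))"
proof (induction A rule: finite_induct)
  case empty
  then show ?case by (simp add: bn_0)
next
  case (insert x A)
  then show ?case using bn_add[of k "c x" "\<lambda>\<alpha>. \<Sum>j\<in>A. c j \<alpha>"] by simp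
qed

lemma le_fun_PiE: "{\<alpha>. \<alpha> \<le> (\<gamma> :: 'n::finite \<Rightarrow> nat)} = PiE UNIV (\<lambda>i. {..\<gamma> i})"
  by (auto simp: le_fun_def PiE_def Pi_def)

lemma mdeg_mono: "\<alpha> \<le> \<gamma> \<Longrightarrow> mdeg \<alpha> \<le> mdeg \<gamma>" for \<gamma> :: "'n::finite \<Rightarrow> nat"
  by (intro sum_mono) (auto simp: le_fun_def)

lemma mdeg_minus: "\<alpha> \<le> \<gamma> \<Longrightarrow> mdeg (\<gamma> - \<alpha>) = mdeg \<gamma> - mdeg \<alpha>" for \<gamma> :: "'n::finite \<Rightarrow> nat"
  by (simp add: sum_subtractf_nat le_fun_def)

lemma mdeg_minus': "\<alpha> \<le> \<gamma> \<Longrightarrow> (\<Sum>i\<in>UNIV. \<gamma> i - \<alpha> i) = mdeg \<gamma> - mdeg \<alpha>" for \<gamma> :: "'n::finite \<Rightarrow> nat"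
  by (simp add: sum_subtractf_nat le_fun_def)

text \<open>Compare the coefficients of X^k in the product of the polynomials (1 + X)^(\<gamma> i),
  which is 1 + X to the power \<open>mdeg \<gamma>\<close>.\<close>

lemma multi_vandermonde:
  fixes \<gamma> :: "'n::finite \<Rightarrow> nat"
  shows "(\<Sum>\<alpha> | \<alpha> \<le> \<gamma> \<and> mdeg \<alpha> = k. \<Prod>i\<in>UNIV. real (\<gamma> i choose \<alpha> i)) = real (mdeg \<gamma> choose k)"
proof -
  have one: "[:1, 1:] ^ m = (\<Sum>j\<le>m. monom (real (m choose j)) j)" for m
  proof -
    have "[:1, 1:] ^ m = (monom 1 1 + 1 :: real poly) ^ m"
      by (simp add: monom_altdef one_pCons)
    also have "\<dots> = (\<Sum>j\<le>m. of_nat (m choose j) * monom 1 1 ^ j)"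
      by (subst binomial_ring) simp
    also have "\<dots> = (\<Sum>j\<le>m. monom (real (m choose j)) j)"
      by (intro sum.cong refl) (simp add: monom_power of_nat_poly smult_monom)
    finally show ?thesis .
  qed
  have pm: "(\<Prod>i\<in>A. monom (b i) (e i)) = monom (\<Prod>i\<in>A. b i) (\<Sum>i\<in>A. e i)"
    if "finite A" for A :: "'n set" and b :: "'n \<Rightarrow> real" and e :: "'n \<Rightarrow> nat"
    using that by (induction A rule: finite_induct) (auto simp: mult_monom)
  have "(\<Sum>j\<le>mdeg \<gamma>. monom (real (mdeg \<gamma> choose j)) j) = (\<Prod>i\<in>UNIV. [:1, 1:] ^ \<gamma> i)"
    by (simp add: power_sum flip: one)
  also have "\<dots> = (\<Sum>\<alpha> | \<alpha> \<le> \<gamma>. monom (\<Prod>i\<in>UNIV. real (\<gamma> i choose \<alpha> i)) (mdeg \<alpha>))"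
    unfolding one by (subst prod_sum_PiE) (auto simp: pm le_fun_PiE)
  finally have "coeff (\<Sum>j\<le>mdeg \<gamma>. monom (real (mdeg \<gamma> choose j)) j) k
    = coeff (\<Sum>\<alpha> | \<alpha> \<le> \<gamma>. monom (\<Prod>i\<in>UNIV. real (\<gamma> i choose \<alpha> i)) (mdeg \<alpha>)) k"
    by (rule arg_cong)
  then have "(if k \<le> mdeg \<gamma> then real (mdeg \<gamma> choose k) else 0)
    = (\<Sum>\<alpha> | \<alpha> \<le> \<gamma>. if mdeg \<alpha> = k then (\<Prod>i\<in>UNIV. real (\<gamma> i choose \<alpha> i)) else 0)"
    by (simp add: coeff_sum)
  also have "\<dots> = (\<Sum>\<alpha> | \<alpha> \<le> \<gamma> \<and> mdeg \<alpha> = k. \<Prod>i\<in>UNIV. real (\<gamma> i choose \<alpha> i))"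
    by (subst sum.inter_filter[symmetric]) (auto intro!: sum.cong)
  finally show ?thesis by (auto split: if_splits)
qed

lemma prod_choose_mfact:
  fixes \<gamma> :: "'n::finite \<Rightarrow> nat"
  assumes "\<alpha> \<le> \<gamma>"
  shows "(\<Prod>i\<in>UNIV. real (\<gamma> i choose \<alpha> i)) = mfact \<gamma> / (mfact \<alpha> * mfact (\<gamma> - \<alpha>))"
proof -
  have "real (\<gamma> i choose \<alpha> i) = fact (\<gamma> i) / (fact (\<alpha> i) * fact (\<gamma> i - \<alpha> i))" for i
    using assms by (intro binomial_fact) (simp add: le_fun_def)
  then show ?thesis by (simp add: mfact_def prod.distrib prod_dividef)
qed

lemma sum_idx_pairs:
  fixes F :: "('n::finite \<Rightarrow> nat) \<Rightarrow> ('n \<Rightarrow> nat) \<Rightarrow> real"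
  assumes "k \<le> N"
  shows "(\<Sum>\<gamma>\<in>(idx N :: ('n \<Rightarrow> nat) set). \<Sum>\<alpha> | \<alpha> \<le> \<gamma> \<and> mdeg \<alpha> = k. F \<alpha> (\<gamma> - \<alpha>)) = (\<Sum>\<alpha>\<in>idx k. \<Sum>\<beta>\<in>idx (N - k). F \<alpha> \<beta>)"
proof -
  have fin: "finite {\<alpha>. \<alpha> \<le> \<gamma> \<and> mdeg \<alpha> = k}" for \<gamma> :: "'n \<Rightarrow> nat"
    by (rule finite_subset[OF _ finite_le_fun[of \<gamma>]]) auto
  have "(\<Sum>\<gamma>\<in>idx N. \<Sum>\<alpha> | \<alpha> \<le> \<gamma> \<and> mdeg \<alpha> = k. F \<alpha> (\<gamma> - \<alpha>))
      = (\<Sum>(\<gamma>,\<alpha>)\<in>Sigma (idx N) (\<lambda>\<gamma>. {\<alpha>. \<alpha> \<le> \<gamma> \<and> mdeg \<alpha> = k}). F \<alpha> (\<gamma> - \<alpha>))"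
    using fin by (subst sum.Sigma) auto
  also have "\<dots> = (\<Sum>(\<alpha>,\<beta>)\<in>idx k \<times> idx (N - k). F \<alpha> \<beta>)"
  proof (rule sum.reindex_bij_witness[where i = "\<lambda>(\<alpha>,\<beta>). (\<alpha> + \<beta>, \<alpha>)" and j = "\<lambda>(\<gamma>,\<alpha>). (\<alpha>, \<gamma> - \<alpha>)"], goal_cases)
    case (1 a) then show ?case by (auto simp: le_fun_def fun_eq_iff)
  next
    case (2 a) then show ?case by (auto simp: idx_def mdeg_minus')
  next
    case (3 a) then show ?case by (auto simp: fun_eq_iff)
  next
    case (4 a) then show ?case using assms by (auto simp: idx_def sum.distrib le_fun_def)
  next
    case (5 a) then show ?case by auto
  qed
  also have "\<dots> = (\<Sum>\<alpha>\<in>idx k. \<Sum>\<beta>\<in>idx (N - k). F \<alpha> \<beta>)"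
    by (subst sum.Sigma) auto
  finally show ?thesis .
qed

text \<open>Bombieri's inequality. Cauchy-Schwarz in each coefficient, with weights \<alpha>!
  \<beta>!, produces the sum of the quotients \<gamma>!/(\<alpha>! \<beta>!), which Vandermonde
  evaluates as \<open>N choose k\<close>; the factorials in \<open>bn\<close> cancel it
  exactly.\<close>

lemma bn_cmul_piece:
  fixes c d :: "('n::finite \<Rightarrow> nat) \<Rightarrow> real"
  assumes "k \<le> N"
  shows "bn N (\<lambda>\<gamma>::'n \<Rightarrow> nat. \<Sum>\<alpha> | \<alpha> \<le> \<gamma> \<and> mdeg \<alpha> = k. c \<alpha> * d (\<gamma> - \<alpha>)) \<le> bn k c * bn (N - k) d"
proof -
  let ?S = "\<lambda>\<gamma>::'n \<Rightarrow> nat. {\<alpha>. \<alpha> \<le> \<gamma> \<and> mdeg \<alpha> = k}"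
  define e where "e = (\<lambda>\<gamma>. \<Sum>\<alpha>\<in>?S \<gamma>. c \<alpha> * d (\<gamma> - \<alpha>))"
  define w where "w = (\<lambda>(\<alpha>::'n \<Rightarrow> nat) (\<beta>::'n \<Rightarrow> nat). mfact \<alpha> * mfact \<beta>)"
  have wpos: "w \<alpha> \<beta> > 0" for \<alpha> \<beta> by (simp add: w_def)
  define F where "F = (\<lambda>\<alpha> \<beta>. w \<alpha> \<beta> * (c \<alpha>)\<^sup>2 * (d \<beta>)\<^sup>2)"
  have le: "mfact \<gamma> * (e \<gamma>)\<^sup>2 \<le> real (N choose k) * (\<Sum>\<alpha>\<in>?S \<gamma>. F \<alpha> (\<gamma> - \<alpha>))" if "\<gamma> \<in> idx N" for \<gamma>
  proof -
    have "(e \<gamma>)\<^sup>2 = (\<Sum>\<alpha>\<in>?S \<gamma>. (1 / sqrt (w \<alpha> (\<gamma> - \<alpha>))) * (sqrt (w \<alpha> (\<gamma> - \<alpha>)) * (c \<alpha> * d (\<gamma> - \<alpha>))))\<^sup>2"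
      unfolding e_def using wpos by (simp add: less_imp_neq[OF wpos, symmetric])
    also have "\<dots> \<le> (\<Sum>\<alpha>\<in>?S \<gamma>. (1 / sqrt (w \<alpha> (\<gamma> - \<alpha>)))\<^sup>2) * (\<Sum>\<alpha>\<in>?S \<gamma>. (sqrt (w \<alpha> (\<gamma> - \<alpha>)) * (c \<alpha> * d (\<gamma> - \<alpha>)))\<^sup>2)"
      by (rule Cauchy_Schwarz_ineq_sum)
    also have "(\<Sum>\<alpha>\<in>?S \<gamma>. (sqrt (w \<alpha> (\<gamma> - \<alpha>)) * (c \<alpha> * d (\<gamma> - \<alpha>)))\<^sup>2) = (\<Sum>\<alpha>\<in>?S \<gamma>. F \<alpha> (\<gamma> - \<alpha>))"
      using wpos by (simp add: F_def power_mult_distrib less_imp_le mult.assoc)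
    also have "(\<Sum>\<alpha>\<in>?S \<gamma>. (1 / sqrt (w \<alpha> (\<gamma> - \<alpha>)))\<^sup>2) = (\<Sum>\<alpha>\<in>?S \<gamma>. (\<Prod>i\<in>UNIV. real (\<gamma> i choose \<alpha> i)) / mfact \<gamma>)"
      using wpos by (intro sum.cong refl)
        (simp add: power_divide less_imp_le prod_choose_mfact w_def less_imp_neq[OF mfact_pos, symmetric])
    also have "\<dots> = real (N choose k) / mfact \<gamma>"
      using multi_vandermonde[of \<gamma> k] that by (simp add: idx_def flip: sum_divide_distrib)
    finally show ?thesis
      by (simp add: pos_le_divide_eq mult_ac fun_diff_def)
  qed
  have "ip N e e = (\<Sum>\<gamma>\<in>idx N. mfact \<gamma> * (e \<gamma>)\<^sup>2)"
    by (simp add: ip_def power2_eq_square mult.assoc)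
  also have "\<dots> \<le> (\<Sum>\<gamma>\<in>idx N. real (N choose k) * (\<Sum>\<alpha>\<in>?S \<gamma>. F \<alpha> (\<gamma> - \<alpha>)))"
    by (rule sum_mono) (rule le)
  also have "\<dots> = real (N choose k) * (\<Sum>\<alpha>\<in>idx k. \<Sum>\<beta>\<in>idx (N - k). F \<alpha> \<beta>)"
    by (simp add: sum_idx_pairs[OF assms] flip: sum_distrib_left)
  also have "(\<Sum>\<alpha>\<in>idx k. \<Sum>\<beta>\<in>idx (N - k). F \<alpha> \<beta>) = ip k c c * ip (N - k) d d"
    unfolding ip_def sum_product F_def w_def by (simp add: power2_eq_square mult_ac)
  finally have "ip N e e / fact N \<le> real (N choose k) / fact N * (ip k c c * ip (N - k) d d)"
    by (simp add: divide_right_mono)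
  also have "real (N choose k) / fact N = 1 / (fact k * fact (N - k))"
    using assms by (simp add: binomial_fact)
  finally have "ip N e e / fact N \<le> (ip k c c / fact k) * (ip (N - k) d d / fact (N - k))" by simp
  then show ?thesis
    unfolding bn_eq e_def[symmetric] real_sqrt_mult[symmetric] by (rule real_sqrt_le_mono)
qed

lemma bn_cmul: "bn N (cmul c d) \<le> (\<Sum>k\<le>N. bn k c * bn (N - k) d)"
proof -
  have "cmul c d \<gamma> = (\<Sum>k\<le>N. \<Sum>\<alpha> | \<alpha> \<le> \<gamma> \<and> mdeg \<alpha> = k. c \<alpha> * d (\<gamma> - \<alpha>))" if "\<gamma> \<in> idx N" for \<gamma>
  proof -
    have "(\<Sum>k\<le>N. \<Sum>\<alpha>\<in>{\<alpha> \<in> {\<alpha>. \<alpha> \<le> \<gamma>}. mdeg \<alpha> = k}. c \<alpha> * d (\<gamma> - \<alpha>)) = (\<Sum>\<alpha> | \<alpha> \<le> \<gamma>. c \<alpha> * d (\<gamma> - \<alpha>))"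
      by (rule sum.group) (use that mdeg_mono in \<open>auto simp: idx_def\<close>)
    then show ?thesis by (simp add: cmul_def)
  qed
  then have "bn N (cmul c d) = bn N (\<lambda>\<gamma>. \<Sum>k\<le>N. \<Sum>\<alpha> | \<alpha> \<le> \<gamma> \<and> mdeg \<alpha> = k. c \<alpha> * d (\<gamma> - \<alpha>))"
    by (rule bn_cong)
  also have "\<dots> \<le> (\<Sum>k\<le>N. bn N (\<lambda>\<gamma>. \<Sum>\<alpha> | \<alpha> \<le> \<gamma> \<and> mdeg \<alpha> = k. c \<alpha> * d (\<gamma> - \<alpha>)))"
    by (rule bn_sum) simp
  also have "\<dots> \<le> (\<Sum>k\<le>N. bn k c * bn (N - k) d)"
    by (rule sum_mono) (simp add: bn_cmul_piece)
  finally show ?thesis .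
qed

text \<open>Truncated at degree \<open>N\<close>, so that bounds can be proved by induction on
  \<open>N\<close> before any convergence is known.\<close>

definition nrm :: "nat \<Rightarrow> real \<Rightarrow> (('n::finite \<Rightarrow> nat) \<Rightarrow> real) \<Rightarrow> real" where
  "nrm N \<rho> c = (\<Sum>k\<le>N. bn k c * \<rho> ^ k)"

lemma nrm_nonneg [simp]: "\<rho> \<ge> 0 \<Longrightarrow> nrm N \<rho> c \<ge> 0"
  unfolding nrm_def by (intro sum_nonneg) simp

lemma nrm_cmul:
  assumes "\<rho> \<ge> 0"
  shows "nrm N \<rho> (cmul c d) \<le> nrm N \<rho> c * nrm N \<rho> d"
proof -
  let ?f = "\<lambda>i. bn i c * \<rho> ^ i" and ?g = "\<lambda>i. bn i d * \<rho> ^ i"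
  have "nrm N \<rho> (cmul c d) \<le> (\<Sum>k\<le>N. (\<Sum>j\<le>k. bn j c * bn (k - j) d) * \<rho> ^ k)"
    unfolding nrm_def by (intro sum_mono mult_right_mono bn_cmul) (simp add: assms)
  also have "\<dots> = (\<Sum>k\<le>N. \<Sum>j\<le>k. ?f j * ?g (k - j))"
  proof (intro sum.cong[OF refl])
    fix k assume "k \<in> {..N}"
    have "bn j c * bn (k - j) d * \<rho> ^ k = ?f j * ?g (k - j)" if "j \<in> {..k}" for j
      using that by (simp add: algebra_simps power_add[symmetric])
    then show "(\<Sum>j\<le>k. bn j c * bn (k - j) d) * \<rho> ^ k = (\<Sum>j\<le>k. ?f j * ?g (k - j))"
      unfolding sum_distrib_right by (rule sum.cong[OF refl])
  qed
  also have "\<dots> = (\<Sum>(i,j)\<in>{(i,j). i + j \<le> N}. ?f i * ?g j)"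
    by (rule sum.triangle_reindex_eq[symmetric])
  also have "\<dots> \<le> (\<Sum>(i,j)\<in>{..N} \<times> {..N}. ?f i * ?g j)"
    by (rule sum_mono2) (auto simp: assms)
  also have "\<dots> = nrm N \<rho> c * nrm N \<rho> d"
    unfolding nrm_def sum_product by (subst sum.Sigma) auto
  finally show ?thesis .
qed

section \<open>Powers and compositions of formal series\<close>

primrec cpow :: "(('n::finite \<Rightarrow> nat) \<Rightarrow> real) \<Rightarrow> nat \<Rightarrow> ('n \<Rightarrow> nat) \<Rightarrow> real" where
  "cpow c 0 = (\<lambda>\<alpha>. if \<alpha> = 0 then 1 else 0)"
| "cpow c (Suc p) = cmul c (cpow c p)"

text \<open>When \<open>c 0 = 0\<close> the p-th power of \<open>c\<close> has no terms below degree
  \<open>p\<close> (\<open>cpow_low\<close>), so the truncation loses nothing and each coefficient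
  of the composite is a finite sum.\<close>

definition ccomp :: "(nat \<Rightarrow> real) \<Rightarrow> (('n::finite \<Rightarrow> nat) \<Rightarrow> real) \<Rightarrow> ('n \<Rightarrow> nat) \<Rightarrow> real" where
  "ccomp a c \<alpha> = (\<Sum>p\<le>mdeg \<alpha>. a p * cpow c p \<alpha>)"

lemma idx_0: "idx 0 = {0 :: 'n::finite \<Rightarrow> nat}"
  by (auto simp: idx_def fun_eq_iff zero_fun_def)

lemma nrm_cpow_0: "nrm N \<rho> (cpow c 0 :: ('n::finite \<Rightarrow> nat) \<Rightarrow> real) \<le> 1"
proof -
  have "bn k (cpow c 0) = (if k = 0 then 1 else 0)" for k
  proof (cases "k = 0")
    case True
    then show ?thesis by (simp add: bn_eq ip_def idx_0 mfact_def)
  next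
    case False
    then show ?thesis by (simp, intro bn_0) (auto simp: idx_def)
  qed
  then have "nrm N \<rho> (cpow c 0) = (\<Sum>k\<le>N. if k = 0 then 1 else 0)"
    unfolding nrm_def by (intro sum.cong) (simp_all del: cpow.simps)
  then show ?thesis by simp
qed

lemma nrm_cpow: "\<rho> \<ge> 0 \<Longrightarrow> nrm N \<rho> (cpow c p) \<le> nrm N \<rho> c ^ p"
proof (induction p)
  case 0
  then show ?case using nrm_cpow_0[of N \<rho> c] by simp
next
  case (Suc p)
  have "nrm N \<rho> (cpow c (Suc p)) \<le> nrm N \<rho> c * nrm N \<rho> (cpow c p)"
    using Suc.prems nrm_cmul by simp
  also have "\<dots> \<le> nrm N \<rho> c * nrm N \<rho> c ^ p"
    using Suc by (intro mult_left_mono) auto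
  finally show ?case by simp
qed

lemma nrm_comp:
  assumes "\<rho> \<ge> 0"
  shows "nrm N \<rho> (ccomp a c) \<le> (\<Sum>p\<le>N. \<bar>a p\<bar> * nrm N \<rho> c ^ p)"
proof -
  have bk: "bn k (ccomp a c) \<le> (\<Sum>p\<le>N. \<bar>a p\<bar> * bn k (cpow c p))" if "k \<le> N" for k
  proof -
    have "bn k (ccomp a c) = bn k (\<lambda>\<alpha>. \<Sum>p\<le>k. a p * cpow c p \<alpha>)"
      by (rule bn_cong) (simp add: ccomp_def idx_def)
    also have "\<dots> \<le> (\<Sum>p\<le>k. bn k (\<lambda>\<alpha>. a p * cpow c p \<alpha>))"
      by (rule bn_sum) simp
    also have "\<dots> \<le> (\<Sum>p\<le>N. \<bar>a p\<bar> * bn k (cpow c p))"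
      unfolding bn_scale by (rule sum_mono2) (use that in auto)
    finally show ?thesis .
  qed
  have "nrm N \<rho> (ccomp a c) \<le> (\<Sum>k\<le>N. (\<Sum>p\<le>N. \<bar>a p\<bar> * bn k (cpow c p)) * \<rho> ^ k)"
    unfolding nrm_def by (intro sum_mono mult_right_mono bk) (auto simp: assms)
  also have "\<dots> = (\<Sum>p\<le>N. \<bar>a p\<bar> * nrm N \<rho> (cpow c p))"
    unfolding nrm_def sum_distrib_right sum_distrib_left by (subst sum.swap) (simp add: mult_ac)
  also have "\<dots> \<le> (\<Sum>p\<le>N. \<bar>a p\<bar> * nrm N \<rho> c ^ p)"
    by (intro sum_mono mult_left_mono nrm_cpow assms) auto
  finally show ?thesis .
qed

lemma cmul_cong:
  assumes "\<And>\<beta>. mdeg \<beta> \<le> mdeg \<gamma> \<Longrightarrow> c \<beta> = c' \<beta>" "\<And>\<beta>. mdeg \<beta> \<le> mdeg \<gamma> \<Longrightarrow> d \<beta> = d' \<beta>"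
  shows "cmul c d \<gamma> = cmul c' d' \<gamma>"
  unfolding cmul_def
proof (intro sum.cong refl arg_cong2[where f = "(*)"] assms)
  fix \<alpha> assume "\<alpha> \<in> {\<alpha>. \<alpha> \<le> \<gamma>}"
  then have "\<alpha> \<le> \<gamma>" by simp
  then show "mdeg \<alpha> \<le> mdeg \<gamma>" "mdeg (\<gamma> - \<alpha>) \<le> mdeg \<gamma>"
    using mdeg_mono[of \<alpha> \<gamma>] mdeg_minus[of \<alpha> \<gamma>] by linarith+
qed

lemma cpow_cong: "(\<And>\<beta>. mdeg \<beta> \<le> mdeg \<alpha> \<Longrightarrow> c \<beta> = d \<beta>) \<Longrightarrow> cpow c p \<alpha> = cpow d p \<alpha>"
proof (induction p arbitrary: \<alpha>)
  case (Suc p)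
  show ?case unfolding cpow.simps
  proof (rule cmul_cong)
    fix \<beta> :: "'a \<Rightarrow> nat" assume b: "mdeg \<beta> \<le> mdeg \<alpha>"
    then show "c \<beta> = d \<beta>" by (rule Suc.prems)
    show "cpow c p \<beta> = cpow d p \<beta>"
      by (rule Suc.IH, rule Suc.prems) (rule order_trans[OF _ b])
  qed
qed simp

lemma ccomp_cong: "(\<And>\<beta>. mdeg \<beta> \<le> mdeg \<alpha> \<Longrightarrow> c \<beta> = d \<beta>) \<Longrightarrow> ccomp a c \<alpha> = ccomp a d \<alpha>"
  unfolding ccomp_def by (intro sum.cong refl arg_cong2[where f = "(*)"] cpow_cong)

lemma cpow_low:
  assumes "c 0 = 0"
  shows "mdeg \<alpha> < p \<Longrightarrow> cpow c p \<alpha> = 0"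
proof (induction p arbitrary: \<alpha>)
  case (Suc p)
  have "c \<beta> * cpow c p (\<alpha> - \<beta>) = 0" if "\<beta> \<le> \<alpha>" for \<beta>
  proof (cases "\<beta> = 0")
    case False
    then have "mdeg \<beta> > 0" by (auto simp: fun_eq_iff intro!: Nat.gr0I)
    then have "mdeg (\<alpha> - \<beta>) < p" using Suc.prems mdeg_mono[OF that] by (simp add: mdeg_minus[OF that] del: minus_apply)
    then show ?thesis using Suc.IH by simp
  qed (simp add: assms)
  then show ?case unfolding cpow.simps cmul_def by (intro sum.neutral) blast
qed simp

section \<open>The formal solution: existence, uniqueness and bounds\<close>

lemma rsq_ilap_cong:
  assumes "\<And>\<beta>. mdeg \<beta> + 2 = mdeg \<alpha> \<Longrightarrow> q \<beta> = r \<beta>"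
  shows "rsq (ilap q) \<alpha> = rsq (ilap r) \<alpha>"
proof (cases "mdeg \<alpha> < 2")
  case True
  then show ?thesis by (simp add: rsq_low[of _ "mdeg \<alpha>"] idx_def)
next
  case False
  define k where "k = mdeg \<alpha> - 2"
  have a: "\<alpha> \<in> idx (k + 2)" using False by (simp add: idx_def k_def)
  have "ilap q \<beta> = ilap r \<beta>" if "\<beta> \<in> idx k" for \<beta>
    by (rule lap_rsq_inj[OF _ that]) (use a assms in \<open>simp add: idx_def\<close>)
  then show ?thesis using a by (intro rsq_cong[of k]) auto
qed

text \<open>Picard iteration starting from \<open>L\<close>. Inverting the Laplacian raises the
  degree by two, so the operator reads only strictly smaller degrees of its argument; the j-th
  iterate is final in all degrees up to j, and the diagonal of the iterates is a fixed
  point.\<close>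

lemma formal_solution_exists:
  fixes L :: "('n::finite \<Rightarrow> nat) \<Rightarrow> real"
  shows "\<exists>u. \<forall>\<alpha>. u \<alpha> = L \<alpha> + rsq (ilap (ccomp a u)) \<alpha>"
proof -
  define T where "T = (\<lambda>c \<alpha>. L \<alpha> + rsq (ilap (ccomp a c)) \<alpha>)"
  have T: "T c \<alpha> = T d \<alpha>" if "\<And>\<beta>. mdeg \<beta> < mdeg \<alpha> \<Longrightarrow> c \<beta> = d \<beta>" for c d \<alpha>
  proof -
    have "rsq (ilap (ccomp a c)) \<alpha> = rsq (ilap (ccomp a d)) \<alpha>"
      by (rule rsq_ilap_cong, rule ccomp_cong) (use that in auto)
    then show ?thesis by (simp add: T_def)
  qed
  define U where "U = (\<lambda>j. (T ^^ j) L)"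
  have U_Suc: "U (Suc j) = T (U j)" for j by (simp add: U_def)
  have step: "U (Suc j) \<alpha> = U j \<alpha>" if "mdeg \<alpha> \<le> j" for j \<alpha>
    using that
  proof (induction j arbitrary: \<alpha>)
    case 0
    then show ?case by (simp add: U_def T_def rsq_low[of _ 0] idx_def)
  next
    case (Suc j)
    show ?case unfolding U_Suc[of "Suc j"] unfolding U_Suc[of j]
      by (rule T) (use Suc in \<open>auto simp flip: U_Suc\<close>)
  qed
  have stable: "U (mdeg \<alpha> + m) \<alpha> = U (mdeg \<alpha>) \<alpha>" for \<alpha> m
    by (induction m) (auto simp: step)
  define u where "u = (\<lambda>\<alpha>. U (mdeg \<alpha>) \<alpha>)"
  have "u \<alpha> = T u \<alpha>" for \<alpha>
  proof -
    have "u \<alpha> = T (U (mdeg \<alpha>)) \<alpha>" using step[of \<alpha> "mdeg \<alpha>"] by (simp add: u_def U_Suc)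
    also have "\<dots> = T u \<alpha>"
    proof (rule T)
      fix \<beta> :: "'n \<Rightarrow> nat" assume "mdeg \<beta> < mdeg \<alpha>"
      then show "U (mdeg \<alpha>) \<beta> = u \<beta>" using stable[of \<beta> "mdeg \<alpha> - mdeg \<beta>"] by (simp add: u_def)
    qed
    finally show ?thesis .
  qed
  then show ?thesis by (auto simp: T_def)
qed

text \<open>Strong induction on the degree: in degree k the right side involves \<open>rsq v\<close>
  only up to degree k, hence \<open>v\<close> only up to degree k - 2, and
  \<open>lap_rsq_inj\<close> recovers \<open>v\<close> in degree k.\<close>

lemma formal_solution_unique:
  fixes L :: "('n::finite \<Rightarrow> nat) \<Rightarrow> real"
  assumes "lap (rsq v) = ccomp a (\<lambda>\<alpha>. L \<alpha> + rsq v \<alpha>)" "lap (rsq w) = ccomp a (\<lambda>\<alpha>. L \<alpha> + rsq w \<alpha>)"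
  shows "v = w"
proof -
  have "\<forall>\<alpha>\<in>idx k. v \<alpha> = w \<alpha>" for k
  proof (induction k rule: less_induct)
    case (less k)
    have r: "rsq v \<beta> = rsq w \<beta>" if "mdeg \<beta> \<le> k" for \<beta>
    proof (cases "mdeg \<beta> < 2")
      case True
      then show ?thesis by (simp add: rsq_low[of _ "mdeg \<beta>"] idx_def)
    next
      case False
      then show ?thesis
        by (intro rsq_cong[of "mdeg \<beta> - 2"]) (use less[of "mdeg \<beta> - 2"] that in \<open>auto simp: idx_def\<close>)
    qed
    show ?case
    proof
      fix \<alpha> :: "'n \<Rightarrow> nat" assume a: "\<alpha> \<in> idx k"
      show "v \<alpha> = w \<alpha>"
      proof (rule lap_rsq_inj[OF _ a])
        fix \<alpha> :: "'n \<Rightarrow> nat" assume a: "\<alpha> \<in> idx k"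
        show "lap (rsq v) \<alpha> = lap (rsq w) \<alpha>"
          unfolding assms by (rule ccomp_cong) (use a r in \<open>simp add: idx_def\<close>)
      qed
    qed
  qed
  then show ?thesis by (auto simp: fun_eq_iff idx_def)
qed

lemma bn_ilap:
  shows "bn (k + 2) (rsq (ilap q)) \<le> bn k q" "bn k (ilap q) \<le> bn k q"
proof -
  have le: "ip (k + 2) (rsq (ilap q)) (rsq (ilap q)) \<le> ip k q q"
    using ip_rsq_le[of k "ilap q"] by simp
  have "ip (k + 2) (rsq (ilap q)) (rsq (ilap q)) / fact (k + 2) \<le> ip k q q / fact k"
    by (rule frac_le[OF ip_self_nonneg le _ fact_mono]) simp_all
  then show "bn (k + 2) (rsq (ilap q)) \<le> bn k q" unfolding bn_eq by (rule real_sqrt_le_mono)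
  have "ip k (ilap q) (ilap q) \<le> ip (k + 2) (rsq (ilap q)) (rsq (ilap q))"
    by (rule ip_self_rsq_le(2)) simp
  also note le
  finally have "ip k (ilap q) (ilap q) / fact k \<le> ip k q q / fact k"
    by (simp add: divide_right_mono)
  then show "bn k (ilap q) \<le> bn k q" unfolding bn_eq by (rule real_sqrt_le_mono)
qed

text \<open>The majorant argument, by induction on the truncation. Multiplication by |x|^2 shifts
  degrees by two, so the nonlinear part up to degree N is at most \<rho>^2 times the source up to
  degree N - 2, which the induction hypothesis bounds by \<open>F\<close>. One half of
  \<open>M\<close> is reserved for \<open>L\<close>, the other for this term.\<close>

lemma formal_solution_bound:
  fixes u :: "('n::finite \<Rightarrow> nat) \<Rightarrow> real"
  assumes u: "\<And>\<alpha>. u \<alpha> = L \<alpha> + rsq (ilap (ccomp a u)) \<alpha>"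
    and rho: "\<rho> \<ge> 0" and L: "\<And>N. nrm N \<rho> L \<le> M / 2"
    and F: "\<And>N. (\<Sum>p\<le>N. \<bar>a p\<bar> * M ^ p) \<le> F" and le: "\<rho>\<^sup>2 * F \<le> M / 2"
  shows "nrm N \<rho> u \<le> M" "nrm N \<rho> (ilap (ccomp a u)) \<le> F"
proof -
  define q where "q = ccomp a u"
  have M0: "M \<ge> 0" using L[of 0] nrm_nonneg[OF rho, of 0 L] by simp
  have ub: "bn k u \<le> bn k L + bn k (rsq (ilap q))" for k
    unfolding q_def by (subst bn_cong[OF u]) (auto intro: bn_add)
  have qF: "nrm N \<rho> q \<le> F" if "nrm N \<rho> u \<le> M" for N
  proof -
    have "nrm N \<rho> q \<le> (\<Sum>p\<le>N. \<bar>a p\<bar> * nrm N \<rho> u ^ p)" unfolding q_def by (rule nrm_comp[OF rho])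
    also have "\<dots> \<le> (\<Sum>p\<le>N. \<bar>a p\<bar> * M ^ p)"
      by (intro sum_mono mult_left_mono power_mono that) (use rho in auto)
    finally show ?thesis using F[of N] by simp
  qed
  have low: "bn k (rsq (ilap q)) = 0" if "k < 2" for k
    by (rule bn_0) (use that rsq_low in auto)
  have main: "nrm N \<rho> u \<le> M" for N
  proof (induction N rule: less_induct)
    case (less N)
    have "nrm N \<rho> u \<le> nrm N \<rho> L + nrm N \<rho> (rsq (ilap q))"
      unfolding nrm_def sum.distrib[symmetric] distrib_right[symmetric]
      by (intro sum_mono mult_right_mono ub) (use rho in auto)
    also have "nrm N \<rho> (rsq (ilap q)) \<le> M / 2"
    proof (cases "N < 2")
      case True
      then have "nrm N \<rho> (rsq (ilap q)) = 0" unfolding nrm_def by (intro sum.neutral) (auto simp: low)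
      then show ?thesis using M0 by simp
    next
      case False
      then obtain m where m: "N = m + 2" by (metis add.commute le_Suc_ex not_less)
      have "nrm N \<rho> (rsq (ilap q)) = (\<Sum>k\<le>m. bn (k + 2) (rsq (ilap q)) * \<rho> ^ (k + 2))"
      proof -
        have "(\<Sum>k\<le>Suc (Suc m). g k) = g 0 + (g 1 + (\<Sum>k\<le>m. g (Suc (Suc k))))" for g :: "nat \<Rightarrow> real"
          by (simp only: sum.atMost_Suc_shift One_nat_def)
        from this[of "\<lambda>k. bn k (rsq (ilap q)) * \<rho> ^ k"] show ?thesis
          by (simp add: nrm_def m low)
      qed
      also have "\<dots> \<le> (\<Sum>k\<le>m. bn k q * \<rho> ^ (k + 2))"
        by (intro sum_mono mult_right_mono bn_ilap) (use rho in auto)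
      also have "\<dots> = \<rho>\<^sup>2 * nrm m \<rho> q"
        by (simp add: nrm_def sum_distrib_left power_add mult_ac power2_eq_square)
      also have "\<dots> \<le> \<rho>\<^sup>2 * F"
        by (intro mult_left_mono qF less) (use m in auto)
      finally show ?thesis using le by simp
    qed
    finally show ?case using L[of N] by simp
  qed
  show "nrm N \<rho> u \<le> M" by (rule main)
  have "nrm N \<rho> (ilap q) \<le> nrm N \<rho> q"
    unfolding nrm_def by (intro sum_mono mult_right_mono bn_ilap) (use rho in auto)
  also have "\<dots> \<le> F" by (rule qF[OF main])
  finally show "nrm N \<rho> (ilap (ccomp a u)) \<le> F" by (simp add: q_def)
qed

section \<open>Convergent power series\<close>

definition A1 :: "nat \<Rightarrow> (('n::finite \<Rightarrow> nat) \<Rightarrow> real) \<Rightarrow> real" where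
  "A1 k c = (\<Sum>\<alpha>\<in>idx k. \<bar>c \<alpha>\<bar>)"

text \<open>Absolute convergence on the closed cube |x_i| \<le> \<rho>, which contains the ball of
  radius \<rho>.\<close>

definition aconv :: "(('n::finite \<Rightarrow> nat) \<Rightarrow> real) \<Rightarrow> real \<Rightarrow> bool" where
  "aconv c \<rho> \<longleftrightarrow> summable (\<lambda>k. A1 k c * \<rho> ^ k)"

definition hom :: "(('n::finite \<Rightarrow> nat) \<Rightarrow> real) \<Rightarrow> nat \<Rightarrow> real^'n \<Rightarrow> real" where
  "hom c k x = (\<Sum>\<alpha>\<in>idx k. c \<alpha> * monomial \<alpha> x)"

text \<open>Terms are grouped by degree, which suits differentiation and rescaling;
  \<open>has_sum_psum\<close> links this to the unordered sums in
  \<open>real_analytic_on\<close>.\<close>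

definition psum :: "(('n::finite \<Rightarrow> nat) \<Rightarrow> real) \<Rightarrow> real^'n \<Rightarrow> real" where
  "psum c x = (\<Sum>k. hom c k x)"

lemma A1_nonneg [simp]: "A1 k c \<ge> 0"
  unfolding A1_def by (intro sum_nonneg) simp

lemma abs_monomial_le:
  assumes "\<And>i. \<bar>x $ i\<bar> \<le> \<rho>"
  shows "\<bar>monomial \<alpha> x\<bar> \<le> \<rho> ^ mdeg \<alpha>"
proof -
  have "\<bar>monomial \<alpha> x\<bar> \<le> (\<Prod>i\<in>UNIV. \<rho> ^ \<alpha> i)"
    unfolding monomial_def abs_prod power_abs by (intro prod_mono conjI power_mono assms) auto
  then show ?thesis by (simp add: power_sum)
qed

lemma abs_hom_le:
  assumes "\<And>i. \<bar>x $ i\<bar> \<le> \<rho>"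
  shows "\<bar>hom c k x\<bar> \<le> A1 k c * \<rho> ^ k"
proof -
  have "\<bar>hom c k x\<bar> \<le> (\<Sum>\<alpha>\<in>idx k. \<bar>c \<alpha> * monomial \<alpha> x\<bar>)" unfolding hom_def by (rule sum_abs)
  also have "\<dots> \<le> (\<Sum>\<alpha>\<in>idx k. \<bar>c \<alpha>\<bar> * \<rho> ^ k)"
    unfolding abs_mult using abs_monomial_le[OF assms] by (intro sum_mono mult_left_mono) (auto simp: idx_def)
  finally show ?thesis by (simp add: A1_def sum_distrib_right)
qed

lemma aconv_mono: "aconv c \<rho> \<Longrightarrow> 0 \<le> \<sigma> \<Longrightarrow> \<sigma> \<le> \<rho> \<Longrightarrow> aconv c \<sigma>"
  unfolding aconv_def
  by (erule summable_comparison_test') (auto intro!: mult_left_mono power_mono)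

lemma aconv_add: "aconv c \<rho> \<Longrightarrow> aconv d \<rho> \<Longrightarrow> 0 \<le> \<rho> \<Longrightarrow> aconv (\<lambda>\<alpha>. c \<alpha> + d \<alpha>) \<rho>"
  unfolding aconv_def
proof (rule summable_comparison_test'[OF summable_add])
  fix k assume "0 \<le> \<rho>"
  have "A1 k (\<lambda>\<alpha>. c \<alpha> + d \<alpha>) \<le> A1 k c + A1 k d"
    unfolding A1_def sum.distrib[symmetric] by (intro sum_mono abs_triangle_ineq)
  then have "A1 k (\<lambda>\<alpha>. c \<alpha> + d \<alpha>) * \<rho> ^ k \<le> (A1 k c + A1 k d) * \<rho> ^ k"
    using \<open>0 \<le> \<rho>\<close> by (intro mult_right_mono) auto
  then show "norm (A1 k (\<lambda>\<alpha>. c \<alpha> + d \<alpha>) * \<rho> ^ k) \<le> A1 k c * \<rho> ^ k + A1 k d * \<rho> ^ k"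
    using \<open>0 \<le> \<rho>\<close> by (simp add: distrib_right)
qed

lemma A1_scale: "A1 k (\<lambda>\<alpha>. a * c \<alpha>) = \<bar>a\<bar> * A1 k c"
  by (simp add: A1_def abs_mult sum_distrib_left)

lemma aconv_scale: "aconv c \<rho> \<Longrightarrow> aconv (\<lambda>\<alpha>. a * c \<alpha>) \<rho>"
  unfolding aconv_def A1_scale by (simp add: mult.assoc summable_mult)

lemma aconv_diff: "aconv c \<rho> \<Longrightarrow> aconv d \<rho> \<Longrightarrow> 0 \<le> \<rho> \<Longrightarrow> aconv (\<lambda>\<alpha>. c \<alpha> - d \<alpha>) \<rho>"
  using aconv_add[of c \<rho> "\<lambda>\<alpha>. (-1) * d \<alpha>"] aconv_scale[of d \<rho> "-1"] by simp

lemma summable_abs_hom: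
  assumes "aconv c \<rho>" "\<And>i. \<bar>x $ i\<bar> \<le> \<rho>"
  shows "summable (\<lambda>k. \<bar>hom c k x\<bar>)"
  using assms(1) unfolding aconv_def
  by (rule summable_comparison_test'[of _ 0]) (auto intro: abs_hom_le[OF assms(2)])

lemma psum_sums:
  assumes "aconv c \<rho>" "\<And>i. \<bar>x $ i\<bar> \<le> \<rho>"
  shows "(\<lambda>k. hom c k x) sums psum c x"
  unfolding psum_def by (rule summable_sums, rule summable_rabs_cancel, rule summable_abs_hom[OF assms])

lemma hom_add: "hom (\<lambda>\<alpha>. c \<alpha> + d \<alpha>) k x = hom c k x + hom d k x"
  by (simp add: hom_def algebra_simps sum.distrib)

lemma hom_diff: "hom (\<lambda>\<alpha>. c \<alpha> - d \<alpha>) k x = hom c k x - hom d k x"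
  by (simp add: hom_def algebra_simps sum_subtractf)

lemma hom_scale: "hom (\<lambda>\<alpha>. a * c \<alpha>) k x = a * hom c k x"
  by (simp add: hom_def algebra_simps sum_distrib_left)

lemma psum_add:
  assumes "aconv c \<rho>" "aconv d \<rho>" "\<And>i. \<bar>x $ i\<bar> \<le> \<rho>"
  shows "psum (\<lambda>\<alpha>. c \<alpha> + d \<alpha>) x = psum c x + psum d x"
  using sums_add[OF psum_sums[OF assms(1,3)] psum_sums[OF assms(2,3)]]
  by (simp add: psum_def[of "\<lambda>\<alpha>. c \<alpha> + d \<alpha>"] hom_add sums_iff)

lemma psum_diff:
  assumes "aconv c \<rho>" "aconv d \<rho>" "\<And>i. \<bar>x $ i\<bar> \<le> \<rho>"
  shows "psum (\<lambda>\<alpha>. c \<alpha> - d \<alpha>) x = psum c x - psum d x"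
  using sums_diff[OF psum_sums[OF assms(1,3)] psum_sums[OF assms(2,3)]]
  by (simp add: psum_def[of "\<lambda>\<alpha>. c \<alpha> - d \<alpha>"] hom_diff sums_iff)

lemma hom_0_eq: "hom c 0 x = c 0"
  by (simp add: hom_def idx_0 monomial_def)

lemma hom_Suc_at_0: "hom c (Suc k) 0 = 0"
proof -
  have "monomial \<alpha> 0 = 0" if "\<alpha> \<in> idx (Suc k)" for \<alpha> :: "'a \<Rightarrow> nat"
  proof -
    have "\<exists>i. \<alpha> i \<noteq> 0"
    proof (rule ccontr)
      assume "\<not> (\<exists>i. \<alpha> i \<noteq> 0)"
      with that show False by (simp add: idx_def)
    qed
    then obtain i where "\<alpha> i \<noteq> 0" by blast
    then show ?thesis unfolding monomial_def by (intro prod_zero bexI[of _ i]) auto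
  qed
  then show ?thesis by (simp add: hom_def)
qed

lemma psum_at_0: "psum c 0 = c 0"
proof -
  have "(\<lambda>k. hom c k 0) = (\<lambda>k. if k = 0 then c 0 else 0)"
    by (rule ext) (metis hom_0_eq hom_Suc_at_0 not0_implies_Suc)
  then show ?thesis unfolding psum_def using sums_single[of 0 "\<lambda>_. c 0"] by (simp add: sums_iff)
qed

subsection \<open>Comparison of the norms\<close>

lemma sum_idx_Suc:
  fixes g :: "('n::finite \<Rightarrow> nat) \<Rightarrow> real"
  assumes "\<And>\<alpha>. \<alpha> \<in> idx (Suc k) \<Longrightarrow> \<alpha> i = 0 \<Longrightarrow> g \<alpha> = 0"
  shows "(\<Sum>\<alpha>\<in>idx (Suc k). g \<alpha>) = (\<Sum>\<beta>\<in>idx k. g (\<beta>(i := Suc (\<beta> i))))"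
proof -
  let ?g = "\<lambda>\<alpha>::'n \<Rightarrow> nat. \<alpha>(i := Suc (\<alpha> i))"
  have inj: "inj_on ?g (idx k)"
    by (rule inj_on_inverseI[where g = "\<lambda>\<alpha>. \<alpha>(i := \<alpha> i - 1)"]) auto
  have img: "?g ` idx k = {\<alpha> \<in> idx (Suc k). \<alpha> i \<noteq> 0}" (is "_ = ?R")
  proof (intro equalityI subsetI)
    fix \<alpha> :: "'n \<Rightarrow> nat" assume a: "\<alpha> \<in> ?R"
    have eq: "\<alpha> = ?g (\<alpha>(i := \<alpha> i - 1))" using a by auto
    from a have "?g (\<alpha>(i := \<alpha> i - 1)) \<in> idx (Suc k)" by (subst eq[symmetric]) simp
    then have "\<alpha>(i := \<alpha> i - 1) \<in> idx k" by (subst (asm) upd_Suc_idx)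
    with eq show "\<alpha> \<in> ?g ` idx k" by blast
  qed auto
  have "(\<Sum>\<alpha>\<in>idx (Suc k). g \<alpha>) = (\<Sum>\<alpha>\<in>{\<alpha> \<in> idx (Suc k). \<alpha> i \<noteq> 0}. g \<alpha>)"
    by (rule sum.mono_neutral_right) (auto simp: assms)
  also have "\<dots> = (\<Sum>\<alpha>\<in>idx k. g (?g \<alpha>))"
    unfolding img[symmetric] by (subst sum.reindex[OF inj]) (simp add: o_def)
  finally show ?thesis .
qed

text \<open>The multinomial theorem at (1, ..., 1). Multiplying by the degree, written as the sum of
  the exponents, and lowering one exponent gives the recursion in k.\<close>

lemma sum_inverse_mfact:
  "(\<Sum>\<alpha>\<in>(idx k :: ('n::finite \<Rightarrow> nat) set). 1 / mfact \<alpha>) = real CARD('n) ^ k / fact k"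
proof (induction k)
  case 0
  then show ?case by (simp add: idx_0 mfact_def)
next
  case (Suc k)
  have mf: "mfact \<alpha> \<noteq> 0" for \<alpha> :: "'n \<Rightarrow> nat" using mfact_pos[of \<alpha>] by linarith
  have "real (Suc k) * (\<Sum>\<alpha>\<in>(idx (Suc k) :: ('n \<Rightarrow> nat) set). 1 / mfact \<alpha>)
      = (\<Sum>\<alpha>\<in>(idx (Suc k) :: ('n \<Rightarrow> nat) set). \<Sum>i\<in>UNIV. real (\<alpha> i) / mfact \<alpha>)"
    unfolding sum_distrib_left
  proof (intro sum.cong refl)
    fix \<alpha> :: "'n \<Rightarrow> nat" assume "\<alpha> \<in> idx (Suc k)"
    then have "real (Suc k) = (\<Sum>i\<in>UNIV. real (\<alpha> i))" by (simp add: idx_def flip: of_nat_sum)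
    then show "real (Suc k) * (1 / mfact \<alpha>) = (\<Sum>i\<in>UNIV. real (\<alpha> i) / mfact \<alpha>)"
      by (simp add: sum_divide_distrib)
  qed
  also have "\<dots> = (\<Sum>i\<in>UNIV. \<Sum>\<alpha>\<in>(idx (Suc k) :: ('n \<Rightarrow> nat) set). real (\<alpha> i) / mfact \<alpha>)"
    by (rule sum.swap)
  also have "\<dots> = (\<Sum>i\<in>(UNIV::'n set). \<Sum>\<alpha>\<in>(idx k :: ('n \<Rightarrow> nat) set). 1 / mfact \<alpha>)"
  proof (rule sum.cong[OF refl])
    fix i :: 'n assume "i \<in> UNIV"
    show "(\<Sum>\<alpha>\<in>(idx (Suc k) :: ('n \<Rightarrow> nat) set). real (\<alpha> i) / mfact \<alpha>) = (\<Sum>\<alpha>\<in>(idx k :: ('n \<Rightarrow> nat) set). 1 / mfact \<alpha>)"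
      by (subst sum_idx_Suc[where i = i]) (simp_all add: mfact_upd_Suc mf del: of_nat_Suc)
  qed
  also have "\<dots> = real CARD('n) * (real CARD('n) ^ k / fact k)" by (simp add: Suc)
  finally show ?case by (simp add: field_simps del: of_nat_Suc) 
qed

text \<open>Cauchy-Schwarz against the weights 1/sqrt(\<alpha>!), whose squares sum to n^k/k!. The
  resulting factor n^(k/2) is rounded up to n^k, so that the loss is a division of the radius by
  n.\<close>

lemma A1_le_bn:
  fixes c :: "('n::finite \<Rightarrow> nat) \<Rightarrow> real"
  shows "A1 k c \<le> real CARD('n) ^ k * bn k c"
proof -
  have mf: "mfact \<alpha> > 0" for \<alpha> :: "'n \<Rightarrow> nat" by simp
  have c1: "real CARD('n) ^ k \<ge> 1" using card_ge_1[where 'n = 'n] by simp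
  have "(A1 k c)\<^sup>2 = (\<Sum>\<alpha>\<in>idx k. (1 / sqrt (mfact \<alpha>)) * (sqrt (mfact \<alpha>) * \<bar>c \<alpha>\<bar>))\<^sup>2"
    unfolding A1_def by (intro arg_cong[where f = "\<lambda>x. x\<^sup>2"] sum.cong refl) (use mf in \<open>simp add: less_imp_neq[symmetric]\<close>)
  also have "\<dots> \<le> (\<Sum>\<alpha>\<in>(idx k :: ('n \<Rightarrow> nat) set). (1 / sqrt (mfact \<alpha>))\<^sup>2) * (\<Sum>\<alpha>\<in>idx k. (sqrt (mfact \<alpha>) * \<bar>c \<alpha>\<bar>)\<^sup>2)"
    by (rule Cauchy_Schwarz_ineq_sum)
  also have "(\<Sum>\<alpha>\<in>(idx k :: ('n \<Rightarrow> nat) set). (1 / sqrt (mfact \<alpha>))\<^sup>2) = real CARD('n) ^ k / fact k"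
    using mf by (simp add: power_divide less_imp_le sum_inverse_mfact)
  also have "(\<Sum>\<alpha>\<in>idx k. (sqrt (mfact \<alpha>) * \<bar>c \<alpha>\<bar>)\<^sup>2) = ip k c c"
    using mf by (simp add: ip_def power_mult_distrib less_imp_le) (simp add: power2_eq_square mult.assoc)
  also have "real CARD('n) ^ k / fact k * ip k c c = real CARD('n) ^ k * (bn k c)\<^sup>2"
    by (simp add: bn_eq ip_self_nonneg)
  also have "\<dots> \<le> real CARD('n) ^ k * (real CARD('n) ^ k * (bn k c)\<^sup>2)"
    using mult_right_mono[OF c1, of "(bn k c)\<^sup>2"] by (intro mult_left_mono) auto
  also have "\<dots> = (real CARD('n) ^ k * bn k c)\<^sup>2" by (simp add: power2_eq_square mult_ac)
  finally show ?thesis by (rule power2_le_imp_le) simp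
qed

lemma mfact_le_fact: "mfact \<alpha> \<le> fact (mdeg \<alpha>)" for \<alpha> :: "'n::finite \<Rightarrow> nat"
proof -
  have "(\<Prod>i\<in>A. fact (\<alpha> i) :: real) \<le> fact (\<Sum>i\<in>A. \<alpha> i)" if "finite A" for A
    using that
  proof (induction A rule: finite_induct)
    case (insert x A)
    have "fact (\<alpha> x) * (\<Prod>i\<in>A. fact (\<alpha> i) :: real) \<le> fact (\<alpha> x) * fact (\<Sum>i\<in>A. \<alpha> i)"
      using insert.IH by (intro mult_left_mono) auto
    also have "\<dots> = real (fact (\<alpha> x) * fact (\<Sum>i\<in>A. \<alpha> i))" by simp
    also have "\<dots> \<le> real (fact (\<alpha> x + (\<Sum>i\<in>A. \<alpha> i)))"
      using fact_fact_dvd_fact[of "\<alpha> x" "\<Sum>i\<in>A. \<alpha> i", where 'a = nat]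
      by (intro of_nat_mono dvd_imp_le) auto
    finally show ?case using insert by simp
  qed simp
  then show ?thesis by (simp add: mfact_def)
qed

lemma bn_le_A1: "bn k c \<le> A1 k c"
proof -
  have "bn k c \<le> (\<Sum>\<alpha>\<in>idx k. \<bar>sqrt (mfact \<alpha> / fact k) * c \<alpha>\<bar>)"
    unfolding bn_def by (rule L2_set_le_sum_abs)
  also have "\<dots> \<le> A1 k c"
    unfolding A1_def
  proof (rule sum_mono)
    fix \<alpha> :: "'a \<Rightarrow> nat" assume "\<alpha> \<in> idx k"
    then have "mfact \<alpha> / fact k \<le> 1" using mfact_le_fact[of \<alpha>] by (simp add: idx_def)
    then have "sqrt (mfact \<alpha> / fact k) \<le> 1" by simp
    then have "\<bar>sqrt (mfact \<alpha> / fact k)\<bar> * \<bar>c \<alpha>\<bar> \<le> 1 * \<bar>c \<alpha>\<bar>"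
      by (intro mult_right_mono) (auto simp: less_imp_le)
    then show "\<bar>sqrt (mfact \<alpha> / fact k) * c \<alpha>\<bar> \<le> \<bar>c \<alpha>\<bar>" by (simp add: abs_mult)
  qed
  finally show ?thesis .
qed

lemma aconv_if_nrm_bounded:
  fixes c :: "('n::finite \<Rightarrow> nat) \<Rightarrow> real"
  assumes "\<And>N. nrm N \<rho> c \<le> M" "\<rho> \<ge> 0"
  shows "aconv c (\<rho> / real CARD('n))"
proof -
  have "summable (\<lambda>k. bn k c * \<rho> ^ k)"
    by (rule bounded_imp_summable[where B = M]) (use assms in \<open>auto simp: nrm_def\<close>)
  then show ?thesis unfolding aconv_def
  proof (rule summable_comparison_test'[of _ 0])
    fix k
    have "A1 k c * (\<rho> / real CARD('n)) ^ k \<le> (real CARD('n) ^ k * bn k c) * (\<rho> / real CARD('n)) ^ k"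
      using assms(2) by (intro mult_right_mono A1_le_bn) auto
    also have "\<dots> = bn k c * \<rho> ^ k" by (simp add: power_divide)
    finally show "norm (A1 k c * (\<rho> / real CARD('n)) ^ k) \<le> bn k c * \<rho> ^ k"
      using assms(2) by simp
  qed
qed

definition l1 :: "(('n::finite \<Rightarrow> nat) \<Rightarrow> real) \<Rightarrow> real \<Rightarrow> real" where
  "l1 c \<rho> = (\<Sum>k. A1 k c * \<rho> ^ k)"

lemma l1_nonneg: "aconv c \<rho> \<Longrightarrow> \<rho> \<ge> 0 \<Longrightarrow> l1 c \<rho> \<ge> 0"
  unfolding l1_def aconv_def by (intro suminf_nonneg) auto

lemma nrm_le_l1:
  assumes "aconv c \<rho>" "\<rho> \<ge> 0"
  shows "nrm N \<rho> c \<le> l1 c \<rho>"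
proof -
  have "nrm N \<rho> c \<le> (\<Sum>k\<le>N. A1 k c * \<rho> ^ k)"
    unfolding nrm_def by (intro sum_mono mult_right_mono bn_le_A1) (use assms in auto)
  also have "\<dots> \<le> l1 c \<rho>"
    unfolding l1_def using assms by (intro sum_le_suminf) (auto simp: aconv_def)
  finally show ?thesis .
qed

text \<open>Without a constant term every summand carries at least one factor t. This is how
  smallness is obtained from shrinking the radius.\<close>

lemma l1_small:
  assumes "aconv c \<rho>" "\<rho> \<ge> 0" "c 0 = 0" "0 \<le> t" "t \<le> 1"
  shows "l1 c (t * \<rho>) \<le> t * l1 c \<rho>"
proof -
  have "A1 k c * (t * \<rho>) ^ k \<le> t * (A1 k c * \<rho> ^ k)" for k
  proof (cases k)
    case 0
    then show ?thesis by (simp add: A1_def idx_0 assms)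
  next
    case (Suc m)
    have "t ^ k \<le> t" using assms by (simp add: Suc mult_le_one power_le_one mult_left_le)
    then have "A1 k c * \<rho> ^ k * t ^ k \<le> A1 k c * \<rho> ^ k * t" by (intro mult_left_mono) (use assms in auto)
    then show ?thesis by (simp add: power_mult_distrib mult_ac)
  qed
  moreover have "aconv c (t * \<rho>)"
    by (rule aconv_mono[OF assms(1)]) (use assms in \<open>auto intro: mult_left_le_one_le\<close>)
  ultimately show ?thesis
    unfolding l1_def using assms(1) unfolding aconv_def
    by (subst suminf_mult[symmetric]) (auto intro!: suminf_le summable_mult)
qed

subsection \<open>Termwise differentiation\<close>

lemma A1_pd: "A1 k (pd i c) \<le> real (Suc k) * A1 (Suc k) c"
proof -
  have "A1 k (pd i c) = (\<Sum>\<alpha>\<in>idx k. real (Suc (\<alpha> i)) * \<bar>c (\<alpha>(i := Suc (\<alpha> i)))\<bar>)"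
    unfolding A1_def pd_def by (simp add: abs_mult)
  also have "\<dots> = (\<Sum>\<alpha>\<in>idx (Suc k). real (\<alpha> i) * \<bar>c \<alpha>\<bar>)"
    by (subst sum_idx_Suc[where i = i]) auto
  also have "\<dots> \<le> (\<Sum>\<alpha>\<in>idx (Suc k). real (Suc k) * \<bar>c \<alpha>\<bar>)"
    by (intro sum_mono mult_right_mono) (auto simp: idx_def le_mdeg simp del: of_nat_Suc dest: sym)
  finally show ?thesis by (simp add: A1_def sum_distrib_left)
qed

lemma aconv_pd:
  assumes "aconv c \<rho>" "0 \<le> \<sigma>" "\<sigma> < \<rho>"
  shows "aconv (pd i c) \<sigma>"
proof -
  have "summable (\<lambda>k. diffs (\<lambda>k. A1 k c) k * \<sigma> ^ k)"
  proof (rule termdiff_converges[where K = \<rho>])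
    fix x :: real assume "norm x < \<rho>"
    then have "aconv c \<bar>x\<bar>" using aconv_mono[OF assms(1)] by auto
    then show "summable (\<lambda>n. A1 n c * x ^ n)"
      unfolding aconv_def by (rule summable_comparison_test'[of _ 0]) (auto simp: abs_mult power_abs)
  qed (use assms in auto)
  then show ?thesis unfolding aconv_def
    by (rule summable_comparison_test'[of _ 0])
       (use assms A1_pd in \<open>auto simp: diffs_def intro!: mult_right_mono\<close>)
qed

lemma has_derivative_monomial:
  "(monomial \<alpha> has_derivative (\<lambda>h. \<Sum>i\<in>UNIV. h $ i * (real (\<alpha> i) * monomial (\<alpha>(i := \<alpha> i - 1)) x))) (at x within S)"
proof -
  have "(monomial \<alpha> has_derivative
     (\<lambda>h. \<Sum>i\<in>UNIV. (real (\<alpha> i) * (h $ i * (x $ i) ^ (\<alpha> i - 1))) * (\<Prod>j\<in>UNIV - {i}. (x $ j) ^ \<alpha> j))) (at x within S)"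
    unfolding monomial_def[abs_def] of_nat_id
    by (rule has_derivative_prod) (auto intro!: derivative_eq_intros bounded_linear_imp_has_derivative bounded_linear_vec_nth simp: mult_ac)
  moreover have "monomial (\<alpha>(i := \<alpha> i - 1)) x = (x $ i) ^ (\<alpha> i - 1) * (\<Prod>j\<in>UNIV - {i}. (x $ j) ^ \<alpha> j)" for i
    unfolding monomial_def by (subst prod.remove[of _ i]) auto
  ultimately show ?thesis by (simp add: mult_ac)
qed

text \<open>Indexed by the degree of the form that is differentiated, so that the differentiated
  series runs parallel to that of \<open>hom c\<close>; the form of degree 0 contributes 0.\<close>

definition dhom :: "'n \<Rightarrow> (('n::finite \<Rightarrow> nat) \<Rightarrow> real) \<Rightarrow> nat \<Rightarrow> real^'n \<Rightarrow> real" where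
  "dhom i c k x = (case k of 0 \<Rightarrow> 0 | Suc m \<Rightarrow> hom (pd i c) m x)"

lemma has_derivative_hom:
  "(hom c k has_derivative (\<lambda>h. \<Sum>i\<in>UNIV. h $ i * dhom i c k x)) (at x within S)"
proof -
  have "(hom c k has_derivative (\<lambda>h. \<Sum>\<alpha>\<in>idx k. c \<alpha> * (\<Sum>i\<in>UNIV. h $ i * (real (\<alpha> i) * monomial (\<alpha>(i := \<alpha> i - 1)) x)))) (at x within S)"
    unfolding hom_def[abs_def]
    by (intro has_derivative_sum has_derivative_mult_right has_derivative_monomial)
  also have "(\<lambda>h. \<Sum>\<alpha>\<in>idx k. c \<alpha> * (\<Sum>i\<in>UNIV. h $ i * (real (\<alpha> i) * monomial (\<alpha>(i := \<alpha> i - 1)) x)))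
    = (\<lambda>h. \<Sum>i\<in>UNIV. h $ i * (\<Sum>\<alpha>\<in>idx k. c \<alpha> * (real (\<alpha> i) * monomial (\<alpha>(i := \<alpha> i - 1)) x)))"
    unfolding sum_distrib_left by (subst sum.swap) (simp add: mult_ac)
  also have "(\<lambda>i. \<Sum>\<alpha>\<in>idx k. c \<alpha> * (real (\<alpha> i) * monomial (\<alpha>(i := \<alpha> i - 1)) x)) = (\<lambda>i. dhom i c k x)"
  proof (rule ext)
    fix i
    show "(\<Sum>\<alpha>\<in>idx k. c \<alpha> * (real (\<alpha> i) * monomial (\<alpha>(i := \<alpha> i - 1)) x)) = dhom i c k x"
    proof (cases k)
      case 0
      then show ?thesis by (simp add: dhom_def idx_0)
    next
      case (Suc m)
      show ?thesis unfolding Suc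
        by (subst sum_idx_Suc[where i = i]) (auto simp: dhom_def hom_def pd_def mult_ac)
    qed
  qed
  finally show ?thesis .
qed

lemma has_derivative_psum:
  fixes c :: "('n::finite \<Rightarrow> nat) \<Rightarrow> real"
  assumes "aconv c \<rho>" "norm x < \<rho>"
  shows "(psum c has_derivative (\<lambda>h. \<Sum>i\<in>UNIV. h $ i * psum (pd i c) x)) (at x)"
proof -
  define \<sigma> where "\<sigma> = (norm x + \<rho>) / 2"
  \<comment> \<open>An intermediate radius is inserted because the series of the derivatives is
    known to converge only strictly below \<rho>.\<close>
  have s: "norm x < \<sigma>" "\<sigma> < \<rho>" "0 \<le> \<sigma>" using assms(2) norm_ge_zero[of x] by (simp_all add: \<sigma>_def field_simps del: norm_ge_zero)
  define S where "S = ball (0::real^'n) \<sigma>"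
  have xS: "x \<in> S" using s by (simp add: S_def)
  have comp_le: "\<bar>y $ i\<bar> \<le> \<sigma>" if "y \<in> S" for y i
    using that component_le_norm_cart[of y i] by (simp add: S_def)
  have unif: "uniform_limit S (\<lambda>n y. \<Sum>k<n. dhom i c k y) (\<lambda>y. \<Sum>k. dhom i c k y) sequentially" for i
  proof (rule Weierstrass_m_test)
    show "norm (dhom i c k y) \<le> (case k of 0 \<Rightarrow> 0 | Suc m \<Rightarrow> A1 m (pd i c) * \<sigma> ^ m)" if "y \<in> S" for k y
      using abs_hom_le[OF comp_le[OF that]] by (auto simp: dhom_def split: nat.split)
    show "summable (\<lambda>k. case k of 0 \<Rightarrow> 0 | Suc m \<Rightarrow> A1 m (pd i c) * \<sigma> ^ m)"
      by (subst summable_Suc_iff[symmetric]) (use aconv_pd[OF assms(1) s(3,2)] in \<open>simp add: aconv_def\<close>)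
  qed
  have sumd: "(\<Sum>k. dhom i c k y) = psum (pd i c) y" if "y \<in> S" for i y
  proof -
    have "(\<lambda>k. dhom i c (Suc k) y) sums psum (pd i c) y"
      using psum_sums[OF aconv_pd[OF assms(1) s(3,2)] comp_le[OF that]] by (simp add: dhom_def)
    then have "(\<lambda>k. dhom i c k y) sums (psum (pd i c) y + dhom i c 0 y)" by (subst (asm) sums_Suc_iff)
    then show ?thesis by (simp add: sums_iff dhom_def[of _ _ 0])
  qed
  have "\<exists>g. \<forall>y\<in>S. (\<lambda>n. hom c n y) sums g y \<and> (g has_derivative (\<lambda>h. \<Sum>i\<in>UNIV. h $ i * psum (pd i c) y)) (at y within S)"
  proof (rule has_derivative_series)
    show "convex S" by (simp add: S_def)
    show "(hom c k has_derivative (\<lambda>h. \<Sum>i\<in>UNIV. h $ i * dhom i c k y)) (at y within S)" for k y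
      by (rule has_derivative_hom)
    show "x \<in> S" by (rule xS)
    show "(\<lambda>k. hom c k x) sums psum c x"
      by (rule psum_sums[OF aconv_mono[OF assms(1)] comp_le[OF xS]]) (use s in auto)
    fix e :: real assume e: "e > 0"
    have "\<forall>\<^sub>F n in sequentially. \<forall>y\<in>S. \<bar>(\<Sum>k<n. dhom i c k y) - psum (pd i c) y\<bar> < e / real CARD('n)" for i
      using uniform_limitD[OF unif[of i], of "e / real CARD('n)"] e by (simp add: dist_real_def sumd)
    then have "\<forall>\<^sub>F n in sequentially. \<forall>i. \<forall>y\<in>S. \<bar>(\<Sum>k<n. dhom i c k y) - psum (pd i c) y\<bar> < e / real CARD('n)"
      by (rule eventually_all_finite)
    then show "\<forall>\<^sub>F n in sequentially. \<forall>y\<in>S. \<forall>h. norm ((\<Sum>k<n. \<Sum>i\<in>UNIV. h $ i * dhom i c k y) - (\<Sum>i\<in>UNIV. h $ i * psum (pd i c) y)) \<le> e * norm h"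
    proof eventually_elim
      case (elim n)
      show ?case
      proof (intro ballI allI)
        fix y h assume y: "y \<in> S"
        have "(\<Sum>k<n. \<Sum>i\<in>UNIV. h $ i * dhom i c k y) - (\<Sum>i\<in>UNIV. h $ i * psum (pd i c) y)
          = (\<Sum>i\<in>UNIV. h $ i * ((\<Sum>k<n. dhom i c k y) - psum (pd i c) y))"
          by (subst sum.swap) (simp add: sum_distrib_left right_diff_distrib sum_subtractf)
        also have "\<bar>\<dots>\<bar> \<le> (\<Sum>i\<in>UNIV. \<bar>h $ i\<bar> * \<bar>(\<Sum>k<n. dhom i c k y) - psum (pd i c) y\<bar>)"
          unfolding abs_mult[symmetric] by (rule sum_abs)
        also have "\<dots> \<le> (\<Sum>i\<in>(UNIV::'n set). norm h * (e / real CARD('n)))"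
          by (intro sum_mono mult_mono component_le_norm_cart) (use elim y in \<open>auto simp: less_imp_le\<close>)
        also have "\<dots> = e * norm h" by simp
        finally show "norm ((\<Sum>k<n. \<Sum>i\<in>UNIV. h $ i * dhom i c k y) - (\<Sum>i\<in>UNIV. h $ i * psum (pd i c) y)) \<le> e * norm h"
          by simp
      qed
    qed
  qed
  then obtain g where g: "\<And>y. y \<in> S \<Longrightarrow> (\<lambda>n. hom c n y) sums g y"
      "\<And>y. y \<in> S \<Longrightarrow> (g has_derivative (\<lambda>h. \<Sum>i\<in>UNIV. h $ i * psum (pd i c) y)) (at y within S)" by blast
  have "g y = psum c y" if "y \<in> S" for y using g(1)[OF that] by (simp add: psum_def sums_iff)
  with g(2)[OF xS] show ?thesis
    by (metis (no_types, lifting) S_def at_within_open has_derivative_transform_within_open open_ball xS)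
qed

subsection \<open>Partial derivatives\<close>

lemma partial_deriv_eqI: "(u has_derivative D) (at x) \<Longrightarrow> partial_deriv i u x = D (axis i 1)"
  unfolding partial_deriv_def using frechet_derivative_at by metis

lemma has_derivative_cong_open:
  assumes "open S" "x \<in> S" "\<And>y. y \<in> S \<Longrightarrow> f y = g y"
  shows "(f has_derivative D) (at x) \<longleftrightarrow> (g has_derivative D) (at x)"
  using assms by (metis has_derivative_transform_within_open)

lemma partial_deriv_cong_open:
  assumes "open S" "x \<in> S" "\<And>y. y \<in> S \<Longrightarrow> f y = g y"
  shows "partial_deriv i f x = partial_deriv i g x"
  unfolding partial_deriv_def frechet_derivative_def
  using has_derivative_cong_open[OF assms] by simp

lemma differentiable_cong_open:
  assumes "open S" "x \<in> S" "\<And>y. y \<in> S \<Longrightarrow> f y = g y"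
  shows "f differentiable (at x) \<longleftrightarrow> g differentiable (at x)"
  unfolding differentiable_def using has_derivative_cong_open[OF assms] by simp

lemma laplacian_cong_open:
  assumes "open S" "x \<in> S" "\<And>y. y \<in> S \<Longrightarrow> f y = g y"
  shows "laplacian f x = laplacian g x"
  unfolding laplacian_def
  using assms by (intro sum.cong refl partial_deriv_cong_open[OF assms(1,2)] partial_deriv_cong_open[OF assms(1)])

lemma Ck_on_cong:
  assumes "open S" "\<And>y. y \<in> S \<Longrightarrow> f y = g y"
  shows "Ck_on k S f \<longleftrightarrow> Ck_on k S g"
  using assms(2)
proof (induction k arbitrary: f g)
  case 0
  then show ?case by (simp cong: continuous_on_cong)
next
  case (Suc k)
  have "Ck_on k S (partial_deriv i f) \<longleftrightarrow> Ck_on k S (partial_deriv i g)" for i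
    by (rule Suc.IH) (rule partial_deriv_cong_open[OF assms(1) _ Suc.prems])
  then show ?case using differentiable_cong_open[OF assms(1) _ Suc.prems] by simp
qed

lemma partial_deriv_psum:
  assumes "aconv c \<rho>" "norm x < \<rho>"
  shows "partial_deriv i (psum c) x = psum (pd i c) x"
  by (subst partial_deriv_eqI[OF has_derivative_psum[OF assms]])
     (simp add: axis_def if_distrib[of "\<lambda>t. t * _"] cong: if_cong)

lemma psum_sum:
  assumes "finite I" "\<And>j. j \<in> I \<Longrightarrow> aconv (c j) \<rho>" "\<And>i. \<bar>x $ i\<bar> \<le> \<rho>" "0 \<le> \<rho>"
  shows "aconv (\<lambda>\<alpha>. \<Sum>j\<in>I. c j \<alpha>) \<rho> \<and> psum (\<lambda>\<alpha>. \<Sum>j\<in>I. c j \<alpha>) x = (\<Sum>j\<in>I. psum (c j) x)"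
  using assms(1,2)
proof (induction I rule: finite_induct)
  case empty
  then show ?case by (simp add: aconv_def A1_def psum_def hom_def)
next
  case (insert j I)
  then show ?case
    using psum_add[of "c j" \<rho> "\<lambda>\<alpha>. \<Sum>j\<in>I. c j \<alpha>" x] aconv_add[of "c j" \<rho> "\<lambda>\<alpha>. \<Sum>j\<in>I. c j \<alpha>"] assms by simp
qed

lemma norm_between:
  assumes "norm x < (\<rho>::real)"
  obtains \<sigma> where "norm x < \<sigma>" "\<sigma> < \<rho>" "0 \<le> \<sigma>"
  using assms dense[of "norm x" \<rho>] norm_ge_zero[of x] by (metis less_eq_real_def order_le_less_trans)

lemma aconv_lap:
  assumes "aconv c \<rho>" "0 \<le> \<sigma>" "\<sigma> < \<rho>"
  shows "aconv (lap c) \<sigma>"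
proof -
  obtain \<tau> where t: "\<sigma> < \<tau>" "\<tau> < \<rho>" using assms(3) dense by blast
  have "aconv (\<lambda>\<alpha>. \<Sum>i\<in>UNIV. pd i (pd i c) \<alpha>) \<sigma> \<and> psum (\<lambda>\<alpha>. \<Sum>i\<in>UNIV. pd i (pd i c) \<alpha>) 0 = (\<Sum>i\<in>UNIV. psum (pd i (pd i c)) 0)"
    by (rule psum_sum) (use assms t aconv_pd in \<open>auto intro!: aconv_pd[of _ \<tau> \<sigma>] aconv_pd[of _ \<rho> \<tau>]\<close>)
  then show ?thesis by (simp add: lap_def[abs_def])
qed

lemma laplacian_psum:
  assumes "aconv c \<rho>" "norm x < \<rho>"
  shows "laplacian (psum c) x = psum (lap c) x"
proof -
  obtain \<sigma> where s: "norm x < \<sigma>" "\<sigma> < \<rho>" "0 \<le> \<sigma>" using norm_between[OF assms(2)] .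
  obtain \<tau> where t: "norm x < \<tau>" "\<tau> < \<sigma>" "0 \<le> \<tau>" using norm_between[OF s(1)] .
  have *: "partial_deriv i (partial_deriv i (psum c)) x = psum (pd i (pd i c)) x" for i
  proof -
    have "partial_deriv i (partial_deriv i (psum c)) x = partial_deriv i (psum (pd i c)) x"
      by (rule partial_deriv_cong_open[of "ball 0 \<rho>"]) (use assms partial_deriv_psum in auto)
    also have "\<dots> = psum (pd i (pd i c)) x"
      by (rule partial_deriv_psum[OF aconv_pd[OF assms(1) s(3,2)] s(1)])
    finally show ?thesis .
  qed
  have cl: "\<bar>x $ i\<bar> \<le> \<tau>" for i using component_le_norm_cart[of x i] t by linarith
  have "aconv (\<lambda>\<alpha>. \<Sum>i\<in>UNIV. pd i (pd i c) \<alpha>) \<tau> \<and> psum (\<lambda>\<alpha>. \<Sum>i\<in>UNIV. pd i (pd i c) \<alpha>) x = (\<Sum>i\<in>UNIV. psum (pd i (pd i c)) x)"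
    by (rule psum_sum) (use aconv_pd[OF aconv_pd[OF assms(1) s(3,2)] t(3,2)] t cl in \<open>auto\<close>)
  with * show ?thesis by (simp add: laplacian_def lap_def[abs_def])
qed

lemma Ck_on_psum:
  fixes c :: "('n::finite \<Rightarrow> nat) \<Rightarrow> real"
  assumes "\<And>\<sigma>. 0 \<le> \<sigma> \<Longrightarrow> \<sigma> < \<rho> \<Longrightarrow> aconv c \<sigma>"
  shows "Ck_on k (ball 0 \<rho>) (psum c)"
  using assms
proof (induction k arbitrary: c)
  case 0
  show ?case unfolding Ck_on.simps
  proof (rule differentiable_imp_continuous_on)
    show "psum c differentiable_on ball 0 \<rho>"
      unfolding differentiable_on_def
    proof
      fix x :: "real^'n" assume "x \<in> ball 0 \<rho>"
      then have "norm x < \<rho>" by simp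
      then obtain \<sigma> where s: "norm x < \<sigma>" "\<sigma> < \<rho>" "0 \<le> \<sigma>" using norm_between by blast
      show "psum c differentiable (at x within ball 0 \<rho>)"
        using has_derivative_psum[OF 0[OF s(3,2)] s(1)]
        by (auto simp: differentiable_def intro: has_derivative_at_withinI)
    qed
  qed
next
  case (Suc k)
  have p: "aconv (pd i c) \<sigma>" if s: "0 \<le> \<sigma>" "\<sigma> < \<rho>" for i \<sigma>
  proof -
    obtain \<tau> where t: "\<sigma> < \<tau>" "\<tau> < \<rho>" using s dense by blast
    then show ?thesis using aconv_pd[OF Suc.prems[of \<tau>] s(1) t(1)] s by simp
  qed
  have d: "psum c differentiable (at x) \<and> partial_deriv i (psum c) x = psum (pd i c) x" if "x \<in> ball 0 \<rho>" for x i
  proof -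
    from that have "norm x < \<rho>" by simp
    then obtain \<sigma> where s: "norm x < \<sigma>" "\<sigma> < \<rho>" "0 \<le> \<sigma>" using norm_between by blast
    show ?thesis
      using has_derivative_psum[OF Suc.prems[OF s(3,2)] s(1)] partial_deriv_psum[OF Suc.prems[OF s(3,2)] s(1)]
      by (auto simp: differentiable_def)
  qed
  have "Ck_on k (ball 0 \<rho>) (partial_deriv i (psum c))" for i
    by (subst Ck_on_cong[of _ _ "psum (pd i c)"]) (use d Suc.IH p in auto)
  then show ?case using d by simp
qed

lemma bij_betw_idx: "bij_betw snd (Sigma UNIV idx) (UNIV :: ('n::finite \<Rightarrow> nat) set)"
  by (rule bij_betwI[of _ _ _ "\<lambda>\<alpha>. (mdeg \<alpha>, \<alpha>)"]) (auto simp: idx_def)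

lemma has_sum_psum:
  assumes "aconv c \<rho>" "\<And>i. \<bar>x $ i\<bar> \<le> \<rho>"
  shows "((\<lambda>\<alpha>. c \<alpha> * monomial \<alpha> x) has_sum psum c x) UNIV"
proof -
  let ?f = "\<lambda>(k::nat, \<alpha>). c \<alpha> * monomial \<alpha> x"
  have rho: "\<rho> \<ge> 0" using assms(2) abs_ge_zero order_trans by blast
  have "(?f has_sum psum c x) (Sigma UNIV idx)"
  proof (rule has_sum_SigmaI)
    show "((\<lambda>y. ?f (k, y)) has_sum hom c k x) (idx k)" for k
      by (intro has_sum_finiteI) (auto simp: hom_def)
    show "((\<lambda>k. hom c k x) has_sum psum c x) UNIV"
      by (rule norm_summable_imp_has_sum) (use summable_abs_hom[OF assms] psum_sums[OF assms] in auto)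
    have "(\<lambda>z. norm (?f z)) summable_on Sigma UNIV idx"
    proof (rule summable_on_SigmaI)
      show "((\<lambda>y. norm (?f (k, y))) has_sum (\<Sum>\<alpha>\<in>idx k. \<bar>c \<alpha> * monomial \<alpha> x\<bar>)) (idx k)" for k
        by (intro has_sum_finiteI) auto
      have "summable (\<lambda>k. \<Sum>\<alpha>\<in>idx k. \<bar>c \<alpha> * monomial \<alpha> x\<bar>)"
        using assms(1) unfolding aconv_def
      proof (rule summable_comparison_test'[of _ 0])
        fix k
        have "(\<Sum>\<alpha>\<in>idx k. \<bar>c \<alpha> * monomial \<alpha> x\<bar>) \<le> (\<Sum>\<alpha>\<in>idx k. \<bar>c \<alpha>\<bar> * \<rho> ^ k)"
          unfolding abs_mult using abs_monomial_le[OF assms(2)] by (intro sum_mono mult_left_mono) (auto simp: idx_def)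
        then show "norm (\<Sum>\<alpha>\<in>idx k. \<bar>c \<alpha> * monomial \<alpha> x\<bar>) \<le> A1 k c * \<rho> ^ k"
          by (simp add: A1_def sum_distrib_right sum_nonneg)
      qed
      then show "(\<lambda>k. \<Sum>\<alpha>\<in>idx k. \<bar>c \<alpha> * monomial \<alpha> x\<bar>) summable_on UNIV"
        by (subst summable_on_UNIV_nonneg_real_iff) (auto intro: sum_nonneg)
    qed auto
    then show "?f summable_on Sigma UNIV idx" by (rule abs_summable_summable)
  qed
  then have "((\<lambda>z. (\<lambda>\<alpha>. c \<alpha> * monomial \<alpha> x) (snd z)) has_sum psum c x) (Sigma UNIV idx)"
    by (simp add: case_prod_unfold)
  then show ?thesis by (subst (asm) has_sum_reindex_bij_betw[OF bij_betw_idx])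
qed

lemma aconv_if_summable_on:
  assumes "(\<lambda>\<alpha>. \<bar>c \<alpha>\<bar> * \<rho> ^ mdeg \<alpha>) summable_on UNIV"
  shows "aconv c \<rho>"
proof -
  let ?g = "\<lambda>\<alpha>. \<bar>c \<alpha>\<bar> * \<rho> ^ mdeg \<alpha>"
  obtain S where "(?g has_sum S) UNIV" using assms by (auto simp: summable_on_def)
  then have "((\<lambda>z. ?g (snd z)) has_sum S) (Sigma UNIV idx)"
    by (subst has_sum_reindex_bij_betw[OF bij_betw_idx])
  then have "((\<lambda>k. A1 k c * \<rho> ^ k) has_sum S) UNIV"
  proof (rule has_sum_SigmaD)
    show "((\<lambda>\<alpha>. ?g (snd (k, \<alpha>))) has_sum A1 k c * \<rho> ^ k) (idx k)" for k
      by (rule has_sum_finiteI[OF finite_idx]) (auto simp: A1_def sum_distrib_right idx_def)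
  qed
  then show ?thesis unfolding aconv_def using has_sum_imp_sums sums_summable by blast
qed

lemma analytic_at_psum:
  fixes c :: "('n::finite \<Rightarrow> nat) \<Rightarrow> real"
  assumes "r > 0" "\<And>x. x \<in> ball x\<^sub>0 r \<Longrightarrow> ((\<lambda>\<alpha>. c \<alpha> * monomial \<alpha> (x - x\<^sub>0)) has_sum u x) UNIV"
  defines "\<rho> \<equiv> r / (2 * real CARD('n))"
  shows "\<rho> > 0" "aconv c \<rho>" "\<And>x. norm (x - x\<^sub>0) \<le> \<rho> \<Longrightarrow> u x = psum c (x - x\<^sub>0)"
proof -
  show rho: "\<rho> > 0" using assms(1) by (simp add: \<rho>_def)
  \<comment> \<open>At a diagonal point every monomial is a power of \<rho>, and unordered
    summability of reals is absolute, so summability there is summability of the coefficients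
    against powers of \<rho>. The factor 2n in \<rho> keeps this point inside the ball.\<close>
  define y :: "real^'n" where "y = (\<chi> i. \<rho>)"
  have "norm y \<le> (\<Sum>i\<in>(UNIV::'n set). \<bar>y $ i\<bar>)" by (rule norm_le_l1_cart)
  also have "\<dots> < r" using assms(1) by (simp add: y_def \<rho>_def)
  finally have "x\<^sub>0 + y \<in> ball x\<^sub>0 r" by (simp add: dist_norm)
  from assms(2)[OF this] have "(\<lambda>\<alpha>. c \<alpha> * monomial \<alpha> y) summable_on UNIV"
    by (auto simp: summable_on_def)
  then have "(\<lambda>\<alpha>. norm (c \<alpha> * monomial \<alpha> y)) summable_on UNIV"
    by (rule iffD1[OF summable_on_iff_abs_summable_on_real])
  moreover have "norm (c \<alpha> * monomial \<alpha> y) = \<bar>c \<alpha>\<bar> * \<rho> ^ mdeg \<alpha>" for \<alpha>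
    using rho by (simp add: abs_mult monomial_def y_def abs_prod power_sum)
  ultimately show a: "aconv c \<rho>" using aconv_if_summable_on by simp
  fix x assume x: "norm (x - x\<^sub>0) \<le> \<rho>"
  have "1 < 2 * real CARD('n)" using card_ge_1[where 'n = 'n] by linarith
  then have "\<rho> < r" using assms(1) by (simp add: \<rho>_def divide_less_eq)
  then have "x \<in> ball x\<^sub>0 r" using x by (simp add: dist_norm norm_minus_commute)
  from assms(2)[OF this] has_sum_psum[OF a, of "x - x\<^sub>0"] show "u x = psum c (x - x\<^sub>0)"
    using x order_trans[OF component_le_norm_cart x] by (blast intro: has_sum_unique)
qed

subsection \<open>Uniqueness of the coefficients and the identity theorem\<close>

text \<open>Vanishing is assumed around points arbitrarily close to the centre rather than around
  the centre, since the identity theorem applies this at limit points. Continuity gives the constant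
  term, and the derivatives inherit the hypothesis, which drives the induction on the
  degree.\<close>

lemma psum_coeffs_zero:
  assumes "aconv c \<rho>" "\<rho> > 0"
    and "\<And>\<delta>. \<delta> > 0 \<Longrightarrow> \<exists>y\<in>ball 0 \<delta>. eventually (\<lambda>z. psum c z = 0) (nhds y)"
  shows "c \<alpha> = 0"
proof -
  have "\<forall>\<alpha>\<in>idx k. c \<alpha> = 0" for k
    using assms
  proof (induction k arbitrary: c \<rho>)
    case 0
    have "isCont (psum c) 0"
      using has_derivative_psum[OF 0(1), of 0] 0(2) by (auto intro: has_derivative_continuous)
    have "psum c 0 = 0"
    proof (rule ccontr)
      assume "psum c 0 \<noteq> 0"
      then obtain \<delta> where d: "\<delta> > 0" "\<And>y. dist 0 y < \<delta> \<Longrightarrow> psum c y \<noteq> 0"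
        using continuous_at_avoid[OF \<open>isCont (psum c) 0\<close>] by blast
      obtain y where "y \<in> ball 0 \<delta>" "eventually (\<lambda>z. psum c z = 0) (nhds y)" using 0(3)[OF d(1)] by blast
      then show False using d(2)[of y] eventually_nhds_x_imp_x by fastforce
    qed
    then show ?case by (simp add: psum_at_0 idx_0 zero_fun_def)
  next
    case (Suc k)
    show ?case
    proof
      fix \<alpha> :: "'a \<Rightarrow> nat" assume a: "\<alpha> \<in> idx (Suc k)"
      have "\<exists>i. \<alpha> i \<noteq> 0"
      proof (rule ccontr)
        assume "\<not> (\<exists>i. \<alpha> i \<noteq> 0)"
        with a show False by (simp add: idx_def)
      qed
      then obtain i where i: "\<alpha> i \<noteq> 0" by blast
      define \<beta> where "\<beta> = \<alpha>(i := \<alpha> i - 1)"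
      have ab: "\<alpha> = \<beta>(i := Suc (\<beta> i))" using i by (auto simp: \<beta>_def)
      have b: "\<beta> \<in> idx k" using a by (subst (asm) ab, subst (asm) upd_Suc_idx)
      have "\<forall>\<beta>\<in>idx k. pd i c \<beta> = 0"
      proof (rule Suc.IH)
        show "aconv (pd i c) (\<rho> / 2)" by (rule aconv_pd[OF Suc.prems(1)]) (use Suc.prems in auto)
        show "\<rho> / 2 > 0" using Suc.prems by simp
        fix \<delta> :: real assume "\<delta> > 0"
        then obtain y where y: "y \<in> ball 0 (min \<delta> \<rho>)" "eventually (\<lambda>z. psum c z = 0) (nhds y)"
          using Suc.prems(3)[of "min \<delta> \<rho>"] Suc.prems(2) by auto
        have "eventually (\<lambda>z. eventually (\<lambda>w. psum c w = 0) (nhds z)) (nhds y)"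
          using y(2) by (simp add: eventually_eventually)
        moreover have "eventually (\<lambda>z. z \<in> ball 0 \<rho>) (nhds y)"
          using y(1) by (intro eventually_nhds_in_open) auto
        ultimately have "eventually (\<lambda>z. psum (pd i c) z = 0) (nhds y)"
        proof eventually_elim
          case (elim z)
          from elim(1) obtain S where S: "open S" "z \<in> S" "\<And>w. w \<in> S \<Longrightarrow> psum c w = 0"
            by (auto simp: eventually_nhds)
          have "psum (pd i c) z = partial_deriv i (psum c) z"
            using partial_deriv_psum[OF Suc.prems(1)] elim(2) by simp
          also have "\<dots> = partial_deriv i (\<lambda>_. 0) z"
            by (rule partial_deriv_cong_open[OF S(1,2)]) (use S in auto)
          also have "\<dots> = 0" by (subst partial_deriv_eqI[of _ "\<lambda>_. 0"]) auto
          finally show ?case .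
        qed
        then show "\<exists>y\<in>ball 0 \<delta>. eventually (\<lambda>z. psum (pd i c) z = 0) (nhds y)"
          using y(1) by auto
      qed
      with b have "pd i c \<beta> = 0" by blast
      then show "c \<alpha> = 0" unfolding pd_def ab[symmetric] by simp
    qed
  qed
  then show ?thesis by (auto simp: idx_def)
qed

lemma psum_eq_imp_coeffs_eq:
  assumes "aconv c \<rho>" "aconv d \<rho>" "\<rho> > 0" "\<delta> > 0" "\<And>x. norm x < \<delta> \<Longrightarrow> psum c x = psum d x"
  shows "c = d"
proof
  fix \<alpha>
  have "(\<lambda>\<alpha>. c \<alpha> - d \<alpha>) \<alpha> = 0"
  proof (rule psum_coeffs_zero)
    show "aconv (\<lambda>\<alpha>. c \<alpha> - d \<alpha>) \<rho>" using assms by (intro aconv_diff) auto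
    fix e :: real assume e: "e > 0"
    have "eventually (\<lambda>z. z \<in> ball 0 (min \<delta> \<rho>)) (nhds 0)"
      by (intro eventually_nhds_in_open) (use assms in auto)
    then have "eventually (\<lambda>z. psum (\<lambda>\<alpha>. c \<alpha> - d \<alpha>) z = 0) (nhds 0)"
    proof eventually_elim
      case (elim z)
      then have "\<bar>z $ i\<bar> \<le> \<rho>" for i using component_le_norm_cart[of z i] by simp
      then show ?case using psum_diff[OF assms(1,2)] assms(5) elim by simp
    qed
    then show "\<exists>y\<in>ball 0 e. eventually (\<lambda>z. psum (\<lambda>\<alpha>. c \<alpha> - d \<alpha>) z = 0) (nhds y)"
      using e by (intro bexI[of _ 0]) auto
  qed (use assms in auto)
  then show "c \<alpha> = d \<alpha>" by simp
qed

text \<open>The points around which \<open>w\<close> vanishes form an open set, and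
  \<open>psum_coeffs_zero\<close> at a limit point shows that it is relatively closed.\<close>

lemma identity_theorem:
  fixes w :: "real^'n::finite \<Rightarrow> real"
  assumes w: "real_analytic_on S w" and S: "open S" "connected S"
    and "x\<^sub>1 \<in> S" "eventually (\<lambda>x. w x = 0) (nhds x\<^sub>1)" and x: "x \<in> S"
  shows "w x = 0"
proof -
  define Z where "Z = {x\<in>S. eventually (\<lambda>x. w x = 0) (nhds x)}"
  have "open Z"
    unfolding open_subopen[of Z]
  proof
    fix x assume "x \<in> Z"
    then have "eventually (\<lambda>y. eventually (\<lambda>x. w x = 0) (nhds y)) (nhds x)" "eventually (\<lambda>y. y \<in> S) (nhds x)"
      using S by (auto simp: Z_def eventually_eventually intro: eventually_nhds_in_open)
    then have "eventually (\<lambda>y. y \<in> Z) (nhds x)" by eventually_elim (auto simp: Z_def)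
    then show "\<exists>T. open T \<and> x \<in> T \<and> T \<subseteq> Z" by (auto simp: eventually_nhds)
  qed
  then have op: "openin (top_of_set S) Z"
    by (auto simp: openin_open Z_def)
  have "closedin (top_of_set S) Z"
    unfolding closedin_limpt
  proof (intro conjI allI impI)
    show "Z \<subseteq> S" by (auto simp: Z_def)
    fix x assume x: "x islimpt Z \<and> x \<in> S"
    with w obtain c r where r: "r > 0" "\<And>y. y \<in> ball x r \<Longrightarrow> ((\<lambda>\<alpha>. c \<alpha> * monomial \<alpha> (y - x)) has_sum w y) UNIV"
      unfolding real_analytic_on_def by metis
    define \<rho> where "\<rho> = r / (2 * real CARD('n))"
    note P = analytic_at_psum[OF r, folded \<rho>_def]
    have "c \<alpha> = 0" for \<alpha>
    proof (rule psum_coeffs_zero[OF P(2,1)])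
      fix \<delta> :: real assume "\<delta> > 0"
      then obtain y where y: "y \<in> Z" "dist y x < min \<delta> \<rho>"
        using x P(1) by (auto simp: islimpt_approachable) (metis min_less_iff_conj)
      have "eventually (\<lambda>y. w y = 0) (nhds y)" using y by (auto simp: Z_def)
      moreover have "((\<lambda>z. x + z) \<longlongrightarrow> x + (y - x)) (nhds (y - x))"
        by (intro tendsto_add tendsto_const filterlim_ident)
      then have "filterlim (\<lambda>z. x + z) (nhds y) (nhds (y - x))" by simp
      ultimately have "eventually (\<lambda>z. w (x + z) = 0) (nhds (y - x))"
        by (rule eventually_compose_filterlim)
      moreover have "eventually (\<lambda>z. z \<in> ball 0 \<rho>) (nhds (y - x))"
        using y by (intro eventually_nhds_in_open) (auto simp: dist_norm norm_minus_commute)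
      ultimately have "eventually (\<lambda>z. psum c z = 0) (nhds (y - x))"
      proof eventually_elim
        case (elim z)
        then show ?case using P(3)[of "x + z"] by simp
      qed
      then show "\<exists>y\<in>ball 0 \<delta>. eventually (\<lambda>z. psum c z = 0) (nhds y)"
        using y by (intro bexI[of _ "y - x"]) (auto simp: dist_norm norm_minus_commute)
    qed
    then have "psum c = (\<lambda>_. 0)" by (auto simp: psum_def hom_def)
    then have "\<And>y. y \<in> ball x \<rho> \<Longrightarrow> w y = 0" using P(3) by (simp add: dist_norm norm_minus_commute)
    then have "eventually (\<lambda>y. w y = 0) (nhds x)"
      using P(1) by (auto simp: eventually_nhds intro!: exI[of _ "ball x \<rho>"])
    with x show "x \<in> Z" by (simp add: Z_def)
  qed
  with op have "Z = {} \<or> Z = S" using S(2) by (auto simp: connected_clopen)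
  then have "x \<in> Z" using assms by (auto simp: Z_def)
  then show ?thesis using eventually_nhds_x_imp_x by (auto simp: Z_def)
qed

subsection \<open>Change of centre\<close>

lemma monomial_add:
  "monomial \<alpha> (x + z) = (\<Sum>\<beta> | \<beta> \<le> \<alpha>. (\<Prod>i\<in>UNIV. real (\<alpha> i choose \<beta> i)) * monomial (\<alpha> - \<beta>) x * monomial \<beta> z)"
proof -
  have "monomial \<alpha> (x + z) = (\<Prod>i\<in>UNIV. \<Sum>k\<in>{..\<alpha> i}. real (\<alpha> i choose k) * (z $ i) ^ k * (x $ i) ^ (\<alpha> i - k))"
  proof -
    have "(x $ i + z $ i) ^ n = (\<Sum>k\<le>n. real (n choose k) * (z $ i) ^ k * (x $ i) ^ (n - k))" for i n
      by (subst add.commute) (simp add: binomial_ring)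
    then show ?thesis by (simp add: monomial_def)
  qed
  also have "\<dots> = (\<Sum>\<beta> | \<beta> \<le> \<alpha>. \<Prod>i\<in>UNIV. real (\<alpha> i choose \<beta> i) * (z $ i) ^ \<beta> i * (x $ i) ^ (\<alpha> i - \<beta> i))"
    by (subst prod_sum_PiE) (auto simp: le_fun_PiE)
  finally show ?thesis by (simp add: monomial_def prod.distrib mult_ac)
qed

lemma A1_abs: "A1 k (\<lambda>\<alpha>. \<bar>c \<alpha>\<bar>) = A1 k c"
  by (simp add: A1_def)

lemma aconv_abs: "aconv (\<lambda>\<alpha>. \<bar>c \<alpha>\<bar>) \<rho> \<longleftrightarrow> aconv c \<rho>"
  by (simp add: aconv_def A1_abs)

lemma abs_monomial: "\<bar>monomial \<alpha> x\<bar> = monomial \<alpha> (\<chi> i. \<bar>x $ i\<bar>)"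
  by (simp add: monomial_def abs_prod power_abs)

text \<open>Expanding each monomial around the new centre gives a double series, whose inner sums
  over \<alpha> are the new coefficients; absolute convergence permits the interchange.\<close>

lemma real_analytic_on_psum:
  fixes c :: "('n::finite \<Rightarrow> nat) \<Rightarrow> real"
  assumes c: "aconv c \<rho>"
  shows "real_analytic_on (ball 0 \<rho>) (psum c)"
  unfolding real_analytic_on_def
proof
  fix x\<^sub>0 :: "real^'n" assume x0: "x\<^sub>0 \<in> ball 0 \<rho>"
  define G where "G = (\<lambda>\<alpha> \<beta>::'n \<Rightarrow> nat. c \<alpha> * (\<Prod>i\<in>UNIV. real (\<alpha> i choose \<beta> i)) * monomial (\<alpha> - \<beta>) x\<^sub>0)"
  define C where "C = (\<lambda>\<beta>. infsum (\<lambda>\<alpha>. G \<alpha> \<beta>) {\<alpha>. \<beta> \<le> \<alpha>})"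
  define \<delta> where "\<delta> = \<rho> - norm x\<^sub>0"
  have "\<delta> > 0" using x0 by (simp add: \<delta>_def)
  moreover have "((\<lambda>\<beta>. C \<beta> * monomial \<beta> (y - x\<^sub>0)) has_sum psum c y) UNIV" if y: "y \<in> ball x\<^sub>0 \<delta>" for y
  proof -
    define z where "z = y - x\<^sub>0"
    \<comment> \<open>The absolute double series is the series of the absolute coefficients at this
      point, which lies in the cube of convergence because the norms of the two summands add up to
      less than \<rho>.\<close>
    define w where "w = (\<chi> i. \<bar>x\<^sub>0 $ i\<bar>) + (\<chi> i. \<bar>z $ i\<bar>)"
    have nz: "norm x\<^sub>0 + norm z < \<rho>" using y by (simp add: \<delta>_def z_def dist_norm norm_minus_commute)
    have w: "\<bar>w $ i\<bar> \<le> \<rho>" for i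
      using nz component_le_norm_cart[of x\<^sub>0 i] component_le_norm_cart[of z i] by (simp add: w_def)
    have yc: "\<bar>y $ i\<bar> \<le> \<rho>" for i
      using w[of i] by (simp add: w_def z_def)
    define F where "F = (\<lambda>(\<alpha>, \<beta>). G \<alpha> \<beta> * monomial \<beta> z)"
    have inner: "(\<Sum>\<beta> | \<beta> \<le> \<alpha>. F (\<alpha>, \<beta>)) = c \<alpha> * monomial \<alpha> y" for \<alpha>
      using monomial_add[of \<alpha> x\<^sub>0 z] by (simp add: F_def G_def sum_distrib_left mult_ac z_def)
    have inner_abs: "(\<Sum>\<beta> | \<beta> \<le> \<alpha>. norm (F (\<alpha>, \<beta>))) = \<bar>c \<alpha>\<bar> * monomial \<alpha> w" for \<alpha>
      unfolding w_def monomial_add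
      by (simp add: F_def G_def sum_distrib_left mult_ac abs_mult abs_monomial abs_prod)
    have "(\<lambda>z. norm (F z)) summable_on Sigma UNIV (\<lambda>\<alpha>. {\<beta>. \<beta> \<le> \<alpha>})"
    proof (rule summable_on_SigmaI)
      show "((\<lambda>\<beta>. norm (F (\<alpha>, \<beta>))) has_sum \<bar>c \<alpha>\<bar> * monomial \<alpha> w) {\<beta>. \<beta> \<le> \<alpha>}" for \<alpha>
        by (rule has_sum_finiteI) (use inner_abs in auto)
      show "(\<lambda>\<alpha>. \<bar>c \<alpha>\<bar> * monomial \<alpha> w) summable_on UNIV"
        using has_sum_psum[of "\<lambda>\<alpha>. \<bar>c \<alpha>\<bar>" \<rho> w] c w by (auto simp: aconv_abs summable_on_def)
    qed auto
    then have sm: "F summable_on Sigma UNIV (\<lambda>\<alpha>. {\<beta>. \<beta> \<le> \<alpha>})" by (rule abs_summable_summable)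
    have "(F has_sum psum c y) (Sigma UNIV (\<lambda>\<alpha>. {\<beta>. \<beta> \<le> \<alpha>}))"
    proof (rule has_sum_SigmaI[OF _ _ sm])
      show "((\<lambda>\<beta>. F (\<alpha>, \<beta>)) has_sum c \<alpha> * monomial \<alpha> y) {\<beta>. \<beta> \<le> \<alpha>}" for \<alpha>
        by (rule has_sum_finiteI) (use inner in auto)
      show "((\<lambda>\<alpha>. c \<alpha> * monomial \<alpha> y) has_sum psum c y) UNIV" by (rule has_sum_psum[OF c yc])
    qed
    also have "(F has_sum psum c y) (Sigma UNIV (\<lambda>\<alpha>. {\<beta>. \<beta> \<le> \<alpha>}))
      \<longleftrightarrow> ((\<lambda>(\<beta>, \<alpha>). F (\<alpha>, \<beta>)) has_sum psum c y) (Sigma UNIV (\<lambda>\<beta>. {\<alpha>. \<beta> \<le> \<alpha>}))"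
      by (rule has_sum_reindex_bij_witness[where i = prod.swap and j = prod.swap]) auto
    finally have sw: "((\<lambda>(\<beta>, \<alpha>). F (\<alpha>, \<beta>)) has_sum psum c y) (Sigma UNIV (\<lambda>\<beta>. {\<alpha>. \<beta> \<le> \<alpha>}))" .
    have "((\<lambda>\<beta>. C \<beta> * monomial \<beta> z) has_sum psum c y) UNIV"
    proof (rule has_sum_SigmaD[OF sw])
      fix \<beta> :: "'n \<Rightarrow> nat"
      have "(\<lambda>\<alpha>. F (\<alpha>, \<beta>)) summable_on {\<alpha>. \<beta> \<le> \<alpha>}"
        using summable_on_SigmaD1[of "\<lambda>\<beta> \<alpha>. F (\<alpha>, \<beta>)" UNIV] sw by (auto simp: summable_on_def)
      then have "((\<lambda>\<alpha>. F (\<alpha>, \<beta>)) has_sum infsum (\<lambda>\<alpha>. F (\<alpha>, \<beta>)) {\<alpha>. \<beta> \<le> \<alpha>}) {\<alpha>. \<beta> \<le> \<alpha>}"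
        by (rule has_sum_infsum)
      moreover have "infsum (\<lambda>\<alpha>. F (\<alpha>, \<beta>)) {\<alpha>. \<beta> \<le> \<alpha>} = C \<beta> * monomial \<beta> z"
        by (simp add: F_def C_def infsum_cmult_left')
      ultimately show "((\<lambda>\<alpha>. case (\<beta>, \<alpha>) of (\<beta>, \<alpha>) \<Rightarrow> F (\<alpha>, \<beta>)) has_sum C \<beta> * monomial \<beta> z) {\<alpha>. \<beta> \<le> \<alpha>}"
        by simp
    qed
    then show ?thesis by (simp add: z_def)
  qed
  ultimately show "\<exists>c' r. r > 0 \<and> (\<forall>y\<in>ball x\<^sub>0 r. ((\<lambda>\<beta>. c' \<beta> * monomial \<beta> (y - x\<^sub>0)) has_sum psum c y) UNIV)"
    by blast
qed

subsection \<open>Products and compositions\<close>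

lemma monomial_plus: "monomial (\<lambda>i. \<alpha> i + \<beta> i) x = monomial \<alpha> x * monomial \<beta> x"
  by (simp add: monomial_def power_add prod.distrib)

lemma hom_cmul: "hom (cmul c d) N x = (\<Sum>k\<le>N. hom c k x * hom d (N - k) x)"
proof -
  have split: "cmul c d \<gamma> * monomial \<gamma> x = (\<Sum>k\<le>N. \<Sum>\<alpha> | \<alpha> \<le> \<gamma> \<and> mdeg \<alpha> = k. (c \<alpha> * monomial \<alpha> x) * (d (\<gamma> - \<alpha>) * monomial (\<gamma> - \<alpha>) x))"
    if "\<gamma> \<in> idx N" for \<gamma>
  proof -
    have "(\<Sum>k\<le>N. \<Sum>\<alpha>\<in>{\<alpha> \<in> {\<alpha>. \<alpha> \<le> \<gamma>}. mdeg \<alpha> = k}. (c \<alpha> * monomial \<alpha> x) * (d (\<gamma> - \<alpha>) * monomial (\<gamma> - \<alpha>) x))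
       = (\<Sum>\<alpha> | \<alpha> \<le> \<gamma>. (c \<alpha> * monomial \<alpha> x) * (d (\<gamma> - \<alpha>) * monomial (\<gamma> - \<alpha>) x))"
      by (rule sum.group) (use that mdeg_mono in \<open>auto simp: idx_def\<close>)
    also have "\<dots> = (\<Sum>\<alpha> | \<alpha> \<le> \<gamma>. c \<alpha> * d (\<gamma> - \<alpha>) * monomial \<gamma> x)"
    proof (rule sum.cong[OF refl])
      fix \<alpha> assume "\<alpha> \<in> {\<alpha>. \<alpha> \<le> \<gamma>}"
      then have "(\<lambda>i. \<alpha> i + (\<gamma> - \<alpha>) i) = \<gamma>" by (auto simp: le_fun_def)
      then have "monomial \<gamma> x = monomial \<alpha> x * monomial (\<gamma> - \<alpha>) x" using monomial_plus[of \<alpha> "\<gamma> - \<alpha>" x] by simp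
      then show "(c \<alpha> * monomial \<alpha> x) * (d (\<gamma> - \<alpha>) * monomial (\<gamma> - \<alpha>) x) = c \<alpha> * d (\<gamma> - \<alpha>) * monomial \<gamma> x"
        by (simp only: mult_ac)
    qed
    finally show ?thesis by (simp add: cmul_def sum_distrib_right)
  qed
  have "hom (cmul c d) N x = (\<Sum>\<gamma>\<in>idx N. \<Sum>k\<le>N. \<Sum>\<alpha> | \<alpha> \<le> \<gamma> \<and> mdeg \<alpha> = k. (c \<alpha> * monomial \<alpha> x) * (d (\<gamma> - \<alpha>) * monomial (\<gamma> - \<alpha>) x))"
    unfolding hom_def by (rule sum.cong[OF refl split])
  also have "\<dots> = (\<Sum>k\<le>N. \<Sum>\<gamma>\<in>idx N. \<Sum>\<alpha> | \<alpha> \<le> \<gamma> \<and> mdeg \<alpha> = k. (c \<alpha> * monomial \<alpha> x) * (d (\<gamma> - \<alpha>) * monomial (\<gamma> - \<alpha>) x))"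
    by (rule sum.swap)
  also have "\<dots> = (\<Sum>k\<le>N. \<Sum>\<alpha>\<in>idx k. \<Sum>\<beta>\<in>idx (N - k). (c \<alpha> * monomial \<alpha> x) * (d \<beta> * monomial \<beta> x))"
    by (rule sum.cong[OF refl], rule sum_idx_pairs[where F = "\<lambda>\<alpha> \<beta>. (c \<alpha> * monomial \<alpha> x) * (d \<beta> * monomial \<beta> x)"]) simp
  finally show ?thesis by (simp add: hom_def sum_product)
qed

lemma hom_cpow_0: "hom (cpow c 0) N x = (if N = 0 then 1 else 0)"
proof (cases "N = 0")
  case True
  then show ?thesis by (simp add: hom_0_eq)
next
  case False
  then show ?thesis by (auto simp: hom_def idx_def intro!: sum.neutral)
qed

text \<open>Fubini for the double family indexed by the power \<open>p\<close> and the degree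
  \<open>N\<close>. Cauchy products bound its absolute sum by that of \<open>a p\<close> against
  powers of \<open>l1 c \<rho>\<close>. Summing over N first gives the left side; summing over p
  first, where \<open>cpow_low\<close> leaves finitely many terms, gives the right side.\<close>

lemma psum_comp:
  assumes c: "aconv c \<rho>" "\<And>i. \<bar>x $ i\<bar> \<le> \<rho>" "c 0 = 0" and a: "summable (\<lambda>p. \<bar>a p\<bar> * l1 c \<rho> ^ p)"
  shows "(\<lambda>p. a p * psum c x ^ p) sums psum (ccomp a c) x"
proof -
  define H where "H = l1 c \<rho>"
  define g where "g = (\<lambda>p N. hom (cpow c p) N x)"
  have sh: "summable (\<lambda>k. \<bar>hom c k x\<bar>)" by (rule summable_abs_hom[OF c(1,2)])
  have H: "(\<Sum>k. \<bar>hom c k x\<bar>) \<le> H"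
    unfolding H_def l1_def by (intro suminf_le sh) (use c abs_hom_le[OF c(2)] in \<open>auto simp: aconv_def\<close>)
  have H0: "H \<ge> 0" using H suminf_nonneg[OF sh] by simp
  have g: "summable (\<lambda>N. \<bar>g p N\<bar>) \<and> g p sums (psum c x ^ p) \<and> (\<Sum>N. \<bar>g p N\<bar>) \<le> H ^ p" for p
  proof (induction p)
    case 0
    have "g 0 = (\<lambda>N. if N = 0 then 1 else 0)" by (auto simp: g_def hom_cpow_0 simp del: cpow.simps)
    moreover have "(\<lambda>N::nat. if N = 0 then 1 else 0 :: real) sums 1" using sums_single[of 0 "\<lambda>_. 1::real"] by simp
    moreover have "(\<lambda>N::nat. \<bar>if N = 0 then 1 else 0 :: real\<bar>) = (\<lambda>N. if N = 0 then 1 else 0)" by auto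
    ultimately show ?case by (auto simp: sums_iff)
  next
    case (Suc p)
    have gS: "g (Suc p) = (\<lambda>N. \<Sum>k\<le>N. hom c k x * g p (N - k))"
      by (auto simp: g_def hom_cmul)
    have s1: "(\<lambda>N. \<Sum>k\<le>N. hom c k x * g p (N - k)) sums ((\<Sum>k. hom c k x) * (\<Sum>N. g p N))"
      by (rule Cauchy_product_sums) (use sh Suc in auto)
    have s2: "(\<lambda>N. \<Sum>k\<le>N. \<bar>hom c k x\<bar> * \<bar>g p (N - k)\<bar>) sums ((\<Sum>k. \<bar>hom c k x\<bar>) * (\<Sum>N. \<bar>g p N\<bar>))"
      by (rule Cauchy_product_sums) (use sh Suc in auto)
    have le: "\<bar>g (Suc p) N\<bar> \<le> (\<Sum>k\<le>N. \<bar>hom c k x\<bar> * \<bar>g p (N - k)\<bar>)" for N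
      unfolding gS by (rule order_trans[OF sum_abs]) (simp add: abs_mult)
    have s3: "summable (\<lambda>N. \<bar>g (Suc p) N\<bar>)"
      by (rule summable_comparison_test'[OF sums_summable[OF s2], of 0]) (use le in auto)
    have "(\<Sum>N. \<bar>g (Suc p) N\<bar>) \<le> (\<Sum>k. \<bar>hom c k x\<bar>) * (\<Sum>N. \<bar>g p N\<bar>)"
      unfolding sums_unique[OF s2] by (rule suminf_le[OF le s3 sums_summable[OF s2]])
    also have "\<dots> \<le> H * H ^ p"
      by (intro mult_mono H) (use Suc H0 in \<open>auto intro: suminf_nonneg\<close>)
    finally show ?case using s1 s3 Suc by (auto simp: gS psum_def sums_iff)
  qed
  have "(\<lambda>(p, N). norm (a p * g p N)) summable_on UNIV \<times> UNIV"
  proof (rule summable_on_SigmaI)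
    show "((\<lambda>N. case (p, N) of (p, N) \<Rightarrow> norm (a p * g p N)) has_sum \<bar>a p\<bar> * (\<Sum>N. \<bar>g p N\<bar>)) UNIV" for p
      using g[of p] by (auto simp: abs_mult intro!: has_sum_cmult_right norm_summable_imp_has_sum summable_sums)
    have "summable (\<lambda>p. \<bar>a p\<bar> * (\<Sum>N. \<bar>g p N\<bar>))"
    proof (rule summable_comparison_test'[OF a, of 0])
      show "norm (\<bar>a p\<bar> * (\<Sum>N. \<bar>g p N\<bar>)) \<le> \<bar>a p\<bar> * l1 c \<rho> ^ p" for p
        using g[of p] suminf_nonneg[of "\<lambda>N. \<bar>g p N\<bar>"] by (auto simp: abs_mult H_def intro!: mult_left_mono)
    qed
    then show "(\<lambda>p. \<bar>a p\<bar> * (\<Sum>N. \<bar>g p N\<bar>)) summable_on UNIV"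
      by (subst summable_on_UNIV_nonneg_real_iff) (use g in \<open>auto intro!: mult_nonneg_nonneg suminf_nonneg\<close>)
  qed auto
  then have "(\<lambda>z. norm (case z of (p, N) \<Rightarrow> a p * g p N)) summable_on UNIV \<times> UNIV"
    by (simp only: case_prod_unfold)
  then have sm: "(\<lambda>(p, N). a p * g p N) summable_on UNIV \<times> UNIV"
    by (rule abs_summable_summable)
  then obtain S where S: "((\<lambda>(p, N). a p * g p N) has_sum S) (UNIV \<times> UNIV)" by (auto simp: summable_on_def)
  have S1: "((\<lambda>p. a p * psum c x ^ p) has_sum S) UNIV"
    by (rule has_sum_SigmaD[OF S])
       (use g in \<open>auto intro!: has_sum_cmult_right norm_summable_imp_has_sum\<close>)
  have "((\<lambda>(N, p). case (p, N) of (p, N) \<Rightarrow> a p * g p N) has_sum S) (UNIV \<times> UNIV)"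
    by (rule iffD1[OF has_sum_swap S])
  then have "((\<lambda>N. hom (ccomp a c) N x) has_sum S) UNIV"
  proof (rule has_sum_SigmaD)
    fix N
    have "hom (ccomp a c) N x = (\<Sum>p\<le>N. a p * g p N)"
    proof -
      have "hom (ccomp a c) N x = (\<Sum>\<alpha>\<in>idx N. \<Sum>p\<le>N. a p * (cpow c p \<alpha> * monomial \<alpha> x))"
        unfolding hom_def by (rule sum.cong[OF refl]) (simp add: ccomp_def idx_def sum_distrib_right mult.assoc)
      also have "\<dots> = (\<Sum>p\<le>N. \<Sum>\<alpha>\<in>idx N. a p * (cpow c p \<alpha> * monomial \<alpha> x))" by (rule sum.swap)
      finally show ?thesis by (simp add: g_def hom_def sum_distrib_left)
    qed
    moreover have "g p N = 0" if "N < p" for p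
      unfolding g_def hom_def using cpow_low[where c = c, OF c(3)] that by (intro sum.neutral) (auto simp: idx_def)
    ultimately show "((\<lambda>p. case (N, p) of (N, p) \<Rightarrow> case (p, N) of (p, N) \<Rightarrow> a p * g p N) has_sum hom (ccomp a c) N x) UNIV"
      by (intro has_sum_finite_neutralI[of "{..N}"]) auto
  qed
  then have "(\<lambda>N. hom (ccomp a c) N x) sums S" by (rule has_sum_imp_sums)
  then have "psum (ccomp a c) x = S" by (simp add: psum_def sums_iff)
  then show ?thesis using has_sum_imp_sums[OF S1] by simp
qed

lemma aconv_comp:
  fixes c :: "('n::finite \<Rightarrow> nat) \<Rightarrow> real"
  assumes c: "aconv c \<rho>" "\<rho> \<ge> 0" and a: "summable (\<lambda>p. \<bar>a p\<bar> * l1 c \<rho> ^ p)"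
  shows "aconv (ccomp a c) (\<rho> / real CARD('n))"
proof (rule aconv_if_nrm_bounded[OF _ c(2)])
  fix N
  have "nrm N \<rho> (ccomp a c) \<le> (\<Sum>p\<le>N. \<bar>a p\<bar> * nrm N \<rho> c ^ p)" by (rule nrm_comp[OF c(2)])
  also have "\<dots> \<le> (\<Sum>p\<le>N. \<bar>a p\<bar> * l1 c \<rho> ^ p)"
    by (intro sum_mono mult_left_mono power_mono nrm_le_l1 c) (use c in auto)
  also have "\<dots> \<le> (\<Sum>p. \<bar>a p\<bar> * l1 c \<rho> ^ p)"
    by (rule sum_le_suminf[OF a]) (use l1_nonneg[OF c] in auto)
  finally show "nrm N \<rho> (ccomp a c) \<le> (\<Sum>p. \<bar>a p\<bar> * l1 c \<rho> ^ p)" .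
qed

lemma hom_xmul: "hom (xmul i c) (Suc k) x = x $ i * hom c k x"
proof -
  have "hom (xmul i c) (Suc k) x = (\<Sum>\<beta>\<in>idx k. xmul i c (\<beta>(i := Suc (\<beta> i))) * monomial (\<beta>(i := Suc (\<beta> i))) x)"
    unfolding hom_def by (rule sum_idx_Suc) (simp add: xmul_def)
  moreover have "monomial (\<beta>(i := Suc (\<beta> i))) x = x $ i * monomial \<beta> x" for \<beta>
    unfolding monomial_def
    by (subst prod.remove[of _ i], simp, simp, subst (2) prod.remove[of _ i]) (auto simp: mult_ac)
  ultimately show ?thesis by (simp add: hom_def xmul_def sum_distrib_left mult_ac)
qed

lemma hom_sum: "hom (\<lambda>\<alpha>. \<Sum>j\<in>I. c j \<alpha>) k x = (\<Sum>j\<in>I. hom (c j) k x)"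
  unfolding hom_def sum_distrib_right by (rule sum.swap)

lemma hom_rsq: "hom (rsq v) (k + 2) x = (norm x)\<^sup>2 * hom v k x"
proof -
  have "hom (rsq v) (k + 2) x = (\<Sum>i\<in>UNIV. x $ i * (x $ i * hom v k x))"
    unfolding rsq_def[abs_def] by (simp add: hom_sum hom_xmul)
  also have "\<dots> = (\<Sum>i\<in>UNIV. x $ i * x $ i) * hom v k x" by (simp add: sum_distrib_right mult.assoc)
  also have "(\<Sum>i\<in>UNIV. x $ i * x $ i) = (norm x)\<^sup>2"
    unfolding power2_norm_eq_inner by (simp add: inner_vec_def)
  finally show ?thesis .
qed

lemma hom_rsq_low: "k < 2 \<Longrightarrow> hom (rsq v) k x = 0"
  unfolding hom_def by (intro sum.neutral) (auto simp: rsq_low)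

lemma A1_xmul: "A1 (Suc k) (xmul i c) = A1 k c"
  unfolding A1_def by (subst sum_idx_Suc[where i = i]) (auto simp: xmul_def)

lemma A1_sum: "A1 k (\<lambda>\<alpha>. \<Sum>j\<in>I. c j \<alpha>) \<le> (\<Sum>j\<in>I. A1 k (c j))"
proof -
  have "(\<Sum>j\<in>I. A1 k (c j)) = (\<Sum>\<alpha>\<in>idx k. \<Sum>j\<in>I. \<bar>c j \<alpha>\<bar>)"
    unfolding A1_def by (rule sum.swap)
  then show ?thesis by (simp add: A1_def sum_mono)
qed

lemma aconv_rsq:
  fixes v :: "('n::finite \<Rightarrow> nat) \<Rightarrow> real"
  assumes "aconv v \<rho>" "\<rho> \<ge> 0"
  shows "aconv (rsq v) \<rho>"
proof -
  have "summable (\<lambda>k. A1 (k + 2) (rsq v) * \<rho> ^ (k + 2))"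
  proof (rule summable_comparison_test'[where N = 0])
    show "summable (\<lambda>k. (real CARD('n) * \<rho>\<^sup>2) * (A1 k v * \<rho> ^ k))"
      using assms(1) unfolding aconv_def by (rule summable_mult)
    fix k
    have "A1 (k + 2) (rsq v) \<le> (\<Sum>i\<in>(UNIV::'n set). A1 k v)"
      using A1_sum[of "k + 2" "\<lambda>i. xmul i (xmul i v)" UNIV] unfolding rsq_def[abs_def] by (simp add: A1_xmul)
    then have "A1 (k + 2) (rsq v) * \<rho> ^ (k + 2) \<le> (real CARD('n) * A1 k v) * \<rho> ^ (k + 2)"
      using assms(2) by (intro mult_right_mono) auto
    then show "norm (A1 (k + 2) (rsq v) * \<rho> ^ (k + 2)) \<le> (real CARD('n) * \<rho>\<^sup>2) * (A1 k v * \<rho> ^ k)"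
      using assms(2) by (simp add: power_add power2_eq_square mult_ac)
  qed
  then show ?thesis unfolding aconv_def by (subst (asm) summable_iff_shift)
qed

lemma psum_rsq:
  assumes "aconv v \<rho>" "\<And>i. \<bar>x $ i\<bar> \<le> \<rho>"
  shows "psum (rsq v) x = (norm x)\<^sup>2 * psum v x"
proof -
  have "(\<lambda>k. hom (rsq v) (k + 2) x) sums ((norm x)\<^sup>2 * psum v x)"
    unfolding hom_rsq by (intro sums_mult psum_sums[OF assms])
  then have "(\<lambda>k. hom (rsq v) k x) sums ((norm x)\<^sup>2 * psum v x + (\<Sum>k<2. hom (rsq v) k x))"
    by (subst (asm) sums_iff_shift)
  then show ?thesis by (simp add: psum_def sums_iff hom_rsq_low)
qed

section \<open>Interior estimates for the Laplacian\<close>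

lemma second_derivative_nonneg_at_min:
  fixes g g' :: "real \<Rightarrow> real"
  assumes d: "\<delta> > 0" and g: "\<And>t. \<bar>t\<bar> < \<delta> \<Longrightarrow> (g has_real_derivative g' t) (at t)"
    and q: "(g' has_real_derivative q) (at 0)" and min: "\<And>t. \<bar>t\<bar> < \<delta> \<Longrightarrow> g 0 \<le> g t"
  shows "q \<ge> 0"
proof (rule ccontr)
  assume "\<not> q \<ge> 0"
  have "g' 0 = 0"
    by (rule DERIV_local_min[OF g[of 0] d]) (use d min in auto)
  moreover obtain e where e: "e > 0" "\<And>h. 0 < h \<Longrightarrow> h < e \<Longrightarrow> g' h < g' 0"
    using DERIV_neg_dec_right[OF q] \<open>\<not> q \<ge> 0\<close> by auto
  ultimately have neg: "g' h < 0" if "0 < h" "h < e" for h using that by auto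
  define t where "t = min e \<delta> / 2"
  have t: "0 < t" "t < e" "t < \<delta>" using e d by (auto simp: t_def)
  have "\<exists>z. z > 0 \<and> z < t \<and> g t - g 0 = (t - 0) * g' z"
    by (rule MVT2[OF t(1)]) (use t g in auto)
  then obtain z where "0 < z" "z < t" "g t - g 0 = t * g' z" by auto
  then have "g t < g 0" using neg[of z] t mult_pos_neg[of t "g' z"] by auto
  with min[of t] t show False by auto
qed

lemma derivative_nonneg_right:
  fixes g :: "real \<Rightarrow> real"
  assumes "(g has_real_derivative q) (at 0)" "g 0 = 0" "\<delta> > 0" "\<And>t. 0 < t \<Longrightarrow> t < \<delta> \<Longrightarrow> g t \<ge> 0"
  shows "q \<ge> 0"
proof (rule ccontr)
  assume "\<not> q \<ge> 0"
  then obtain e where e: "e > 0" "\<And>h. 0 < h \<Longrightarrow> h < e \<Longrightarrow> g h < g 0"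
    using DERIV_neg_dec_right[OF assms(1)] by auto
  define t where "t = min e \<delta> / 2"
  have "0 < t" "t < e" "t < \<delta>" using e assms(3) by (auto simp: t_def)
  then show False using assms(2) assms(4)[of t] e(2)[of t] by auto
qed

text \<open>At an interior minimum all pure second derivatives are nonnegative, which the strict
  inequality for their sum excludes. Derivatives enter along the axes only, which is easy to check
  for functions built from a reflection.\<close>

lemma minimum_principle:
  fixes w :: "real^'n::finite \<Rightarrow> real"
  assumes D: "bounded D" "open D" and w: "continuous_on (closure D) w"
    and bd: "\<And>z. z \<in> closure D \<Longrightarrow> z \<notin> D \<Longrightarrow> w z \<ge> 0"
    and P: "\<And>z j. z \<in> D \<Longrightarrow> ((\<lambda>t. w (z + t *\<^sub>R axis j 1)) has_real_derivative P j z) (at 0)"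
    and Q: "\<And>z j. z \<in> D \<Longrightarrow> ((\<lambda>t. P j (z + t *\<^sub>R axis j 1)) has_real_derivative Q j z) (at 0)"
    and neg: "\<And>z. z \<in> D \<Longrightarrow> (\<Sum>j\<in>UNIV. Q j z) < 0"
    and z: "z \<in> closure D"
  shows "w z \<ge> 0"
proof -
  have ne: "closure D \<noteq> {}" using z by (auto simp del: closure_eq_empty)
  have "compact (closure D)" using D by (simp add: compact_eq_bounded_closed bounded_closure)
  then obtain z0 where z0: "z0 \<in> closure D" "\<And>y. y \<in> closure D \<Longrightarrow> w z0 \<le> w y"
    using continuous_attains_inf[OF _ ne w] by meson
  have "w z0 \<ge> 0"
  proof (cases "z0 \<in> D")
    case False
    then show ?thesis using bd z0 by blast
  next
    case True
    then obtain \<delta> where d: "\<delta> > 0" "ball z0 \<delta> \<subseteq> D" using D(2) open_contains_ball by blast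
    have in_D: "z0 + t *\<^sub>R axis j 1 \<in> D" if "\<bar>t\<bar> < \<delta>" for t j
      using d(2) that by (auto simp: dist_norm norm_axis_1)
    have "Q j z0 \<ge> 0" for j
    proof (rule second_derivative_nonneg_at_min[OF d(1)])
      fix t assume t: "\<bar>t\<bar> < \<delta>"
      have "((\<lambda>s. w ((z0 + t *\<^sub>R axis j 1) + s *\<^sub>R axis j 1)) has_real_derivative P j (z0 + t *\<^sub>R axis j 1)) (at 0)"
        by (rule P[OF in_D[OF t]])
      also have "(\<lambda>s. w ((z0 + t *\<^sub>R axis j 1) + s *\<^sub>R axis j 1)) = (\<lambda>s. w (z0 + (s + t) *\<^sub>R axis j 1))"
        by (simp add: algebra_simps)
      finally show "((\<lambda>t. w (z0 + t *\<^sub>R axis j 1)) has_real_derivative P j (z0 + t *\<^sub>R axis j 1)) (at t)"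
        using DERIV_shift[of "\<lambda>t. w (z0 + t *\<^sub>R axis j 1)" _ 0 t] by simp
      show "w (z0 + 0 *\<^sub>R axis j 1) \<le> w (z0 + t *\<^sub>R axis j 1)"
        using z0(2) in_D[OF t] closure_subset by auto
    qed (rule Q[OF True])
    then have "(\<Sum>j\<in>UNIV. Q j z0) \<ge> 0" by (intro sum_nonneg) auto
    with neg[OF True] show ?thesis by simp
  qed
  with z0(2)[OF z] show ?thesis by simp
qed

lemma has_derivative_partial:
  assumes "u differentiable (at y)"
  shows "(u has_derivative (\<lambda>h. \<Sum>i\<in>UNIV. h $ i * partial_deriv i u y)) (at y)"
proof -
  let ?D = "frechet_derivative u (at y)"
  have D: "(u has_derivative ?D) (at y)" using assms frechet_derivative_works by blast
  then have lin: "linear ?D" by (rule has_derivative_linear)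
  have "?D = (\<lambda>h. \<Sum>i\<in>UNIV. h $ i * partial_deriv i u y)"
  proof
    fix h
    have "?D h = ?D (\<Sum>i\<in>UNIV. h $ i *\<^sub>R axis i 1)"
      using basis_expansion[of h] by (simp add: scalar_mult_eq_scaleR)
    also have "\<dots> = (\<Sum>i\<in>UNIV. h $ i * partial_deriv i u y)"
      unfolding linear_sum[OF lin] linear_cmul[OF lin] by (simp add: partial_deriv_def)
    finally show "?D h = (\<Sum>i\<in>UNIV. h $ i * partial_deriv i u y)" .
  qed
  with D show ?thesis by simp
qed

lemma has_real_derivative_line:
  assumes "u differentiable (at (y + t *\<^sub>R v))"
  shows "((\<lambda>s. u (y + s *\<^sub>R v)) has_real_derivative (\<Sum>i\<in>UNIV. v $ i * partial_deriv i u (y + t *\<^sub>R v))) (at t within T)"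
proof -
  have "((\<lambda>s. y + s *\<^sub>R v) has_derivative (\<lambda>s. s *\<^sub>R v)) (at t within T)"
    by (auto intro!: derivative_eq_intros)
  from has_derivative_compose[OF this has_derivative_partial[OF assms]]
  show ?thesis
    unfolding has_field_derivative_def
    by (rule has_derivative_eq_rhs) (auto simp: sum_distrib_left mult_ac)
qed

lemma has_real_derivative_axis:
  assumes "u differentiable (at y)"
  shows "((\<lambda>t. u (y + (c * t) *\<^sub>R axis j 1)) has_real_derivative c * partial_deriv j u y) (at 0)"
proof -
  have "((\<lambda>t. u (y + t *\<^sub>R (c *\<^sub>R axis j 1))) has_real_derivative
     (\<Sum>i\<in>UNIV. (c *\<^sub>R axis j 1) $ i * partial_deriv i u (y + 0 *\<^sub>R (c *\<^sub>R axis j 1)))) (at 0)"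
    by (rule has_real_derivative_line) (use assms in simp)
  then show ?thesis
    by (simp add: mult_ac axis_def if_distrib[of "\<lambda>t. _ * t"] cong: if_cong)
qed

lemma Ck_on_2D:
  assumes "Ck_on 2 S u"
  shows "\<And>x. x \<in> S \<Longrightarrow> u differentiable (at x)"
    "\<And>x i. x \<in> S \<Longrightarrow> partial_deriv i u differentiable (at x)"
    "\<And>i j. continuous_on S (partial_deriv j (partial_deriv i u))"
  using assms by (auto simp: numeral_2_eq_2)

lemma continuous_on_if_differentiable: "(\<And>x. x \<in> S \<Longrightarrow> u differentiable (at x)) \<Longrightarrow> continuous_on S u"
  by (rule differentiable_imp_continuous_on)
     (auto simp: differentiable_on_def intro: differentiable_at_withinI)

text \<open>The odd part of \<open>u\<close> in the variable \<open>x\<^sub>i\<close> vanishes on the flat part of the boundary of a half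
  ball, so it is controlled there by an explicit quadratic barrier.\<close>

lemma gradient_estimate_aux:
  fixes u :: "real^'n::finite \<Rightarrow> real"
  assumes C2: "Ck_on 2 S u" and S: "cball x d \<subseteq> S" and d: "d > 0"
    and M: "\<And>y. y \<in> cball x d \<Longrightarrow> \<bar>u y\<bar> \<le> M" and N: "\<And>y. y \<in> cball x d \<Longrightarrow> \<bar>laplacian u y\<bar> \<le> N"
    and s: "s = 1 \<or> s = -1" and e: "\<epsilon> > 0"
  shows "s * partial_deriv i u x \<le> (real CARD('n) * M / d\<^sup>2 + N / 2 + \<epsilon>) * d"
proof -
  \<comment> \<open>The Laplacian of the comparison function \<open>w\<close> is 2nM/d^2 - 2K up to
    an error of size N; this K makes it at most -2\<epsilon>, hence strictly negative.\<close>
  define K where "K = real CARD('n) * M / d\<^sup>2 + N / 2 + \<epsilon>"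
  have M0: "M \<ge> 0" and N0: "N \<ge> 0" using M[of x] N[of x] d by auto
  have K0: "K \<ge> 0" using M0 N0 e d by (auto simp: K_def)
  define D where "D = {z::real^'n. norm z < d \<and> z $ i > 0}"
  define \<sigma> where "\<sigma> = (\<lambda>z::real^'n. z - (2 * z $ i) *\<^sub>R axis i 1)"
  \<comment> \<open>On the spherical part of the boundary the first term equals M, which dominates
    half the difference of two values of u. The second term is nonnegative on the half ball and
    supplies the negative Laplacian.\<close>
  define w where "w = (\<lambda>z. M / d\<^sup>2 * (z \<bullet> z) + K * (z $ i * (d - z $ i)) - s / 2 * (u (x + z) - u (x + \<sigma> z)))"
  define \<tau> where "\<tau> = (\<lambda>j. if j = i then -1 else 1 :: real)"
  define P where "P = (\<lambda>j z. M / d\<^sup>2 * (2 * z $ j) + (if j = i then K * (d - 2 * z $ i) else 0)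
      - s / 2 * (partial_deriv j u (x + z) - \<tau> j * partial_deriv j u (x + \<sigma> z)))"
  define Q where "Q = (\<lambda>j z. M / d\<^sup>2 * 2 + (if j = i then K * (- 2) else 0)
      - s / 2 * (partial_deriv j (partial_deriv j u) (x + z) - partial_deriv j (partial_deriv j u) (x + \<sigma> z)))"
  have \<sigma>norm: "norm (\<sigma> z) = norm z" for z
  proof -
    have "\<sigma> z \<bullet> \<sigma> z = z \<bullet> z"
      by (simp add: \<sigma>_def algebra_simps inner_axis inner_axis' inner_axis_axis)
    then show ?thesis by (simp add: norm_eq_sqrt_inner)
  qed
  have \<sigma>line: "\<sigma> (z + t *\<^sub>R axis j 1) = \<sigma> z + (\<tau> j * t) *\<^sub>R axis j 1" for z t j
    by (auto simp: \<sigma>_def \<tau>_def vec_eq_iff axis_def algebra_simps)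
  have inS: "x + z \<in> S" "x + \<sigma> z \<in> S" "x + z \<in> cball x d" "x + \<sigma> z \<in> cball x d" if "norm z \<le> d" for z
    using that S \<sigma>norm[of z] by (auto simp: dist_norm)
  have Dd: "norm z \<le> d" if "z \<in> D" for z using that by (simp add: D_def)
  have cl: "norm z \<le> d \<and> z $ i \<ge> 0" if "z \<in> closure D" for z
  proof -
    have "closed {z::real^'n. norm z \<le> d \<and> z $ i \<ge> 0}"
      by (intro closed_Collect_conj closed_Collect_le continuous_intros)
    then have "closure D \<subseteq> {z::real^'n. norm z \<le> d \<and> z $ i \<ge> 0}"
      by (intro closure_minimal) (auto simp: D_def)
    with that show ?thesis by auto
  qed
  have w_nonneg: "w z \<ge> 0" if zD: "z \<in> closure D" for z
  proof (rule minimum_principle[OF _ _ _ _ _ _ _ zD, where P = P and Q = Q])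
    show "bounded D" by (rule bounded_subset[of "ball 0 d"]) (auto simp: D_def)
    show "open D" unfolding D_def by (intro open_Collect_conj open_Collect_less continuous_intros)
    have cu: "continuous_on S u" using Ck_on_2D(1)[OF C2] by (rule continuous_on_if_differentiable)
    have "continuous_on (closure D) (\<lambda>z. u (x + z))" "continuous_on (closure D) (\<lambda>z. u (x + \<sigma> z))"
      unfolding \<sigma>_def
      by (rule continuous_on_compose2[OF cu], intro continuous_intros, use inS cl in \<open>force simp: \<sigma>_def\<close>)+
    then show "continuous_on (closure D) w" unfolding w_def by (intro continuous_intros)
    show "w z \<ge> 0" if "z \<in> closure D" "z \<notin> D" for z
    proof (cases "z $ i = 0")
      case True
      then have "\<sigma> z = z" by (simp add: \<sigma>_def)
      then show ?thesis using M0 by (simp add: w_def True)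
    next
      case False
      then have nz: "norm z = d" "z $ i \<ge> 0" using cl[OF that(1)] that(2) by (auto simp: D_def)
      have "z $ i \<le> d" using component_le_norm_cart[of z i] nz by simp
      then have "K * (z $ i * (d - z $ i)) \<ge> 0" using K0 nz by simp
      moreover have "M / d\<^sup>2 * (z \<bullet> z) = M" using nz d by (simp add: dot_square_norm)
      moreover have "\<bar>s / 2 * (u (x + z) - u (x + \<sigma> z))\<bar> \<le> M"
      proof -
        have "\<bar>u (x + z) - u (x + \<sigma> z)\<bar> \<le> 2 * M"
          using M[OF inS(3)[of z]] M[OF inS(4)[of z]] nz by linarith
        then show ?thesis using s by (auto simp: abs_mult)
      qed
      ultimately show ?thesis unfolding w_def by linarith
    qed
    fix z j assume z: "z \<in> D"
    note zz = inS[OF Dd[OF z]]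
    have dz: "((\<lambda>t. (z + t *\<^sub>R axis j 1) $ k) has_real_derivative (if k = j then 1 else 0)) (at 0)" for k
      by (auto simp: axis_def intro!: derivative_eq_intros)
    have dq: "((\<lambda>t. (z + t *\<^sub>R axis j 1) \<bullet> (z + t *\<^sub>R axis j 1)) has_real_derivative 2 * z $ j) (at 0)"
      by (simp add: algebra_simps inner_axis inner_axis' inner_axis_axis) (auto intro!: derivative_eq_intros)
    have du: "((\<lambda>t. v (x + (z + t *\<^sub>R axis j 1))) has_real_derivative partial_deriv j v (x + z)) (at 0)"
      "((\<lambda>t. v (x + \<sigma> (z + t *\<^sub>R axis j 1))) has_real_derivative \<tau> j * partial_deriv j v (x + \<sigma> z)) (at 0)"
      if "\<And>y. y \<in> S \<Longrightarrow> v differentiable (at y)" for v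
      using has_real_derivative_axis[OF that[OF zz(1)], of 1 j] has_real_derivative_axis[OF that[OF zz(2)], of "\<tau> j" j]
      by (simp_all add: \<sigma>line add.assoc)
    let ?l = "\<lambda>t. z + t *\<^sub>R axis j 1"
    note du1 = du[of u, OF Ck_on_2D(1)[OF C2]] and du2 = du[of "partial_deriv j u", OF Ck_on_2D(2)[OF C2]]
    have "((\<lambda>t. w (?l t)) has_real_derivative M / d\<^sup>2 * (2 * z $ j)
        + K * ((if i = j then 1 else 0) * (d - ?l 0 $ i) + (0 - (if i = j then 1 else 0)) * ?l 0 $ i)
        - s / 2 * (partial_deriv j u (x + z) - \<tau> j * partial_deriv j u (x + \<sigma> z))) (at 0)"
      unfolding w_def by (intro DERIV_add DERIV_diff DERIV_cmult DERIV_mult DERIV_const dz dq du1)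
    then show "((\<lambda>t. w (?l t)) has_real_derivative P j z) (at 0)"
      by (rule DERIV_cong) (auto simp: P_def)
    show "((\<lambda>t. P j (?l t)) has_real_derivative Q j z) (at 0)"
    proof (cases "j = i")
      case True
      have "((\<lambda>t. M / d\<^sup>2 * (2 * ?l t $ j) + K * (d - 2 * ?l t $ j)
         - s / 2 * (partial_deriv j u (x + ?l t) - \<tau> j * partial_deriv j u (x + \<sigma> (?l t))))
        has_real_derivative M / d\<^sup>2 * (2 * (if j = j then 1 else 0)) + K * (0 - 2 * (if j = j then 1 else 0))
         - s / 2 * (partial_deriv j (partial_deriv j u) (x + z) - \<tau> j * (\<tau> j * partial_deriv j (partial_deriv j u) (x + \<sigma> z)))) (at 0)"
        by (intro DERIV_add DERIV_diff DERIV_cmult DERIV_const dz du2)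
      then show ?thesis by (simp add: P_def Q_def True \<tau>_def)
    next
      case False
      have "((\<lambda>t. M / d\<^sup>2 * (2 * ?l t $ j)
         - s / 2 * (partial_deriv j u (x + ?l t) - \<tau> j * partial_deriv j u (x + \<sigma> (?l t))))
        has_real_derivative M / d\<^sup>2 * (2 * (if j = j then 1 else 0))
         - s / 2 * (partial_deriv j (partial_deriv j u) (x + z) - \<tau> j * (\<tau> j * partial_deriv j (partial_deriv j u) (x + \<sigma> z)))) (at 0)"
        by (intro DERIV_add DERIV_diff DERIV_cmult DERIV_const dz du2)
      then show ?thesis using False by (simp add: P_def Q_def \<tau>_def)
    qed
    define X where "X = s / 2 * (laplacian u (x + z) - laplacian u (x + \<sigma> z))"
    have "(\<Sum>j\<in>UNIV. Q j z) = 2 * (real CARD('n) * M / d\<^sup>2) - 2 * K - X"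
      by (simp add: X_def Q_def sum.distrib sum_subtractf laplacian_def flip: sum_distrib_left sum_divide_distrib)
    moreover have "\<bar>X\<bar> \<le> N"
    proof -
      have "\<bar>laplacian u (x + z) - laplacian u (x + \<sigma> z)\<bar> \<le> 2 * N"
        using N[OF zz(3)] N[OF zz(4)] by linarith
      then show ?thesis using s by (auto simp: abs_mult X_def)
    qed
    moreover have "2 * K = 2 * (real CARD('n) * M / d\<^sup>2) + N + 2 * \<epsilon>" by (simp add: K_def)
    ultimately have "(\<Sum>j\<in>UNIV. Q j z) = - N - 2 * \<epsilon> - X" by simp
    then show "(\<Sum>j\<in>UNIV. Q j z) < 0" using e \<open>\<bar>X\<bar> \<le> N\<close> abs_ge_minus_self[of X] by linarith
  qed
  define g where "g = (\<lambda>t. w (t *\<^sub>R axis i 1))"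
  \<comment> \<open>\<open>w\<close> vanishes at 0 and is nonnegative along the positive i-th axis,
    so its derivative there, which is this expression, is nonnegative.\<close>
  have "K * d - s * partial_deriv i u x \<ge> 0"
  proof (rule derivative_nonneg_right[OF _ _ d])
    have "\<sigma> (t *\<^sub>R axis i 1) = (-1 * t) *\<^sub>R axis i 1" for t
      using \<sigma>line[of 0 t i] by (simp add: \<tau>_def) (simp add: \<sigma>_def)
    then have g_eq: "g = (\<lambda>t. M / d\<^sup>2 * (t * t) + K * (t * (d - t)) - s / 2 * (u (x + (1 * t) *\<^sub>R axis i 1) - u (x + (-1 * t) *\<^sub>R axis i 1)))"
      by (simp add: g_def w_def inner_axis_axis)
    have xS: "x \<in> S" using S d by auto
    have "(g has_real_derivative M / d\<^sup>2 * (1 * 0 + 1 * 0) + K * (1 * (d - 0) + (0 - 1) * 0)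
        - s / 2 * (1 * partial_deriv i u x - (-1) * partial_deriv i u x)) (at 0)"
      unfolding g_eq
      by (intro DERIV_add DERIV_diff DERIV_cmult DERIV_mult DERIV_const DERIV_ident
           has_real_derivative_axis[OF Ck_on_2D(1)[OF C2 xS]])
    then show "(g has_real_derivative K * d - s * partial_deriv i u x) (at 0)"
      by (rule DERIV_cong) (simp add: algebra_simps)
    show "g 0 = 0" by (simp add: g_eq)
    show "g t \<ge> 0" if "0 < t" "t < d" for t
    proof -
      have "t *\<^sub>R axis i 1 \<in> D" using that by (simp add: D_def norm_axis_1)
      then show ?thesis unfolding g_def using w_nonneg closure_subset by blast
    qed
  qed
  then show ?thesis by (simp add: K_def)
qed

lemma gradient_estimate:
  fixes u :: "real^'n::finite \<Rightarrow> real"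
  assumes "Ck_on 2 S u" "cball x d \<subseteq> S" "d > 0"
    and "\<And>y. y \<in> cball x d \<Longrightarrow> \<bar>u y\<bar> \<le> M" "\<And>y. y \<in> cball x d \<Longrightarrow> \<bar>laplacian u y\<bar> \<le> N"
  shows "\<bar>partial_deriv i u x\<bar> \<le> real CARD('n) * M / d + N * d / 2"
proof -
  have "s * partial_deriv i u x \<le> real CARD('n) * M / d + N * d / 2" if s: "s = 1 \<or> s = -1" for s
  proof (rule field_le_epsilon)
    fix e :: real assume "e > 0"
    then have "s * partial_deriv i u x \<le> (real CARD('n) * M / d\<^sup>2 + N / 2 + e / d) * d"
      using gradient_estimate_aux[OF assms s, of "e / d"] assms(3) by simp
    also have "\<dots> = real CARD('n) * M / d + N * d / 2 + e"
      using assms(3) by (simp add: field_simps power2_eq_square)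
    finally show "s * partial_deriv i u x \<le> real CARD('n) * M / d + N * d / 2 + e" .
  qed
  from this[of 1] this[of "-1"] show ?thesis by linarith
qed

subsection \<open>Functions of class $C^k$\<close>

lemma Ck_on_Suc_imp: "Ck_on (Suc k) S u \<Longrightarrow> Ck_on k S u"
proof (induction k arbitrary: u)
  case 0
  then show ?case by (auto intro: continuous_on_if_differentiable)
qed auto

lemma Ck_on_le: "Ck_on m S u \<Longrightarrow> k \<le> m \<Longrightarrow> Ck_on k S u"
  by (induction m) (auto simp: le_Suc_eq dest: Ck_on_Suc_imp simp del: Ck_on.simps(2))

lemma Ck_on_subset: "Ck_on k S u \<Longrightarrow> T \<subseteq> S \<Longrightarrow> Ck_on k T u"
  by (induction k arbitrary: u) (auto intro: continuous_on_subset)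

lemma partial_deriv_linear:
  assumes "f differentiable (at x)" "g differentiable (at x)"
  shows "(\<lambda>x. a * f x + b * g x) differentiable (at x)"
    "partial_deriv i (\<lambda>x. a * f x + b * g x) x = a * partial_deriv i f x + b * partial_deriv i g x"
proof -
  have D: "((\<lambda>x. a * f x + b * g x) has_derivative
      (\<lambda>h. a * frechet_derivative f (at x) h + b * frechet_derivative g (at x) h)) (at x)"
    using assms by (intro has_derivative_add has_derivative_mult_right) (simp_all add: frechet_derivative_works)
  then show "(\<lambda>x. a * f x + b * g x) differentiable (at x)" by (auto simp: differentiable_def)
  show "partial_deriv i (\<lambda>x. a * f x + b * g x) x = a * partial_deriv i f x + b * partial_deriv i g x"
    unfolding partial_deriv_eqI[OF D] by (simp add: partial_deriv_def)
qed

lemma Ck_on_linear: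
  assumes "open S" "Ck_on k S f" "Ck_on k S g"
  shows "Ck_on k S (\<lambda>x. a * f x + b * g x)"
  using assms(2,3)
proof (induction k arbitrary: f g)
  case 0
  then show ?case by (auto intro!: continuous_intros)
next
  case (Suc k)
  have "Ck_on k S (partial_deriv i (\<lambda>x. a * f x + b * g x))" for i
  proof (subst Ck_on_cong[OF assms(1)])
    show "partial_deriv i (\<lambda>x. a * f x + b * g x) y = a * partial_deriv i f y + b * partial_deriv i g y" if "y \<in> S" for y
      using Suc.prems that by (intro partial_deriv_linear) auto
    show "Ck_on k S (\<lambda>y. a * partial_deriv i f y + b * partial_deriv i g y)"
      using Suc.prems by (intro Suc.IH) auto
  qed
  then show ?case using Suc.prems by (auto intro!: partial_deriv_linear)
qed

lemma laplacian_linear: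
  assumes "open S" "Ck_on 2 S f" "Ck_on 2 S g" "x \<in> S"
  shows "laplacian (\<lambda>x. a * f x + b * g x) x = a * laplacian f x + b * laplacian g x"
proof -
  have "partial_deriv i (partial_deriv i (\<lambda>x. a * f x + b * g x)) x
      = a * partial_deriv i (partial_deriv i f) x + b * partial_deriv i (partial_deriv i g) x" for i
  proof -
    have "partial_deriv i (partial_deriv i (\<lambda>x. a * f x + b * g x)) x
      = partial_deriv i (\<lambda>y. a * partial_deriv i f y + b * partial_deriv i g y) x"
      by (rule partial_deriv_cong_open[OF assms(1,4)])
         (intro partial_deriv_linear Ck_on_2D(1)[OF assms(2)] Ck_on_2D(1)[OF assms(3)])
    then show ?thesis
      using partial_deriv_linear(2)[OF Ck_on_2D(2)[OF assms(2,4)] Ck_on_2D(2)[OF assms(3,4)]] by simp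
  qed
  then show ?thesis by (simp add: laplacian_def sum.distrib sum_distrib_left)
qed

lemma has_derivative_shift_iff:
  "((\<lambda>x. u (x + a)) has_derivative D) (at x) \<longleftrightarrow> (u has_derivative D) (at (x + a))"
proof
  assume "(u has_derivative D) (at (x + a))"
  moreover have "((\<lambda>x. x + a) has_derivative (\<lambda>h. h)) (at x)" by (auto intro!: derivative_eq_intros)
  ultimately show "((\<lambda>x. u (x + a)) has_derivative D) (at x)"
    using has_derivative_compose[of "\<lambda>x. x + a" "\<lambda>h. h" x UNIV u D] by simp
next
  assume "((\<lambda>x. u (x + a)) has_derivative D) (at x)"
  then have "((\<lambda>x. u (x + a)) has_derivative D) (at ((x + a) - a))" by simp
  moreover have "((\<lambda>x. x - a) has_derivative (\<lambda>h. h)) (at (x + a))" by (auto intro!: derivative_eq_intros)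
  ultimately show "(u has_derivative D) (at (x + a))"
    using has_derivative_compose[of "\<lambda>x. x - a" "\<lambda>h. h" "x + a" UNIV "\<lambda>x. u (x + a)" D] by simp
qed

lemma partial_deriv_shift: "partial_deriv i (\<lambda>x. u (x + a)) = (\<lambda>x. partial_deriv i u (x + a))"
  by (rule ext) (simp add: partial_deriv_def frechet_derivative_def has_derivative_shift_iff)

lemma laplacian_shift: "laplacian (\<lambda>x. u (x + a)) x = laplacian u (x + a)"
  by (simp add: laplacian_def partial_deriv_shift)

lemma Ck_on_shift: "Ck_on k S u \<Longrightarrow> (\<And>x. x \<in> T \<Longrightarrow> x + a \<in> S) \<Longrightarrow> Ck_on k T (\<lambda>x. u (x + a))"
proof (induction k arbitrary: u)
  case 0
  then have "continuous_on S u" by simp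
  then have "continuous_on T (\<lambda>x. u (x + a))"
    by (rule continuous_on_compose2) (use 0 in \<open>auto intro!: continuous_intros\<close>)
  then show ?case by simp
next
  case (Suc k)
  then show ?case
    by (simp add: partial_deriv_shift) (simp add: differentiable_def has_derivative_shift_iff)
qed

lemma has_real_derivative_line_axis:
  assumes "u differentiable (at (y + t *\<^sub>R axis j 1))"
  shows "((\<lambda>s. u (y + s *\<^sub>R axis j 1)) has_real_derivative partial_deriv j u (y + t *\<^sub>R axis j 1)) (at t within T)"
  using has_real_derivative_line[OF assms, of T]
  by (simp add: axis_def if_distrib[of "\<lambda>t. t * _"] cong: if_cong)

text \<open>The mean value theorem applied once in each direction. An exact value at a nearby point
  serves both the symmetry of second derivatives and the uniform convergence of second difference
  quotients.\<close>

lemma double_difference: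
  assumes C2: "Ck_on 2 S u" and r: "r > 0" and S: "cball x (2 * r) \<subseteq> S"
  shows "\<exists>y\<in>cball x (2 * r). u (x + r *\<^sub>R axis i 1 + r *\<^sub>R axis j 1) - u (x + r *\<^sub>R axis i 1) - u (x + r *\<^sub>R axis j 1) + u x
     = r\<^sup>2 * partial_deriv j (partial_deriv i u) y"
proof -
  let ?e = "\<lambda>i. axis i (1::real)"
  have in_ball: "x + s *\<^sub>R ?e i + t *\<^sub>R ?e j \<in> cball x (2 * r)" if "0 \<le> s" "s \<le> r" "0 \<le> t" "t \<le> r" for s t
  proof -
    have "norm (s *\<^sub>R ?e i + t *\<^sub>R ?e j) \<le> s + t"
      using norm_triangle_ineq[of "s *\<^sub>R ?e i" "t *\<^sub>R ?e j"] that by (simp add: norm_axis_1)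
    then have "norm (s *\<^sub>R ?e i + t *\<^sub>R ?e j) \<le> 2 * r" using that by linarith
    then show ?thesis using dist_add_cancel[of x 0 "s *\<^sub>R ?e i + t *\<^sub>R ?e j"] by (simp add: add.assoc)
  qed
  note in_S = subsetD[OF S in_ball]
  define g where "g = (\<lambda>s. u ((x + r *\<^sub>R ?e j) + s *\<^sub>R ?e i) - u (x + s *\<^sub>R ?e i))"
  have "\<exists>z. z > 0 \<and> z < r \<and> g r - g 0 = (r - 0) * (partial_deriv i u ((x + r *\<^sub>R ?e j) + z *\<^sub>R ?e i) - partial_deriv i u (x + z *\<^sub>R ?e i))"
  proof (rule MVT2[OF r])
    fix s :: real assume s: "0 \<le> s" "s \<le> r"
    show "(g has_real_derivative (partial_deriv i u ((x + r *\<^sub>R ?e j) + s *\<^sub>R ?e i) - partial_deriv i u (x + s *\<^sub>R ?e i))) (at s)"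
      unfolding g_def using in_S[of s r] in_S[of s 0] s r
      by (intro DERIV_diff has_real_derivative_line_axis Ck_on_2D(1)[OF C2]) (simp_all add: add_ac)
  qed
  then obtain s where s: "0 < s" "s < r" and gs: "g r - g 0 = r * (partial_deriv i u ((x + r *\<^sub>R ?e j) + s *\<^sub>R ?e i) - partial_deriv i u (x + s *\<^sub>R ?e i))"
    by auto
  define k where "k = (\<lambda>t. partial_deriv i u ((x + s *\<^sub>R ?e i) + t *\<^sub>R ?e j))"
  have "\<exists>z. z > 0 \<and> z < r \<and> k r - k 0 = (r - 0) * (partial_deriv j (partial_deriv i u) ((x + s *\<^sub>R ?e i) + z *\<^sub>R ?e j))"
  proof (rule MVT2[OF r])
    fix t :: real assume t: "0 \<le> t" "t \<le> r"
    show "(k has_real_derivative (partial_deriv j (partial_deriv i u) ((x + s *\<^sub>R ?e i) + t *\<^sub>R ?e j))) (at t)"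
      unfolding k_def using in_S[of s t] s t
      by (intro has_real_derivative_line_axis Ck_on_2D(2)[OF C2]) simp_all
  qed
  then obtain t where t: "0 < t" "t < r" and kt: "k r - k 0 = r * partial_deriv j (partial_deriv i u) ((x + s *\<^sub>R ?e i) + t *\<^sub>R ?e j)"
    by auto
  have "u (x + r *\<^sub>R ?e i + r *\<^sub>R ?e j) - u (x + r *\<^sub>R ?e i) - u (x + r *\<^sub>R ?e j) + u x = g r - g 0"
    by (simp add: g_def add_ac)
  also have "\<dots> = r * (k r - k 0)" unfolding gs by (simp add: k_def add_ac)
  also have "\<dots> = r\<^sup>2 * partial_deriv j (partial_deriv i u) ((x + s *\<^sub>R ?e i) + t *\<^sub>R ?e j)"
    unfolding kt by (simp add: power2_eq_square)
  finally show ?thesis using in_ball[of s t] s t by (intro bexI[of _ "(x + s *\<^sub>R ?e i) + t *\<^sub>R ?e j"]) auto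
qed

text \<open>The second difference is symmetric in the two directions, so both mixed derivatives take
  a common value at points arbitrarily close to \<open>x\<close>; continuity concludes.\<close>

lemma partial_deriv_commute:
  assumes S: "open S" and C2: "Ck_on 2 S u" and x: "x \<in> S"
  shows "partial_deriv i (partial_deriv j u) x = partial_deriv j (partial_deriv i u) x"
proof -
  define A where "A = partial_deriv i (partial_deriv j u)"
  define B where "B = partial_deriv j (partial_deriv i u)"
  have "\<bar>A x - B x\<bar> \<le> 0 + e" if e: "e > 0" for e
  proof -
    have "isCont A x" "isCont B x"
      using Ck_on_2D(3)[OF C2] S x by (auto simp: A_def B_def continuous_on_eq_continuous_at)
    then obtain d1 d2 where d: "d1 > 0" "d2 > 0" "\<And>y. dist y x < d1 \<Longrightarrow> dist (A y) (A x) < e / 2" "\<And>y. dist y x < d2 \<Longrightarrow> dist (B y) (B x) < e / 2"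
      using e unfolding continuous_at_eps_delta dist_norm by (metis half_gt_zero)
    obtain d3 where d3: "d3 > 0" "ball x d3 \<subseteq> S" using S x open_contains_ball by blast
    define r where "r = min d1 (min d2 d3) / 4"
    have r: "r > 0" "2 * r < d1" "2 * r < d2" "2 * r < d3" using d d3 by (auto simp: r_def)
    have cS: "cball x (2 * r) \<subseteq> S" using d3 r by auto
    obtain y1 where y1: "y1 \<in> cball x (2 * r)" "u (x + r *\<^sub>R axis i 1 + r *\<^sub>R axis j 1) - u (x + r *\<^sub>R axis i 1) - u (x + r *\<^sub>R axis j 1) + u x = r\<^sup>2 * B y1"
      using double_difference[OF C2 r(1) cS] unfolding B_def by blast
    obtain y2 where y2: "y2 \<in> cball x (2 * r)" "u (x + r *\<^sub>R axis j 1 + r *\<^sub>R axis i 1) - u (x + r *\<^sub>R axis j 1) - u (x + r *\<^sub>R axis i 1) + u x = r\<^sup>2 * A y2"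
      using double_difference[OF C2 r(1) cS] unfolding A_def by blast
    have "r\<^sup>2 * B y1 = r\<^sup>2 * A y2" unfolding y1(2)[symmetric] y2(2)[symmetric] by (simp add: add_ac)
    then have "A y2 = B y1" using r by simp
    moreover have "dist (A y2) (A x) < e / 2" "dist (B y1) (B x) < e / 2"
      using d(3)[of y2] d(4)[of y1] y1(1) y2(1) r by (auto simp: dist_commute)
    ultimately show ?thesis unfolding dist_real_def by linarith
  qed
  then have "\<bar>A x - B x\<bar> \<le> 0" by (rule field_le_epsilon)
  then show ?thesis by (simp add: A_def B_def)
qed

lemma laplacian_partial_deriv:
  assumes S: "open S" and C3: "Ck_on 3 S u" and x: "x \<in> S"
  shows "laplacian (partial_deriv i u) x = partial_deriv i (laplacian u) x"
proof -
  have C2: "Ck_on 2 S u" by (rule Ck_on_le[OF C3]) simp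
  have C2': "Ck_on 2 S (partial_deriv j u)" for j using C3 by (simp add: numeral_3_eq_3 numeral_2_eq_2)
  have "partial_deriv j (partial_deriv j (partial_deriv i u)) x = partial_deriv i (partial_deriv j (partial_deriv j u)) x" for j
  proof -
    have "partial_deriv j (partial_deriv j (partial_deriv i u)) x = partial_deriv j (partial_deriv i (partial_deriv j u)) x"
      by (rule partial_deriv_cong_open[OF S x]) (rule partial_deriv_commute[OF S C2])
    also have "\<dots> = partial_deriv i (partial_deriv j (partial_deriv j u)) x"
      by (rule partial_deriv_commute[OF S C2' x])
    finally show ?thesis .
  qed
  then have "laplacian (partial_deriv i u) x = (\<Sum>j\<in>UNIV. partial_deriv i (partial_deriv j (partial_deriv j u)) x)"
    by (simp add: laplacian_def)
  also have "\<dots> = partial_deriv i (laplacian u) x"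
  proof -
    have "(laplacian u has_derivative (\<lambda>h. \<Sum>j\<in>UNIV. frechet_derivative (partial_deriv j (partial_deriv j u)) (at x) h)) (at x)"
      unfolding laplacian_def[abs_def]
      by (intro has_derivative_sum) (use Ck_on_2D(2)[OF C2' x] in \<open>simp add: frechet_derivative_works\<close>)
    from partial_deriv_eqI[OF this] show ?thesis by (simp add: partial_deriv_def)
  qed
  finally show ?thesis .
qed

subsection \<open>Harmonic functions are smooth\<close>

text \<open>The second difference quotients of \<open>u\<close> are again harmonic, being
  combinations of translates, and converge uniformly to the second derivative. The gradient estimate
  applied to their differences makes the gradients uniformly Cauchy, so the limit is continuously
  differentiable.\<close>

lemma harmonic_C3_aux:
  fixes u :: "real^'n::finite \<Rightarrow> real"
  assumes S: "open S" and C2: "Ck_on 2 S u" and harm: "\<And>x. x \<in> S \<Longrightarrow> laplacian u x = 0" and x0: "x\<^sub>0 \<in> S"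
  shows "\<exists>B. open B \<and> x\<^sub>0 \<in> B \<and> B \<subseteq> S \<and> Ck_on 1 B (partial_deriv j (partial_deriv i u))"
proof -
  define v where "v = partial_deriv j (partial_deriv i u)"
  obtain R0 where R0: "R0 > 0" "cball x\<^sub>0 R0 \<subseteq> S" using S x0 open_contains_cball by blast
  \<comment> \<open>Room for nested balls: gradients are compared on \<open>B\<close>, the quotients
    live on \<open>T\<close>, and translates of \<open>T\<close> by up to 2R stay within radius
    4R.\<close>
  define R where "R = R0 / 4"
  have R: "R > 0" "cball x\<^sub>0 (4 * R) \<subseteq> S" using R0 by (auto simp: R_def)
  define T where "T = ball x\<^sub>0 (2 * R)"
  define B where "B = ball x\<^sub>0 R"
  define r where "r = (\<lambda>m::nat. R / (real m + 1))"
  have r: "0 < r m" "r m \<le> R" for m using R by (auto simp: r_def divide_le_eq)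
  let ?e = "\<lambda>i. axis i (1::real)"
  \<comment> \<open>The second difference quotient, written as nested two-term combinations so that
    \<open>Ck_on_linear\<close> and \<open>laplacian_linear\<close> apply.\<close>
  define z where "z = (\<lambda>m x. (1 / (r m)\<^sup>2) * (1 * (1 * u (x + (r m *\<^sub>R ?e i + r m *\<^sub>R ?e j)) + (-1) * u (x + r m *\<^sub>R ?e i))
     + 1 * ((-1) * u (x + r m *\<^sub>R ?e j) + 1 * u x)) + 0 * u x)"
  have shift: "x + a \<in> S" if "x \<in> T" "norm a \<le> 2 * R" for x a
  proof -
    have "dist x\<^sub>0 (x + a) \<le> dist x\<^sub>0 x + norm a" using norm_triangle_ineq4[of "x\<^sub>0 - x" a] by (simp add: dist_norm algebra_simps)
    then show ?thesis using that R by (auto simp: T_def)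
  qed
  have na: "norm (r m *\<^sub>R ?e i + r m *\<^sub>R ?e j) \<le> 2 * R" "norm (r m *\<^sub>R ?e i) \<le> 2 * R" "norm (r m *\<^sub>R ?e j) \<le> 2 * R" for m
    using norm_triangle_ineq[of "r m *\<^sub>R ?e i" "r m *\<^sub>R ?e j"] r[of m] R(1) by (auto simp: norm_axis_1)
  have T: "open T" "T \<subseteq> S" "convex T" using R by (auto simp: T_def)
  have C2s: "Ck_on 2 T (\<lambda>x. u (x + a))" "\<And>x. x \<in> T \<Longrightarrow> laplacian (\<lambda>x. u (x + a)) x = 0" if "norm a \<le> 2 * R" for a
    using Ck_on_shift[OF C2] shift that harm by (auto simp: laplacian_shift)
  have zC2: "Ck_on 2 T (z m)" and zlap: "\<And>x. x \<in> T \<Longrightarrow> laplacian (z m) x = 0" for m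
  proof -
    note h = C2s[OF na(1)[of m]] C2s[OF na(2)[of m]] C2s[OF na(3)[of m]] C2s[of 0, simplified]
    show "Ck_on 2 T (z m)" unfolding z_def by (intro Ck_on_linear T h) (use R in auto)
    show "laplacian (z m) x = 0" if "x \<in> T" for x
      unfolding z_def using that R
      by (simp only: laplacian_linear[OF T(1)] Ck_on_linear[OF T(1)] h less_imp_le mult_nonneg_nonneg zero_le_numeral) simp
  qed
  have dd: "\<exists>y\<in>cball x (2 * r m). z m x = v y" if "x \<in> T" for x m
  proof -
    have "cball x (2 * r m) \<subseteq> S"
    proof
      fix y assume "y \<in> cball x (2 * r m)"
      then have "norm (y - x) \<le> 2 * R" using r[of m] by (simp add: dist_norm norm_minus_commute)
      from shift[OF that this] show "y \<in> S" by simp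
    qed
    from double_difference[OF C2 r(1) this, of i j] obtain y where y: "y \<in> cball x (2 * r m)"
      "u (x + r m *\<^sub>R ?e i + r m *\<^sub>R ?e j) - u (x + r m *\<^sub>R ?e i) - u (x + r m *\<^sub>R ?e j) + u x = (r m)\<^sup>2 * v y"
      unfolding v_def by blast
    have "z m x = (1 / (r m)\<^sup>2) * (u (x + r m *\<^sub>R ?e i + r m *\<^sub>R ?e j) - u (x + r m *\<^sub>R ?e i) - u (x + r m *\<^sub>R ?e j) + u x)"
      by (simp add: z_def add.assoc)
    also have "\<dots> = v y" unfolding y(2) using r(1)[of m] by simp
    finally show ?thesis using y(1) by blast
  qed
  have r0: "r \<longlonglongrightarrow> 0" unfolding r_def by real_asymp
  have zunif: "\<exists>N. \<forall>m\<ge>N. \<forall>x\<in>T. \<bar>z m x - v x\<bar> < e" if e: "e > 0" for e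
  proof -
    have "continuous_on (cball x\<^sub>0 (4 * R)) v" using Ck_on_2D(3)[OF C2] R(2) unfolding v_def by (rule continuous_on_subset)
    then have "uniformly_continuous_on (cball x\<^sub>0 (4 * R)) v" by (rule compact_uniformly_continuous) simp
    then obtain d where d: "d > 0" "\<And>x y. x \<in> cball x\<^sub>0 (4 * R) \<Longrightarrow> y \<in> cball x\<^sub>0 (4 * R) \<Longrightarrow> dist y x < d \<Longrightarrow> dist (v y) (v x) < e"
      using e unfolding uniformly_continuous_on_def by metis
    obtain N where N: "\<And>m. m \<ge> N \<Longrightarrow> r m < d / 2"
      using order_tendstoD(2)[OF r0, of "d / 2"] d by (auto simp: eventually_sequentially)
    show ?thesis
    proof (intro exI allI impI ballI)
      fix m x assume m: "m \<ge> N" and x: "x \<in> T"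
      obtain y where y: "y \<in> cball x (2 * r m)" "z m x = v y" using dd[OF x] by blast
      have "dist x\<^sub>0 y \<le> 4 * R" using x y(1) r[of m] dist_triangle[of x\<^sub>0 y x] by (auto simp: T_def)
      moreover have "dist x\<^sub>0 x \<le> 4 * R" using x R by (auto simp: T_def)
      moreover have "dist y x < d" using y(1) N[OF m] by (simp add: dist_commute)
      ultimately have "dist (v y) (v x) < e" using d(2) by simp
      then show "\<bar>z m x - v x\<bar> < e" using y(2) by (simp add: dist_real_def)
    qed
  qed
  have ucauchy: "uniformly_Cauchy_on B (\<lambda>m. partial_deriv k (z m))" for k
    unfolding uniformly_Cauchy_on_def
  proof (intro allI impI)
    fix e :: real assume e: "e > 0"
    \<comment> \<open>A function bounded by 2e' on a ball of radius R/2 has, by the gradient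
      estimate, partial derivatives of size at most 4ne'/R, which is e/2.\<close>
    define e' where "e' = e * R / (8 * real CARD('n))"
    have e': "e' > 0" using e R by (simp add: e'_def)
    obtain N where N: "\<And>m x. m \<ge> N \<Longrightarrow> x \<in> T \<Longrightarrow> \<bar>z m x - v x\<bar> < e'" using zunif[OF e'] by blast
    show "\<exists>M. \<forall>x\<in>B. \<forall>m\<ge>M. \<forall>n\<ge>M. dist (partial_deriv k (z m) x) (partial_deriv k (z n) x) < e"
    proof (intro exI ballI allI impI)
      fix x m n assume x: "x \<in> B" and mn: "m \<ge> N" "n \<ge> N"
      define w where "w = (\<lambda>y. 1 * z m y + (-1) * z n y)"
      have cT: "cball x (R / 2) \<subseteq> T"
      proof
        fix y assume "y \<in> cball x (R / 2)"
        then have "dist x\<^sub>0 y < 2 * R" using x R(1) dist_triangle[of x\<^sub>0 y x] by (auto simp: B_def)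
        then show "y \<in> T" by (simp add: T_def)
      qed
      have xT: "x \<in> T" using cT R(1) by auto
      have "\<bar>partial_deriv k w x\<bar> \<le> real CARD('n) * (2 * e') / (R / 2) + 0 * (R / 2) / 2"
      proof (rule gradient_estimate[OF _ cT])
        show "Ck_on 2 T w" unfolding w_def by (intro Ck_on_linear T zC2)
        fix y assume "y \<in> cball x (R / 2)"
        then have y: "y \<in> T" using cT by blast
        show "\<bar>w y\<bar> \<le> 2 * e'" using N[OF mn(1) y] N[OF mn(2) y] by (simp add: w_def)
        show "\<bar>laplacian w y\<bar> \<le> 0" unfolding w_def laplacian_linear[OF T(1) zC2 zC2 y] zlap[OF y] by simp
      qed (use R in auto)
      also have "\<dots> = e / 2" using R by (simp add: e'_def)
      also have "\<dots> < e" using e by simp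
      also have "partial_deriv k w x = 1 * partial_deriv k (z m) x + (-1) * partial_deriv k (z n) x"
        unfolding w_def by (intro partial_deriv_linear Ck_on_2D(1)[OF zC2 xT])
      finally show "dist (partial_deriv k (z m) x) (partial_deriv k (z n) x) < e" by (simp add: dist_real_def)
    qed
  qed
  then have "\<forall>k. \<exists>g. uniform_limit B (\<lambda>m. partial_deriv k (z m)) g sequentially"
    using Cauchy_uniformly_convergent uniformly_convergent_on_def by blast
  then obtain g where g: "\<And>k. uniform_limit B (\<lambda>m. partial_deriv k (z m)) (g k) sequentially" by metis
  have BT: "B \<subseteq> T" using R(1) by (auto simp: B_def T_def)
  have x0B: "x\<^sub>0 \<in> B" using R(1) by (simp add: B_def)
  have gcont: "continuous_on B (g k)" for k
  proof (rule uniform_limit_theorem[OF _ g])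
    have "continuous_on B (partial_deriv k (z m))" for m
      by (rule continuous_on_if_differentiable) (use Ck_on_2D(2)[OF zC2] BT in auto)
    then show "\<forall>\<^sub>F m in sequentially. continuous_on B (partial_deriv k (z m))" by simp
  qed simp
  have zlim: "(\<lambda>m. z m x) \<longlonglongrightarrow> v x" if "x \<in> T" for x
    unfolding LIMSEQ_def dist_real_def using zunif that by blast
  have "\<exists>G. \<forall>x\<in>B. (\<lambda>m. z m x) \<longlonglongrightarrow> G x \<and> (G has_derivative (\<lambda>h. \<Sum>k\<in>UNIV. h $ k * g k x)) (at x within B)"
  proof (rule has_derivative_sequence)
    show "convex B" "x\<^sub>0 \<in> B" using R(1) by (auto simp: B_def)
    show "(z m has_derivative (\<lambda>h. \<Sum>k\<in>UNIV. h $ k * partial_deriv k (z m) x)) (at x within B)" if "x \<in> B" for m x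
      by (rule has_derivative_at_withinI, rule has_derivative_partial) (use Ck_on_2D(1)[OF zC2] BT that in auto)
    show "(\<lambda>m. z m x\<^sub>0) \<longlonglongrightarrow> v x\<^sub>0" using zlim x0B BT by blast
    fix e :: real assume e: "e > 0"
    have "\<forall>\<^sub>F m in sequentially. \<forall>y\<in>B. \<bar>partial_deriv k (z m) y - g k y\<bar> < e / real CARD('n)" for k
      using uniform_limitD[OF g[of k], of "e / real CARD('n)"] e by (simp add: dist_real_def)
    then have "\<forall>\<^sub>F m in sequentially. \<forall>k. \<forall>y\<in>B. \<bar>partial_deriv k (z m) y - g k y\<bar> < e / real CARD('n)"
      by (rule eventually_all_finite)
    then show "\<forall>\<^sub>F m in sequentially. \<forall>y\<in>B. \<forall>h. norm ((\<Sum>k\<in>UNIV. h $ k * partial_deriv k (z m) y) - (\<Sum>k\<in>UNIV. h $ k * g k y)) \<le> e * norm h"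
    proof eventually_elim
      case (elim m)
      show ?case
      proof (intro ballI allI)
        fix y h assume y: "y \<in> B"
        have "(\<Sum>k\<in>UNIV. h $ k * partial_deriv k (z m) y) - (\<Sum>k\<in>UNIV. h $ k * g k y) = (\<Sum>k\<in>UNIV. h $ k * (partial_deriv k (z m) y - g k y))"
          by (simp add: right_diff_distrib sum_subtractf)
        also have "\<bar>\<dots>\<bar> \<le> (\<Sum>k\<in>UNIV. \<bar>h $ k\<bar> * \<bar>partial_deriv k (z m) y - g k y\<bar>)"
          unfolding abs_mult[symmetric] by (rule sum_abs)
        also have "\<dots> \<le> (\<Sum>k\<in>(UNIV::'n set). norm h * (e / real CARD('n)))"
          by (intro sum_mono mult_mono component_le_norm_cart) (use elim y in \<open>auto simp: less_imp_le\<close>)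
        also have "\<dots> = e * norm h" by simp
        finally show "norm ((\<Sum>k\<in>UNIV. h $ k * partial_deriv k (z m) y) - (\<Sum>k\<in>UNIV. h $ k * g k y)) \<le> e * norm h"
          by simp
      qed
    qed
  qed
  then obtain G where G: "\<And>x. x \<in> B \<Longrightarrow> (\<lambda>m. z m x) \<longlonglongrightarrow> G x"
     "\<And>x. x \<in> B \<Longrightarrow> (G has_derivative (\<lambda>h. \<Sum>k\<in>UNIV. h $ k * g k x)) (at x within B)" by blast
  have Gv: "G x = v x" if "x \<in> B" for x using LIMSEQ_unique[OF G(1)[OF that] zlim] that BT by blast
  have oB: "open B" by (simp add: B_def)
  have vder: "(v has_derivative (\<lambda>h. \<Sum>k\<in>UNIV. h $ k * g k x)) (at x)" if "x \<in> B" for x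
    using G(2)[OF that] has_derivative_cong_open[OF oB that Gv] at_within_open[OF that oB] by simp
  have pv: "partial_deriv k v x = g k x" if "x \<in> B" for x k
    unfolding partial_deriv_eqI[OF vder[OF that]] by (simp add: axis_def if_distrib[of "\<lambda>t. t * _"] cong: if_cong)
  have "Ck_on 1 B v"
    using vder gcont by (auto simp: differentiable_def pv cong: continuous_on_cong)
  then show ?thesis using oB x0B BT T(2) unfolding v_def by blast
qed

lemma Ck_on_local:
  assumes "\<And>x. x \<in> S \<Longrightarrow> \<exists>B. open B \<and> x \<in> B \<and> Ck_on k B u"
  shows "Ck_on k S u"
  using assms
proof (induction k arbitrary: u)
  case 0
  show ?case unfolding Ck_on.simps
  proof (rule continuous_at_imp_continuous_on, rule ballI)
    fix x assume "x \<in> S"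
    with 0 obtain B where "open B" "x \<in> B" "continuous_on B u" by auto
    then show "isCont u x" by (simp add: continuous_on_eq_continuous_at)
  qed
next
  case (Suc k)
  have "Ck_on k S (partial_deriv i u)" for i
    by (rule Suc.IH) (use Suc.prems in \<open>auto; blast\<close>)
  then show ?case using Suc.prems by auto
qed

text \<open>Bootstrapping: once \<open>u\<close> has three continuous derivatives, its partial
  derivatives are themselves harmonic, and the induction hypothesis applies to them.\<close>

lemma harmonic_smooth:
  fixes u :: "real^'n::finite \<Rightarrow> real"
  assumes S: "open S" and u: "harmonic_on S u"
  shows "smooth_on S u"
proof -
  have "Ck_on (k + 2) S u" for k
    using u
  proof (induction k arbitrary: u)
    case 0
    then show ?case by (simp only: harmonic_on_def add_0)
  next
    case (Suc k)
    then have C2: "Ck_on 2 S u" and h: "\<And>x. x \<in> S \<Longrightarrow> laplacian u x = 0" by (auto simp: harmonic_on_def)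
    have "Ck_on 1 S (partial_deriv j (partial_deriv i u))" for i j
      by (rule Ck_on_local) (use harmonic_C3_aux[OF S C2 h] in blast)
    then have C3: "Ck_on 3 S u" using Ck_on_2D(1,2)[OF C2] by (simp add: numeral_3_eq_3)
    have "harmonic_on S (partial_deriv i u)" for i
      unfolding harmonic_on_def
    proof
      show "Ck_on 2 S (partial_deriv i u)" using C3 by (simp add: numeral_3_eq_3 numeral_2_eq_2)
      show "\<forall>x\<in>S. laplacian (partial_deriv i u) x = 0"
      proof
        fix x assume x: "x \<in> S"
        have "laplacian (partial_deriv i u) x = partial_deriv i (laplacian u) x"
          by (rule laplacian_partial_deriv[OF S C3 x])
        also have "\<dots> = partial_deriv i (\<lambda>_. 0) x" by (rule partial_deriv_cong_open[OF S x h])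
        also have "\<dots> = 0" by (subst partial_deriv_eqI[of _ "\<lambda>_. 0"]) auto
        finally show "laplacian (partial_deriv i u) x = 0" .
      qed
    qed
    then have "Ck_on (k + 2) S (partial_deriv i u)" for i using Suc.IH by blast
    then show ?case using Ck_on_2D(1)[OF C2] by simp
  qed
  then show ?thesis unfolding smooth_on_def using Ck_on_le le_add1 by blast
qed

subsection \<open>Iterated directional derivatives\<close>

text \<open>Derivatives along one fixed direction turn the chain rule for compositions into algebra
  with power series in one variable; Taylor coefficients in several variables are recovered from all
  directions by \<open>ddn_polynomial\<close> and \<open>A1_le_sup\<close>.\<close>

definition dd :: "real^'n::finite \<Rightarrow> (real^'n \<Rightarrow> real) \<Rightarrow> real^'n \<Rightarrow> real" where
  "dd h v x = (\<Sum>i\<in>UNIV. h $ i * partial_deriv i v x)"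

definition ddn :: "real^'n::finite \<Rightarrow> nat \<Rightarrow> (real^'n \<Rightarrow> real) \<Rightarrow> real^'n \<Rightarrow> real" where
  "ddn h k = (dd h ^^ k)"

lemma ddn_0 [simp]: "ddn h 0 v = v"
  by (simp add: ddn_def)

lemma ddn_Suc: "ddn h (Suc k) v = dd h (ddn h k v)"
  by (simp add: ddn_def)

lemma ddn_Suc': "ddn h (Suc k) v = ddn h k (dd h v)"
  by (simp add: ddn_def funpow_swap1)

lemma Ck_on_const: "Ck_on k S (\<lambda>_. c)"
proof (induction k arbitrary: c)
  case (Suc k)
  have "partial_deriv i (\<lambda>_. c) = (\<lambda>_. 0)" for i :: 'a
    by (rule ext) (simp add: partial_deriv_eqI[OF has_derivative_const])
  then show ?case using Suc[of 0] by simp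
qed auto

lemma Ck_on_sum:
  assumes "open S" "finite I" "\<And>i. i \<in> I \<Longrightarrow> Ck_on k S (f i)"
  shows "Ck_on k S (\<lambda>x. \<Sum>i\<in>I. a i * f i x)"
  using assms(2,3)
proof (induction I rule: finite_induct)
  case empty
  then show ?case using Ck_on_const[of k S 0] by simp
next
  case (insert j I)
  then show ?case using Ck_on_linear[OF assms(1), of k "f j" "\<lambda>x. \<Sum>i\<in>I. a i * f i x" "a j" 1] by simp
qed

lemma laplacian_sum:
  assumes "open S" "finite I" "\<And>i. i \<in> I \<Longrightarrow> Ck_on 2 S (f i)" "x \<in> S"
  shows "laplacian (\<lambda>x. \<Sum>i\<in>I. a i * f i x) x = (\<Sum>i\<in>I. a i * laplacian (f i) x)"
  using assms(2,3)
proof (induction I rule: finite_induct)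
  case empty
  have "partial_deriv i (\<lambda>_. 0) = (\<lambda>_. 0)" for i :: 'a
    by (rule ext) (simp add: partial_deriv_eqI[OF has_derivative_const])
  then show ?case by (simp add: laplacian_def)
next
  case (insert j I)
  then have "laplacian (\<lambda>x. a j * f j x + 1 * (\<Sum>i\<in>I. a i * f i x)) x = a j * laplacian (f j) x + 1 * laplacian (\<lambda>x. \<Sum>i\<in>I. a i * f i x) x"
    by (intro laplacian_linear[OF assms(1)] Ck_on_sum[OF assms(1)] assms(4)) auto
  then show ?case using insert by simp
qed

lemma Ck_on_mult:
  assumes "open S" "Ck_on k S f" "Ck_on k S g"
  shows "Ck_on k S (\<lambda>x. f x * g x)"
  using assms(2,3)
proof (induction k arbitrary: f g)
  case 0
  then show ?case by (auto intro!: continuous_intros)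
next
  case (Suc k)
  have D: "((\<lambda>x. f x * g x) has_derivative (\<lambda>h. f x * frechet_derivative g (at x) h + frechet_derivative f (at x) h * g x)) (at x)"
    if "x \<in> S" for x
    using Suc.prems that by (intro has_derivative_mult) (simp_all add: frechet_derivative_works)
  have p: "partial_deriv i (\<lambda>x. f x * g x) x = 1 * (f x * partial_deriv i g x) + 1 * (partial_deriv i f x * g x)" if "x \<in> S" for x i
    unfolding partial_deriv_eqI[OF D[OF that]] by (simp add: partial_deriv_def)
  have C: "Ck_on k S (\<lambda>x. 1 * (f x * partial_deriv i g x) + 1 * (partial_deriv i f x * g x))" for i
    using Suc.prems by (intro Ck_on_linear[OF assms(1)] Suc.IH) (auto dest: Ck_on_Suc_imp simp del: Ck_on.simps(2), auto)
  have "Ck_on k S (partial_deriv i (\<lambda>x. f x * g x))" for i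
    by (rule iffD2[OF Ck_on_cong[OF assms(1)] C]) (rule p)
  then show ?case using D by (auto simp: differentiable_def)
qed

lemma smooth_onD: "smooth_on S v \<Longrightarrow> Ck_on k S v"
  by (simp add: smooth_on_def)

lemma smooth_on_differentiable: "smooth_on S v \<Longrightarrow> x \<in> S \<Longrightarrow> v differentiable (at x)"
  using smooth_onD[of S v 1] by simp

lemma smooth_on_partial: "smooth_on S v \<Longrightarrow> smooth_on S (partial_deriv i v)"
  unfolding smooth_on_def using Ck_on.simps(2) by blast

lemma smooth_on_dd: "open S \<Longrightarrow> smooth_on S v \<Longrightarrow> smooth_on S (dd h v)"
  unfolding dd_def[abs_def] using smooth_on_partial[of S v]
  by (auto simp: smooth_on_def intro: Ck_on_sum)

lemma smooth_on_ddn: "open S \<Longrightarrow> smooth_on S v \<Longrightarrow> smooth_on S (ddn h k v)"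
  by (induction k) (auto simp: ddn_Suc smooth_on_dd)

lemma dd_cong_open:
  assumes "open S" "x \<in> S" "\<And>y. y \<in> S \<Longrightarrow> v y = w y"
  shows "dd h v x = dd h w x"
  unfolding dd_def using partial_deriv_cong_open[OF assms] by simp

lemma ddn_cong_open:
  assumes "open S" "\<And>y. y \<in> S \<Longrightarrow> v y = w y"
  shows "x \<in> S \<Longrightarrow> ddn h k v x = ddn h k w x"
  by (induction k arbitrary: x) (auto simp: ddn_Suc assms(2) intro: dd_cong_open[OF assms(1)])

lemma dd_mult:
  assumes "v differentiable (at x)" "w differentiable (at x)"
  shows "dd h (\<lambda>x. v x * w x) x = dd h v x * w x + v x * dd h w x"
proof -
  have D: "((\<lambda>x. v x * w x) has_derivative (\<lambda>h. v x * frechet_derivative w (at x) h + frechet_derivative v (at x) h * w x)) (at x)"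
    using assms by (intro has_derivative_mult) (simp_all add: frechet_derivative_works)
  have p: "partial_deriv i (\<lambda>x. v x * w x) x = v x * partial_deriv i w x + partial_deriv i v x * w x" for i
    unfolding partial_deriv_eqI[OF D] by (simp add: partial_deriv_def)
  then show ?thesis unfolding dd_def p by (simp add: algebra_simps sum.distrib sum_distrib_left)
qed

lemma dd_linear:
  assumes "v differentiable (at x)" "w differentiable (at x)"
  shows "dd h (\<lambda>x. a * v x + b * w x) x = a * dd h v x + b * dd h w x"
  unfolding dd_def partial_deriv_linear(2)[OF assms]
  by (simp add: algebra_simps sum.distrib sum_distrib_left)

lemma ddn_linear:
  assumes S: "open S" and "smooth_on S v" "smooth_on S w" "x \<in> S"
  shows "ddn h k (\<lambda>x. a * v x + b * w x) x = a * ddn h k v x + b * ddn h k w x"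
  using assms(4)
proof (induction k arbitrary: x)
  case (Suc k)
  have "ddn h (Suc k) (\<lambda>x. a * v x + b * w x) x = dd h (\<lambda>x. a * ddn h k v x + b * ddn h k w x) x"
    unfolding ddn_Suc by (rule dd_cong_open[OF S Suc.prems Suc.IH])
  also have "\<dots> = a * ddn h (Suc k) v x + b * ddn h (Suc k) w x"
    unfolding ddn_Suc using assms Suc.prems by (intro dd_linear smooth_on_differentiable[of S] smooth_on_ddn)
  finally show ?case .
qed simp

lemma dd_scale: "dd (c *\<^sub>R h) v x = c * dd h v x"
  by (simp add: dd_def sum_distrib_left mult_ac)

lemma ddn_scale:
  assumes S: "open S" and v: "smooth_on S v" and x: "x \<in> S"
  shows "ddn (c *\<^sub>R h) k v x = c ^ k * ddn h k v x"
  using x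
proof (induction k arbitrary: x)
  case (Suc k)
  have "ddn (c *\<^sub>R h) (Suc k) v x = c * dd h (ddn (c *\<^sub>R h) k v) x" by (simp add: ddn_Suc dd_scale)
  also have "dd h (ddn (c *\<^sub>R h) k v) x = dd h (\<lambda>x. c ^ k * ddn h k v x + 0 * v x) x"
    by (rule dd_cong_open[OF S Suc.prems]) (simp add: Suc.IH)
  also have "\<dots> = c ^ k * dd h (ddn h k v) x + 0 * dd h v x"
    using S v Suc.prems by (intro dd_linear smooth_on_differentiable[of S] smooth_on_ddn)
  finally show ?case by (simp add: ddn_Suc)
qed simp

lemma laplacian_dd:
  assumes S: "open S" and v: "smooth_on S v" and x: "x \<in> S"
  shows "laplacian (dd h v) x = dd h (laplacian v) x"
proof -
  have "laplacian (dd h v) x = (\<Sum>i\<in>UNIV. h $ i * laplacian (partial_deriv i v) x)"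
    unfolding dd_def[abs_def] by (rule laplacian_sum[OF S]) (use x smooth_on_partial[OF v] in \<open>auto intro: smooth_onD\<close>)
  also have "\<dots> = dd h (laplacian v) x"
    unfolding dd_def using laplacian_partial_deriv[OF S smooth_onD[OF v] x] by simp
  finally show ?thesis .
qed

lemma laplacian_ddn:
  assumes S: "open S" and v: "smooth_on S v" and x: "x \<in> S"
  shows "laplacian (ddn h k v) x = ddn h k (laplacian v) x"
  using x
proof (induction k arbitrary: x)
  case (Suc k)
  have "laplacian (ddn h (Suc k) v) x = dd h (laplacian (ddn h k v)) x"
    unfolding ddn_Suc by (rule laplacian_dd[OF S smooth_on_ddn[OF S v] Suc.prems])
  also have "\<dots> = dd h (ddn h k (laplacian v)) x"
    by (rule dd_cong_open[OF S Suc.prems Suc.IH])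
  finally show ?case by (simp add: ddn_Suc)
qed simp

notation fps_nth (infixl "$$" 75)

text \<open>The Taylor series in t of v(x + t h). Differentiation along \<open>h\<close> becomes the
  formal derivative and products become products.\<close>

definition J :: "real^'n::finite \<Rightarrow> (real^'n \<Rightarrow> real) \<Rightarrow> real^'n \<Rightarrow> real fps" where
  "J h v x = Abs_fps (\<lambda>k. ddn h k v x / fact k)"

lemma J_nth: "J h v x $$ k = ddn h k v x / fact k"
  by (simp add: J_def)

lemma J_dd: "J h (dd h v) x = fps_deriv (J h v x)"
proof (rule fps_ext)
  fix k
  have "fps_deriv (J h v x) $$ k = real (Suc k) * (ddn h k (dd h v) x / (real (Suc k) * fact k))"
    by (simp only: fps_deriv_nth J_nth Suc_eq_plus1[symmetric] ddn_Suc' fact_Suc)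
  also have "\<dots> = ddn h k (dd h v) x / fact k" by (simp del: of_nat_Suc)
  finally show "J h (dd h v) x $$ k = fps_deriv (J h v x) $$ k" by (simp add: J_nth)
qed

lemma J_cong_open:
  assumes "open S" "x \<in> S" "\<And>y. y \<in> S \<Longrightarrow> v y = w y"
  shows "J h v x = J h w x"
  by (rule fps_ext) (simp add: J_nth ddn_cong_open[OF assms(1,3,2)])

lemma J_linear:
  assumes "open S" "smooth_on S v" "smooth_on S w" "x \<in> S"
  shows "J h (\<lambda>x. a * v x + b * w x) x = fps_const a * J h v x + fps_const b * J h w x"
  by (rule fps_ext) (simp add: J_nth ddn_linear[OF assms] add_divide_distrib)

lemma smooth_on_mult: "open S \<Longrightarrow> smooth_on S v \<Longrightarrow> smooth_on S w \<Longrightarrow> smooth_on S (\<lambda>x. v x * w x)"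
  by (simp add: smooth_on_def Ck_on_mult)

text \<open>Leibniz's rule of all orders: both sides have the same constant term, and their formal
  derivatives agree by the first order rule and the induction hypothesis.\<close>

lemma J_mult:
  assumes S: "open S" and "smooth_on S v" "smooth_on S w" and x: "x \<in> S"
  shows "J h (\<lambda>x. v x * w x) x = J h v x * J h w x"
proof (rule fps_ext)
  fix k
  show "J h (\<lambda>x. v x * w x) x $$ k = (J h v x * J h w x) $$ k"
    using assms(2,3)
  proof (induction k arbitrary: v w)
    case 0
    then show ?case by (simp add: J_nth)
  next
    case (Suc k)
    note sm = Suc.prems smooth_on_dd[OF S Suc.prems(1), of h] smooth_on_dd[OF S Suc.prems(2), of h]
    have "real (Suc k) * J h (\<lambda>x. v x * w x) x $$ Suc k = J h (dd h (\<lambda>x. v x * w x)) x $$ k"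
      by (simp add: J_dd)
    also have "J h (dd h (\<lambda>x. v x * w x)) x = J h (\<lambda>x. 1 * (dd h v x * w x) + 1 * (v x * dd h w x)) x"
      by (rule J_cong_open[OF S x]) (use Suc.prems in \<open>auto intro!: dd_mult smooth_on_differentiable\<close>)
    also have "\<dots> = fps_const 1 * J h (\<lambda>x. dd h v x * w x) x + fps_const 1 * J h (\<lambda>x. v x * dd h w x) x"
      by (rule J_linear[OF S _ _ x]) (auto intro!: smooth_on_mult S sm)
    also have "\<dots> $$ k = (J h (dd h v) x * J h w x) $$ k + (J h v x * J h (dd h w) x) $$ k"
      using Suc.IH[OF sm(3,2)] Suc.IH[OF sm(1,4)] by simp
    also have "\<dots> = fps_deriv (J h v x * J h w x) $$ k"
      by (simp only: J_dd fps_deriv_mult fps_add_nth add.commute)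
    also have "\<dots> = real (Suc k) * (J h v x * J h w x) $$ Suc k" by (simp only: fps_deriv_nth Suc_eq_plus1)
    finally show ?case by (simp del: of_nat_Suc)
  qed
qed

subsection \<open>Majorants for compositions\<close>

lemma sum_inverse_squares_le: "(\<Sum>i\<le>k. 1 / (real i + 1)\<^sup>2) \<le> 2 - 1 / (real k + 1)"
proof (induction k)
  case (Suc k)
  have "1 / (real (Suc k) + 1)\<^sup>2 \<le> 1 / ((real k + 1) * (real (Suc k) + 1))"
    by (intro divide_left_mono) (auto simp: power2_eq_square intro!: mult_right_mono)
  also have "\<dots> = 1 / (real k + 1) - 1 / (real (Suc k) + 1)" by (simp add: field_simps)
  finally show ?case using Suc by simp
qed simp

text \<open>The identity 1/(pq) = (1/p + 1/q)/(p + q) splits the convolution into two sums of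
  inverse squares, each at most 2, times the square of 1/(k + 2) and a constant.\<close>

lemma convolution_inverse_squares:
  "(\<Sum>i\<le>k. 1 / (real i + 1)\<^sup>2 * (1 / (real (k - i) + 1)\<^sup>2)) \<le> 8 / (real k + 1)\<^sup>2"
proof -
  let ?q = "\<lambda>i. 1 / (real i + 1)\<^sup>2"
  have "?q i * ?q (k - i) \<le> 2 / (real k + 2)\<^sup>2 * (?q i + ?q (k - i))" if "i \<le> k" for i
  proof -
    define a where "a = 1 / (real i + 1)"
    define b where "b = 1 / (real (k - i) + 1)"
    have "a * b = (a + b) / (real k + 2)"
    proof -
      have "real k = real i + real (k - i)" using that by simp
      then have k: "real k + 2 = (real i + 1) + (real (k - i) + 1)" by linarith
      have "1 / p * (1 / q) = (1 / p + 1 / q) / (p + q)" if "p > 0" "q > 0" for p q :: real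
      proof -
        have "1 / p + 1 / q = (p + q) / (p * q)" using that by (simp add: add_frac_eq add.commute)
        then show ?thesis using that by simp
      qed
      then show ?thesis unfolding a_def b_def k by simp
    qed
    then have "(a * b)\<^sup>2 = (a + b)\<^sup>2 / (real k + 2)\<^sup>2" by (simp add: power_divide)
    also have "\<dots> \<le> (2 * (a\<^sup>2 + b\<^sup>2)) / (real k + 2)\<^sup>2"
      using sum_squares_bound[of a b] by (intro divide_right_mono) (auto simp: power2_sum)
    finally show ?thesis by (simp add: a_def b_def power_divide power_mult_distrib)
  qed
  then have "(\<Sum>i\<le>k. ?q i * ?q (k - i)) \<le> (\<Sum>i\<le>k. 2 / (real k + 2)\<^sup>2 * (?q i + ?q (k - i)))"
    by (intro sum_mono) auto
  also have "\<dots> = 2 / (real k + 2)\<^sup>2 * ((\<Sum>i\<le>k. ?q i) + (\<Sum>i\<le>k. ?q (k - i)))"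
    by (simp add: sum_distrib_left sum.distrib distrib_left)
  also have "(\<Sum>i\<le>k. ?q (k - i)) = (\<Sum>i\<le>k. ?q i)"
    by (rule sum.reindex_bij_witness[of _ "\<lambda>i. k - i" "\<lambda>i. k - i"]) auto
  also have "2 / (real k + 2)\<^sup>2 * ((\<Sum>i\<le>k. ?q i) + (\<Sum>i\<le>k. ?q i)) \<le> 2 / (real k + 2)\<^sup>2 * (2 + 2)"
  proof -
    have "0 \<le> 1 / (real k + 1)" by simp
    then have "(\<Sum>i\<le>k. ?q i) \<le> 2" using sum_inverse_squares_le[of k] by linarith
    then show ?thesis by (intro mult_left_mono) auto
  qed
  also have "\<dots> \<le> 8 / (real k + 1)\<^sup>2"
    by (simp add: frac_le power_mono)
  finally show ?thesis .
qed

text \<open>Since E = 1 + \<tau>VE, the coefficients of \<open>E\<close> are convolutions.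
  \<open>convolution_inverse_squares\<close> costs a factor 8, which 8\<tau>C \<le> 1 absorbs, so
  \<open>E\<close> obeys a bound with the same base \<open>A\<close> as \<open>V\<close>.\<close>

lemma geometric_majorant:
  fixes V :: "real fps"
  assumes V: "V $$ 0 = 0" "\<And>j. j > 0 \<Longrightarrow> V $$ j = C * A ^ j / (real j + 1)\<^sup>2"
    and pos: "A \<ge> 0" "C \<ge> 0" "\<tau> \<ge> 0" and small: "8 * (\<tau> * C) \<le> 1"
  defines "E \<equiv> inverse (1 - fps_const \<tau> * V)"
  shows "E $$ k \<ge> 0" "E $$ k \<le> A ^ k / (real k + 1)\<^sup>2"
proof -
  define W where "W = fps_const \<tau> * V"
  have W: "W $$ j \<ge> 0" "W $$ j \<le> (\<tau> * C) * A ^ j / (real j + 1)\<^sup>2" "W $$ 0 = 0" for j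
    using V pos by (cases "j = 0"; auto simp: W_def)+
  have "E * (1 - W) = 1" unfolding E_def W_def by (rule inverse_mult_eq_1) (simp add: V)
  then have E: "E = 1 + W * E" by (simp add: algebra_simps)
  have "E $$ k \<ge> 0 \<and> E $$ k \<le> A ^ k / (real k + 1)\<^sup>2"
  proof (induction k rule: less_induct)
    case (less k)
    show ?case
    proof (cases k)
      case 0
      have "E $$ 0 = 1" by (subst E) (simp add: W)
      then show ?thesis using 0 by simp
    next
      case (Suc m)
      have Ek: "E $$ k = (\<Sum>i\<le>k. W $$ i * E $$ (k - i))"
        by (subst E) (simp add: Suc fps_mult_nth atMost_atLeast0)
      have t: "0 \<le> W $$ i * E $$ (k - i) \<and> W $$ i * E $$ (k - i) \<le> (\<tau> * C) * A ^ k * (1 / (real i + 1)\<^sup>2 * (1 / (real (k - i) + 1)\<^sup>2))" if "i \<le> k" for i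
      proof (cases "i = 0")
        case True
        then show ?thesis using W(3) pos by simp
      next
        case False
        then have "k - i < k" using Suc by simp
        from less.IH[OF this] have IH: "E $$ (k - i) \<ge> 0" "E $$ (k - i) \<le> A ^ (k - i) / (real (k - i) + 1)\<^sup>2" by auto
        have "W $$ i * E $$ (k - i) \<le> ((\<tau> * C) * A ^ i / (real i + 1)\<^sup>2) * (A ^ (k - i) / (real (k - i) + 1)\<^sup>2)"
          by (intro mult_mono W IH) (use pos in auto)
        also have "\<dots> = (\<tau> * C) * (A ^ i * A ^ (k - i)) * (1 / (real i + 1)\<^sup>2 * (1 / (real (k - i) + 1)\<^sup>2))" by simp
        also have "A ^ i * A ^ (k - i) = A ^ k" using that by (simp flip: power_add)
        finally show ?thesis using W(1) IH(1) by simp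
      qed
      have "E $$ k \<le> (\<Sum>i\<le>k. (\<tau> * C) * A ^ k * (1 / (real i + 1)\<^sup>2 * (1 / (real (k - i) + 1)\<^sup>2)))"
        unfolding Ek by (intro sum_mono) (use t in auto)
      also have "\<dots> \<le> (\<tau> * C) * A ^ k * (8 / (real k + 1)\<^sup>2)"
        unfolding sum_distrib_left[symmetric] by (intro mult_left_mono convolution_inverse_squares) (use pos in auto)
      also have "\<dots> = (8 * (\<tau> * C)) * (A ^ k / (real k + 1)\<^sup>2)" by simp
      also have "\<dots> \<le> 1 * (A ^ k / (real k + 1)\<^sup>2)" by (intro mult_right_mono small) (use pos in auto)
      finally have "E $$ k \<le> A ^ k / (real k + 1)\<^sup>2" by simp
      moreover have "E $$ k \<ge> 0" unfolding Ek by (intro sum_nonneg) (use t in auto)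
      ultimately show ?thesis by simp
    qed
  qed
  then show "E $$ k \<ge> 0" "E $$ k \<le> A ^ k / (real k + 1)\<^sup>2" by auto
qed

lemma fps_nonneg_mult: "(\<And>k. (f::real fps) $$ k \<ge> 0) \<Longrightarrow> (\<And>k. g $$ k \<ge> 0) \<Longrightarrow> (f * g) $$ k \<ge> 0"
  by (auto simp: fps_mult_nth intro!: sum_nonneg mult_nonneg_nonneg)

lemma fps_nonneg_power: "(\<And>k. (f::real fps) $$ k \<ge> 0) \<Longrightarrow> (f ^ m) $$ k \<ge> 0"
proof (induction m arbitrary: k)
  case 0
  then show ?case by (cases k) auto
next
  case (Suc m)
  then show ?case using fps_nonneg_mult[of f "f ^ m"] by simp
qed

text \<open>\<open>g m\<close> models the m-th derivative divided by m!, so the chain rule raises m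
  by one. The majorants K \<tau>^m E^(m+1) satisfy the corresponding recursion with equality,
  because E' = \<tau> V' E^2; the comparison goes by induction on the coefficient, for all m at
  once.\<close>

lemma J_composition_le:
  fixes u :: "real^'n::finite \<Rightarrow> real" and V :: "real fps"
  assumes S: "open S" and u: "smooth_on S u" and x: "x \<in> S"
    and g: "\<And>m. smooth_on S (\<lambda>y. g m (u y))"
    and dg: "\<And>m y. y \<in> S \<Longrightarrow> dd h (\<lambda>y. g m (u y)) y = (real m + 1) * (g (Suc m) (u y) * dd h u y)"
    and K: "\<And>m. \<bar>g m (u x)\<bar> \<le> K * \<tau> ^ m" and pos: "\<tau> \<ge> 0"
    and V: "V $$ 0 = 0" "\<And>j. V $$ j \<ge> 0" "\<And>j. 0 < j \<Longrightarrow> j \<le> k \<Longrightarrow> \<bar>J h u x $$ j\<bar> \<le> V $$ j"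
    and E: "E = inverse (1 - fps_const \<tau> * V)" "\<And>j. E $$ j \<ge> 0"
  shows "\<bar>J h (\<lambda>y. g m (u y)) x $$ k\<bar> \<le> K * \<tau> ^ m * (E ^ (Suc m)) $$ k"
proof -
  have "j \<le> k \<Longrightarrow> \<bar>J h (\<lambda>y. g m (u y)) x $$ j\<bar> \<le> K * \<tau> ^ m * (E ^ (Suc m)) $$ j" for j
  proof (induction j arbitrary: m rule: less_induct)
    case (less j)
    have K0: "K \<ge> 0" using K[of 0] by simp
    show ?case
    proof (cases j)
      case 0
      have "E $$ 0 = 1" using V(1) by (simp add: E(1))
      then have "(E ^ Suc m) $$ 0 = 1" by (simp add: fps_nth_power_0)
      then show ?thesis using K[of m] 0 by (simp add: J_nth)
    next
      case (Suc l)
      let ?G = "\<lambda>m y. g m (u y)"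
      have E': "fps_deriv E = fps_const \<tau> * fps_deriv V * E\<^sup>2"
      proof -
        have "fps_deriv E = - fps_deriv (1 - fps_const \<tau> * V) * (inverse (1 - fps_const \<tau> * V))\<^sup>2"
          unfolding E(1) by (rule fps_inverse_deriv) (simp add: V)
        then show ?thesis by (simp add: E(1))
      qed
      have "fps_deriv (E ^ Suc m) = fps_const (real m + 1) * fps_deriv E * E ^ m"
        by (subst fps_deriv_power) (simp add: add.commute)
      also have "\<dots> = fps_const (real m + 1) * fps_const \<tau> * (E ^ Suc (Suc m) * fps_deriv V)"
        unfolding E' by (simp add: power2_eq_square fps_of_nat[symmetric] mult_ac)
      finally have dE: "fps_deriv (E ^ Suc m) $$ l = (real m + 1) * \<tau> * (E ^ Suc (Suc m) * fps_deriv V) $$ l"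
        by (simp only: fps_const_mult fps_mult_left_const_nth)
      have "J h (dd h (?G m)) x = J h (\<lambda>y. (real m + 1) * (?G (Suc m) y * dd h u y) + 0 * u y) x"
        by (rule J_cong_open[OF S x]) (simp add: dg)
      also have "\<dots> = fps_const (real m + 1) * J h (\<lambda>y. ?G (Suc m) y * dd h u y) x + fps_const 0 * J h u x"
        by (rule J_linear[OF S _ u x]) (intro smooth_on_mult S g smooth_on_dd u)
      also have "J h (\<lambda>y. ?G (Suc m) y * dd h u y) x = J h (?G (Suc m)) x * fps_deriv (J h u x)"
        unfolding J_dd[symmetric] by (rule J_mult[OF S g smooth_on_dd[OF S u] x])
      finally have "fps_deriv (J h (?G m) x) = fps_const (real m + 1) * (J h (?G (Suc m)) x * fps_deriv (J h u x))"
        by (simp add: J_dd)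
      then have "fps_deriv (J h (?G m) x) $$ l = (fps_const (real m + 1) * (J h (?G (Suc m)) x * fps_deriv (J h u x))) $$ l"
        by simp
      then have "real (Suc l) * J h (?G m) x $$ Suc l = (real m + 1) * (J h (?G (Suc m)) x * fps_deriv (J h u x)) $$ l"
        by (simp only: fps_deriv_nth fps_mult_left_const_nth Suc_eq_plus1)
      then have "real (Suc l) * \<bar>J h (?G m) x $$ Suc l\<bar> = (real m + 1) * \<bar>(J h (?G (Suc m)) x * fps_deriv (J h u x)) $$ l\<bar>"
        by (metis abs_mult abs_of_nat of_nat_Suc add.commute)
      also have "\<bar>(J h (?G (Suc m)) x * fps_deriv (J h u x)) $$ l\<bar> \<le> (\<Sum>i=0..l. \<bar>J h (?G (Suc m)) x $$ i\<bar> * \<bar>fps_deriv (J h u x) $$ (l - i)\<bar>)"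
        unfolding fps_mult_nth abs_mult[symmetric] by (rule sum_abs)
      also have "\<dots> \<le> (\<Sum>i=0..l. (K * \<tau> ^ Suc m * (E ^ Suc (Suc m)) $$ i) * fps_deriv V $$ (l - i))"
      proof (intro sum_mono mult_mono)
        fix i assume i: "i \<in> {0..l}"
        show "\<bar>J h (?G (Suc m)) x $$ i\<bar> \<le> K * \<tau> ^ Suc m * (E ^ Suc (Suc m)) $$ i"
          by (rule less.IH) (use i Suc less.prems in auto)
        show "\<bar>fps_deriv (J h u x) $$ (l - i)\<bar> \<le> fps_deriv V $$ (l - i)"
          using V(3)[of "l - i + 1"] i Suc less.prems by (auto simp: abs_mult intro!: mult_left_mono)
        show "0 \<le> K * \<tau> ^ Suc m * (E ^ Suc (Suc m)) $$ i"
          by (intro mult_nonneg_nonneg K0 zero_le_power pos fps_nonneg_power E(2))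
      qed auto
      also have "\<dots> = K * \<tau> ^ Suc m * (E ^ Suc (Suc m) * fps_deriv V) $$ l"
        by (simp only: fps_mult_nth[of "E ^ Suc (Suc m)"] sum_distrib_left mult.assoc)
      finally have "real (Suc l) * \<bar>J h (?G m) x $$ Suc l\<bar> \<le> (real m + 1) * (K * \<tau> ^ Suc m * (E ^ Suc (Suc m) * fps_deriv V) $$ l)"
        by (simp add: mult_left_mono)
      also have "\<dots> = K * \<tau> ^ m * fps_deriv (E ^ Suc m) $$ l" unfolding dE by simp
      also have "\<dots> = real (Suc l) * (K * \<tau> ^ m * (E ^ Suc m) $$ Suc l)"
        by (simp only: fps_deriv_nth Suc_eq_plus1[symmetric] mult_ac)
      finally show ?thesis unfolding Suc by (rule mult_left_le_imp_le) simp
    qed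
  qed
  then show ?thesis by simp
qed

subsection \<open>Analyticity of solutions\<close>

text \<open>\<open>g m t\<close> is the m-th derivative of \<open>f\<close> at a + t divided by m!.
  Cauchy's bound on the Taylor coefficients at \<open>a\<close> controls all of them uniformly near
  \<open>a\<close>.\<close>

lemma analytic_majorant:
  fixes f :: "real \<Rightarrow> real"
  assumes "analytic_real f"
  shows "\<exists>(g :: nat \<Rightarrow> real \<Rightarrow> real) K \<tau> \<eta>. \<eta> > 0 \<and> \<tau> > 0 \<and> K \<ge> 0 \<and> (\<forall>t. \<bar>t\<bar> < \<eta> \<longrightarrow> g 0 t = f (a + t)) \<and>
    (\<forall>m t. \<bar>t\<bar> < \<eta> \<longrightarrow> (g m has_real_derivative (real m + 1) * g (Suc m) t) (at t) \<and> \<bar>g m t\<bar> \<le> K * \<tau> ^ m)"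
proof -
  obtain c \<rho> where rho: "\<rho> > 0" and c: "\<And>t. \<bar>t - a\<bar> < \<rho> \<Longrightarrow> (\<lambda>n. c n * (t - a) ^ n) sums f t"
    using assms unfolding analytic_real_def by metis
  define r where "r = \<rho> / 2"
  have r: "r > 0" "r < \<rho>" using rho by (auto simp: r_def)
  have "summable (\<lambda>n. c n * r ^ n)" using c[of "a + r"] r by (auto simp: sums_iff)
  then have "Bseq (\<lambda>n. c n * r ^ n)" using summable_LIMSEQ_zero convergentI convergent_imp_Bseq by blast
  then obtain K0 where K0: "K0 > 0" "\<And>n. \<bar>c n * r ^ n\<bar> \<le> K0" by (auto elim!: BseqE)
  have cb: "\<bar>c n\<bar> \<le> K0 / r ^ n" for n using K0(2)[of n] r(1) by (simp add: abs_mult pos_le_divide_eq)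
  define e where "e = (\<lambda>m p. real ((p + m) choose m) * c (p + m))"
  define g where "g = (\<lambda>m t. \<Sum>p. e m p * t ^ p)"
  \<comment> \<open>The factor 1/r comes from the bound on the Taylor coefficients, the factor 2
    from the binomial coefficients in \<open>e\<close>.\<close>
  define \<tau> where "\<tau> = 2 / r"
  have tau: "\<tau> > 0" using r by (simp add: \<tau>_def)
  have eb: "\<bar>e m p\<bar> \<le> K0 * \<tau> ^ m * \<tau> ^ p" for m p
  proof -
    have "real ((p + m) choose m) \<le> 2 ^ (p + m)" by (metis binomial_le_pow2 of_nat_le_iff of_nat_numeral of_nat_power)
    then have "\<bar>e m p\<bar> \<le> 2 ^ (p + m) * (K0 / r ^ (p + m))"
      unfolding e_def abs_mult by (intro mult_mono cb) (use K0 r in auto)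
    also have "\<dots> = K0 * \<tau> ^ m * \<tau> ^ p" by (simp add: \<tau>_def power_add power_divide mult_ac)
    finally show ?thesis .
  qed
  \<comment> \<open>Chosen so that \<tau>\<eta> = 1/2: the series for \<open>g m\<close> is then
    dominated by a geometric series of sum 2, the factor in the final constant 2 K0.\<close>
  define \<eta> where "\<eta> = r / 4"
  have eta: "\<eta> > 0" "\<eta> < \<rho>" "\<tau> * \<eta> = 1 / 2" using r by (auto simp: \<eta>_def \<tau>_def)
  have term_le: "\<bar>e m p * t ^ p\<bar> \<le> K0 * \<tau> ^ m * (1 / 2) ^ p" if "\<bar>t\<bar> \<le> \<eta>" for m p t
  proof -
    have "\<bar>e m p * t ^ p\<bar> \<le> (K0 * \<tau> ^ m * \<tau> ^ p) * \<eta> ^ p"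
      unfolding abs_mult power_abs by (intro mult_mono eb power_mono that) (use K0 tau in auto)
    also have "\<dots> = K0 * \<tau> ^ m * (\<tau> * \<eta>) ^ p" by (simp add: power_mult_distrib)
    finally show ?thesis unfolding eta .
  qed
  have geo: "summable (\<lambda>p. K0 * \<tau> ^ m * (1 / 2) ^ p)" for m by (intro summable_mult summable_geometric) simp
  have sm: "summable (\<lambda>p. e m p * t ^ p)" if "\<bar>t\<bar> \<le> \<eta>" for m t
    by (rule summable_comparison_test'[OF geo, of 0]) (use term_le[OF that] in auto)
  have gb: "\<bar>g m t\<bar> \<le> 2 * K0 * \<tau> ^ m" if "\<bar>t\<bar> < \<eta>" for m t
  proof -
    have sa: "summable (\<lambda>p. \<bar>e m p * t ^ p\<bar>)"
      by (rule summable_comparison_test'[OF geo, of 0]) (use term_le[of t] that in auto)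
    have "\<bar>g m t\<bar> \<le> (\<Sum>p. \<bar>e m p * t ^ p\<bar>)" unfolding g_def by (rule summable_rabs[OF sa])
    also have "\<dots> \<le> (\<Sum>p. K0 * \<tau> ^ m * (1 / 2) ^ p)"
      by (rule suminf_le[OF _ sa geo]) (use term_le[of t] that in auto)
    also have "\<dots> = 2 * K0 * \<tau> ^ m" by (subst suminf_mult) (simp_all add: suminf_geometric)
    finally show ?thesis .
  qed
  have gd: "(g m has_real_derivative (real m + 1) * g (Suc m) t) (at t)" if t: "\<bar>t\<bar> < \<eta>" for m t
  proof -
    have "DERIV (\<lambda>t. \<Sum>p. e m p * t ^ p) t :> (\<Sum>p. diffs (e m) p * t ^ p)"
      by (rule termdiffs_strong[where K = \<eta>]) (use sm[of \<eta> m] eta t in auto)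
    moreover have "diffs (e m) p = (real m + 1) * e (Suc m) p" for p
    proof -
      have e1: "Suc m * (Suc (p + m) choose Suc m) = Suc (p + m) * ((p + m) choose m)"
        by (rule Suc_times_binomial)
      have e2: "Suc p * (Suc (p + m) choose m) = Suc (p + m) * ((p + m) choose m)"
        using binomial_absorb_comp[of "Suc (p + m)" m] by (simp del: binomial_Suc_Suc)
      have "Suc p * ((Suc p + m) choose m) = Suc m * ((Suc p + m) choose Suc m)"
        unfolding add_Suc e1 e2 ..
      then have h: "real (Suc p) * real ((Suc p + m) choose m) = real (Suc m) * real ((Suc p + m) choose Suc m)"
        by (metis of_nat_mult)
      have "diffs (e m) p = (real (Suc p) * real ((Suc p + m) choose m)) * c (Suc p + m)"
        by (simp only: diffs_def e_def mult.assoc)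
      also have "\<dots> = real (Suc m) * real ((Suc p + m) choose Suc m) * c (Suc p + m)" by (simp only: h)
      also have "Suc p + m = p + Suc m" by simp
      also have "real (Suc m) * real ((p + Suc m) choose Suc m) * c (p + Suc m) = (real m + 1) * e (Suc m) p"
        by (simp only: e_def mult.assoc of_nat_Suc add.commute[of 1])
      finally show ?thesis .
    qed
    ultimately show ?thesis
      using suminf_mult[OF sm[of t "Suc m"], of "real m + 1"] t by (simp add: g_def mult.assoc)
  qed
  have "g 0 t = f (a + t)" if "\<bar>t\<bar> < \<eta>" for t
    using c[of "a + t"] that eta by (simp add: g_def e_def sums_iff)
  then show ?thesis using eta(1) tau K0(1) gb gd
    by (intro exI[of _ g] exI[of _ "2 * K0"] exI[of _ \<tau>] exI[of _ \<eta>]) auto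
qed

lemma partial_deriv_compose:
  assumes "(g has_real_derivative g') (at (u y))" "u differentiable (at y)"
  shows "(\<lambda>y. g (u y)) differentiable (at y)" "partial_deriv i (\<lambda>y. g (u y)) y = g' * partial_deriv i u y"
proof -
  have "(g has_derivative (\<lambda>h. h * g')) (at (u y))"
    using assms(1) by (simp add: has_field_derivative_def mult_commute_abs)
  moreover have "(u has_derivative frechet_derivative u (at y)) (at y)"
    using assms(2) frechet_derivative_works by blast
  ultimately have D: "((\<lambda>y. g (u y)) has_derivative (\<lambda>h. frechet_derivative u (at y) h * g')) (at y)"
    using has_derivative_compose by blast
  then show "(\<lambda>y. g (u y)) differentiable (at y)" by (auto simp: differentiable_def)
  show "partial_deriv i (\<lambda>y. g (u y)) y = g' * partial_deriv i u y"
    unfolding partial_deriv_eqI[OF D] by (simp add: partial_deriv_def)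
qed

lemma smooth_on_compose:
  assumes S: "open S" and u: "smooth_on S u"
    and g: "\<And>m y. y \<in> S \<Longrightarrow> (g m has_real_derivative (real m + 1) * g (Suc m) (u y)) (at (u y))"
  shows "smooth_on S (\<lambda>y. g m (u y))"
proof -
  note P = partial_deriv_compose[OF g smooth_on_differentiable[OF u]]
  have "Ck_on k S (\<lambda>y. g m (u y))" for k
  proof (induction k arbitrary: m)
    case 0
    show ?case by (simp, rule continuous_on_if_differentiable) (rule P(1))
  next
    case (Suc k)
    have "Ck_on k S (partial_deriv i (\<lambda>y. g m (u y)))" for i
    proof (rule iffD2[OF Ck_on_cong[OF S]])
      show "partial_deriv i (\<lambda>y. g m (u y)) y = (real m + 1) * (g (Suc m) (u y) * partial_deriv i u y) + 0 * u y" if "y \<in> S" for y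
        using P(2)[OF that that] by simp
      show "Ck_on k S (\<lambda>y. (real m + 1) * (g (Suc m) (u y) * partial_deriv i u y) + 0 * u y)"
        by (intro Ck_on_linear[OF S] Ck_on_mult[OF S] Suc smooth_onD[OF u] smooth_onD[OF smooth_on_partial[OF u]])
    qed
    then show ?case using P(1) by simp
  qed
  then show ?thesis by (simp add: smooth_on_def)
qed

text \<open>The numerical part of the induction step of \<open>directional_estimate\<close>.
  \<open>A\<close> is chosen so that, with q = k + 1, the two contributions add up to a quarter of C
  A q; the quarter is at most the ratio of (k + 1)^2 to (k + 2)^2.\<close>

lemma estimate_arithmetic:
  fixes k :: nat
  assumes "n \<ge> 0" "C > 0" "K \<ge> 0" "0 < d" "d \<le> 1" "Y \<ge> (0::real)"
  defines "A \<equiv> 24 * n\<^sup>2 + 6 * n * K / C" and "\<delta> \<equiv> d / (real k + 2)"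
  shows "n * (n * (3 * C * Y) / \<delta> + (3 * K * Y) * \<delta> / 2) \<le> C * (real k + 1) * Y * (real k + 1)\<^sup>2 * (A / d) / (real k + 2)\<^sup>2"
proof -
  define q where "q = real k + 1"
  have q: "q \<ge> 1" "real k + 2 = q + 1" by (auto simp: q_def)
  have dd: "d * d \<le> 1 * 1" by (rule mult_mono) (use assms in auto)
  have "n * (n * (3 * C * Y) / \<delta> + (3 * K * Y) * \<delta> / 2) = Y / d * (3 * n\<^sup>2 * C * (q + 1) + 3 / 2 * n * K * (d * d) / (q + 1))"
    using assms(4) q(1) unfolding \<delta>_def q(2) by (simp add: field_simps power2_eq_square)
  also have "\<dots> \<le> Y / d * (3 * n\<^sup>2 * C * (2 * q) + 3 / 2 * n * K * q)"
  proof (intro mult_left_mono add_mono)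
    have "3 / 2 * n * K * (d * d) / (q + 1) \<le> 3 / 2 * n * K * 1 / 1"
      by (intro frac_le mult_left_mono) (use dd assms q in auto)
    also have "\<dots> \<le> 3 / 2 * n * K * q" using mult_left_mono[of 1 q "3 / 2 * n * K"] q assms by simp
    finally show "3 / 2 * n * K * (d * d) / (q + 1) \<le> 3 / 2 * n * K * q" .
  qed (use assms q in auto)
  also have "\<dots> = Y / d * (C * A * q / 4)"
  proof -
    have CA: "C * A = 24 * n\<^sup>2 * C + 6 * n * K" using assms(2) by (simp add: A_def distrib_left)
    have "3 * n\<^sup>2 * C * (2 * q) + 3 / 2 * n * K * q = C * A * q / 4"
      unfolding CA by (simp add: field_simps)
    then show ?thesis by (simp only:)
  qed
  also have "\<dots> \<le> Y / d * (C * A * q * (q\<^sup>2 / (q + 1)\<^sup>2))"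
  proof -
    have "(q + 1)\<^sup>2 \<le> (2 * q)\<^sup>2" by (rule power_mono) (use q in auto)
    then have "1 / 4 \<le> q\<^sup>2 / (q + 1)\<^sup>2" using q by (simp add: field_simps power_mult_distrib)
    moreover have "A \<ge> 0" using assms by (simp add: A_def)
    ultimately have "C * A * q * (1 / 4) \<le> C * A * q * (q\<^sup>2 / (q + 1)\<^sup>2)"
      using assms q by (intro mult_left_mono) auto
    then show ?thesis using assms by (intro mult_left_mono) auto
  qed
  also have "\<dots> = C * (real k + 1) * Y * (real k + 1)\<^sup>2 * (A / d) / (real k + 2)\<^sup>2"
    unfolding q(2) by (simp add: q_def mult_ac)
  finally show ?thesis .
qed

text \<open>Induction on the order. The gradient estimate, on a ball that shrinks with the order,
  bounds a derivative of order k by those of order k - 1 and their Laplacians. By the equation these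
  Laplacians are derivatives of order k - 1 of \<open>g 0 (u y)\<close>, which the composition
  majorant controls; the divisor (k + 1)^2 lets that majorant reproduce a bound of the same
  form.\<close>

lemma directional_estimate:
  fixes u :: "real^'n::finite \<Rightarrow> real"
  assumes R: "R \<le> 1" and u: "smooth_on (ball x\<^sub>0 R) u"
    and g: "\<And>m y. y \<in> ball x\<^sub>0 R \<Longrightarrow> (g m has_real_derivative (real m + 1) * g (Suc m) (u y)) (at (u y))"
    and gK: "\<And>m y. y \<in> ball x\<^sub>0 R \<Longrightarrow> \<bar>g m (u y)\<bar> \<le> K * \<tau> ^ m"
    and uC: "\<And>y. y \<in> ball x\<^sub>0 R \<Longrightarrow> \<bar>u y\<bar> \<le> C"
    and eq: "\<And>y. y \<in> ball x\<^sub>0 R \<Longrightarrow> laplacian u y = g 0 (u y)"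
    and C: "C > 0" and K: "K \<ge> 0" and tau: "\<tau> \<ge> 0" "8 * (\<tau> * C) \<le> 1" and h: "norm h \<le> 1"
  defines "A \<equiv> 24 * (real CARD('n))\<^sup>2 + 6 * real CARD('n) * K / C"
  shows "x \<in> ball x\<^sub>0 R \<Longrightarrow> \<bar>ddn h k u x\<bar> \<le> C * fact k * (A / (R - dist x\<^sub>0 x)) ^ k / (real k + 1)\<^sup>2"
proof (induction k arbitrary: x rule: less_induct)
  case (less k)
  define S where "S = ball x\<^sub>0 R"
  have S: "open S" by (simp add: S_def)
  define dst where "dst = (\<lambda>y. R - dist x\<^sub>0 y)"
  have A0: "A \<ge> 0" using C K by (simp add: A_def)
  show ?case
  proof (cases k)
    case 0
    then show ?thesis using uC[OF less.prems] by simp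
  next
    case (Suc m)
    define v where "v = ddn h m u"
    have x: "x \<in> S" using less.prems by (simp add: S_def)
    have d: "dst x > 0" "dst x \<le> 1" using less.prems R zero_le_dist[of x\<^sub>0 x] unfolding dst_def mem_ball by linarith+
    \<comment> \<open>Moving by this much reduces the distance to the boundary at worst by the
      factor (m + 1)/(m + 2), whose inverse to the power m is at most e \<le> 3, whatever the
      order.\<close>
    define \<delta> where "\<delta> = dst x / (real m + 2)"
    have \<delta>: "\<delta> > 0" using d by (simp add: \<delta>_def)
    define Y where "Y = fact m * (A / dst x) ^ m / (real m + 1)\<^sup>2"
    have Y0: "Y \<ge> 0" using A0 d by (simp add: Y_def)
    have near: "y \<in> S \<and> (A / dst y) ^ m \<le> 3 * (A / dst x) ^ m" if y: "y \<in> cball x \<delta>" for y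
    proof -
      have "dist x\<^sub>0 y \<le> dist x\<^sub>0 x + \<delta>" using y dist_triangle[of x\<^sub>0 y x] by auto
      then have dy: "dst y \<ge> dst x - \<delta>" by (simp add: dst_def)
      have eq: "dst x - \<delta> = dst x * ((real m + 1) / (real m + 2))" by (simp add: \<delta>_def field_simps)
      have pos: "dst x - \<delta> > 0" unfolding eq using d by simp
      then have "y \<in> S" using dy by (simp add: S_def dst_def)
      moreover have "(A / dst y) ^ m \<le> (A / (dst x - \<delta>)) ^ m"
        by (intro power_mono frac_le) (use A0 dy pos in auto)
      moreover have "(A / (dst x - \<delta>)) ^ m = (A / dst x) ^ m * ((real m + 2) / (real m + 1)) ^ m"
        unfolding eq by (simp add: power_mult_distrib power_divide)
      moreover have "((real m + 2) / (real m + 1)) ^ m \<le> 3"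
      proof -
        have "(real m + 2) / (real m + 1) \<le> exp (1 / (real m + 1))"
          using exp_ge_add_one_self[of "1 / (real m + 1)"] by (simp add: field_simps)
        then have "((real m + 2) / (real m + 1)) ^ m \<le> exp (1 / (real m + 1)) ^ m" by (intro power_mono) auto
        also have "\<dots> = exp (real m / (real m + 1))" by (simp add: exp_of_nat_mult[symmetric])
        also have "\<dots> \<le> exp 1" by simp
        also have "\<dots> \<le> 3" by (rule exp_le)
        finally show ?thesis .
      qed
      then have "(A / dst x) ^ m * ((real m + 2) / (real m + 1)) ^ m \<le> (A / dst x) ^ m * 3"
        by (intro mult_left_mono) (use A0 d in auto)
      ultimately show ?thesis by simp
    qed
    have v_sm: "smooth_on S v" unfolding v_def by (rule smooth_on_ddn[OF S]) (use u in \<open>simp add: S_def\<close>)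
    have "\<bar>partial_deriv i v x\<bar> \<le> real CARD('n) * (3 * C * Y) / \<delta> + (3 * K * Y) * \<delta> / 2" for i
    proof (rule gradient_estimate[OF smooth_onD[OF v_sm] _ \<delta>])
      show "cball x \<delta> \<subseteq> S" using near by blast
      fix y assume y: "y \<in> cball x \<delta>"
      have yS: "y \<in> S" and yA: "(A / dst y) ^ m \<le> 3 * (A / dst x) ^ m" using near[OF y] by auto
      have "\<bar>v y\<bar> \<le> C * fact m * (A / dst y) ^ m / (real m + 1)\<^sup>2"
        using less.IH[of m y] yS Suc by (simp add: v_def dst_def S_def)
      also have "\<dots> \<le> C * fact m * (3 * (A / dst x) ^ m) / (real m + 1)\<^sup>2"
        by (intro divide_right_mono mult_left_mono yA) (use C in auto)
      also have "\<dots> = 3 * C * Y" by (simp add: Y_def)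
      finally show "\<bar>v y\<bar> \<le> 3 * C * Y" .
      define B where "B = A / dst y"
      have B0: "B \<ge> 0" using A0 yS by (simp add: B_def dst_def S_def)
      \<comment> \<open>Majorant of the Taylor series of \<open>u\<close> along \<open>h\<close> at
        \<open>y\<close>, from the induction hypothesis. The constant term is left out because the
        value of \<open>u\<close> already enters through the bounds on \<open>g m\<close>.\<close>
      define V where "V = Abs_fps (\<lambda>j. if j = 0 then 0 else C * B ^ j / (real j + 1)\<^sup>2)"
      define E where "E = inverse (1 - fps_const \<tau> * V)"
      note gm = geometric_majorant[of V C B \<tau>, folded E_def, OF _ _ B0 less_imp_le[OF C] tau]
      have "laplacian v y = ddn h m (laplacian u) y"
        unfolding v_def using laplacian_ddn[OF S _ yS] u by (simp add: S_def)
      also have "\<dots> = ddn h m (\<lambda>y. g 0 (u y)) y"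
        by (rule ddn_cong_open[OF S _ yS]) (use eq in \<open>simp add: S_def\<close>)
      also have "\<dots> = fact m * (J h (\<lambda>y. g 0 (u y)) y $$ m)" by (simp add: J_nth)
      finally have "\<bar>laplacian v y\<bar> = fact m * \<bar>J h (\<lambda>y. g 0 (u y)) y $$ m\<bar>" by (simp add: abs_mult)
      also have "\<bar>J h (\<lambda>y. g 0 (u y)) y $$ m\<bar> \<le> K * \<tau> ^ 0 * (E ^ Suc 0) $$ m"
      proof (rule J_composition_le[OF S, where V = V and u = u and g = g and x = y])
        show sm: "smooth_on S u" using u by (simp add: S_def)
        show "smooth_on S (\<lambda>y. g m (u y))" for m
          by (rule smooth_on_compose[OF S sm]) (use g in \<open>simp add: S_def\<close>)
        show "dd h (\<lambda>y. g m (u y)) y = (real m + 1) * (g (Suc m) (u y) * dd h u y)" if "y \<in> S" for m y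
          using partial_deriv_compose(2)[OF g smooth_on_differentiable[OF sm that]] that
          by (simp add: dd_def S_def sum_distrib_left mult_ac)
        show "\<bar>J h u y $$ j\<bar> \<le> V $$ j" if "0 < j" "j \<le> m" for j
        proof -
          have "\<bar>ddn h j u y\<bar> \<le> C * fact j * B ^ j / (real j + 1)\<^sup>2"
            using less.IH[of j y] yS that Suc by (simp add: S_def B_def dst_def)
          then show ?thesis using that by (simp add: J_nth V_def field_simps)
        qed
        show "0 \<le> E $$ j" for j by (rule gm(1)) (auto simp: V_def)
      qed (use yS gK tau C B0 in \<open>auto simp: V_def S_def E_def\<close>)
      also have "\<dots> \<le> K * (B ^ m / (real m + 1)\<^sup>2)"
      proof -
        have "E $$ m \<le> B ^ m / (real m + 1)\<^sup>2" by (rule gm(2)) (auto simp: V_def)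
        from mult_left_mono[OF this K] show ?thesis by simp
      qed
      also have "\<dots> \<le> K * ((3 * (A / dst x) ^ m) / (real m + 1)\<^sup>2)"
        unfolding B_def by (intro divide_right_mono mult_left_mono yA) (use K in auto)
      finally have "\<bar>laplacian v y\<bar> \<le> fact m * (K * ((3 * (A / dst x) ^ m) / (real m + 1)\<^sup>2))"
        by (simp add: mult_left_mono)
      also have "\<dots> = 3 * K * Y" by (simp add: Y_def)
      finally show "\<bar>laplacian v y\<bar> \<le> 3 * K * Y" .
    qed
    then have "\<bar>dd h v x\<bar> \<le> (\<Sum>i\<in>(UNIV::'n set). 1 * (real CARD('n) * (3 * C * Y) / \<delta> + (3 * K * Y) * \<delta> / 2))"
      unfolding dd_def
      by (intro order_trans[OF sum_abs] sum_mono, unfold abs_mult, intro mult_mono)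
         (use h component_le_norm_cart[of h] order_trans in \<open>auto, blast\<close>)
    also have "\<dots> = real CARD('n) * (real CARD('n) * (3 * C * Y) / \<delta> + (3 * K * Y) * \<delta> / 2)" by simp
    also have "\<dots> \<le> C * (real m + 1) * Y * (real m + 1)\<^sup>2 * (A / dst x) / (real m + 2)\<^sup>2"
      unfolding \<delta>_def A_def by (rule estimate_arithmetic) (use C K d Y0 in auto)
    also have "\<dots> = C * fact k * (A / dst x) ^ k / (real k + 1)\<^sup>2"
      by (simp add: Y_def Suc add.commute mult_ac)
    finally show ?thesis by (simp add: Suc ddn_Suc v_def dst_def)
  qed
qed

text \<open>The bound for directions of norm at most 1 rescales to \<open>y\<close> with a factor
  |y|^k, so the Maclaurin remainder along the segment is geometric with ratio B|y| < 1.\<close>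

lemma directional_taylor:
  fixes u :: "real^'n::finite \<Rightarrow> real"
  assumes S: "open S" "ball x\<^sub>0 r \<subseteq> S" and u: "smooth_on S u"
    and bd: "\<And>h k x. norm h \<le> 1 \<Longrightarrow> x \<in> ball x\<^sub>0 r \<Longrightarrow> \<bar>ddn h k u x\<bar> \<le> C * fact k * B ^ k"
    and y: "norm y < r" "B * norm y < 1" and B: "B \<ge> 0"
  shows "(\<lambda>k. ddn y k u x\<^sub>0 / fact k) sums u (x\<^sub>0 + y)"
proof -
  have seg: "x\<^sub>0 + t *\<^sub>R y \<in> ball x\<^sub>0 r" if "0 \<le> t" "t \<le> 1" for t
  proof -
    have "t * norm y \<le> 1 * norm y" using that by (intro mult_right_mono) auto
    then show ?thesis using y that by (simp add: dist_norm)
  qed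
  have bd': "\<bar>ddn y k u x\<bar> \<le> C * fact k * (B * norm y) ^ k" if x: "x \<in> ball x\<^sub>0 r" for k x
  proof -
    have "norm y *\<^sub>R sgn y = y" by (cases "y = 0") (auto simp: sgn_div_norm)
    then have "ddn y k u x = (norm y) ^ k * ddn (sgn y) k u x"
      using ddn_scale[OF S(1) u, of x "norm y" "sgn y" k] x S(2) by auto
    moreover have "\<bar>ddn (sgn y) k u x\<bar> \<le> C * fact k * B ^ k" by (rule bd[OF _ x]) (simp add: norm_sgn)
    ultimately have "\<bar>ddn y k u x\<bar> \<le> norm y ^ k * (C * fact k * B ^ k)"
      by (simp add: abs_mult mult_left_mono)
    also have "norm y ^ k * (C * fact k * B ^ k) = C * fact k * (B * norm y) ^ k"
      by (simp only: power_mult_distrib mult_ac)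
    finally show ?thesis .
  qed
  define \<phi> where "\<phi> = (\<lambda>m t. ddn y m u (x\<^sub>0 + t *\<^sub>R y))"
  have der: "(\<phi> m has_real_derivative \<phi> (Suc m) t) (at t)" if "0 \<le> t" "t \<le> 1" for m t
    unfolding \<phi>_def ddn_Suc dd_def
    by (rule has_real_derivative_line, rule smooth_on_differentiable[OF smooth_on_ddn[OF S(1) u]])
       (use seg[OF that] S in auto)
  have rem: "\<bar>u (x\<^sub>0 + y) - (\<Sum>m<n. ddn y m u x\<^sub>0 / fact m)\<bar> \<le> C * (B * norm y) ^ n" if n: "n > 0" for n
  proof -
    obtain t where t: "0 < t" "t < 1" "\<phi> 0 1 = (\<Sum>m<n. \<phi> m 0 / fact m * 1 ^ m) + \<phi> n t / fact n * 1 ^ n"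
      using Maclaurin[of 1 n \<phi> "\<phi> 0"] n der by auto
    have "u (x\<^sub>0 + y) - (\<Sum>m<n. ddn y m u x\<^sub>0 / fact m) = \<phi> n t / fact n"
      using t(3) by (simp add: \<phi>_def)
    also have "\<bar>\<dots>\<bar> \<le> C * (B * norm y) ^ n"
      using bd'[OF seg[of t], of n] t by (simp add: \<phi>_def field_simps)
    finally show ?thesis .
  qed
  have "(\<lambda>n. C * (B * norm y) ^ n) \<longlonglongrightarrow> C * 0"
    using y B by (intro tendsto_mult tendsto_const LIMSEQ_realpow_zero) auto
  then have lim: "(\<lambda>n. C * (B * norm y) ^ n) \<longlonglongrightarrow> 0" by simp
  have "\<forall>\<^sub>F n in sequentially. norm (u (x\<^sub>0 + y) - (\<Sum>m<n. ddn y m u x\<^sub>0 / fact m)) \<le> C * (B * norm y) ^ n"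
    by (rule eventually_sequentiallyI[of 1]) (use rem in auto)
  then have "(\<lambda>n. u (x\<^sub>0 + y) - (\<Sum>m<n. ddn y m u x\<^sub>0 / fact m)) \<longlonglongrightarrow> 0"
    by (rule Lim_null_comparison[OF _ lim])
  then have "(\<lambda>n. u (x\<^sub>0 + y) - (u (x\<^sub>0 + y) - (\<Sum>m<n. ddn y m u x\<^sub>0 / fact m))) \<longlonglongrightarrow> u (x\<^sub>0 + y) - 0"
    by (intro tendsto_diff tendsto_const)
  then show ?thesis by (simp add: sums_def)
qed

lemma ddn_polynomial:
  fixes u :: "real^'n::finite \<Rightarrow> real"
  assumes S: "open S" and u: "smooth_on S u"
  shows "\<exists>c. (\<forall>\<alpha>. smooth_on S (c \<alpha>)) \<and> (\<forall>y x. x \<in> S \<longrightarrow> ddn y k u x = hom (\<lambda>\<alpha>. c \<alpha> x) k y)"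
proof (induction k)
  case 0
  show ?case by (intro exI[of _ "\<lambda>_. u"]) (simp add: hom_0_eq u)
next
  case (Suc k)
  then obtain c where c: "\<And>\<alpha>. smooth_on S (c \<alpha>)" "\<And>y x. x \<in> S \<Longrightarrow> ddn y k u x = hom (\<lambda>\<alpha>. c \<alpha> x) k y" by blast
  define c' where "c' = (\<lambda>\<alpha> x. \<Sum>i\<in>UNIV. xmul i (\<lambda>\<beta>. partial_deriv i (c \<beta>) x) \<alpha>)"
  have "smooth_on S (c' \<alpha>)" for \<alpha>
  proof -
    have e: "c' \<alpha> = (\<lambda>x. \<Sum>i\<in>UNIV. (if \<alpha> i = 0 then 0 else 1) * partial_deriv i (c (\<alpha>(i := \<alpha> i - 1))) x)"
      unfolding c'_def xmul_def by (intro ext sum.cong) auto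
    show ?thesis unfolding smooth_on_def e using smooth_on_partial[OF c(1)]
      by (intro allI Ck_on_sum[OF S]) (auto simp: smooth_on_def)
  qed
  moreover have "ddn y (Suc k) u x = hom (\<lambda>\<alpha>. c' \<alpha> x) (Suc k) y" if x: "x \<in> S" for x y
  proof -
    have "ddn y (Suc k) u x = dd y (\<lambda>x. \<Sum>\<alpha>\<in>idx k. monomial \<alpha> y * c \<alpha> x) x"
      unfolding ddn_Suc by (rule dd_cong_open[OF S x]) (simp add: c(2) hom_def mult.commute)
    also have "\<dots> = (\<Sum>i\<in>UNIV. y $ i * (\<Sum>\<alpha>\<in>idx k. monomial \<alpha> y * partial_deriv i (c \<alpha>) x))"
    proof -
      have D: "((\<lambda>x. \<Sum>\<alpha>\<in>idx k. monomial \<alpha> y * c \<alpha> x) has_derivative (\<lambda>h. \<Sum>\<alpha>\<in>idx k. monomial \<alpha> y * frechet_derivative (c \<alpha>) (at x) h)) (at x)"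
        using smooth_on_differentiable[OF c(1) x]
        by (intro has_derivative_sum has_derivative_mult_right) (simp add: frechet_derivative_works)
      show ?thesis unfolding dd_def partial_deriv_eqI[OF D] by (simp add: partial_deriv_def)
    qed
    also have "\<dots> = (\<Sum>i\<in>UNIV. hom (xmul i (\<lambda>\<beta>. partial_deriv i (c \<beta>) x)) (Suc k) y)"
      unfolding hom_xmul by (simp add: hom_def mult.commute)
    also have "\<dots> = hom (\<lambda>\<alpha>. c' \<alpha> x) (Suc k) y" by (simp add: c'_def hom_sum)
    finally show ?thesis .
  qed
  ultimately show ?case by blast
qed

subsection \<open>Coefficients of homogeneous polynomials\<close>

text \<open>The left side is the a-th finite difference of j^b at 0. It equals b! times the
  coefficient of X^b in (exp X - 1)^a, a series that starts with X^a.\<close>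

lemma alternating_power_sum:
  assumes "b \<le> a"
  shows "(\<Sum>j\<le>a. (-1) ^ (a - j) * real (a choose j) * real j ^ b) = (if b < a then 0 else fact a)"
proof -
  let ?F = "fps_exp 1 - 1 :: real fps"
  have "?F ^ a = (fps_exp 1 + (-1)) ^ a" by simp
  also have "\<dots> = (\<Sum>j\<le>a. of_nat (a choose j) * fps_exp 1 ^ j * (-1) ^ (a - j))" by (rule binomial_ring)
  also have "\<dots> = (\<Sum>j\<le>a. fps_const ((-1) ^ (a - j) * real (a choose j)) * fps_exp (real j))"
  proof (rule sum.cong[OF refl])
    fix j
    have "(- 1 :: real fps) = fps_const (- 1)" by (simp add: fps_eq_iff)
    then have "(- 1 :: real fps) ^ (a - j) = fps_const ((- 1) ^ (a - j))" by (simp only: fps_const_power)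
    then show "of_nat (a choose j) * fps_exp 1 ^ j * (-1) ^ (a - j) = fps_const ((-1) ^ (a - j) * real (a choose j)) * fps_exp (real j)"
      by (simp add: fps_exp_power_mult fps_of_nat[symmetric] mult_ac flip: fps_const_mult)
  qed
  finally have "(?F ^ a) $$ b = (\<Sum>j\<le>a. (-1) ^ (a - j) * real (a choose j) * real j ^ b / fact b)"
    by (simp add: fps_sum_nth)
  then have "(\<Sum>j\<le>a. (-1) ^ (a - j) * real (a choose j) * real j ^ b) = fact b * (?F ^ a) $$ b"
    by (simp add: sum_divide_distrib[symmetric])
  also have "\<dots> = (if b < a then 0 else fact a)"
  proof (cases "b < a")
    case True
    then show ?thesis using startsby_zero_power_prefix[of ?F a] by simp
  next
    case False
    then have "b = a" using assms by simp
    then show ?thesis using startsby_zero_power_nth_same[of ?F a] by simp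
  qed
  finally show ?thesis .
qed

lemma hom_scaleR: "hom c k (t *\<^sub>R y) = t ^ k * hom c k y"
proof -
  have "monomial \<alpha> (t *\<^sub>R y) = t ^ k * monomial \<alpha> y" if "\<alpha> \<in> idx k" for \<alpha>
    using that by (simp add: monomial_def power_mult_distrib prod.distrib power_sum[symmetric] idx_def)
  then show ?thesis by (simp add: hom_def sum_distrib_left mult_ac)
qed

text \<open>The quotient is a single term of the exponential series at k.\<close>

lemma power_div_fact_le: "real k ^ k / fact k \<le> 3 ^ k"
proof -
  have s: "(\<lambda>n. real k ^ n /\<^sub>R fact n) sums exp (real k)" by (rule exp_converges)
  have "(\<Sum>n\<in>{k}. real k ^ n /\<^sub>R fact n) \<le> (\<Sum>n. real k ^ n /\<^sub>R fact n)"
    by (rule sum_le_suminf) (use s in \<open>auto simp: sums_iff\<close>)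
  then have "real k ^ k / fact k \<le> exp (real k)" using s by (simp add: sums_iff divide_inverse mult.commute)
  also have "\<dots> = exp 1 ^ k" using exp_of_nat_mult[of k "1::real"] by simp
  also have "\<dots> \<le> 3 ^ k" by (intro power_mono exp_le) simp
  finally show ?thesis .
qed

text \<open>Iterated finite differences of a form of degree \<open>k\<close> at lattice points extract its coefficients.\<close>

lemma A1_le_sup:
  fixes c :: "('n::finite \<Rightarrow> nat) \<Rightarrow> real"
  assumes M: "\<And>y::real^'n. norm y \<le> 1 \<Longrightarrow> \<bar>hom c k y\<bar> \<le> M"
  shows "A1 k c \<le> M * (6 * real CARD('n)) ^ k"
proof -
  have M0: "M \<ge> 0" using M[of 0] by simp
  define L where "L = (\<lambda>\<beta>::'n \<Rightarrow> nat. (\<chi> i. real (\<beta> i)) :: real^'n)"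
  define s where "s = (\<lambda>\<alpha> \<beta>::'n \<Rightarrow> nat. \<Prod>i\<in>UNIV. (-1) ^ (\<alpha> i - \<beta> i) * real (\<alpha> i choose \<beta> i))"
  have hb: "\<bar>hom c k y\<bar> \<le> M * norm y ^ k" for y :: "real^'n"
  proof -
    have "norm y *\<^sub>R sgn y = y" by (cases "y = 0") (auto simp: sgn_div_norm)
    then have "hom c k y = norm y ^ k * hom c k (sgn y)"
      using hom_scaleR[of c k "norm y" "sgn y"] by simp
    moreover have "\<bar>hom c k (sgn y)\<bar> \<le> M" by (rule M) (simp add: norm_sgn)
    ultimately have "\<bar>hom c k y\<bar> \<le> norm y ^ k * M" by (simp add: abs_mult mult_left_mono)
    then show ?thesis by (simp add: mult.commute)
  qed
  have ex: "mfact \<alpha> * c \<alpha> = (\<Sum>\<beta> | \<beta> \<le> \<alpha>. s \<alpha> \<beta> * hom c k (L \<beta>))" if a: "\<alpha> \<in> idx k" for \<alpha>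
  proof -
    have one: "(\<Sum>\<beta> | \<beta> \<le> \<alpha>. s \<alpha> \<beta> * monomial \<gamma> (L \<beta>)) = (if \<gamma> = \<alpha> then mfact \<alpha> else 0)" if g: "\<gamma> \<in> idx k" for \<gamma>
    proof -
      have "(\<Sum>\<beta> | \<beta> \<le> \<alpha>. s \<alpha> \<beta> * monomial \<gamma> (L \<beta>))
          = (\<Sum>\<beta> | \<beta> \<le> \<alpha>. \<Prod>i\<in>UNIV. (-1) ^ (\<alpha> i - \<beta> i) * real (\<alpha> i choose \<beta> i) * real (\<beta> i) ^ \<gamma> i)"
        by (simp add: s_def L_def monomial_def prod.distrib)
      also have "\<dots> = (\<Prod>i\<in>UNIV. \<Sum>j\<in>{..\<alpha> i}. (-1) ^ (\<alpha> i - j) * real (\<alpha> i choose j) * real j ^ \<gamma> i)"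
        by (subst prod_sum_PiE) (auto simp: le_fun_PiE)
      also have "\<dots> = (if \<gamma> = \<alpha> then mfact \<alpha> else 0)"
      proof (cases "\<gamma> = \<alpha>")
        case True
        then show ?thesis by (simp add: alternating_power_sum mfact_def)
      next
        case False
        have "\<exists>i. \<gamma> i < \<alpha> i"
        proof (rule ccontr)
          assume "\<not> (\<exists>i. \<gamma> i < \<alpha> i)"
          then have le: "\<alpha> i \<le> \<gamma> i" for i by (simp add: not_less)
          obtain i where "\<gamma> i \<noteq> \<alpha> i" using False by (meson ext)
          then have "\<alpha> i < \<gamma> i" using le[of i] by simp
          then have "mdeg \<alpha> < mdeg \<gamma>" by (intro sum_strict_mono_ex1) (use le in auto)
          then show False using a g by (simp add: idx_def)
        qed
        then obtain i where "\<gamma> i < \<alpha> i" by blast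
        then have "(\<Sum>j\<in>{..\<alpha> i}. (-1) ^ (\<alpha> i - j) * real (\<alpha> i choose j) * real j ^ \<gamma> i) = 0"
          using alternating_power_sum[of "\<gamma> i" "\<alpha> i"] by simp
        then have "(\<Prod>i\<in>UNIV. \<Sum>j\<in>{..\<alpha> i}. (-1) ^ (\<alpha> i - j) * real (\<alpha> i choose j) * real j ^ \<gamma> i) = 0"
          by (intro prod_zero bexI[of _ i]) auto
        then show ?thesis using False by simp
      qed
      finally show ?thesis .
    qed
    have "(\<Sum>\<beta> | \<beta> \<le> \<alpha>. s \<alpha> \<beta> * hom c k (L \<beta>)) = (\<Sum>\<beta> | \<beta> \<le> \<alpha>. \<Sum>\<gamma>\<in>idx k. c \<gamma> * (s \<alpha> \<beta> * monomial \<gamma> (L \<beta>)))"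
      by (simp add: hom_def sum_distrib_left mult_ac)
    also have "\<dots> = (\<Sum>\<gamma>\<in>idx k. c \<gamma> * (\<Sum>\<beta> | \<beta> \<le> \<alpha>. s \<alpha> \<beta> * monomial \<gamma> (L \<beta>)))"
      by (subst sum.swap) (simp add: sum_distrib_left)
    also have "\<dots> = (\<Sum>\<gamma>\<in>idx k. if \<gamma> = \<alpha> then c \<gamma> * mfact \<alpha> else 0)"
      by (rule sum.cong[OF refl]) (simp add: one)
    also have "\<dots> = mfact \<alpha> * c \<alpha>" using a by simp
    finally show ?thesis by simp
  qed
  have cb: "\<bar>c \<alpha>\<bar> \<le> M * (2 * real k) ^ k * (1 / mfact \<alpha>)" if a: "\<alpha> \<in> idx k" for \<alpha>
  proof -
    have "mfact \<alpha> * \<bar>c \<alpha>\<bar> = \<bar>\<Sum>\<beta> | \<beta> \<le> \<alpha>. s \<alpha> \<beta> * hom c k (L \<beta>)\<bar>"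
      using ex[OF a] by (metis abs_mult abs_of_pos mfact_pos)
    also have "\<dots> \<le> (\<Sum>\<beta> | \<beta> \<le> \<alpha>. (\<Prod>i\<in>UNIV. real (\<alpha> i choose \<beta> i)) * (M * real k ^ k))"
    proof (rule order_trans[OF sum_abs], rule sum_mono)
      fix \<beta> assume "\<beta> \<in> {\<beta>. \<beta> \<le> \<alpha>}"
      then have "mdeg \<beta> \<le> k" using mdeg_mono[of \<beta> \<alpha>] a by (simp add: idx_def)
      then have "real (mdeg \<beta>) \<le> real k" by (rule of_nat_mono)
      moreover have "norm (L \<beta>) \<le> real (mdeg \<beta>)" using norm_le_l1_cart[of "L \<beta>"] by (simp add: L_def)
      ultimately have "norm (L \<beta>) \<le> real k" by (rule order_trans[rotated])
      then have "norm (L \<beta>) ^ k \<le> real k ^ k" by (rule power_mono) simp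
      then have "\<bar>hom c k (L \<beta>)\<bar> \<le> M * real k ^ k" using hb[of "L \<beta>"] M0 by (meson mult_left_mono order_trans)
      moreover have "\<bar>s \<alpha> \<beta>\<bar> = (\<Prod>i\<in>UNIV. real (\<alpha> i choose \<beta> i))" by (simp add: s_def abs_prod abs_mult)
      ultimately show "\<bar>s \<alpha> \<beta> * hom c k (L \<beta>)\<bar> \<le> (\<Prod>i\<in>UNIV. real (\<alpha> i choose \<beta> i)) * (M * real k ^ k)"
        unfolding abs_mult by (intro mult_mono) (auto intro: prod_nonneg)
    qed
    also have "\<dots> = (\<Prod>i\<in>UNIV. \<Sum>j\<in>{..\<alpha> i}. real (\<alpha> i choose j)) * (M * real k ^ k)"
      unfolding sum_distrib_right[symmetric] by (subst prod_sum_PiE) (auto simp: le_fun_PiE)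
    also have "(\<Prod>i\<in>UNIV. \<Sum>j\<in>{..\<alpha> i}. real (\<alpha> i choose j)) = (\<Prod>i\<in>UNIV. 2 ^ \<alpha> i)"
      using choose_row_sum by (simp flip: of_nat_sum)
    also have "\<dots> = 2 ^ k" using a by (simp add: idx_def flip: power_sum)
    finally show ?thesis by (simp add: field_simps power_mult_distrib)
  qed
  \<comment> \<open>The base 6n collects a factor 2 from the row sums of binomial coefficients, a
    factor 3 from k^k/k! \<le> 3^k for lattice points of norm at most k, and n from the sum of the
    inverse factorials.\<close>
  have "A1 k c \<le> (\<Sum>\<alpha>\<in>(idx k :: ('n \<Rightarrow> nat) set). M * (2 * real k) ^ k * (1 / mfact \<alpha>))"
    unfolding A1_def by (rule sum_mono) (rule cb)
  also have "\<dots> = M * (2 * real CARD('n)) ^ k * (real k ^ k / fact k)"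
    unfolding sum_distrib_left[symmetric] sum_inverse_mfact by (simp add: power_mult_distrib)
  also have "\<dots> \<le> M * (2 * real CARD('n)) ^ k * 3 ^ k"
    by (intro mult_left_mono power_div_fact_le) (use M0 in auto)
  also have "\<dots> = M * (6 * real CARD('n)) ^ k"
  proof -
    have "(6 * real CARD('n)) ^ k = (2 * real CARD('n)) ^ k * 3 ^ k"
      using power_mult_distrib[of "2 * real CARD('n)" 3 k] by simp
    then show ?thesis by (simp only: mult.assoc)
  qed
  finally show ?thesis .
qed

theorem solution_analytic:
  fixes u :: "real^'n::finite \<Rightarrow> real"
  assumes S: "open S" and u: "smooth_on S u" and eq: "\<And>x. x \<in> S \<Longrightarrow> laplacian u x = f (u x)" and f: "analytic_real f"
  shows "real_analytic_on S u"
  unfolding real_analytic_on_def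
proof
  fix x\<^sub>0 assume x0: "x\<^sub>0 \<in> S"
  define a where "a = u x\<^sub>0"
  obtain g :: "nat \<Rightarrow> real \<Rightarrow> real" and K \<tau> \<eta> where eta: "\<eta> > 0" and tau: "\<tau> > 0" and K: "K \<ge> 0"
    and g0: "\<And>t. \<bar>t\<bar> < \<eta> \<Longrightarrow> g 0 t = f (a + t)"
    and gd: "\<And>m t. \<bar>t\<bar> < \<eta> \<Longrightarrow> (g m has_real_derivative (real m + 1) * g (Suc m) t) (at t)"
    and gK: "\<And>m t. \<bar>t\<bar> < \<eta> \<Longrightarrow> \<bar>g m t\<bar> \<le> K * \<tau> ^ m"
    using analytic_majorant[OF f, of a] by blast
  \<comment> \<open>Small enough for the expansion of \<open>f\<close> around \<open>a\<close> to
    apply to u - a, and for the condition 8\<tau>C \<le> 1 of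
    \<open>geometric_majorant\<close>.\<close>
  define C where "C = min (\<eta> / 2) (1 / (8 * \<tau>))"
  have C: "C > 0" "C < \<eta>" using eta tau by (auto simp: C_def)
  have "\<tau> * C \<le> \<tau> * (1 / (8 * \<tau>))" using tau by (intro mult_left_mono) (auto simp: C_def)
  then have tC: "8 * (\<tau> * C) \<le> 1" using tau by simp
  have "continuous_on S u" using smooth_onD[OF u, of 0] by simp
  then have "isCont u x\<^sub>0" using S x0 by (simp add: continuous_on_eq_continuous_at)
  then obtain d1 where d1: "d1 > 0" "\<And>y. dist y x\<^sub>0 < d1 \<Longrightarrow> dist (u y) (u x\<^sub>0) < C"
    using C(1) unfolding continuous_at_eps_delta dist_norm by metis
  obtain d2 where d2: "d2 > 0" "ball x\<^sub>0 d2 \<subseteq> S" using S x0 open_contains_ball by blast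
  define R where "R = min 1 (min d1 d2)"
  have R: "R > 0" "R \<le> 1" "ball x\<^sub>0 R \<subseteq> S" "\<And>y. y \<in> ball x\<^sub>0 R \<Longrightarrow> \<bar>u y - a\<bar> \<le> C"
    using d1 d2 by (auto simp: R_def a_def dist_real_def dist_commute less_imp_le)
  \<comment> \<open>Subtracting the value at the centre makes the function small nearby; the form of
    a linear combination fits \<open>Ck_on_linear\<close> and
    \<open>laplacian_linear\<close>.\<close>
  define w where "w = (\<lambda>x. 1 * u x + (-a) * 1)"
  have sw: "smooth_on (ball x\<^sub>0 R) w"
    unfolding smooth_on_def w_def using Ck_on_subset[OF smooth_onD[OF u] R(3)]
    by (intro allI Ck_on_linear Ck_on_const) auto
  have lw: "laplacian w y = g 0 (w y)" if y: "y \<in> ball x\<^sub>0 R" for y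
  proof -
    have "laplacian w y = 1 * laplacian u y + (-a) * laplacian (\<lambda>_. 1) y"
      unfolding w_def using Ck_on_subset[OF smooth_onD[OF u] R(3)] y
      by (intro laplacian_linear[of "ball x\<^sub>0 R"] Ck_on_const) auto
    moreover have "partial_deriv i (\<lambda>_. c) = (\<lambda>_. 0)" for i :: 'n and c
      by (rule ext) (simp add: partial_deriv_eqI[OF has_derivative_const])
    ultimately have "laplacian w y = laplacian u y" by (simp add: laplacian_def)
    then show ?thesis using eq[of y] g0[of "w y"] R(3) R(4)[OF y] C y by (auto simp: w_def)
  qed
  have wC: "\<bar>w y\<bar> \<le> C" if "y \<in> ball x\<^sub>0 R" for y using R(4)[OF that] by (simp add: w_def)
  define A where "A = 24 * (real CARD('n))\<^sup>2 + 6 * real CARD('n) * K / C"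
  have A: "A > 0" using C K by (simp add: A_def add_pos_nonneg)
  \<comment> \<open>On the half ball the distance to the boundary is at least R/2.\<close>
  define B where "B = 2 * A / R"
  have B: "B > 0" using A R by (simp add: B_def)
  have bd: "\<bar>ddn h k w x\<bar> \<le> C * fact k * B ^ k" if h: "norm h \<le> 1" and x: "x \<in> ball x\<^sub>0 (R / 2)" for h k x
  proof -
    have xR: "x \<in> ball x\<^sub>0 R" using x R by auto
    have "\<bar>ddn h k w x\<bar> \<le> C * fact k * (A / (R - dist x\<^sub>0 x)) ^ k / (real k + 1)\<^sup>2"
      unfolding A_def
      by (rule directional_estimate[OF R(2) sw, where g = g and \<tau> = \<tau>, OF gd gK wC lw C(1) K _ tC h xR])
         (use wC C tau in \<open>auto intro: order_le_less_trans\<close>)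
    also have "\<dots> \<le> C * fact k * B ^ k / 1"
    proof (intro frac_le mult_left_mono power_mono)
      show "A / (R - dist x\<^sub>0 x) \<le> B"
        using x A R unfolding B_def by (simp add: field_simps)
      show "1 \<le> (real k + 1)\<^sup>2" by (rule one_le_power) simp
      show "0 \<le> A / (R - dist x\<^sub>0 x)" using xR A by simp
    qed (use C B in auto)
    finally show ?thesis by simp
  qed
  have "\<forall>k. \<exists>c. \<forall>y. ddn y k w x\<^sub>0 = hom c k y"
    using ddn_polynomial[OF _ sw] R(1) by (metis centre_in_ball open_ball)
  then obtain c0 where c0: "\<And>k y. ddn y k w x\<^sub>0 = hom (c0 k) k y" by metis
  define c where "c = (\<lambda>\<alpha>. (1 / fact (mdeg \<alpha>)) * c0 (mdeg \<alpha>) \<alpha>)"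
  have hc: "hom c k y = ddn y k w x\<^sub>0 / fact k" for k y
    unfolding c0 hom_def c_def sum_divide_distrib by (rule sum.cong) (auto simp: idx_def)
  have x0R: "x\<^sub>0 \<in> ball x\<^sub>0 (R / 2)" using R by simp
  have A1c: "A1 k c \<le> C * B ^ k * (6 * real CARD('n)) ^ k" for k
  proof (rule A1_le_sup)
    fix y :: "real^'n" assume "norm y \<le> 1"
    then show "\<bar>hom c k y\<bar> \<le> C * B ^ k" using bd[OF _ x0R, of y k] by (simp add: hc field_simps)
  qed
  \<comment> \<open>The coefficients grow at most like powers of 6nB, so this radius leaves a
    geometric series of ratio 1/2.\<close>
  define \<rho> where "\<rho> = 1 / (12 * real CARD('n) * B)"
  have rho: "\<rho> > 0" using B by (simp add: \<rho>_def)
  have ac: "aconv c \<rho>" unfolding aconv_def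
  proof (rule summable_comparison_test'[of "\<lambda>k. C * (1 / 2) ^ k" 0])
    show "summable (\<lambda>k. C * (1 / 2) ^ k)" by (intro summable_mult summable_geometric) simp
    fix k
    have "A1 k c * \<rho> ^ k \<le> (C * B ^ k * (6 * real CARD('n)) ^ k) * \<rho> ^ k"
      using A1c rho by (intro mult_right_mono) auto
    also have "\<dots> = C * (B * (6 * real CARD('n)) * \<rho>) ^ k" by (simp add: power_mult_distrib)
    also have "B * (6 * real CARD('n)) * \<rho> = 1 / 2" using B by (simp add: \<rho>_def)
    finally show "norm (A1 k c * \<rho> ^ k) \<le> C * (1 / 2) ^ k" using rho by simp
  qed
  define r where "r = min \<rho> (min (R / 2) (1 / B))"
  have r: "r > 0" using rho R B by (simp add: r_def)
  have "((\<lambda>\<alpha>. (c \<alpha> + (if \<alpha> = 0 then a else 0)) * monomial \<alpha> (x - x\<^sub>0)) has_sum u x) UNIV" if x: "x \<in> ball x\<^sub>0 r" for x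
  proof -
    define y where "y = x - x\<^sub>0"
    have y: "norm y < \<rho>" "norm y < R / 2" "norm y < 1 / B" using x by (auto simp: r_def y_def dist_norm norm_minus_commute)
    have "(\<lambda>k. ddn y k w x\<^sub>0 / fact k) sums w (x\<^sub>0 + y)"
      by (rule directional_taylor[where r = "R / 2", OF _ _ sw bd]) (use R y B in \<open>auto simp: field_simps\<close>)
    then have "psum c y = w x" by (simp add: psum_def hc sums_iff y_def)
    moreover have "\<bar>y $ i\<bar> \<le> \<rho>" for i using component_le_norm_cart[of y i] y(1) by linarith
    ultimately have "((\<lambda>\<alpha>. c \<alpha> * monomial \<alpha> y) has_sum w x) UNIV" using has_sum_psum[OF ac, of y] by simp
    moreover have "((\<lambda>\<alpha>. (if \<alpha> = 0 then a else 0) * monomial \<alpha> y) has_sum a) UNIV"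
      by (rule has_sum_finite_neutralI[of "{0}"]) (auto simp: monomial_def)
    ultimately have "((\<lambda>\<alpha>. c \<alpha> * monomial \<alpha> y + (if \<alpha> = 0 then a else 0) * monomial \<alpha> y) has_sum (w x + a)) UNIV"
      by (rule has_sum_add)
    then show ?thesis by (simp add: y_def w_def distrib_right)
  qed
  then show "\<exists>c r. r > 0 \<and> (\<forall>x\<in>ball x\<^sub>0 r. ((\<lambda>\<alpha>. c \<alpha> * monomial \<alpha> (x - x\<^sub>0)) has_sum u x) UNIV)"
    by (intro exI[of _ "\<lambda>\<alpha>. c \<alpha> + (if \<alpha> = 0 then a else 0)"] exI[of _ r] conjI ballI r)
qed

section \<open>Solutions as power series\<close>

lemma real_analytic_on_subset: "real_analytic_on S u \<Longrightarrow> T \<subseteq> S \<Longrightarrow> real_analytic_on T u"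
  by (auto simp: real_analytic_on_def)

lemma real_analytic_onE:
  assumes "real_analytic_on S u" "x\<^sub>0 \<in> S"
  obtains c r where "r > 0" "\<And>x. x \<in> ball x\<^sub>0 r \<Longrightarrow> ((\<lambda>\<alpha>. c \<alpha> * monomial \<alpha> (x - x\<^sub>0)) has_sum u x) UNIV"
proof -
  obtain c r where "r > 0 \<and> (\<forall>x\<in>ball x\<^sub>0 r. ((\<lambda>\<alpha>. c \<alpha> * monomial \<alpha> (x - x\<^sub>0)) has_sum u x) UNIV)"
    using bspec[OF assms(1)[unfolded real_analytic_on_def] assms(2)] by (elim exE)
  then show thesis by (intro that[of r c]) auto
qed

lemma real_analytic_on_diff:
  assumes "real_analytic_on S u" "real_analytic_on S v"
  shows "real_analytic_on S (\<lambda>x. u x - v x)"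
  unfolding real_analytic_on_def
proof
  fix x\<^sub>0 assume x0: "x\<^sub>0 \<in> S"
  obtain c r where c: "r > 0" "\<And>x. x \<in> ball x\<^sub>0 r \<Longrightarrow> ((\<lambda>\<alpha>. c \<alpha> * monomial \<alpha> (x - x\<^sub>0)) has_sum u x) UNIV"
    by (rule real_analytic_onE[OF assms(1) x0]) (rule that; assumption)
  obtain d r' where d: "r' > 0" "\<And>x. x \<in> ball x\<^sub>0 r' \<Longrightarrow> ((\<lambda>\<alpha>. d \<alpha> * monomial \<alpha> (x - x\<^sub>0)) has_sum v x) UNIV"
    by (rule real_analytic_onE[OF assms(2) x0]) (rule that; assumption)
  have "((\<lambda>\<alpha>. (c \<alpha> + (-1) * d \<alpha>) * monomial \<alpha> (x - x\<^sub>0)) has_sum (u x - v x)) UNIV" if x: "x \<in> ball x\<^sub>0 (min r r')" for x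
  proof -
    have "((\<lambda>\<alpha>. c \<alpha> * monomial \<alpha> (x - x\<^sub>0) + (-1) * (d \<alpha> * monomial \<alpha> (x - x\<^sub>0))) has_sum (u x + (-1) * v x)) UNIV"
      by (intro has_sum_add has_sum_cmult_right c d) (use x in auto)
    then show ?thesis by (simp add: algebra_simps)
  qed
  then show "\<exists>c r. r > 0 \<and> (\<forall>x\<in>ball x\<^sub>0 r. ((\<lambda>\<alpha>. c \<alpha> * monomial \<alpha> (x - x\<^sub>0)) has_sum u x - v x) UNIV)"
    using c(1) d(1) by (intro exI[of _ "\<lambda>\<alpha>. c \<alpha> + (-1) * d \<alpha>"] exI[of _ "min r r'"]) auto
qed

lemma analytic_eq_on_ball:
  fixes u v :: "real^'n::finite \<Rightarrow> real"
  assumes "real_analytic_on (ball 0 r) u" "real_analytic_on (ball 0 r) v" "\<delta> > 0"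
    "\<And>x. norm x < \<delta> \<Longrightarrow> u x = v x" "x \<in> ball 0 r"
  shows "u x = v x"
proof -
  have r: "r > 0" using assms(5) by (metis ball_eq_empty empty_iff not_le)
  have "(\<lambda>x. u x - v x) x = 0"
  proof (rule identity_theorem[OF real_analytic_on_diff[OF assms(1,2)]])
    have "eventually (\<lambda>x. x \<in> ball 0 \<delta>) (nhds 0)" using assms(3) by (intro eventually_nhds_in_open) auto
    then show "eventually (\<lambda>x. u x - v x = 0) (nhds 0)" by eventually_elim (simp add: assms(4))
  qed (use assms r in auto)
  then show ?thesis by simp
qed

lemma analytic_near_0:
  fixes u :: "real^'n::finite \<Rightarrow> real"
  assumes "real_analytic_on (ball 0 r) u" "r > 0"
  obtains c \<rho> where "\<rho> > 0" "\<rho> < r" "aconv c \<rho>" "\<And>x. norm x \<le> \<rho> \<Longrightarrow> u x = psum c x"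
proof -
  have z: "0 \<in> ball 0 r" using assms(2) by simp
  obtain c r' where c: "r' > 0" "\<And>x. x \<in> ball 0 r' \<Longrightarrow> ((\<lambda>\<alpha>. c \<alpha> * monomial \<alpha> (x - 0)) has_sum u x) UNIV"
    by (rule real_analytic_onE[OF assms(1) z]) (rule that; assumption)
  define \<rho> where "\<rho> = min (r' / (2 * real CARD('n))) (r / 2)"
  note P = analytic_at_psum[OF c]
  show thesis
  proof
    show "\<rho> > 0" "\<rho> < r" using P(1) assms(2) by (auto simp: \<rho>_def)
    then show "aconv c \<rho>" by (intro aconv_mono[OF P(2)]) (auto simp: \<rho>_def)
    show "u x = psum c x" if "norm x \<le> \<rho>" for x using P(3)[of x] that by (simp add: \<rho>_def)
  qed
qed

lemma lap_coeffs_eq: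
  assumes "aconv c \<rho>" "aconv d \<rho>" "\<rho> > 0" "r > 0"
    and "\<And>x. norm x < r \<Longrightarrow> laplacian (psum c) x = psum d x"
  shows "lap c = d"
proof (rule psum_eq_imp_coeffs_eq)
  show "aconv (lap c) (\<rho> / 2)" "aconv d (\<rho> / 2)"
    using assms by (auto intro: aconv_lap aconv_mono)
  show "\<rho> / 2 > 0" "min r \<rho> > 0" using assms by auto
  show "psum (lap c) x = psum d x" if "norm x < min r \<rho>" for x
    using laplacian_psum[OF assms(1), of x] assms(5)[of x] that by simp
qed

lemma laplacian_eq_psum:
  fixes u :: "real^'n::finite \<Rightarrow> real"
  assumes "\<And>x. norm x \<le> \<rho> \<Longrightarrow> u x = psum c x" "norm x < \<rho>"
  shows "laplacian u x = laplacian (psum c) x"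
  by (rule laplacian_cong_open[of "ball 0 \<rho>"]) (use assms in auto)

lemma harmonic_analytic:
  fixes u :: "real^'n::finite \<Rightarrow> real"
  assumes "open S" "harmonic_on S u"
  shows "real_analytic_on S u"
proof (rule solution_analytic[OF assms(1) harmonic_smooth[OF assms]])
  show "laplacian u x = (\<lambda>_. 0) (u x)" if "x \<in> S" for x using assms(2) that by (simp add: harmonic_on_def)
  show "analytic_real (\<lambda>_. 0)" unfolding analytic_real_def
    by (intro allI exI[of _ "\<lambda>_. 0"] exI[of _ 1]) auto
qed

lemma harmonic_near_0:
  fixes u :: "real^'n::finite \<Rightarrow> real"
  assumes "harmonic_on (ball 0 r) u" "r > 0"
  obtains L \<rho> where "\<rho> > 0" "\<rho> < r" "aconv L \<rho>" "\<And>x. norm x \<le> \<rho> \<Longrightarrow> u x = psum L x" "lap L = (\<lambda>_. 0)"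
proof -
  obtain L \<rho> where L: "\<rho> > 0" "\<rho> < r" "aconv L \<rho>" "\<And>x. norm x \<le> \<rho> \<Longrightarrow> u x = psum L x"
    by (rule analytic_near_0[OF harmonic_analytic[OF open_ball assms(1)] assms(2)]) (rule that; assumption)
  have "lap L = (\<lambda>_. 0)"
  proof (rule lap_coeffs_eq[OF L(3) _ L(1) L(1)])
    show "aconv (\<lambda>_. 0) \<rho>" by (simp add: aconv_def A1_def)
    fix x :: "real^'n" assume x: "norm x < \<rho>"
    have "laplacian (psum L) x = laplacian u x" using laplacian_eq_psum[OF L(4) x] by simp
    also have "\<dots> = 0" using assms(1) x L(2) by (simp add: harmonic_on_def)
    finally show "laplacian (psum L) x = psum (\<lambda>_. 0) x" by (simp add: psum_def hom_def)
  qed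
  with L show thesis by (rule that)
qed

lemma decomposes_coeffs:
  fixes u :: "real^'n::finite \<Rightarrow> real"
  assumes "decomposes r u uL" "r > 0"
    and c: "\<rho> > 0" "aconv c \<rho>" "\<And>x. norm x \<le> \<rho> \<Longrightarrow> u x = psum c x"
    and L: "\<sigma> > 0" "aconv L \<sigma>" "\<And>x. norm x \<le> \<sigma> \<Longrightarrow> uL x = psum L x"
  obtains e where "c = (\<lambda>\<alpha>. L \<alpha> + rsq e \<alpha>)"
proof -
  obtain g where g: "real_analytic_on (ball 0 r) g" "\<And>x. x \<in> ball 0 r \<Longrightarrow> u x = uL x + (norm x)\<^sup>2 * g x"
    using assms(1) unfolding decomposes_def by blast
  obtain e \<tau> where e: "\<tau> > 0" "\<tau> < r" "aconv e \<tau>" "\<And>x. norm x \<le> \<tau> \<Longrightarrow> g x = psum e x"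
    by (rule analytic_near_0[OF g(1) assms(2)]) (rule that; assumption)
  define \<mu> where "\<mu> = min \<rho> (min \<sigma> \<tau>)"
  have mu: "\<mu> > 0" using c L e by (simp add: \<mu>_def)
  have ac: "aconv c \<mu>" "aconv L \<mu>" "aconv e \<mu>"
    using aconv_mono[OF c(2)] aconv_mono[OF L(2)] aconv_mono[OF e(3)] mu by (auto simp: \<mu>_def)
  have "c = (\<lambda>\<alpha>. L \<alpha> + rsq e \<alpha>)"
  proof (rule psum_eq_imp_coeffs_eq[OF ac(1) _ mu mu])
    show "aconv (\<lambda>\<alpha>. L \<alpha> + rsq e \<alpha>) \<mu>" using ac mu by (intro aconv_add aconv_rsq) auto
    fix x :: "real^'n" assume x: "norm x < \<mu>"
    then have xi: "\<bar>x $ i\<bar> \<le> \<mu>" for i using component_le_norm_cart[of x i] by linarith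
    have "psum c x = u x" using c(3)[of x] x by (simp add: \<mu>_def)
    also have "\<dots> = uL x + (norm x)\<^sup>2 * g x" using g(2)[of x] x e(2) by (simp add: \<mu>_def)
    also have "\<dots> = psum L x + psum (rsq e) x"
      using L(3)[of x] e(4)[of x] x psum_rsq[OF ac(3) xi] by (simp add: \<mu>_def)
    also have "\<dots> = psum (\<lambda>\<alpha>. L \<alpha> + rsq e \<alpha>) x"
      using psum_add[OF ac(2) aconv_rsq[OF ac(3)] xi] mu by simp
    finally show "psum c x = psum (\<lambda>\<alpha>. L \<alpha> + rsq e \<alpha>) x" .
  qed
  then show thesis by (rule that)
qed

lemma decomposesI:
  fixes u :: "real^'n::finite \<Rightarrow> real"
  assumes "aconv L \<rho>" "aconv v \<rho>" "\<And>x. norm x \<le> \<rho> \<Longrightarrow> uL x = psum L x" "0 < r" "r \<le> \<rho>"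
    and "\<And>x. x \<in> ball 0 r \<Longrightarrow> u x = psum (\<lambda>\<alpha>. L \<alpha> + rsq v \<alpha>) x"
  shows "decomposes r u uL"
  unfolding decomposes_def
proof (intro exI conjI ballI)
  show "real_analytic_on (ball 0 r) (psum v)"
    by (rule real_analytic_on_subset[OF real_analytic_on_psum[OF assms(2)]]) (use assms in auto)
  fix x :: "real^'n" assume x: "x \<in> ball 0 r"
  then have xi: "\<bar>x $ i\<bar> \<le> \<rho>" for i using component_le_norm_cart[of x i] assms(5) by simp
  show "u x = uL x + (norm x)\<^sup>2 * psum v x"
    using psum_add[OF assms(1) aconv_rsq[OF assms(2)] xi] psum_rsq[OF assms(2) xi] assms x by simp
qed

text \<open>\<open>ip_self_rsq_le\<close> bounds the Fischer norm of the quotient in degree k by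
  that of \<open>c\<close> in degree k + 2. The different factorial normalisations cost k + 2 \<le>
  2 * 2^k and the change of norm costs n^k, whence the radius \<rho>/(2n).\<close>

lemma aconv_ilap_lap:
  fixes c :: "('n::finite \<Rightarrow> nat) \<Rightarrow> real"
  assumes c: "aconv c \<rho>" "\<rho> > 0"
  shows "aconv (ilap (lap c)) (\<rho> / (2 * real CARD('n)))"
proof -
  define v where "v = ilap (lap c)"
  define n where "n = real CARD('n)"
  have n: "n \<ge> 1" using card_ge_1[where 'n = 'n] by (simp add: n_def)
  have bv: "bn k v \<le> real (k + 2) * bn (k + 2) c" for k
  proof -
    have "ip k v v \<le> ip (k + 2) c c" by (rule ip_self_rsq_le(2)) (simp add: v_def)
    then have "ip k v v / fact k \<le> ip (k + 2) c c / fact k" by (rule divide_right_mono) simp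
    also have "\<dots> = real ((k + 2) * (k + 1)) * (ip (k + 2) c c / fact (k + 2))"
    proof -
      have f2: "fact (k + 2) = real ((k + 2) * (k + 1)) * fact k" by (simp add: algebra_simps)
      have "X / y = r * (X / (r * y))" if "r \<noteq> 0" for X y r :: real using that by simp
      then show ?thesis unfolding f2 by (metis add_2_eq_Suc' mult_eq_0_iff nat.distinct(1) of_nat_eq_0_iff Suc_eq_plus1)
    qed
    also have "\<dots> \<le> (real (k + 2))\<^sup>2 * (ip (k + 2) c c / fact (k + 2))"
      by (intro mult_right_mono) (auto simp: power2_eq_square ip_self_nonneg algebra_simps)
    finally have "bn k v \<le> sqrt ((real (k + 2))\<^sup>2 * (ip (k + 2) c c / fact (k + 2)))"
      unfolding bn_eq by (rule real_sqrt_le_mono)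
    then show ?thesis by (simp only: real_sqrt_mult bn_eq real_sqrt_abs abs_of_nat)
  qed
  have two: "real (k + 2) \<le> 2 * 2 ^ k" for k
    by (induction k) auto
  have "summable (\<lambda>k. A1 (k + 2) c * \<rho> ^ (k + 2))"
    using c(1) unfolding aconv_def by (subst summable_iff_shift)
  then have "summable (\<lambda>k. 2 / \<rho>\<^sup>2 * (A1 (k + 2) c * \<rho> ^ (k + 2)))" by (rule summable_mult)
  then show ?thesis unfolding aconv_def v_def[symmetric] n_def[symmetric]
  proof (rule summable_comparison_test'[of _ 0])
    fix k
    have "A1 k v \<le> n ^ k * (real (k + 2) * A1 (k + 2) c)"
      using A1_le_bn[of k v] bv[of k] bn_le_A1[of "k + 2" c] n unfolding n_def
      by (meson mult_left_mono of_nat_0_le_iff order_trans zero_le_power)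
    also have "\<dots> \<le> n ^ k * ((2 * 2 ^ k) * A1 (k + 2) c)"
      by (intro mult_left_mono mult_right_mono two) (use n in auto)
    finally have "A1 k v * (\<rho> / (2 * n)) ^ k \<le> (n ^ k * ((2 * 2 ^ k) * A1 (k + 2) c)) * (\<rho> / (2 * n)) ^ k"
      by (rule mult_right_mono) (use c n in auto)
    also have "\<dots> = 2 * A1 (k + 2) c * ((\<rho> / (2 * n)) ^ k * (n ^ k * 2 ^ k))"
      by (simp only: mult_ac)
    also have "(\<rho> / (2 * n)) ^ k * (n ^ k * 2 ^ k) = \<rho> ^ k"
      unfolding power_mult_distrib[symmetric] using n by simp
    also have "2 * A1 (k + 2) c * \<rho> ^ k = 2 / \<rho>\<^sup>2 * (A1 (k + 2) c * \<rho> ^ (k + 2))"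
      using c(2) by (simp add: power_add power2_eq_square)
    finally have "A1 k v * (\<rho> / (2 * n)) ^ k \<le> 2 / \<rho>\<^sup>2 * (A1 (k + 2) c * \<rho> ^ (k + 2))" .
    moreover have "0 \<le> A1 k v * (\<rho> / (2 * n)) ^ k"
    proof -
      have "0 \<le> \<rho> / (2 * n)" using c(2) n by simp
      from mult_nonneg_nonneg[OF A1_nonneg zero_le_power[OF this]] show ?thesis .
    qed
    ultimately show "norm (A1 k v * (\<rho> / (2 * n)) ^ k) \<le> 2 / \<rho>\<^sup>2 * (A1 (k + 2) c * \<rho> ^ (k + 2))"
      by (simp only: real_norm_def abs_of_nonneg)
  qed
qed

text \<open>The Fischer decomposition of the Taylor series at 0: subtracting the multiple of |x|^2
  that has the same Laplacian leaves the harmonic part, and both pieces still converge.\<close>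

theorem solution_decomposes:
  fixes u :: "real^'n::finite \<Rightarrow> real"
  assumes u: "smooth_on (ball 0 1) u" "\<And>x. x \<in> ball 0 1 \<Longrightarrow> laplacian u x = f (u x)" and f: "analytic_real f"
  shows "\<exists>r uL. 0 < r \<and> r < 1 \<and> harmonic_on (ball 0 r) uL \<and> decomposes r u uL"
proof -
  have ua: "real_analytic_on (ball 0 1) u" by (rule solution_analytic[OF open_ball u f])
  obtain c \<rho> where c: "\<rho> > 0" "\<rho> < 1" "aconv c \<rho>" "\<And>x. norm x \<le> \<rho> \<Longrightarrow> u x = psum c x"
    by (rule analytic_near_0[OF ua zero_less_one]) (rule that; assumption)
  define v where "v = ilap (lap c)"
  define r where "r = \<rho> / (2 * real CARD('n))"
  have "1 \<le> 2 * real CARD('n)" using card_ge_1[where 'n = 'n] by linarith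
  then have r: "r > 0" "r \<le> \<rho>" using c(1) by (auto simp: r_def divide_le_eq)
  define L where "L = (\<lambda>\<alpha>. c \<alpha> - rsq v \<alpha>)"
  have v: "aconv v r" unfolding v_def r_def by (rule aconv_ilap_lap[OF c(3,1)])
  have L: "aconv L r" unfolding L_def using r c v by (intro aconv_diff aconv_rsq aconv_mono[OF c(3)]) auto
  have "lap L = (\<lambda>_. 0)" by (simp add: L_def lap_diff v_def)
  then have "laplacian (psum L) x = 0" if "x \<in> ball 0 r" for x
    using laplacian_psum[OF L, of x] that by (simp add: psum_def hom_def)
  then have "harmonic_on (ball 0 r) (psum L)"
    unfolding harmonic_on_def using Ck_on_psum[of r L 2] aconv_mono[OF L] by auto
  moreover have "decomposes r u (psum L)"
    by (rule decomposesI[OF L v]) (use r c in \<open>auto simp: L_def\<close>)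
  ultimately show ?thesis using r c(2) by (intro exI[of _ r] exI[of _ "psum L"]) auto
qed

text \<open>Near 0 both decompositions expand the same series. Taking the Laplacian eliminates the
  harmonic parts, so the quotients by |x|^2 agree by \<open>lap_rsq_inj\<close>, and then so do the
  harmonic series; analyticity spreads this to the unit ball.\<close>

theorem harmonic_part_unique:
  fixes u u' :: "real^'n::finite \<Rightarrow> real"
  assumes h: "harmonic_on (ball 0 1) uL" "harmonic_on (ball 0 1) uL'" and r: "0 < r" "0 < r'"
    and u: "real_analytic_on (ball 0 r) u" "decomposes r u uL" "decomposes r' u' uL'"
    and eq: "\<And>x. x \<in> ball 0 (min r r') \<Longrightarrow> u x = u' x" and x: "x \<in> ball 0 1"
  shows "uL x = uL' x"
proof -
  obtain L \<sigma> where L: "\<sigma> > 0" "\<sigma> < 1" "aconv L \<sigma>" "\<And>x. norm x \<le> \<sigma> \<Longrightarrow> uL x = psum L x" "lap L = (\<lambda>_. 0)"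
    by (rule harmonic_near_0[OF h(1) zero_less_one]) (rule that; assumption)
  obtain L' \<sigma>' where L': "\<sigma>' > 0" "\<sigma>' < 1" "aconv L' \<sigma>'" "\<And>x. norm x \<le> \<sigma>' \<Longrightarrow> uL' x = psum L' x" "lap L' = (\<lambda>_. 0)"
    by (rule harmonic_near_0[OF h(2) zero_less_one]) (rule that; assumption)
  obtain c \<rho> where c: "\<rho> > 0" "\<rho> < r" "aconv c \<rho>" "\<And>x. norm x \<le> \<rho> \<Longrightarrow> u x = psum c x"
    by (rule analytic_near_0[OF u(1) r(1)]) (rule that; assumption)
  define \<rho>' where "\<rho>' = min \<rho> (r' / 2)"
  have c': "\<rho>' > 0" "aconv c \<rho>'" "\<And>x. norm x \<le> \<rho>' \<Longrightarrow> u' x = psum c x"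
  proof -
    show r0: "\<rho>' > 0" using c r by (simp add: \<rho>'_def)
    then show "aconv c \<rho>'" using aconv_mono[OF c(3)] by (simp add: \<rho>'_def)
    fix x :: "real^'n" assume "norm x \<le> \<rho>'"
    then show "u' x = psum c x" using c(2) c(4)[of x] eq[of x] r by (simp add: \<rho>'_def)
  qed
  obtain e where e: "c = (\<lambda>\<alpha>. L \<alpha> + rsq e \<alpha>)"
    using decomposes_coeffs[OF u(2) r(1) c(1,3,4) L(1,3,4)] .
  obtain e' where e': "c = (\<lambda>\<alpha>. L' \<alpha> + rsq e' \<alpha>)"
    using decomposes_coeffs[OF u(3) r(2) c' L'(1,3,4)] .
  have le: "lap (rsq e) = lap c" "lap (rsq e') = lap c"
    using arg_cong[OF e, of lap] arg_cong[OF e', of lap] by (simp_all add: lap_add L(5) L'(5))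
  have ee: "e = e'"
  proof (rule ext)
    fix \<alpha>
    show "e \<alpha> = e' \<alpha>"
      by (rule lap_rsq_inj[of "mdeg \<alpha>"]) (simp_all only: le idx_def mem_Collect_eq)
  qed
  have "L \<alpha> = L' \<alpha>" for \<alpha>
  proof -
    have "rsq e \<alpha> = rsq e' \<alpha>" by (rule arg_cong[OF ee, of "\<lambda>e. rsq e \<alpha>"])
    then show ?thesis using fun_cong[OF e, of \<alpha>] fun_cong[OF e', of \<alpha>] by linarith
  qed
  then have "L = L'" by (rule ext)
  then show ?thesis
    by (intro analytic_eq_on_ball[OF harmonic_analytic[OF open_ball h(1)] harmonic_analytic[OF open_ball h(2)], where \<delta> = "min \<sigma> \<sigma>'", OF _ _ x])
       (use L(1,4) L'(1,4) in auto)
qed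

text \<open>Since \<open>c 0 = 0\<close>, shrinking the radius brings the coefficient norm of
  \<open>c\<close> down to R/2, well inside the convergence of the series of \<open>f\<close>, where
  \<open>psum_comp\<close> applies.\<close>

lemma f_psum_eq_psum_comp:
  fixes c :: "('n::finite \<Rightarrow> nat) \<Rightarrow> real"
  assumes f: "R > 0" "\<And>t. \<bar>t\<bar> < R \<Longrightarrow> (\<lambda>p. a p * t ^ p) sums f t"
    and c: "aconv c \<rho>" "\<rho> > 0" "c 0 = 0"
  obtains \<rho>' where "\<rho>' > 0" "\<rho>' \<le> \<rho>" "aconv (ccomp a c) \<rho>'" "\<And>x. norm x \<le> \<rho>' \<Longrightarrow> f (psum c x) = psum (ccomp a c) x"
proof -
  define M where "M = R / 2"
  have M: "M > 0" "M < R" using f by (auto simp: M_def)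
  have sM: "summable (\<lambda>p. \<bar>a p\<bar> * M ^ p)"
  proof -
    have "summable (\<lambda>p. a p * ((M + R) / 2) ^ p)" using f(2)[of "(M + R) / 2"] M by (auto simp: sums_iff)
    then have "summable (\<lambda>p. norm (a p * M ^ p))" by (rule powser_insidea) (use M in auto)
    then show ?thesis using M by (simp add: abs_mult)
  qed
  define l where "l = l1 c \<rho>"
  have l: "l \<ge> 0" unfolding l_def by (rule l1_nonneg[OF c(1) less_imp_le[OF c(2)]])
  define t where "t = min 1 (M / (l + 1))"
  have t: "t > 0" "t \<le> 1" "t * l \<le> M"
  proof -
    show "t > 0" "t \<le> 1" using M l by (auto simp: t_def)
    have "t * l \<le> M / (l + 1) * l" using l by (intro mult_right_mono) (auto simp: t_def)
    also have "\<dots> \<le> M" using M l by (simp add: field_simps)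
    finally show "t * l \<le> M" .
  qed
  define \<rho>1 where "\<rho>1 = t * \<rho>"
  have r1: "\<rho>1 > 0" "\<rho>1 \<le> \<rho>" using t c by (auto simp: \<rho>1_def mult_left_le_one_le)
  have a1: "aconv c \<rho>1" using aconv_mono[OF c(1)] r1 by simp
  have l1: "l1 c \<rho>1 \<le> M" using l1_small[OF c(1) _ c(3), of t] t c by (simp add: \<rho>1_def l_def)
  have l0: "l1 c \<rho>1 \<ge> 0" using l1_nonneg[OF a1] r1 by simp
  have s1: "summable (\<lambda>p. \<bar>a p\<bar> * l1 c \<rho>1 ^ p)"
    by (rule summable_comparison_test'[OF sM, of 0]) (use l1 l0 in \<open>auto intro!: mult_left_mono power_mono\<close>)
  define \<rho>' where "\<rho>' = \<rho>1 / real CARD('n)"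
  have r': "\<rho>' > 0" "\<rho>' \<le> \<rho>1" using r1 card_ge_1[where 'n = 'n] by (auto simp: \<rho>'_def divide_le_eq)
  have main: "f (psum c x) = psum (ccomp a c) x" if x: "norm x \<le> \<rho>'" for x
  proof -
    have xi: "\<bar>x $ i\<bar> \<le> \<rho>1" for i using component_le_norm_cart[of x i] x r' by linarith
    have sh: "summable (\<lambda>k. \<bar>hom c k x\<bar>)" by (rule summable_abs_hom[OF a1 xi])
    have "\<bar>psum c x\<bar> \<le> (\<Sum>k. \<bar>hom c k x\<bar>)" unfolding psum_def by (rule summable_rabs[OF sh])
    also have "\<dots> \<le> l1 c \<rho>1"
      unfolding l1_def by (rule suminf_le[OF abs_hom_le[OF xi] sh]) (use a1 in \<open>simp add: aconv_def\<close>)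
    finally have "\<bar>psum c x\<bar> < R" using l1 M by linarith
    from sums_unique2[OF f(2)[OF this] psum_comp[OF a1 xi c(3) s1]] show ?thesis .
  qed
  show thesis
    by (rule that[of \<rho>']) (use r' r1 aconv_comp[OF a1 _ s1] main in \<open>auto simp: \<rho>'_def\<close>)
qed

text \<open>Existence is the formal solution together with its majorant bound. For uniqueness, the
  Taylor series at 0 of any analytic solution with this harmonic part satisfies the same recursion,
  so it is the formal solution, and the identity theorem covers the rest of the ball.\<close>

theorem local_solution:
  fixes uL :: "real^'n::finite \<Rightarrow> real"
  assumes f: "analytic_real f" and h: "harmonic_on (ball 0 1) uL" "uL 0 = 0"
  obtains c \<rho> where "\<rho> > 0" "\<rho> < 1" "aconv c \<rho>" "\<And>r. 0 < r \<Longrightarrow> r \<le> \<rho> \<Longrightarrow> analytic_solution f uL r (psum c)"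
    "\<And>r v x. 0 < r \<Longrightarrow> r \<le> \<rho> \<Longrightarrow> analytic_solution f uL r v \<Longrightarrow> x \<in> ball 0 r \<Longrightarrow> v x = psum c x"
proof -
  obtain L \<sigma> where L: "\<sigma> > 0" "\<sigma> < 1" "aconv L \<sigma>" "\<And>x. norm x \<le> \<sigma> \<Longrightarrow> uL x = psum L x" "lap L = (\<lambda>_. 0)"
    by (rule harmonic_near_0[OF h(1) zero_less_one]) (rule that; assumption)
  have L0: "L 0 = 0" using L(4)[of 0] L(1) h(2) by (simp add: psum_at_0)
  obtain a R where a: "R > 0" "\<And>t. \<bar>t\<bar> < R \<Longrightarrow> (\<lambda>p. a p * t ^ p) sums f t"
    using f unfolding analytic_real_def by (metis diff_zero)
  define M where "M = R / 2"
  have M: "M > 0" "M < R" using a by (auto simp: M_def)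
  have sM: "summable (\<lambda>p. \<bar>a p\<bar> * M ^ p)"
  proof -
    have "summable (\<lambda>p. a p * ((M + R) / 2) ^ p)" using a(2)[of "(M + R) / 2"] M by (auto simp: sums_iff)
    then have "summable (\<lambda>p. norm (a p * M ^ p))" by (rule powser_insidea) (use M in auto)
    then show ?thesis using M by (simp add: abs_mult)
  qed
  define F where "F = (\<Sum>p. \<bar>a p\<bar> * M ^ p)"
  have F: "(\<Sum>p\<le>N. \<bar>a p\<bar> * M ^ p) \<le> F" for N
    unfolding F_def by (rule sum_le_suminf[OF sM]) (use M in auto)
  have F0: "F \<ge> 0" using F[of 0] by (auto intro: order_trans[rotated])
  define l where "l = l1 L \<sigma>"
  have l: "l \<ge> 0" unfolding l_def by (rule l1_nonneg[OF L(3) less_imp_le[OF L(1)]])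
  define b where "b = l + F + 1"
  have b: "b > 0" "l \<le> b" "F \<le> b" using l F0 by (auto simp: b_def)
  \<comment> \<open>The contraction of the radius. It brings \<open>L\<close> below M/2 through
    \<open>l1_small\<close>, and it also controls the nonlinear term, since the square of \<rho>0 =
    t\<sigma> is at most t.\<close>
  define t where "t = min 1 (M / (2 * b))"
  have t: "t > 0" "t \<le> 1" and tl: "t * b \<le> M / 2"
  proof -
    show "t > 0" "t \<le> 1" using M b by (auto simp: t_def)
    have "t * b \<le> M / (2 * b) * b" using b by (intro mult_right_mono) (auto simp: t_def)
    also have "\<dots> = M / 2" using b by simp
    finally show "t * b \<le> M / 2" .
  qed
  have tl': "t * l \<le> M / 2" "t * F \<le> M / 2"
    using order_trans[OF mult_left_mono tl] t b by auto
  define \<rho>0 where "\<rho>0 = t * \<sigma>"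
  have r0: "\<rho>0 > 0" "\<rho>0 \<le> \<sigma>" "\<rho>0 \<le> t" using t L by (auto simp: \<rho>0_def mult_left_le_one_le mult_left_le)
  obtain u where u: "\<And>\<alpha>. u \<alpha> = L \<alpha> + rsq (ilap (ccomp a u)) \<alpha>" using formal_solution_exists by blast
  define v where "v = ilap (ccomp a u)"
  have bound: "nrm N \<rho>0 u \<le> M" "nrm N \<rho>0 v \<le> F" for N
  proof -
    have nL: "nrm N \<rho>0 L \<le> M / 2" for N
      using nrm_le_l1[of L \<rho>0 N] l1_small[OF L(3) _ L0, of t] t L r0 tl' aconv_mono[OF L(3), of \<rho>0]
      by (simp add: \<rho>0_def l_def)
    have "\<rho>0\<^sup>2 * F \<le> t * F"
    proof (rule mult_right_mono[OF _ F0])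
      have "\<rho>0 * \<rho>0 \<le> t * 1" by (rule mult_mono) (use r0 t L in auto)
      then show "\<rho>0\<^sup>2 \<le> t" by (simp add: power2_eq_square)
    qed
    then have rF: "\<rho>0\<^sup>2 * F \<le> M / 2" using tl' by linarith
    show "nrm N \<rho>0 u \<le> M" "nrm N \<rho>0 v \<le> F"
      unfolding v_def using formal_solution_bound[OF u _ nL F rF] r0 by auto
  qed
  define \<rho>1 where "\<rho>1 = \<rho>0 / real CARD('n)"
  have r1: "\<rho>1 > 0" "\<rho>1 \<le> \<rho>0" using r0 card_ge_1[where 'n = 'n] by (auto simp: \<rho>1_def divide_le_eq)
  have au: "aconv u \<rho>1" and av: "aconv v \<rho>1"
    unfolding \<rho>1_def using aconv_if_nrm_bounded bound r0 less_imp_le by blast+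
  have u0: "u 0 = 0" by (subst u) (simp add: L0 rsq_low[of _ 0] idx_0)
  have ueq: "u = (\<lambda>\<alpha>. L \<alpha> + rsq v \<alpha>)" unfolding v_def by (rule ext) (rule u)
  have "lap u = lap (\<lambda>\<alpha>. L \<alpha> + rsq v \<alpha>)" by (rule arg_cong[OF ueq])
  also have "\<dots> = ccomp a u" by (simp add: lap_add L(5) v_def)
  finally have lu: "lap u = ccomp a u" .
  obtain \<rho> where rho': "\<rho> > 0" "\<rho> \<le> \<rho>1" "aconv (ccomp a u) \<rho>" "\<And>x. norm x \<le> \<rho> \<Longrightarrow> f (psum u x) = psum (ccomp a u) x"
    by (rule f_psum_eq_psum_comp[OF a au r1(1) u0], assumption) (rule that; assumption)
  note rho = rho'(1,2,4)
  have "\<rho> \<le> \<sigma>" using rho r1 r0 by linarith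
  note mono = less_imp_le[OF rho(1)]
  have au': "aconv u \<rho>" "aconv v \<rho>" "aconv L \<rho>"
    by (rule aconv_mono[OF au mono rho(2)], rule aconv_mono[OF av mono rho(2)],
        rule aconv_mono[OF L(3) mono \<open>\<rho> \<le> \<sigma>\<close>])
  show thesis
  proof (rule that[of \<rho> u])
    show "\<rho> > 0" "aconv u \<rho>" by fact+
    show "\<rho> < 1" using rho r1 r0 L by linarith
    fix r :: real assume r: "0 < r" "r \<le> \<rho>"
    show "analytic_solution f uL r (psum u)"
      unfolding analytic_solution_def
    proof (intro conjI ballI)
      show "real_analytic_on (ball 0 r) (psum u)"
        by (rule real_analytic_on_subset[OF real_analytic_on_psum[OF au'(1)]]) (use r in auto)
      show "laplacian (psum u) x = f (psum u x)" if "x \<in> ball 0 r" for x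
        using laplacian_psum[OF au'(1), of x] rho(3)[of x] that r by (simp add: lu)
      show "decomposes r (psum u) uL"
        by (rule decomposesI[OF au'(3,2) _ r]) (use L(4) rho r1 r0 in \<open>auto simp flip: ueq\<close>)
    qed
    fix w :: "real^'n \<Rightarrow> real" and x :: "real^'n" assume w: "analytic_solution f uL r w" and x: "x \<in> ball 0 r"
    then have wa: "real_analytic_on (ball 0 r) w" and wl: "\<And>x. x \<in> ball 0 r \<Longrightarrow> laplacian w x = f (w x)" and wd: "decomposes r w uL"
      by (auto simp: analytic_solution_def)
    obtain d \<tau> where d: "\<tau> > 0" "\<tau> < r" "aconv d \<tau>" "\<And>x. norm x \<le> \<tau> \<Longrightarrow> w x = psum d x"
      by (rule analytic_near_0[OF wa r(1)]) (rule that; assumption)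
    obtain e where e: "d = (\<lambda>\<alpha>. L \<alpha> + rsq e \<alpha>)"
      using decomposes_coeffs[OF wd r(1) d(1,3,4) L(1,3,4)] .
    have d0: "d 0 = 0" by (subst e) (simp add: L0 rsq_low[of _ 0] idx_0)
    obtain \<tau>' where tau': "\<tau>' > 0" "\<tau>' \<le> \<tau>" "aconv (ccomp a d) \<tau>'" "\<And>x. norm x \<le> \<tau>' \<Longrightarrow> f (psum d x) = psum (ccomp a d) x"
        by (rule f_psum_eq_psum_comp[OF a d(3,1) d0], assumption) (rule that; assumption)
    have "lap d = ccomp a d"
    proof (rule lap_coeffs_eq[OF _ tau'(3,1,1)])
      show "aconv d \<tau>'" using aconv_mono[OF d(3)] tau' by simp
      fix x :: "real^'n" assume x: "norm x < \<tau>'"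
      have "laplacian (psum d) x = laplacian w x" using laplacian_eq_psum[OF d(4)] x tau' by simp
      also have "\<dots> = f (psum d x)" using wl[of x] d(2) d(4)[of x] x tau' by simp
      also have "\<dots> = psum (ccomp a d) x" using tau'(4) x by simp
      finally show "laplacian (psum d) x = psum (ccomp a d) x" .
    qed
    moreover have "lap d = lap (\<lambda>\<alpha>. L \<alpha> + rsq e \<alpha>)" by (rule arg_cong[OF e])
    ultimately have "lap (rsq e) = ccomp a (\<lambda>\<alpha>. L \<alpha> + rsq e \<alpha>)" using e by (simp add: lap_add L(5))
    moreover have "lap (rsq v) = ccomp a (\<lambda>\<alpha>. L \<alpha> + rsq v \<alpha>)" by (simp add: v_def flip: ueq[unfolded v_def])
    ultimately have "e = v" by (rule formal_solution_unique)
    then have "d = u" using e ueq by simp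
    then show "w x = psum u x"
      by (intro analytic_eq_on_ball[OF wa real_analytic_on_subset[OF real_analytic_on_psum[OF au'(1)]] d(1) _ x])
         (use r d(4) in auto)
  qed
qed

section \<open>Integration over the sphere\<close>

lemma nn_integral_lborel_translate:
  fixes h :: "'a::euclidean_space \<Rightarrow> ennreal"
  assumes [measurable]: "h \<in> borel_measurable borel"
  shows "(\<integral>\<^sup>+ y. h (c + y) \<partial>lborel) = (\<integral>\<^sup>+ y. h y \<partial>lborel)"
proof -
  have "(\<integral>\<^sup>+ y. h y \<partial>lborel) = (\<integral>\<^sup>+ y. h y \<partial>distr lborel borel ((+) c))"
    by (simp add: lborel_distr_plus)
  then show ?thesis by (simp add: nn_integral_distr)
qed

lemma nn_integral_lborel_uminus:
  fixes h :: "'a::euclidean_space \<Rightarrow> ennreal"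
  assumes [measurable]: "h \<in> borel_measurable borel"
  shows "(\<integral>\<^sup>+ y. h (- y) \<partial>lborel) = (\<integral>\<^sup>+ y. h y \<partial>lborel)"
proof -
  have "(\<integral>\<^sup>+ y. h y \<partial>lborel) = (\<integral>\<^sup>+ y. h y \<partial>distr lborel borel uminus)"
    by (subst lborel_affine[of "-1" 0]) (simp_all add: density_1)
  then show ?thesis by (simp add: nn_integral_distr)
qed

text \<open>Fubini shows that the translation invariant measures \<open>A \<mapsto> |T\<^sup>-\<^sup>1 A|\<close> and \<open>A \<mapsto> |A|\<close> are
  proportional; comparing the unit balls gives the factor 1.\<close>

lemma emeasure_orthogonal_vimage:
  fixes T :: "'a::euclidean_space \<Rightarrow> 'a"
  assumes T: "orthogonal_transformation T" and A[measurable]: "A \<in> sets borel"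
  shows "emeasure lborel (T -` A) = emeasure lborel A"
proof -
  let ?B = "ball 0 1 :: 'a set"
  have [measurable]: "?B \<in> sets borel" by simp
  have lin: "linear T" by (rule orthogonal_transformation_linear[OF T])
  have Tm[measurable]: "T \<in> borel_measurable borel"
    using linear_continuous_on[of T UNIV] lin by (intro borel_measurable_continuous_onI) (simp add: linear_conv_bounded_linear)
  obtain S where S: "\<And>y. T (S y) = y"
    using orthogonal_transformation_surj[OF T] by (metis surjD)
  have "(\<integral>\<^sup>+ x. \<integral>\<^sup>+ y. indicator A (T x) * indicator ?B y \<partial>lborel \<partial>lborel)
      = (\<integral>\<^sup>+ x. \<integral>\<^sup>+ y. indicator A (T x) * indicator ?B (T x + y) \<partial>lborel \<partial>lborel)"
  proof (rule nn_integral_cong)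
    fix x
    have "(\<lambda>y. indicator A (T x) * indicator ?B y :: ennreal) \<in> borel_measurable borel" by measurable
    from nn_integral_lborel_translate[OF this, of "T x"]
    show "(\<integral>\<^sup>+ y. indicator A (T x) * indicator ?B y \<partial>lborel) = (\<integral>\<^sup>+ y. indicator A (T x) * indicator ?B (T x + y) \<partial>lborel)" ..
  qed
  also have "\<dots> = (\<integral>\<^sup>+ y. \<integral>\<^sup>+ x. indicator A (T x) * indicator ?B (T x + y) \<partial>lborel \<partial>lborel)"
    by (rule lborel_pair.Fubini'[symmetric]) measurable
  also have "\<dots> = (\<integral>\<^sup>+ y. \<integral>\<^sup>+ x. indicator A (T x - y) * indicator ?B (T x) \<partial>lborel \<partial>lborel)"
  proof (rule nn_integral_cong)
    fix y
    have "T (- S y + x) = T x - y" for x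
      by (simp only: linear_add[OF lin] linear_neg[OF lin] S) simp
    moreover have "(\<lambda>x. indicator A (T x) * indicator ?B (T x + y) :: ennreal) \<in> borel_measurable borel" by measurable
    note nn_integral_lborel_translate[OF this, of "- S y"]
    ultimately show "(\<integral>\<^sup>+ x. indicator A (T x) * indicator ?B (T x + y) \<partial>lborel) = (\<integral>\<^sup>+ x. indicator A (T x - y) * indicator ?B (T x) \<partial>lborel)"
      by simp
  qed
  also have "\<dots> = (\<integral>\<^sup>+ x. \<integral>\<^sup>+ y. indicator A (T x - y) * indicator ?B (T x) \<partial>lborel \<partial>lborel)"
    by (rule lborel_pair.Fubini') measurable
  also have "\<dots> = (\<integral>\<^sup>+ x. \<integral>\<^sup>+ y. indicator A y * indicator ?B (T x) \<partial>lborel \<partial>lborel)"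
  proof (rule nn_integral_cong)
    fix x
    have "(\<integral>\<^sup>+ y. indicator A (T x - y) * indicator ?B (T x) \<partial>lborel) = (\<integral>\<^sup>+ y. indicator A (T x + y) * indicator ?B (T x) \<partial>lborel)"
      using nn_integral_lborel_uminus[of "\<lambda>y. indicator A (T x + y) * indicator ?B (T x)"] by simp
    also have "\<dots> = (\<integral>\<^sup>+ y. indicator A y * indicator ?B (T x) \<partial>lborel)"
      by (rule nn_integral_lborel_translate) simp
    finally show "(\<integral>\<^sup>+ y. indicator A (T x - y) * indicator ?B (T x) \<partial>lborel) = (\<integral>\<^sup>+ y. indicator A y * indicator ?B (T x) \<partial>lborel)" .
  qed
  finally have "(\<integral>\<^sup>+ x. indicator A (T x) \<partial>lborel) * emeasure lborel ?B
      = emeasure lborel A * (\<integral>\<^sup>+ x. indicator ?B (T x) \<partial>lborel)"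
    by (simp add: nn_integral_cmult nn_integral_multc)
  moreover have "indicator C (T x) = (indicator (T -` C) x :: ennreal)" for C x by (simp add: indicator_def)
  moreover have "T -` ?B = ?B" using orthogonal_transformation_norm[OF T] by auto
  moreover have "T -` A \<in> sets borel" using measurable_sets[OF Tm A] by simp
  ultimately have "emeasure lborel ?B * emeasure lborel (T -` A) = emeasure lborel ?B * emeasure lborel A"
    by (simp add: mult.commute)
  moreover have "emeasure lborel ?B \<noteq> top" using emeasure_bounded_finite[of ?B] by simp
  moreover have "emeasure lborel ?B \<noteq> 0" using unit_ball_vol_pos[of "real DIM('a)"] by (simp add: emeasure_ball del: unit_ball_vol_pos)
  ultimately show ?thesis unfolding ennreal_mult_cancel_left by blast
qed

section \<open>The surface measure of the sphere\<close>

lemma space_sphere_measure: "space (sphere_measure :: (real^'n::finite) measure) = sphere 0 1"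
  by (simp add: sphere_measure_def space_restrict_space)

lemma sets_sphere_measure: "sets (sphere_measure :: (real^'n::finite) measure) = sets (restrict_space borel (sphere 0 1))"
  by (simp add: sphere_measure_def)

lemma sgn_measurable_sphere:
  "sgn \<in> measurable (scale_measure (of_nat CARD('n)) (restrict_space lborel (ball 0 1 - {0})))
     (restrict_space borel (sphere 0 1 :: (real^'n::finite) set))"
proof -
  have "sgn \<in> measurable (restrict_space lborel (ball 0 1 - {0})) (restrict_space borel (sphere 0 1 :: (real^'n) set))"
    by (rule measurable_restrict_space2)
       (auto simp: space_restrict_space norm_sgn intro!: measurable_restrict_space1)
  then show ?thesis by (simp cong: measurable_cong_sets)
qed

lemma emeasure_sphere_measure:
  assumes "A \<in> sets (sphere_measure :: (real^'n::finite) measure)"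
  shows "emeasure sphere_measure A = of_nat CARD('n) * emeasure lborel (sgn -` A \<inter> (ball 0 1 - {0}))"
proof -
  have "emeasure sphere_measure A = emeasure (scale_measure (of_nat CARD('n)) (restrict_space lborel (ball 0 1 - {0})))
     (sgn -` A \<inter> space (scale_measure (of_nat CARD('n)) (restrict_space lborel (ball 0 1 - {0}))))"
    unfolding sphere_measure_def
    by (rule emeasure_distr[OF sgn_measurable_sphere]) (use assms in \<open>simp add: sphere_measure_def\<close>)
  also have "space (scale_measure (of_nat CARD('n)) (restrict_space lborel (ball 0 1 - {0}))) = ball 0 1 - {0 :: real^'n}"
    by (subst space_scale_measure) (simp add: space_restrict_space)
  finally show ?thesis by (simp add: emeasure_restrict_space)
qed

lemma finite_measure_sphere_measure: "finite_measure (sphere_measure :: (real^'n::finite) measure)"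
proof (rule finite_measureI)
  have "emeasure lborel (sgn -` sphere 0 1 \<inter> (ball 0 1 - {0 :: real^'n})) \<le> emeasure lborel (ball (0::real^'n) 1)"
    by (rule emeasure_mono) auto
  also have "\<dots> < \<infinity>" using emeasure_bounded_finite[of "ball (0::real^'n) 1"] by simp
  finally have "emeasure lborel (sgn -` sphere 0 1 \<inter> (ball 0 1 - {0 :: real^'n})) < \<infinity>" .
  then show "emeasure (sphere_measure :: (real^'n) measure) (space sphere_measure) \<noteq> \<infinity>"
    by (subst emeasure_sphere_measure) (auto simp: space_sphere_measure sets_sphere_measure ennreal_mult_eq_top_iff sets_restrict_space)
qed

interpretation sphere: finite_measure "sphere_measure :: (real^'n::finite) measure"
  by (rule finite_measure_sphere_measure)

lemma borel_measurable_sphere_measure: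
  "(continuous_on (sphere 0 1) g) \<Longrightarrow> (g :: real^'n::finite \<Rightarrow> real) \<in> borel_measurable sphere_measure"
  by (simp add: measurable_cong_sets[OF sets_sphere_measure refl] borel_measurable_continuous_on_restrict)

lemma integrable_sphere_measure:
  fixes g :: "real^'n::finite \<Rightarrow> real"
  assumes "continuous_on (sphere 0 1) g"
  shows "integrable sphere_measure g"
proof -
  have "bounded (g ` sphere 0 1)" by (intro compact_imp_bounded compact_continuous_image assms) simp
  then obtain B where "\<And>y. y \<in> sphere 0 1 \<Longrightarrow> \<bar>g y\<bar> \<le> B" unfolding bounded_iff by fastforce
  then show ?thesis
    by (intro sphere.integrable_const_bound[where B = B] borel_measurable_sphere_measure assms AE_I2)
       (auto simp: space_sphere_measure)
qed

lemma orthogonal_measurable_sphere: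
  fixes T :: "real^'n::finite \<Rightarrow> real^'n"
  assumes T: "orthogonal_transformation T"
  shows "T \<in> measurable sphere_measure sphere_measure"
proof -
  have "continuous_on UNIV T"
    using linear_continuous_on[of T UNIV] orthogonal_transformation_linear[OF T] by (simp add: linear_conv_bounded_linear)
  then have "T \<in> borel_measurable borel" by (rule borel_measurable_continuous_onI)
  then have "T \<in> measurable (restrict_space borel (sphere 0 1)) (restrict_space borel (sphere 0 1))"
    by (intro measurable_restrict_space2 measurable_restrict_space1)
       (auto simp: space_restrict_space orthogonal_transformation_norm[OF T])
  then show ?thesis by (simp add: measurable_cong_sets[OF sets_sphere_measure sets_sphere_measure])
qed

text \<open>The measure of a set is n times the volume of the cone over it. Orthogonal maps commute
  with \<open>sgn\<close>, so they carry cones to cones, and they preserve volume.\<close>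

lemma distr_sphere_measure_orthogonal:
  fixes T :: "real^'n::finite \<Rightarrow> real^'n"
  assumes T: "orthogonal_transformation T"
  shows "distr sphere_measure sphere_measure T = sphere_measure"
proof (rule measure_eqI)
  have lin: "linear T" by (rule orthogonal_transformation_linear[OF T])
  note Tm = orthogonal_measurable_sphere[OF T]
  fix A assume "A \<in> sets (distr (sphere_measure :: (real^'n) measure) sphere_measure T)"
  then have A: "A \<in> sets (sphere_measure :: (real^'n) measure)" by simp
  have Am: "A \<in> sets borel" using A unfolding sets_sphere_measure by (auto simp: sets_restrict_space)
  have sub: "A \<subseteq> sphere 0 1" using sets.sets_into_space[OF A] by (simp add: space_sphere_measure)
  let ?C = "sgn -` A \<inter> (ball 0 1 - {0 :: real^'n})"
  have Cm: "?C \<in> sets borel"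
    by (intro sets.Int) (use measurable_sets[OF borel_measurable_sgn Am] in auto)
  have "emeasure (distr sphere_measure sphere_measure T) A = emeasure sphere_measure (T -` A \<inter> sphere 0 1)"
    by (simp add: emeasure_distr[OF Tm A] space_sphere_measure)
  also have "T -` A \<inter> sphere 0 1 = T -` A" using sub orthogonal_transformation_norm[OF T] by auto
  also have "emeasure sphere_measure (T -` A) = of_nat CARD('n) * emeasure lborel (sgn -` (T -` A) \<inter> (ball 0 1 - {0}))"
    using measurable_sets[OF Tm A] \<open>T -` A \<inter> sphere 0 1 = T -` A\<close>
    by (intro emeasure_sphere_measure) (simp add: space_sphere_measure)
  also have "sgn -` (T -` A) \<inter> (ball 0 1 - {0}) = T -` ?C"
  proof -
    have "T (sgn x) = sgn (T x)" for x
      by (simp add: sgn_div_norm orthogonal_transformation_norm[OF T] linear_scale[OF lin])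
    moreover have "T x = 0 \<longleftrightarrow> x = 0" for x using orthogonal_transformation_norm[OF T, of x] by (metis norm_eq_zero)
    ultimately show ?thesis using orthogonal_transformation_norm[OF T] by auto
  qed
  also have "emeasure lborel (T -` ?C) = emeasure lborel ?C" by (rule emeasure_orthogonal_vimage[OF T Cm])
  also have "of_nat CARD('n) * \<dots> = emeasure sphere_measure A" by (rule emeasure_sphere_measure[OF A, symmetric])
  finally show "emeasure (distr sphere_measure sphere_measure T) A = emeasure sphere_measure A" .
qed simp

lemma integral_sphere_orthogonal:
  fixes T :: "real^'n::finite \<Rightarrow> real^'n" and F :: "real^'n \<Rightarrow> real"
  assumes "orthogonal_transformation T" "continuous_on (sphere 0 1) F"
  shows "(\<integral>y. F (T y) \<partial>sphere_measure) = (\<integral>y. F y \<partial>sphere_measure)"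
proof -
  have "(\<integral>y. F y \<partial>sphere_measure) = (\<integral>y. F y \<partial>distr sphere_measure sphere_measure T)"
    by (simp add: distr_sphere_measure_orthogonal assms(1))
  also have "\<dots> = (\<integral>y. F (T y) \<partial>sphere_measure)"
    by (intro integral_distr orthogonal_measurable_sphere borel_measurable_sphere_measure assms)
  finally show ?thesis ..
qed

text \<open>Open subsets of the sphere are not null: the cone over a neighbourhood contains a ball.\<close>

lemma continuous_zero_if_AE:
  fixes g :: "real^'n::finite \<Rightarrow> real"
  assumes g: "continuous_on (sphere 0 1) g" and "AE y in sphere_measure. g y = 0" and y: "y \<in> sphere 0 1"
  shows "g y = 0"
proof (rule ccontr)
  assume "g y \<noteq> 0"
  have gm: "g \<in> borel_measurable sphere_measure" by (rule borel_measurable_sphere_measure[OF g])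
  let ?A = "{z \<in> sphere 0 1. g z \<noteq> 0}"
  have A: "?A \<in> sets sphere_measure"
  proof -
    have "?A = {z \<in> space sphere_measure. g z \<noteq> 0}" by (auto simp: space_sphere_measure)
    also have "\<dots> \<in> sets sphere_measure" using gm by measurable
    finally show ?thesis .
  qed
  have "?A \<in> null_sets sphere_measure"
    using assms(2) A by (subst (asm) AE_iff_null) (auto simp: space_sphere_measure)
  then have "emeasure lborel (sgn -` ?A \<inter> (ball 0 1 - {0})) = 0"
    using emeasure_sphere_measure[OF A] by (auto simp: null_sets_def)
  moreover have "sgn -` ?A \<inter> (ball 0 1 - {0}) = {x \<in> ball 0 1 - {0}. g (sgn x) \<noteq> 0}" by (auto simp: norm_sgn)
  ultimately have null: "emeasure lborel {x \<in> ball 0 1 - {0}. g (sgn x) \<noteq> 0} = 0" by simp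
  have cont: "continuous_on (ball 0 1 - {0}) (\<lambda>x. g (sgn x))"
    by (rule continuous_on_compose2[OF g]) (auto simp: norm_sgn intro!: continuous_intros split: if_splits)
  have op: "open {x \<in> ball 0 1 - {0}. g (sgn x) \<noteq> 0}"
  proof -
    have "{x \<in> ball 0 1 - {0}. g (sgn x) \<noteq> 0} = (ball 0 1 - {0}) \<inter> (\<lambda>x. g (sgn x)) -` (- {0})" by auto
    moreover have "open ((ball 0 1 - {0}) \<inter> (\<lambda>x. g (sgn x)) -` (- {0}))"
      by (rule continuous_open_preimage[OF cont]) auto
    ultimately show ?thesis by simp
  qed
  have "(1/2) *\<^sub>R y \<in> {x \<in> ball 0 1 - {0}. g (sgn x) \<noteq> 0}"
    using y \<open>g y \<noteq> 0\<close> by (auto simp: sgn_div_norm)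
  then have "\<not> negligible {x \<in> ball 0 1 - {0}. g (sgn x) \<noteq> 0}"
    using open_not_negligible[OF op] by blast
  moreover have "{x \<in> ball 0 1 - {0}. g (sgn x) \<noteq> 0} \<in> null_sets lborel"
    using null op by (auto simp: null_sets_def)
  ultimately show False using negligible_iff_null_sets null_sets_completionI by blast
qed

section \<open>Spherical harmonics\<close>

subsection \<open>Homogeneous polynomials on the sphere\<close>

definition hpoly :: "nat \<Rightarrow> (real^'n::finite \<Rightarrow> real) set" where
  "hpoly k = {F. \<exists>c. F = hom c k}"

lemma hpolyI: "hom c k \<in> hpoly k"
  by (auto simp: hpoly_def)

lemma spherical_harmonics_eq: "spherical_harmonics l = {Y \<in> hpoly l. \<forall>x. laplacian Y x = 0}"
  unfolding spherical_harmonics_def hpoly_def hom_def[abs_def] idx_def by auto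

lemma partial_deriv_hom: "partial_deriv i (hom c k) x = dhom i c k x"
  by (subst partial_deriv_eqI[OF has_derivative_hom])
     (simp add: axis_def if_distrib[of "\<lambda>t. t * _"] cong: if_cong)

lemma hpoly_differentiable: "F \<in> hpoly k \<Longrightarrow> F differentiable (at x)"
  unfolding hpoly_def differentiable_def using has_derivative_hom by blast

lemma hpoly_continuous: "F \<in> hpoly k \<Longrightarrow> continuous_on S F"
  by (rule continuous_on_if_differentiable) (rule hpoly_differentiable)

lemma hpoly_partial_deriv: "F \<in> hpoly (Suc k) \<Longrightarrow> partial_deriv i F \<in> hpoly k"
  by (auto simp: hpoly_def partial_deriv_hom[abs_def] dhom_def)

lemma hpoly_0_partial_deriv: "F \<in> hpoly 0 \<Longrightarrow> partial_deriv i F x = 0"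
  by (auto simp: hpoly_def partial_deriv_hom dhom_def)

lemma continuous_partial_deriv_hpoly: "F \<in> hpoly k \<Longrightarrow> continuous_on S (partial_deriv i F)"
proof (cases k)
  case 0
  assume "F \<in> hpoly k"
  then have "partial_deriv i F = (\<lambda>x. 0)" using hpoly_0_partial_deriv 0 by auto
  then show ?thesis by simp
next
  case (Suc m)
  assume "F \<in> hpoly k"
  then show ?thesis using hpoly_partial_deriv[of F m] hpoly_continuous Suc by blast
qed

lemma hpoly_coord: "F \<in> hpoly k \<Longrightarrow> (\<lambda>x. x $ i * F x) \<in> hpoly (Suc k)"
  by (auto simp: hpoly_def fun_eq_iff simp flip: hom_xmul)

lemma hpoly_scaleR: "F \<in> hpoly k \<Longrightarrow> F (t *\<^sub>R x) = t ^ k * F x"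
  by (auto simp: hpoly_def hom_scaleR)

lemma hpoly_linear: "F \<in> hpoly k \<Longrightarrow> G \<in> hpoly k \<Longrightarrow> (\<lambda>x. a * F x + b * G x) \<in> hpoly k"
proof -
  have "(\<lambda>x. a * hom c k x + b * hom d k x) = hom (\<lambda>\<alpha>. a * c \<alpha> + b * d \<alpha>) k" for c d :: "('a \<Rightarrow> nat) \<Rightarrow> real"
    by (simp add: fun_eq_iff hom_add hom_scale)
  then show "F \<in> hpoly k \<Longrightarrow> G \<in> hpoly k \<Longrightarrow> (\<lambda>x. a * F x + b * G x) \<in> hpoly k"
    unfolding hpoly_def by blast
qed

lemma hpoly_mult:
  assumes "F \<in> hpoly k" "G \<in> hpoly l"
  shows "(\<lambda>x. F x * G x) \<in> hpoly (k + l)"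
proof -
  obtain c d where F: "F = hom c k" and G: "G = hom d l" using assms by (auto simp: hpoly_def)
  \<comment> \<open>\<open>hom c k\<close> sees only the coefficients of degree \<open>k\<close>;
    discarding the others removes all but one term from the Cauchy product.\<close>
  let ?c = "\<lambda>\<alpha>. if \<alpha> \<in> idx k then c \<alpha> else 0"
  have z: "hom ?c m x = (if m = k then hom c k x else 0)" for m x
    unfolding hom_def by (cases "m = k") (auto simp: idx_def intro!: sum.neutral)
  have "hom (cmul ?c d) (k + l) x = hom c k x * hom d l x" for x
    unfolding hom_cmul z by (simp add: if_distrib[of "\<lambda>t. t * _"] cong: if_cong)
  then show ?thesis unfolding F G hpoly_def by (auto simp: fun_eq_iff intro!: exI[of _ "cmul ?c d"])
qed

lemma euler_hpoly:
  assumes "F \<in> hpoly k"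
  shows "(\<Sum>i\<in>UNIV. x $ i * partial_deriv i F x) = real k * F x"
proof -
  obtain c where F: "F = hom c k" using assms by (auto simp: hpoly_def)
  show ?thesis
  proof (cases k)
    case 0
    then show ?thesis by (simp add: F partial_deriv_hom dhom_def)
  next
    case (Suc m)
    have "(\<Sum>i\<in>UNIV. x $ i * partial_deriv i F x) = hom (\<lambda>\<alpha>. \<Sum>i\<in>UNIV. xmul i (pd i c) \<alpha>) k x"
      unfolding hom_sum Suc hom_xmul F partial_deriv_hom dhom_def by simp
    also have "\<dots> = hom (\<lambda>\<alpha>. real k * c \<alpha>) k x"
      unfolding sum_xmul_pd hom_def by (rule sum.cong[OF refl]) (simp add: idx_def)
    finally show ?thesis by (simp add: hom_scale F)
  qed
qed

lemma laplacian_hom: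
  "laplacian (hom c k) x = (if k < 2 then 0 else hom (lap c) (k - 2) x)"
proof (cases "k < 2")
  case True
  have "partial_deriv i (partial_deriv i (hom c k)) x = 0" for i
  proof (cases k)
    case 0
    then have "partial_deriv i (hom c k) = (\<lambda>x. 0)" by (simp add: partial_deriv_hom[abs_def] dhom_def)
    then show ?thesis by (simp add: partial_deriv_def)
  next
    case (Suc m)
    then have "partial_deriv i (hom c k) \<in> hpoly 0" using hpoly_partial_deriv[OF hpolyI] True by (metis One_nat_def Suc_lessD less_2_cases nat.inject nat.simps(3))
    then show ?thesis by (rule hpoly_0_partial_deriv)
  qed
  then show ?thesis using True by (simp add: laplacian_def)
next
  case False
  then obtain m where k: "k = Suc (Suc m)" by (metis One_nat_def Suc_1 less_Suc_eq not0_implies_Suc zero_less_Suc)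
  have "partial_deriv i (partial_deriv i (hom c k)) x = hom (pd i (pd i c)) m x" for i
    unfolding partial_deriv_hom[abs_def] k dhom_def by (simp add: partial_deriv_hom dhom_def)
  then show ?thesis using False by (simp add: laplacian_def lap_def[abs_def] hom_sum k)
qed

definition plane_rot :: "'n \<Rightarrow> 'n \<Rightarrow> real \<Rightarrow> real^'n::finite \<Rightarrow> real^'n" where
  "plane_rot i j \<theta> y = (\<chi> k. if k = i then cos \<theta> * y $ i - sin \<theta> * y $ j
      else if k = j then sin \<theta> * y $ i + cos \<theta> * y $ j else y $ k)"

lemma orthogonal_plane_rot:
  assumes "i \<noteq> j"
  shows "orthogonal_transformation (plane_rot i j \<theta> :: real^'n::finite \<Rightarrow> real^'n)"
proof -
  have "plane_rot i j \<theta> x \<bullet> plane_rot i j \<theta> y = x \<bullet> y" for x y :: "real^'n"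
  proof -
    have split: "(\<Sum>k\<in>UNIV. g k) = g i + g j + (\<Sum>k\<in>UNIV - {i, j}. g k)" for g :: "'n \<Rightarrow> real"
      using assms by (subst sum.subset_diff[of "{i, j}"]) (auto simp: add.commute)
    have "plane_rot i j \<theta> x \<bullet> plane_rot i j \<theta> y =
        (cos \<theta> * x $ i - sin \<theta> * x $ j) * (cos \<theta> * y $ i - sin \<theta> * y $ j)
      + (sin \<theta> * x $ i + cos \<theta> * x $ j) * (sin \<theta> * y $ i + cos \<theta> * y $ j) + (\<Sum>k\<in>UNIV - {i, j}. x $ k * y $ k)"
      unfolding inner_vec_def split using assms by (auto simp: plane_rot_def intro!: sum.cong)
    also have "(cos \<theta> * x $ i - sin \<theta> * x $ j) * (cos \<theta> * y $ i - sin \<theta> * y $ j)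
      + (sin \<theta> * x $ i + cos \<theta> * x $ j) * (sin \<theta> * y $ i + cos \<theta> * y $ j)
      = ((cos \<theta>)\<^sup>2 + (sin \<theta>)\<^sup>2) * (x $ i * y $ i + x $ j * y $ j)" by algebra
    finally show ?thesis unfolding inner_vec_def split[of "\<lambda>k. x $ k \<bullet> y $ k"] by simp
  qed
  moreover have "linear (plane_rot i j \<theta> :: real^'n \<Rightarrow> real^'n)"
    by (rule linearI) (auto simp: plane_rot_def vec_eq_iff algebra_simps)
  ultimately show ?thesis by (simp add: orthogonal_transformation_def)
qed

lemma has_vector_derivative_plane_rot:
  assumes "i \<noteq> j"
  shows "((\<lambda>\<theta>. plane_rot i j \<theta> y) has_vector_derivative
     (plane_rot i j \<theta> y $ i) *\<^sub>R axis j 1 - (plane_rot i j \<theta> y $ j) *\<^sub>R axis i 1) (at \<theta>)"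
proof -
  \<comment> \<open>In this form the orbit is affine in the cosine and the sine, so the derivative
    can be read off.\<close>
  have "plane_rot i j \<theta> y = y + (cos \<theta> - 1) *\<^sub>R (y $ i *\<^sub>R axis i 1 + y $ j *\<^sub>R axis j 1)
      + sin \<theta> *\<^sub>R (y $ i *\<^sub>R axis j 1 - y $ j *\<^sub>R axis i 1)" for \<theta>
    using assms by (auto simp: plane_rot_def vec_eq_iff axis_def algebra_simps)
  moreover have "((\<lambda>\<theta>. y + (cos \<theta> - 1) *\<^sub>R (y $ i *\<^sub>R axis i 1 + y $ j *\<^sub>R axis j 1)
      + sin \<theta> *\<^sub>R (y $ i *\<^sub>R axis j 1 - y $ j *\<^sub>R axis i 1)) has_vector_derivative
      (- sin \<theta>) *\<^sub>R (y $ i *\<^sub>R axis i 1 + y $ j *\<^sub>R axis j 1) + cos \<theta> *\<^sub>R (y $ i *\<^sub>R axis j 1 - y $ j *\<^sub>R axis i 1)) (at \<theta>)"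
    unfolding has_vector_derivative_def by (rule derivative_eq_intros | simp add: algebra_simps)+
  moreover have "(- sin \<theta>) *\<^sub>R (y $ i *\<^sub>R axis i 1 + y $ j *\<^sub>R axis j 1) + cos \<theta> *\<^sub>R (y $ i *\<^sub>R axis j 1 - y $ j *\<^sub>R axis i 1)
     = (plane_rot i j \<theta> y $ i) *\<^sub>R axis j 1 - (plane_rot i j \<theta> y $ j) *\<^sub>R axis i (1::real)"
    using assms by (auto simp: plane_rot_def vec_eq_iff axis_def algebra_simps)
  ultimately show ?thesis by simp
qed

lemma has_real_derivative_plane_rot:
  fixes F :: "real^'n::finite \<Rightarrow> real"
  assumes "i \<noteq> j" "\<And>x. F differentiable (at x)"
  defines "D \<equiv> \<lambda>y. y $ i * partial_deriv j F y - y $ j * partial_deriv i F y"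
  shows "((\<lambda>\<theta>. F (plane_rot i j \<theta> y)) has_real_derivative D (plane_rot i j \<theta> y)) (at \<theta>)"
proof -
  let ?R = "plane_rot i j \<theta> y"
  have "((\<lambda>\<theta>. F (plane_rot i j \<theta> y)) has_derivative
     (\<lambda>t. \<Sum>k\<in>UNIV. (t *\<^sub>R ((?R $ i) *\<^sub>R axis j 1 - (?R $ j) *\<^sub>R axis i 1)) $ k * partial_deriv k F ?R)) (at \<theta>)"
    by (rule has_derivative_compose[OF has_vector_derivative_plane_rot[OF assms(1), unfolded has_vector_derivative_def] has_derivative_partial[OF assms(2)]])
  also have "(\<lambda>t. \<Sum>k\<in>UNIV. (t *\<^sub>R ((?R $ i) *\<^sub>R axis j 1 - (?R $ j) *\<^sub>R axis i 1)) $ k * partial_deriv k F ?R) = (*) (D ?R)"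
    by (auto simp: D_def axis_def fun_eq_iff algebra_simps sum_subtractf if_distrib[of "\<lambda>t. _ * t"] if_distrib[of "\<lambda>t. t * _"] cong: if_cong)
  finally show ?thesis by (simp add: has_field_derivative_def)
qed

text \<open>The integral of \<open>F\<close> composed with the rotation by \<theta> does not depend
  on \<theta>, and its derivative at 0 is the integral in question. Difference quotients at the
  angles 1/(m+1) are bounded uniformly by the mean value theorem along the orbit, so dominated
  convergence applies.\<close>

lemma integral_rotation_field:
  fixes F :: "real^'n::finite \<Rightarrow> real"
  assumes "i \<noteq> j" "\<And>x. F differentiable (at x)" "\<And>k. continuous_on (sphere 0 1) (partial_deriv k F)"
  shows "(\<integral>y. y $ i * partial_deriv j F y - y $ j * partial_deriv i F y \<partial>sphere_measure) = 0"
proof -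
  define D where "D = (\<lambda>y. y $ i * partial_deriv j F y - y $ j * partial_deriv i F y)"
  let ?R = "plane_rot i j"
  have Fc: "continuous_on S F" for S by (rule continuous_on_if_differentiable) (rule assms(2))
  have Dc: "continuous_on (sphere 0 1) D" unfolding D_def by (intro continuous_intros assms(3))
  have deriv: "((\<lambda>\<theta>. F (?R \<theta> y)) has_real_derivative D (?R \<theta> y)) (at \<theta>)" for y \<theta>
    using has_real_derivative_plane_rot[OF assms(1,2)] by (simp add: D_def)
  have "bounded (D ` sphere 0 1)" by (intro compact_imp_bounded compact_continuous_image Dc) simp
  then obtain B where B: "\<And>y. norm y = 1 \<Longrightarrow> \<bar>D y\<bar> \<le> B" unfolding bounded_iff by fastforce
  have ort: "orthogonal_transformation (?R \<theta> :: real^'n \<Rightarrow> real^'n)" for \<theta> by (rule orthogonal_plane_rot[OF assms(1)])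
  have R0: "?R 0 y = y" for y by (auto simp: plane_rot_def vec_eq_iff)
  have Rc: "continuous_on (sphere 0 1) (\<lambda>y. F (?R \<theta> y))" for \<theta>
    using linear_continuous_on[of "?R \<theta>" "sphere 0 1"] orthogonal_transformation_linear[OF ort]
    by (intro continuous_on_compose2[OF Fc[of UNIV]]) (auto simp: linear_conv_bounded_linear)
  let ?q = "\<lambda>m y. real (Suc m) * (F (?R (1 / real (Suc m)) y) - F y)"
  have "(\<lambda>m. \<integral>y. ?q m y \<partial>sphere_measure) \<longlonglongrightarrow> (\<integral>y. D y \<partial>sphere_measure)"
  proof (rule integral_dominated_convergence[where w = "\<lambda>_. B"])
    show "D \<in> borel_measurable sphere_measure" by (rule borel_measurable_sphere_measure[OF Dc])
    show "?q m \<in> borel_measurable sphere_measure" for m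
      by (intro borel_measurable_sphere_measure continuous_intros Rc Fc)
    show "AE y in sphere_measure. (\<lambda>m. ?q m y) \<longlonglongrightarrow> D y"
    proof (rule AE_I2)
      fix y
      have "((\<lambda>h. (F (?R (0 + h) y) - F (?R 0 y)) / h) \<longlongrightarrow> D (?R 0 y)) (at 0)"
        using deriv[of y 0] unfolding DERIV_def by (simp add: D_def)
      moreover have "filterlim (\<lambda>m. 1 / real (Suc m)) (at 0) sequentially"
        using LIMSEQ_inverse_real_of_nat by (auto simp: filterlim_at inverse_eq_divide)
      ultimately have "(\<lambda>m. (F (?R (0 + 1 / real (Suc m)) y) - F (?R 0 y)) / (1 / real (Suc m))) \<longlonglongrightarrow> D (?R 0 y)"
        by (rule filterlim_compose)
      then show "(\<lambda>m. ?q m y) \<longlonglongrightarrow> D y" by (simp add: R0 mult.commute)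
    qed
    show "AE y in sphere_measure. norm (?q m y) \<le> B" for m
    proof (rule AE_I2)
      fix y :: "real^'n" assume "y \<in> space sphere_measure"
      then have y: "norm y = 1" by (simp add: space_sphere_measure)
      have "\<exists>z. 0 < z \<and> z < 1 / real (Suc m) \<and> F (?R (1 / real (Suc m)) y) - F (?R 0 y) = (1 / real (Suc m) - 0) * D (?R z y)"
        by (rule MVT2) (simp, rule deriv)
      then obtain z where "F (?R (1 / real (Suc m)) y) - F y = (1 / real (Suc m)) * D (?R z y)" by (auto simp: R0)
      then have "?q m y = D (?R z y)" by simp
      then show "norm (?q m y) \<le> B" using B[of "?R z y"] orthogonal_transformation_norm[OF ort] y by simp
    qed
  qed simp
  moreover have "(\<integral>y. ?q m y \<partial>sphere_measure) = 0" for m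
    using integral_sphere_orthogonal[OF ort Fc] integrable_sphere_measure[OF Rc] integrable_sphere_measure[OF Fc] by simp
  ultimately have "(\<integral>y. D y \<partial>sphere_measure) = 0" using LIMSEQ_unique[OF _ tendsto_const] by force
  then show ?thesis by (simp add: D_def)
qed

lemma partial_deriv_mult:
  assumes "f differentiable (at x)" "g differentiable (at x)"
  shows "partial_deriv i (\<lambda>x. f x * g x) x = partial_deriv i f x * g x + f x * partial_deriv i g x"
  by (subst partial_deriv_eqI[OF has_derivative_mult[OF has_derivative_partial[OF assms(1)] has_derivative_partial[OF assms(2)]]])
     (simp add: axis_def if_distrib[of "\<lambda>t. t * _"] cong: if_cong)

lemma sum_squares_sphere: "y \<in> sphere 0 1 \<Longrightarrow> (\<Sum>j\<in>UNIV. y $ j * y $ j) = 1" for y :: "real^'n::finite"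
  using power2_norm_eq_inner[of y] by (simp add: inner_vec_def)

text \<open>Integration by parts on the sphere. The rotation field of the plane i, j applied to x_j
  G has mean zero; after summing over j, the relation |y| = 1 and Euler's identity leave exactly the
  two integrals.\<close>

lemma integral_partial_deriv_hpoly:
  fixes G :: "real^'n::finite \<Rightarrow> real"
  assumes G: "G \<in> hpoly m"
  shows "(\<integral>y. partial_deriv i G y \<partial>sphere_measure) = (real CARD('n) - 1 + real m) * (\<integral>y. y $ i * G y \<partial>sphere_measure)"
proof -
  note Gd = hpoly_differentiable[OF G]
  define H where "H j = (\<lambda>x. x $ j * G x)" for j
  have Hp: "H j \<in> hpoly (Suc m)" for j unfolding H_def by (rule hpoly_coord[OF G])
  define E where "E j y = y $ i * partial_deriv j (H j) y - y $ j * partial_deriv i (H j) y" for j y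
  have dH: "partial_deriv k (H j) y = (if k = j then G y else 0) + y $ j * partial_deriv k G y" for k j y
  proof -
    have c: "((\<lambda>x. x $ j) has_derivative (\<lambda>h. h $ j)) (at y)"
      by (rule bounded_linear_imp_has_derivative) (rule bounded_linear_vec_nth)
    have "partial_deriv k (\<lambda>x. x $ j) y = (if k = j then 1 else 0)"
      by (subst partial_deriv_eqI[OF c]) (simp add: axis_def)
    moreover have "(\<lambda>x::real^'n. x $ j) differentiable (at y)" using c by (auto simp: differentiable_def)
    ultimately show ?thesis unfolding H_def by (simp add: partial_deriv_mult Gd)
  qed
  have E0: "(\<integral>y. E j y \<partial>sphere_measure) = 0" for j
  proof (cases "j = i")
    case True
    then show ?thesis by (simp add: E_def)
  next
    case False
    then show ?thesis unfolding E_def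
      by (intro integral_rotation_field hpoly_differentiable[OF Hp] continuous_partial_deriv_hpoly[OF Hp]) simp
  qed
  have Ec: "continuous_on (sphere 0 1) (E j)" for j
    unfolding E_def by (intro continuous_intros continuous_partial_deriv_hpoly[OF Hp])
  have "(\<Sum>j\<in>UNIV. E j y) = (real CARD('n) - 1 + real m) * (y $ i * G y) - partial_deriv i G y"
    if "y \<in> sphere 0 1" for y
  proof -
    have "E j y = y $ i * G y + y $ i * (y $ j * partial_deriv j G y) - (if j = i then y $ j * G y else 0) - (y $ j * y $ j) * partial_deriv i G y" for j
      by (simp add: E_def dH algebra_simps)
    then have "(\<Sum>j\<in>UNIV. E j y) = real CARD('n) * (y $ i * G y) + y $ i * (\<Sum>j\<in>UNIV. y $ j * partial_deriv j G y)
       - y $ i * G y - (\<Sum>j\<in>UNIV. y $ j * y $ j) * partial_deriv i G y"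
      by (simp add: sum.distrib sum_subtractf sum_distrib_left sum_distrib_right)
    then show ?thesis unfolding sum_squares_sphere[OF that] euler_hpoly[OF G] by (simp add: algebra_simps)
  qed
  then have "(\<integral>y. (\<Sum>j\<in>UNIV. E j y) \<partial>sphere_measure)
     = (\<integral>y. (real CARD('n) - 1 + real m) * (y $ i * G y) - partial_deriv i G y \<partial>sphere_measure)"
    by (intro Bochner_Integration.integral_cong) (auto simp: space_sphere_measure)
  also have "\<dots> = (real CARD('n) - 1 + real m) * (\<integral>y. y $ i * G y \<partial>sphere_measure) - (\<integral>y. partial_deriv i G y \<partial>sphere_measure)"
    by (subst Bochner_Integration.integral_diff)
       (auto intro!: integrable_sphere_measure continuous_intros continuous_partial_deriv_hpoly[OF G] hpoly_continuous[OF G])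
  finally show ?thesis
    using E0 by (simp add: Bochner_Integration.integral_sum integrable_sphere_measure[OF Ec])
qed

text \<open>As \<open>V\<close> is harmonic, the divergence of \<open>F\<close> times the gradient
  of \<open>V\<close> is the product of the gradients, so
  \<open>integral_partial_deriv_hpoly\<close> applies in degree l + k - 1. The left side is
  symmetric in \<open>F\<close> and \<open>V\<close>, the factor k on the right is not.\<close>

lemma green_hpoly:
  fixes F V :: "real^'n::finite \<Rightarrow> real"
  assumes F: "F \<in> hpoly l" and V: "V \<in> hpoly k" and harm: "\<And>x. laplacian V x = 0"
  shows "(\<integral>y. (\<Sum>i\<in>UNIV. partial_deriv i F y * partial_deriv i V y) \<partial>sphere_measure)
    = (real CARD('n) - 2 + real l + real k) * real k * (\<integral>y. F y * V y \<partial>sphere_measure)"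
proof (cases k)
  case 0
  then show ?thesis using hpoly_0_partial_deriv[of V] V by simp
next
  case (Suc m)
  have dV: "partial_deriv i V \<in> hpoly m" for i using hpoly_partial_deriv V Suc by blast
  define G where "G i = (\<lambda>x. F x * partial_deriv i V x)" for i
  have Gp: "G i \<in> hpoly (l + m)" for i unfolding G_def by (rule hpoly_mult[OF F dV])
  have dG: "partial_deriv i (G i) y = partial_deriv i F y * partial_deriv i V y + F y * partial_deriv i (partial_deriv i V) y" for i y
    unfolding G_def by (rule partial_deriv_mult[OF hpoly_differentiable[OF F] hpoly_differentiable[OF dV]])
  have "(\<Sum>i\<in>UNIV. partial_deriv i F y * partial_deriv i V y) = (\<Sum>i\<in>UNIV. partial_deriv i (G i) y)" for y
    using harm[of y] by (simp add: dG sum.distrib sum_distrib_left[symmetric] laplacian_def)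
  then have "(\<integral>y. (\<Sum>i\<in>UNIV. partial_deriv i F y * partial_deriv i V y) \<partial>sphere_measure)
      = (\<Sum>i\<in>UNIV. (\<integral>y. partial_deriv i (G i) y \<partial>sphere_measure))"
    by (simp add: Bochner_Integration.integral_sum integrable_sphere_measure continuous_partial_deriv_hpoly[OF Gp])
  also have "\<dots> = (real CARD('n) - 1 + real (l + m)) * (\<Sum>i\<in>UNIV. (\<integral>y. y $ i * G i y \<partial>sphere_measure))"
    by (simp only: integral_partial_deriv_hpoly[OF Gp] sum_distrib_left)
  also have "(\<Sum>i\<in>UNIV. (\<integral>y. y $ i * G i y \<partial>sphere_measure)) = (\<integral>y. (\<Sum>i\<in>UNIV. y $ i * G i y) \<partial>sphere_measure)"
    by (rule Bochner_Integration.integral_sum[symmetric])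
       (intro integrable_sphere_measure continuous_intros hpoly_continuous[OF Gp])
  also have "(\<lambda>y. \<Sum>i\<in>UNIV. y $ i * G i y) = (\<lambda>y. real k * (F y * V y))"
  proof
    fix y
    have "(\<Sum>i\<in>UNIV. y $ i * G i y) = F y * (\<Sum>i\<in>UNIV. y $ i * partial_deriv i V y)"
      by (simp add: G_def sum_distrib_left algebra_simps)
    then show "(\<Sum>i\<in>UNIV. y $ i * G i y) = real k * (F y * V y)" by (simp add: euler_hpoly[OF V])
  qed
  also have "(\<integral>y. real k * (F y * V y) \<partial>sphere_measure) = real k * (\<integral>y. F y * V y \<partial>sphere_measure)" by simp
  finally show ?thesis unfolding Suc by (simp add: algebra_simps)
qed

text \<open>Exchanging the two functions in \<open>green_hpoly\<close> and subtracting leaves the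
  factor (n - 2 + l + k)(k - l), which is nonzero for distinct degrees when n \<ge> 2.\<close>

lemma spherical_harmonics_orthogonal:
  fixes Y W :: "real^'n::finite \<Rightarrow> real"
  assumes n: "CARD('n) \<ge> 2" and Y: "Y \<in> spherical_harmonics l" and W: "W \<in> spherical_harmonics k" and "l \<noteq> k"
  shows "(\<integral>y. Y y * W y \<partial>sphere_measure) = 0"
proof -
  have "(real CARD('n) - 2 + real l + real k) * real k * (\<integral>y. Y y * W y \<partial>sphere_measure)
     = (real CARD('n) - 2 + real k + real l) * real l * (\<integral>y. W y * Y y \<partial>sphere_measure)"
    using green_hpoly[of Y l W k] green_hpoly[of W k Y l] Y W
    by (simp add: spherical_harmonics_eq mult.commute[of "partial_deriv _ Y _"])
  then have "(real CARD('n) - 2 + real l + real k) * (real k - real l) * (\<integral>y. Y y * W y \<partial>sphere_measure) = 0"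
    by (simp add: algebra_simps)
  moreover have "real CARD('n) - 2 + real l + real k > 0" using n \<open>l \<noteq> k\<close> by linarith
  ultimately show ?thesis using \<open>l \<noteq> k\<close> by simp
qed

lemma spherical_harmonics_hpoly: "Y \<in> spherical_harmonics l \<Longrightarrow> Y \<in> hpoly l"
  by (simp add: spherical_harmonics_eq)

lemma spherical_harmonics_continuous: "Y \<in> spherical_harmonics l \<Longrightarrow> continuous_on S Y"
  by (rule hpoly_continuous[OF spherical_harmonics_hpoly])

lemma laplacian_hpoly_linear:
  assumes "F \<in> hpoly k" "G \<in> hpoly k"
  shows "laplacian (\<lambda>x. a * F x + b * G x) x = a * laplacian F x + b * laplacian G x"
proof -
  have dF: "partial_deriv i (\<lambda>x. a * F x + b * G x) = (\<lambda>x. a * partial_deriv i F x + b * partial_deriv i G x)" for i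
    by (rule ext) (rule partial_deriv_linear(2)[OF hpoly_differentiable[OF assms(1)] hpoly_differentiable[OF assms(2)]])
  have dd: "partial_deriv i H differentiable (at x)" if "H \<in> hpoly k" for H :: "real^'a \<Rightarrow> real" and i
  proof (cases k)
    case 0
    then have "partial_deriv i H = (\<lambda>x. 0)" using that hpoly_0_partial_deriv by auto
    then show ?thesis by simp
  next
    case (Suc m)
    then show ?thesis using hpoly_differentiable[OF hpoly_partial_deriv] that by blast
  qed
  show ?thesis
    by (simp add: laplacian_def dF partial_deriv_linear(2)[OF dd[OF assms(1)] dd[OF assms(2)]] sum.distrib sum_distrib_left)
qed

lemma spherical_harmonics_linear:
  "Y \<in> spherical_harmonics l \<Longrightarrow> W \<in> spherical_harmonics l \<Longrightarrow> (\<lambda>x. a * Y x + b * W x) \<in> spherical_harmonics l"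
  using laplacian_hpoly_linear[of Y l W a b] by (simp add: spherical_harmonics_eq hpoly_linear)

lemma spherical_harmonics_zero: "(\<lambda>x. 0) \<in> spherical_harmonics l"
proof -
  have "(\<lambda>x. 0) = hom (\<lambda>_. 0) l" by (simp add: hom_def fun_eq_iff)
  then have "(\<lambda>x::real^'a. 0) \<in> hpoly l" by (auto simp: hpoly_def)
  then show ?thesis using laplacian_hpoly_linear[of "\<lambda>x::real^'a. 0" l "\<lambda>x. 0" 0 0] by (simp add: spherical_harmonics_eq)
qed

lemma spherical_harmonics_sum:
  "finite I \<Longrightarrow> (\<And>i. i \<in> I \<Longrightarrow> Y i \<in> spherical_harmonics l) \<Longrightarrow> (\<lambda>x. \<Sum>i\<in>I. a i * Y i x) \<in> spherical_harmonics l"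
proof (induction I rule: finite_induct)
  case empty
  then show ?case by (simp add: spherical_harmonics_zero)
next
  case (insert i I)
  then show ?case using spherical_harmonics_linear[of "Y i" l "\<lambda>x. \<Sum>i\<in>I. a i * Y i x" "a i" 1] by simp
qed

text \<open>On the sphere the factor \<open>|x|\<^sup>2\<close> of the Fischer decomposition disappears.\<close>

lemma fischer_decomposition:
  fixes c :: "('n::finite \<Rightarrow> nat) \<Rightarrow> real"
  obtains H where "\<And>l. H l \<in> spherical_harmonics l" "\<And>l. l > k \<Longrightarrow> H l = (\<lambda>x. 0)"
    "\<And>y. y \<in> sphere 0 1 \<Longrightarrow> hom c k y = (\<Sum>l\<le>k. H l y)"
proof -
  have "\<exists>H. (\<forall>l. H l \<in> spherical_harmonics l) \<and> (\<forall>l>k. H l = (\<lambda>x. 0)) \<and> (\<forall>y\<in>sphere 0 1. hom c k y = (\<Sum>l\<le>k. H l y))"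
  proof (induction k arbitrary: c rule: less_induct)
    case (less k)
    define v where "v = ilap (lap c)"
    define h where "h = (\<lambda>\<alpha>. c \<alpha> - rsq v \<alpha>)"
    have "lap h = (\<lambda>\<alpha>. 0)" by (simp add: h_def lap_diff v_def fun_eq_iff)
    then have hh: "hom h k \<in> spherical_harmonics k"
      by (auto simp: spherical_harmonics_eq hpolyI laplacian_hom hom_def)
    show ?case
    proof (cases "k < 2")
      case True
      then have "hom c k y = hom h k y" for y by (simp add: h_def hom_diff hom_rsq_low)
      define H where "H l = (if l = k then hom h k else (\<lambda>x. 0))" for l
      have "H l \<in> spherical_harmonics l" for l using hh spherical_harmonics_zero by (cases "l = k") (simp_all add: H_def)
      moreover have "H l = (\<lambda>x. 0)" if "l > k" for l using that by (simp add: H_def)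
      moreover have "(\<Sum>l\<le>k. H l y) = hom h k y" for y
        by (subst sum.mono_neutral_right[of "{..k}" "{k}"]) (auto simp: H_def)
      ultimately show ?thesis using \<open>\<And>y. hom c k y = hom h k y\<close> by (intro exI[of _ H]) auto
    next
      case False
      then obtain m where k: "k = m + 2" by (metis add.commute le_Suc_ex not_less)
      obtain H where H: "\<forall>l. H l \<in> spherical_harmonics l" "\<forall>l>m. H l = (\<lambda>x. 0)" "\<forall>y\<in>sphere 0 1. hom v m y = (\<Sum>l\<le>m. H l y)"
        using less[of m v] k by auto
      have "hom c k y = hom h k y + (\<Sum>l\<le>m. H l y)" if "y \<in> sphere 0 1" for y
        using that H(3) hom_rsq[of v m y] by (simp add: h_def hom_diff k)
      moreover have "(\<Sum>l\<le>k. (if l = k then hom h k else H l) y) = hom h k y + (\<Sum>l\<le>m. H l y)" for y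
        using H(2) by (simp add: k atMost_Suc cong: if_cong)
      ultimately show ?thesis
        using hh H k by (intro exI[of _ "\<lambda>l. if l = k then hom h k else H l"]) auto
    qed
  qed
  then show ?thesis using that by blast
qed

text \<open>On the sphere a form of degree k is a sum of harmonics of degree at most k, all
  orthogonal to those of degree l > k.\<close>

lemma spherical_harmonics_orthogonal_hom:
  fixes W :: "real^'n::finite \<Rightarrow> real"
  assumes n: "CARD('n) \<ge> 2" and W: "W \<in> spherical_harmonics l" and "k < l"
  shows "(\<integral>y. hom c k y * W y \<partial>sphere_measure) = 0"
proof -
  obtain H :: "nat \<Rightarrow> real^'n \<Rightarrow> real" where H: "\<And>l. H l \<in> spherical_harmonics l" "\<And>y. y \<in> sphere 0 1 \<Longrightarrow> hom c k y = (\<Sum>l\<le>k. H l y)"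
    by (rule fischer_decomposition[of k c]) (rule that; assumption)
  have "(\<integral>y. hom c k y * W y \<partial>sphere_measure) = (\<integral>y. (\<Sum>j\<le>k. H j y * W y) \<partial>sphere_measure)"
    by (intro Bochner_Integration.integral_cong refl) (simp add: space_sphere_measure H(2) sum_distrib_right)
  also have "\<dots> = (\<Sum>j\<le>k. (\<integral>y. H j y * W y \<partial>sphere_measure))"
    by (intro Bochner_Integration.integral_sum integrable_sphere_measure continuous_intros
        spherical_harmonics_continuous[OF H(1)] spherical_harmonics_continuous[OF W])
  also have "\<dots> = 0"
    using \<open>k < l\<close> by (intro sum.neutral ballI spherical_harmonics_orthogonal[OF n H(1) W]) auto
  finally show ?thesis .
qed

subsection \<open>Orthogonal projections\<close>

abbreviation sip :: "(real^'n::finite \<Rightarrow> real) \<Rightarrow> (real^'n \<Rightarrow> real) \<Rightarrow> real" where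
  "sip v w \<equiv> (\<integral>y. v y * w y \<partial>sphere_measure)"

lemma L2_sphere_measurable: "v \<in> L2_sphere \<Longrightarrow> v \<in> borel_measurable sphere_measure"
  by (simp add: L2_sphere_def)

lemma L2_sphere_integrable_mult:
  assumes "v \<in> L2_sphere" "w \<in> L2_sphere"
  shows "integrable sphere_measure (\<lambda>y. v y * w y)"
proof (rule Bochner_Integration.integrable_bound)
  show "integrable sphere_measure (\<lambda>y. (v y)\<^sup>2 + (w y)\<^sup>2)" using assms by (simp add: L2_sphere_def)
  show "(\<lambda>y. v y * w y) \<in> borel_measurable sphere_measure"
    using assms by (intro borel_measurable_times L2_sphere_measurable)
  have "\<bar>a * b\<bar> \<le> a\<^sup>2 + b\<^sup>2" for a b :: real
    using sum_squares_bound[of "\<bar>a\<bar>" "\<bar>b\<bar>"] mult_nonneg_nonneg[OF abs_ge_zero[of a] abs_ge_zero[of b]]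
    unfolding abs_mult power2_abs by linarith
  then show "AE y in sphere_measure. norm (v y * w y) \<le> norm ((v y)\<^sup>2 + (w y)\<^sup>2)" by simp
qed

lemma L2_sphere_linear:
  assumes "v \<in> L2_sphere" "w \<in> L2_sphere"
  shows "(\<lambda>y. a * v y + b * w y) \<in> L2_sphere"
proof -
  have "(a * v y + b * w y)\<^sup>2 = a\<^sup>2 * (v y)\<^sup>2 + b\<^sup>2 * (w y)\<^sup>2 + (2 * a * b) * (v y * w y)" for y
    by (simp add: power2_eq_square algebra_simps)
  moreover have "integrable sphere_measure (\<lambda>y. a\<^sup>2 * (v y)\<^sup>2 + b\<^sup>2 * (w y)\<^sup>2 + (2 * a * b) * (v y * w y))"
    using assms L2_sphere_integrable_mult[OF assms] unfolding L2_sphere_def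
    by (intro Bochner_Integration.integrable_add integrable_mult_right) auto
  ultimately show ?thesis using assms unfolding L2_sphere_def by auto
qed

lemma L2_sphere_diff: "v \<in> L2_sphere \<Longrightarrow> w \<in> L2_sphere \<Longrightarrow> (\<lambda>y. v y - w y) \<in> L2_sphere"
  using L2_sphere_linear[of v w 1 "-1"] by simp

lemma continuous_L2_sphere: "continuous_on (sphere 0 1) g \<Longrightarrow> g \<in> L2_sphere"
  by (auto simp: L2_sphere_def intro!: borel_measurable_sphere_measure integrable_sphere_measure continuous_intros)

lemma L2_sphere_norm_nonneg [simp]: "L2_sphere_norm v \<ge> 0"
  by (simp add: L2_sphere_norm_def)

lemma L2_sphere_norm_power2: "(L2_sphere_norm v)\<^sup>2 = sip v v"
  by (simp add: L2_sphere_norm_def power2_eq_square[of "v _"])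

lemma sip_linear_left:
  assumes "v \<in> L2_sphere" "w \<in> L2_sphere" "u \<in> L2_sphere"
  shows "sip (\<lambda>y. a * v y + b * w y) u = a * sip v u + b * sip w u"
  using L2_sphere_integrable_mult[OF assms(1,3)] L2_sphere_integrable_mult[OF assms(2,3)]
  by (simp add: distrib_right mult.assoc)

lemma sip_diff_left:
  assumes "v \<in> L2_sphere" "w \<in> L2_sphere" "u \<in> L2_sphere"
  shows "sip (\<lambda>y. v y - w y) u = sip v u - sip w u"
  using sip_linear_left[OF assms, of 1 "-1"] by simp

lemma sip_commute: "sip v w = sip w v"
  by (simp add: mult.commute)

lemma sip_cong:
  assumes "\<And>y. y \<in> sphere 0 1 \<Longrightarrow> v y = v' y" "\<And>y. y \<in> sphere 0 1 \<Longrightarrow> w y = w' y"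
  shows "sip v w = sip v' w'"
  by (rule Bochner_Integration.integral_cong) (simp_all add: assms space_sphere_measure)

lemma sip_Cauchy_Schwarz:
  assumes v: "v \<in> L2_sphere" and w: "w \<in> L2_sphere"
  shows "\<bar>sip v w\<bar> \<le> L2_sphere_norm v * L2_sphere_norm w"
proof -
  define a b c where abc: "a = sip v v" "b = sip v w" "c = sip w w"
  have a0: "a \<ge> 0" and c0: "c \<ge> 0" unfolding abc by (simp_all add: L2_sphere_norm_power2[symmetric])
  have q: "0 \<le> a + 2 * t * b + t\<^sup>2 * c" for t
  proof -
    let ?z = "\<lambda>y. 1 * v y + t * w y"
    have z: "?z \<in> L2_sphere" by (rule L2_sphere_linear[OF v w])
    have "0 \<le> sip ?z ?z" by (simp add: L2_sphere_norm_power2[symmetric])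
    also have "\<dots> = 1 * sip v ?z + t * sip w ?z" by (rule sip_linear_left[OF v w z])
    also have "sip v ?z = 1 * sip v v + t * sip w v" by (subst sip_commute) (rule sip_linear_left[OF v w v])
    also have "sip w ?z = 1 * sip v w + t * sip w w" by (subst sip_commute) (rule sip_linear_left[OF v w w])
    finally show ?thesis by (simp add: abc sip_commute[of w v] power2_eq_square algebra_simps)
  qed
  have "b\<^sup>2 \<le> a * c"
  proof (cases "c = 0")
    case True
    have "b = 0"
    proof (rule ccontr)
      assume "b \<noteq> 0"
      \<comment> \<open>With c = 0 the quadratic is affine in t, and this value of t makes it equal
        to -1.\<close>
      then have "2 * (- (a + 1) / (2 * b)) * b = - (a + 1)" by (simp add: field_simps)
      then show False using q[of "- (a + 1) / (2 * b)"] True by simp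
    qed
    then show ?thesis using True by simp
  next
    case False
    then have "c > 0" using c0 by simp
    have "2 * (- b / c) * b + (- b / c)\<^sup>2 * c = - (b\<^sup>2 / c)" using False by (simp add: power2_eq_square field_simps)
    then have "0 \<le> a - b\<^sup>2 / c" using q[of "- b / c"] by linarith
    then show ?thesis using \<open>c > 0\<close> by (simp add: field_simps)
  qed
  then have "sqrt (b\<^sup>2) \<le> sqrt (a * c)" by (rule real_sqrt_le_mono)
  then show ?thesis by (simp add: abc real_sqrt_mult L2_sphere_norm_def power2_eq_square)
qed

text \<open>Gram-Schmidt, one monomial at a time: the members of \<open>V\<close> that can be
  written without the monomial \<open>i\<close> form a subspace of codimension at most one, to which
  the induction hypothesis applies.\<close>

lemma subspace_projection_exists:
  fixes V :: "(real^'n::finite \<Rightarrow> real) set"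
  assumes "finite I"
    and "V \<subseteq> {\<lambda>x. \<Sum>\<alpha>\<in>I. c \<alpha> * monomial \<alpha> x | c. True}" "(\<lambda>x. 0) \<in> V"
    and "\<And>F G a b. F \<in> V \<Longrightarrow> G \<in> V \<Longrightarrow> (\<lambda>x. a * F x + b * G x) \<in> V"
    and "\<And>F. F \<in> V \<Longrightarrow> continuous_on (sphere 0 1) F"
    and "v \<in> L2_sphere"
  shows "\<exists>p\<in>V. \<forall>w\<in>V. sip (\<lambda>y. v y - p y) w = 0"
  using assms
proof (induction I arbitrary: V v rule: finite_induct)
  case empty
  then have "w = (\<lambda>x. 0)" if "w \<in> V" for w using that by auto
  then have "sip (\<lambda>y. v y - 0) w = 0" if "w \<in> V" for w by (subst \<open>\<And>w. w \<in> V \<Longrightarrow> w = (\<lambda>x. 0)\<close>[OF that]) simp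
  then show ?case using empty.prems(2) by (intro bexI[of _ "\<lambda>x. 0"] ballI)
next
  case (insert i I)
  note lin = insert.prems(3)
  have L2: "F \<in> V \<Longrightarrow> F \<in> L2_sphere" for F by (rule continuous_L2_sphere[OF insert.prems(4)])
  define S where "S = {\<lambda>x. \<Sum>\<alpha>\<in>I. c \<alpha> * monomial \<alpha> x | c. True}"
  show ?case
  proof (cases "V \<subseteq> S")
    case True
    show ?thesis
      by (rule insert.IH[OF True[unfolded S_def] insert.prems(2-5)])
  next
    case False
    then obtain w0 where w0: "w0 \<in> V" "w0 \<notin> S" by blast
    have rep: "\<exists>c. F = (\<lambda>x. c i * monomial i x + (\<Sum>\<alpha>\<in>I. c \<alpha> * monomial \<alpha> x))" if "F \<in> V" for F
      using insert.prems(1) that insert.hyps by auto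
    obtain c0 where c0: "w0 = (\<lambda>x. c0 i * monomial i x + (\<Sum>\<alpha>\<in>I. c0 \<alpha> * monomial \<alpha> x))"
      using rep[OF w0(1)] by blast
    have "c0 i \<noteq> 0" using w0(2) c0 by (auto simp: S_def)
    let ?V = "V \<inter> S"
    have Slin: "(\<lambda>x. a * F x + b * G x) \<in> S" if "F \<in> S" "G \<in> S" for F G a b
    proof -
      obtain c d where "F = (\<lambda>x. \<Sum>\<alpha>\<in>I. c \<alpha> * monomial \<alpha> x)" "G = (\<lambda>x. \<Sum>\<alpha>\<in>I. d \<alpha> * monomial \<alpha> x)"
        using \<open>F \<in> S\<close> \<open>G \<in> S\<close> by (auto simp: S_def)
      then show ?thesis
        unfolding S_def by (auto intro!: exI[of _ "\<lambda>\<alpha>. a * c \<alpha> + b * d \<alpha>"] simp: fun_eq_iff sum_distrib_left sum.distrib algebra_simps)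
    qed
    have zS: "(\<lambda>x. 0) \<in> S" by (auto simp: S_def intro!: exI[of _ "\<lambda>_. 0"])
    have IH: "\<exists>p\<in>?V. \<forall>w\<in>?V. sip (\<lambda>y. u y - p y) w = 0" if "u \<in> L2_sphere" for u
    proof (rule insert.IH)
      show "?V \<subseteq> {\<lambda>x. \<Sum>\<alpha>\<in>I. c \<alpha> * monomial \<alpha> x |c. True}" by (auto simp: S_def)
    qed (use insert.prems(2,4) zS Slin lin that in auto)
    obtain p where p: "p \<in> ?V" "\<forall>w\<in>?V. sip (\<lambda>y. v y - p y) w = 0" using IH[OF insert.prems(5)] by blast
    obtain q where q: "q \<in> ?V" "\<forall>w\<in>?V. sip (\<lambda>y. w0 y - q y) w = 0" using IH[OF L2[OF w0(1)]] by blast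
    \<comment> \<open>Orthogonal to the smaller subspace and, together with it, spanning
      \<open>V\<close>: the new direction of Gram-Schmidt.\<close>
    define e where "e = (\<lambda>y. w0 y - q y)"
    have eV: "e \<in> V" using lin[OF w0(1), of q 1 "-1"] q(1) by (simp add: e_def)
    have dec: "\<exists>b. \<exists>u\<in>?V. w = (\<lambda>x. b * e x + 1 * u x)" if wV: "w \<in> V" for w
    proof -
      obtain c where c: "w = (\<lambda>x. c i * monomial i x + (\<Sum>\<alpha>\<in>I. c \<alpha> * monomial \<alpha> x))" using rep[OF wV] by blast
      define b where "b = c i / c0 i"
      have "(\<lambda>x. 1 * w x + (- b) * w0 x) = (\<lambda>x. \<Sum>\<alpha>\<in>I. (c \<alpha> - b * c0 \<alpha>) * monomial \<alpha> x)"
        using \<open>c0 i \<noteq> 0\<close>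
        by (simp add: c c0 fun_eq_iff left_diff_distrib sum_subtractf distrib_left sum_distrib_left mult.assoc) (simp add: b_def sum_negf)
      then have "(\<lambda>x. 1 * w x + (- b) * w0 x) \<in> S" by (auto simp: S_def)
      then have "(\<lambda>x. 1 * w x + (- b) * w0 x) \<in> ?V" using lin[OF wV w0(1)] by blast
      then have "(\<lambda>x. 1 * (1 * w x + (- b) * w0 x) + b * q x) \<in> ?V" using lin Slin q(1) by blast
      moreover have "w = (\<lambda>x. b * e x + 1 * (1 * (1 * w x + (- b) * w0 x) + b * q x))"
        by (auto simp: e_def fun_eq_iff algebra_simps)
      ultimately show ?thesis
        by (intro exI[of _ b] bexI[of _ "\<lambda>x. 1 * (1 * w x + (- b) * w0 x) + b * q x"])
    qed
    \<comment> \<open>If \<open>e\<close> has norm zero, all pairings with it vanish by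
      Cauchy-Schwarz, and the coefficient 0 is correct.\<close>
    define a where "a = (if sip e e = 0 then 0 else sip (\<lambda>y. v y - p y) e / sip e e)"
    define P where "P = (\<lambda>y. 1 * p y + a * e y)"
    have PV: "P \<in> V" unfolding P_def using lin p(1) eV by blast
    note Lv = L2_sphere_diff[OF insert.prems(5) L2]
    have eV': "e \<in> L2_sphere" by (rule L2[OF eV])
    have "sip (\<lambda>y. v y - p y) e - a * sip e e = 0"
    proof (cases "sip e e = 0")
      case True
      have "L2_sphere_norm e = 0" using True L2_sphere_norm_power2[of e] by simp
      then have "sip (\<lambda>y. v y - p y) e = 0" using sip_Cauchy_Schwarz[OF Lv eV'] p(1) by fastforce
      then show ?thesis using True by simp
    qed (simp add: a_def)
    have split: "sip (\<lambda>y. v y - P y) w = sip (\<lambda>y. v y - p y) w - a * sip e w" if "w \<in> V" for w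
      using sip_linear_left[OF Lv eV' L2[OF that], of p 1 "-a"] p(1) by (simp add: P_def algebra_simps)
    have "sip (\<lambda>y. v y - P y) w = 0" if w: "w \<in> V" for w
    proof -
      obtain b u where u: "u \<in> ?V" and w': "w = (\<lambda>x. b * e x + 1 * u x)" using dec[OF w] by blast
      have "sip (\<lambda>y. v y - P y) u = 0" using split[of u] u p(2) q(2) by (simp add: e_def)
      moreover have "sip (\<lambda>y. v y - P y) e = 0" using split[OF eV] \<open>_ - a * sip e e = 0\<close> by simp
      moreover have "sip w (\<lambda>y. v y - P y) = b * sip e (\<lambda>y. v y - P y) + 1 * sip u (\<lambda>y. v y - P y)"
        unfolding w' by (rule sip_linear_left[OF eV' L2 Lv[OF PV]]) (use u in auto)
      ultimately show ?thesis by (simp add: sip_commute[of w] sip_commute[of e] sip_commute[of u])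
    qed
    then show ?thesis using PV by blast
  qed
qed

lemma hpoly_zero_if_zero_on_sphere:
  assumes "F \<in> hpoly k" "\<And>y. y \<in> sphere 0 1 \<Longrightarrow> F y = 0"
  shows "F x = 0"
proof -
  obtain y :: "real^'a" where y: "norm y = 1" "x = norm x *\<^sub>R y"
  proof (cases "x = 0")
    case True
    then show ?thesis using that[of "axis undefined 1"] by (simp add: norm_axis_1)
  next
    case False
    then show ?thesis using that[of "sgn x"] by (simp add: norm_sgn sgn_div_norm)
  qed
  have "F x = norm x ^ k * F y" using y(2) hpoly_scaleR[OF assms(1)] by metis
  then show ?thesis using assms(2)[of y] y(1) by simp
qed

text \<open>The difference is orthogonal to itself, hence zero almost everywhere on the sphere,
  everywhere on it by continuity, and on the whole space by homogeneity. The definite description in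
  \<open>sph_proj\<close> asks for equality as functions on the whole space.\<close>

lemma sph_proj_unique:
  assumes Y: "Y \<in> spherical_harmonics l" and Z: "Z \<in> spherical_harmonics l"
    and eq: "\<And>W. W \<in> spherical_harmonics l \<Longrightarrow> sip Y W = sip Z W"
  shows "Y = Z"
proof -
  define D where "D = (\<lambda>y. 1 * Y y + (-1) * Z y)"
  have D: "D \<in> spherical_harmonics l" unfolding D_def by (rule spherical_harmonics_linear[OF Y Z])
  note L = continuous_L2_sphere[OF spherical_harmonics_continuous]
  have "sip D D = 0" unfolding D_def using sip_linear_left[OF L[OF Y] L[OF Z] L[OF D], of 1 "-1"] eq[OF D] by (simp add: D_def)
  then have "AE y in sphere_measure. D y * D y = 0"
    by (subst (asm) integral_nonneg_eq_0_iff_AE) (auto intro: L2_sphere_integrable_mult L[OF D])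
  then have "D y * D y = 0" if "y \<in> sphere 0 1" for y
    using that by (rule continuous_zero_if_AE[rotated]) (intro continuous_intros spherical_harmonics_continuous[OF D])
  then have "D x = 0" for x using hpoly_zero_if_zero_on_sphere[OF spherical_harmonics_hpoly[OF D]] by auto
  then show ?thesis by (auto simp: D_def fun_eq_iff)
qed

lemma sph_proj:
  assumes v: "v \<in> L2_sphere"
  shows "sph_proj l v \<in> spherical_harmonics l"
    and "W \<in> spherical_harmonics l \<Longrightarrow> sip (sph_proj l v) W = sip v W"
proof -
  note L = continuous_L2_sphere[OF spherical_harmonics_continuous]
  have sub: "spherical_harmonics l \<subseteq> {\<lambda>x. \<Sum>\<alpha>\<in>idx l. c \<alpha> * monomial \<alpha> x | c. True}"
    unfolding spherical_harmonics_eq hpoly_def hom_def[abs_def] by blast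
  have "\<exists>p\<in>spherical_harmonics l. \<forall>w\<in>spherical_harmonics l. sip (\<lambda>y. v y - p y) w = 0"
    by (rule subspace_projection_exists[OF finite_idx sub spherical_harmonics_zero spherical_harmonics_linear
        spherical_harmonics_continuous v])
  then obtain p where p: "p \<in> spherical_harmonics l" "\<forall>w\<in>spherical_harmonics l. sip (\<lambda>y. v y - p y) w = 0" ..
  have *: "sip Y W = sip v W" if "Y \<in> spherical_harmonics l" "W \<in> spherical_harmonics l"
    "\<forall>w\<in>spherical_harmonics l. sip (\<lambda>y. v y - Y y) w = 0" for Y W
    using that sip_diff_left[OF v L[OF that(1)] L[OF that(2)]] by simp
  have "\<exists>!Y. Y \<in> spherical_harmonics l \<and> (\<forall>W\<in>spherical_harmonics l. sip (\<lambda>y. v y - Y y) W = 0)"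
  proof (rule ex1I[of _ p])
    fix Y assume Y: "Y \<in> spherical_harmonics l \<and> (\<forall>W\<in>spherical_harmonics l. sip (\<lambda>y. v y - Y y) W = 0)"
    show "Y = p" by (rule sph_proj_unique[of Y l]) (use Y p * in auto)
  qed (use p in blast)
  then have "sph_proj l v \<in> spherical_harmonics l \<and> (\<forall>W\<in>spherical_harmonics l. sip (\<lambda>y. v y - sph_proj l v y) W = 0)"
    unfolding sph_proj_def by (rule theI')
  then show "sph_proj l v \<in> spherical_harmonics l" "W \<in> spherical_harmonics l \<Longrightarrow> sip (sph_proj l v) W = sip v W"
    using * by auto
qed

lemma sph_proj_eqI:
  assumes "v \<in> L2_sphere" "Y \<in> spherical_harmonics l"
    "\<And>W. W \<in> spherical_harmonics l \<Longrightarrow> sip v W = sip Y W"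
  shows "sph_proj l v = Y"
  by (rule sph_proj_unique[of _ l]) (simp_all add: sph_proj assms)

lemma sph_proj_cong:
  assumes "\<And>y. y \<in> sphere 0 1 \<Longrightarrow> v y = w y"
  shows "sph_proj l v = sph_proj l w"
proof -
  have "sip (\<lambda>y. v y - Y y) W = sip (\<lambda>y. w y - Y y) W" for Y W
    by (rule sip_cong) (simp_all add: assms)
  then show ?thesis by (simp add: sph_proj_def)
qed

text \<open>Test the hypothesis with the projection itself and cancel one factor of its
  norm.\<close>

lemma L2_norm_sph_proj_le:
  assumes v: "v \<in> L2_sphere" and "E \<ge> 0"
    and "\<And>W. W \<in> spherical_harmonics l \<Longrightarrow> \<bar>sip v W\<bar> \<le> E * L2_sphere_norm W"
  shows "L2_sphere_norm (sph_proj l v) \<le> E"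
proof -
  let ?P = "sph_proj l v"
  have "(L2_sphere_norm ?P)\<^sup>2 = sip v ?P"
    using sph_proj[OF v] by (simp add: L2_sphere_norm_power2)
  also have "\<dots> \<le> E * L2_sphere_norm ?P" using assms(3)[OF sph_proj(1)[OF v]] by linarith
  finally have "L2_sphere_norm ?P * L2_sphere_norm ?P \<le> E * L2_sphere_norm ?P" by (simp add: power2_eq_square)
  then show ?thesis using L2_sphere_norm_nonneg[of ?P] \<open>E \<ge> 0\<close> by (metis mult_le_cancel_right not_less order_trans le_less)
qed

lemma abs_sip_le_sph_proj:
  assumes "v \<in> L2_sphere" "W \<in> spherical_harmonics l"
  shows "\<bar>sip v W\<bar> \<le> L2_sphere_norm (sph_proj l v) * L2_sphere_norm W"
proof -
  note L = continuous_L2_sphere[OF spherical_harmonics_continuous]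
  show ?thesis
    using sip_Cauchy_Schwarz[OF L[OF sph_proj(1)[OF assms(1), of l]] L[OF assms(2)]] 
    by (simp only: sph_proj(2)[OF assms])
qed

section \<open>The spaces on the sphere and on the ball\<close>

subsection \<open>Power series in the norm of the sphere\<close>

lemma component_le_1_sphere: "y \<in> sphere 0 1 \<Longrightarrow> \<bar>y $ i\<bar> \<le> 1" for y :: "real^'n::finite"
  using component_le_norm_cart[of y i] by simp

lemma summable_cubic_geometric: "summable (\<lambda>k. real (Suc k) ^ 3 * (1/2) ^ k)"
proof (rule summable_comparison_test_bigo)
  show "summable (\<lambda>k. norm ((3/4 :: real) ^ k))" by simp
  show "(\<lambda>k. real (Suc k) ^ 3 * (1/2) ^ k) \<in> O(\<lambda>k. (3/4) ^ k)" by real_asymp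
qed

lemma summable_bracket_geometric: "summable (\<lambda>l. sqrt (1 + (real l)\<^sup>2) powr (2 * s) * (1/4) ^ l)"
proof (rule summable_comparison_test_bigo)
  show "summable (\<lambda>k. norm ((1/2 :: real) ^ k))" by simp
  show "(\<lambda>l. sqrt (1 + (real l)\<^sup>2) powr (2 * s) * (1/4) ^ l) \<in> O(\<lambda>k. (1/2) ^ k)" by real_asymp
qed

definition tail_const :: real where
  "tail_const = (\<Sum>k. real (Suc k) ^ 3 * (1/2) ^ k)"

text \<open>Collects the losses in \<open>Z_bound\<close>: the tail of the power series, the passage
  from suprema to the L2 norm, and the summation of the weights against (1/4)^l.\<close>

definition Z_const :: "'n::finite itself \<Rightarrow> real \<Rightarrow> real" where
  "Z_const TYPE('n) s = tail_const *
     sqrt (measure (sphere_measure :: (real^'n) measure) (space sphere_measure) * (\<Sum>l. sqrt (1 + (real l)\<^sup>2) powr (2 * s) * (1/4) ^ l))"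

lemma tail_const_nonneg: "tail_const \<ge> 0"
  unfolding tail_const_def by (intro suminf_nonneg summable_cubic_geometric) simp

lemma L2_sphere_norm_le_sup:
  fixes g :: "real^'n::finite \<Rightarrow> real"
  assumes g: "continuous_on (sphere 0 1) g" and le: "\<And>y. y \<in> sphere 0 1 \<Longrightarrow> \<bar>g y\<bar> \<le> E" and "E \<ge> 0"
  shows "L2_sphere_norm g \<le> E * sqrt (measure (sphere_measure :: (real^'n) measure) (space sphere_measure))"
proof -
  have "(\<integral>y. (g y)\<^sup>2 \<partial>sphere_measure) \<le> (\<integral>y. E\<^sup>2 \<partial>(sphere_measure :: (real^'n) measure))"
  proof (rule integral_mono)
    show "integrable sphere_measure (\<lambda>y. (g y)\<^sup>2)" by (rule integrable_sphere_measure) (intro continuous_intros g)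
    show "(g y)\<^sup>2 \<le> E\<^sup>2" if "y \<in> space sphere_measure" for y
      using le[of y] that \<open>E \<ge> 0\<close> by (subst abs_le_square_iff[symmetric]) (simp add: space_sphere_measure)
  qed simp
  then have "L2_sphere_norm g \<le> sqrt (E\<^sup>2 * measure (sphere_measure :: (real^'n) measure) (space sphere_measure))"
    unfolding L2_sphere_norm_def by (intro real_sqrt_le_mono) (simp add: mult.commute)
  then show ?thesis using \<open>E \<ge> 0\<close> by (simp add: real_sqrt_mult)
qed

lemma aconv_2_if_cubic:
  assumes x: "0 < x" "x \<le> 1" and c: "\<And>k. A1 k c \<le> B * real (Suc k) ^ 3 * (x/4) ^ k" and "B \<ge> 0"
  shows "aconv c 2"
  unfolding aconv_def
proof (rule summable_comparison_test'[OF summable_mult[OF summable_cubic_geometric, of B]])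
  fix k
  have "A1 k c * 2 ^ k \<le> B * real (Suc k) ^ 3 * (x/4) ^ k * 2 ^ k" by (intro mult_right_mono c) simp
  also have "\<dots> = B * real (Suc k) ^ 3 * (x/2) ^ k" by (simp add: power_divide flip: power_mult_distrib)
      (simp add: field_simps flip: power_mult_distrib)
  also have "\<dots> \<le> B * real (Suc k) ^ 3 * (1/2) ^ k"
    using x \<open>B \<ge> 0\<close> by (intro mult_left_mono power_mono) auto
  finally show "norm (A1 k c * 2 ^ k) \<le> B * (real (Suc k) ^ 3 * (1/2) ^ k)" by (simp add: mult.assoc)
qed

lemma continuous_on_psum_sphere: "aconv c 2 \<Longrightarrow> continuous_on (sphere 0 1) (psum c)"
proof (rule continuous_on_if_differentiable)
  fix y :: "real^'a" assume "aconv c 2" "y \<in> sphere 0 1"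
  then show "psum c differentiable (at y)"
    using has_derivative_psum[of c 2 y] by (auto simp: differentiable_def)
qed

text \<open>The ratio x/4 is split as x * 1/2 * 1/2: the powers of x are to pay for the weight, one
  power (1/2)^l for the summation over l, and the last factor sums the cubic series.\<close>

lemma psum_tail_le:
  fixes c :: "('n::finite \<Rightarrow> nat) \<Rightarrow> real"
  assumes x: "0 < x" "x \<le> 1" and c: "\<And>k. A1 k c \<le> B * real (Suc k) ^ 3 * (x/4) ^ k" and B: "B \<ge> 0"
    and y: "y \<in> sphere 0 1"
  shows "\<bar>psum c y - (\<Sum>k<l. hom c k y)\<bar> \<le> B * x ^ l * (1/2) ^ l * tail_const"
proof -
  have a2: "aconv c 2" by (rule aconv_2_if_cubic[OF assms(1-4)])
  have le2: "\<bar>y $ i\<bar> \<le> 2" for i using component_le_1_sphere[OF y, of i] by linarith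
  let ?g = "\<lambda>k. real (Suc k) ^ 3 * (1/2) ^ k"
  let ?E = "B * x ^ l * (1/2) ^ l"
  have sh: "summable (\<lambda>k. hom c k y)" using psum_sums[OF a2 le2] by (rule sums_summable)
  have eq: "psum c y - (\<Sum>k<l. hom c k y) = (\<Sum>k. hom c (k + l) y)"
    unfolding psum_def by (rule suminf_minus_initial_segment[OF sh, symmetric])
  have le: "\<bar>hom c (k + l) y\<bar> \<le> ?E * ?g (k + l)" for k
  proof -
    have "\<bar>hom c (k + l) y\<bar> \<le> A1 (k + l) c" using abs_hom_le[OF component_le_1_sphere[OF y], of c "k + l"] by simp
    also have "\<dots> \<le> B * real (Suc (k + l)) ^ 3 * (x/4) ^ (k + l)" by (rule c)
    also have "(x/4) ^ (k + l) \<le> x ^ l * (1/2) ^ l * (1/2) ^ (k + l)"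
    proof -
      have "x / 4 = x * ((1/2) * (1/2))" by simp
      then have "(x/4) ^ (k + l) = x ^ (k + l) * ((1/2) ^ (k + l) * (1/2) ^ (k + l))"
        by (simp only: power_mult_distrib)
      then have "(x/4) ^ (k + l) = x ^ k * x ^ l * ((1/2) ^ k * (1/2) ^ l * (1/2) ^ (k + l))"
        by (simp only: power_add[of x] power_add[of "1/2" k l])
      also have "\<dots> \<le> 1 * x ^ l * (1 * (1/2) ^ l * (1/2) ^ (k + l))"
        using x by (intro mult_mono mult_right_mono power_le_one) auto
      finally show ?thesis by simp
    qed
    finally show ?thesis using B by (simp add: mult_left_mono mult.assoc mult.left_commute)
  qed
  have sg: "summable (\<lambda>k. ?E * ?g (k + l))"
    by (intro summable_mult summable_ignore_initial_segment summable_cubic_geometric)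
  have sa: "summable (\<lambda>k. \<bar>hom c (k + l) y\<bar>)"
    by (rule summable_comparison_test'[OF sg]) (use le in auto)
  have "\<bar>\<Sum>k. hom c (k + l) y\<bar> \<le> (\<Sum>k. \<bar>hom c (k + l) y\<bar>)" by (rule summable_rabs[OF sa])
  also have "\<dots> \<le> (\<Sum>k. ?E * ?g (k + l))" by (rule suminf_le[OF le sa sg])
  also have "\<dots> = ?E * (\<Sum>k. ?g (k + l))"
    by (intro suminf_mult summable_ignore_initial_segment summable_cubic_geometric)
  also have "(\<Sum>k. ?g (k + l)) \<le> tail_const"
    unfolding tail_const_def suminf_minus_initial_segment[OF summable_cubic_geometric]
    by (simp add: sum_nonneg)
  finally show ?thesis using eq B x by (simp add: mult_left_mono)
qed

lemma Z_term_nonneg: "0 \<le> r \<Longrightarrow> Z_term s r v l \<ge> 0"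
  by (simp add: Z_term_def)

lemma Z_term_cong: "(\<And>y. y \<in> sphere 0 1 \<Longrightarrow> v y = w y) \<Longrightarrow> Z_term s r v = Z_term s r w"
  unfolding Z_term_def[abs_def] using sph_proj_cong[of v w] by simp

lemma Z_norm_cong: "(\<And>y. y \<in> sphere 0 1 \<Longrightarrow> v y = w y) \<Longrightarrow> Z_norm s r v = Z_norm s r w"
  unfolding Z_norm_def using Z_term_cong[of v w] by simp

lemma Z_norm_nonneg: "0 \<le> r \<Longrightarrow> summable (Z_term s r v) \<Longrightarrow> Z_norm s r v \<ge> 0"
  unfolding Z_norm_def by (intro real_sqrt_ge_zero suminf_nonneg) (auto simp: Z_term_nonneg)

text \<open>After squaring, the factor x^l of \<open>psum_tail_le\<close> cancels the weight
  x^(-2l), and its factor (1/2)^l makes the sum over l converge for every real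
  \<open>s\<close>.\<close>

lemma Z_bound:
  fixes c :: "('n::finite \<Rightarrow> nat) \<Rightarrow> real"
  assumes n: "CARD('n) \<ge> 2" and x: "0 < x" "x \<le> 1" and c: "\<And>k. A1 k c \<le> B * real (Suc k) ^ 3 * (x/4) ^ k" and B: "B \<ge> 0"
  shows "summable (Z_term s x (psum c))" "Z_norm s x (psum c) \<le> B * Z_const TYPE('n) s"
proof -
  let ?S = "measure (sphere_measure :: (real^'n) measure) (space sphere_measure)"
  let ?g = "\<lambda>l. sqrt (1 + (real l)\<^sup>2) powr (2 * s) * (1/4) ^ l"
  have a2: "aconv c 2" by (rule aconv_2_if_cubic[OF x c B])
  note pc = continuous_on_psum_sphere[OF a2]
  note L = continuous_L2_sphere
  have E: "L2_sphere_norm (sph_proj l (psum c)) \<le> B * x ^ l * (1/2) ^ l * tail_const * sqrt ?S" (is "_ \<le> ?E l") for l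
  proof (rule L2_norm_sph_proj_le[OF L[OF pc]])
    show "?E l \<ge> 0" using B x tail_const_nonneg by (intro mult_nonneg_nonneg) auto
    fix W :: "real^'n \<Rightarrow> real" assume W: "W \<in> spherical_harmonics l"
    note Wc = spherical_harmonics_continuous[OF W]
    let ?h = "\<lambda>y. \<Sum>k<l. hom c k y"
    have hc: "continuous_on S ?h" for S by (intro continuous_intros hpoly_continuous[OF hpolyI])
    have tc: "continuous_on (sphere 0 1) (\<lambda>y. psum c y - ?h y)" by (intro continuous_intros pc hc)
    have "sip ?h W = (\<Sum>k<l. sip (hom c k) W)"
      unfolding sum_distrib_right
      by (intro Bochner_Integration.integral_sum integrable_sphere_measure continuous_intros hpoly_continuous[OF hpolyI] Wc)
    also have "\<dots> = 0" by (intro sum.neutral ballI spherical_harmonics_orthogonal_hom[OF n W]) simp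
    finally have "sip (psum c) W = sip (\<lambda>y. psum c y - ?h y) W"
      using sip_diff_left[OF L[OF pc] L[OF hc] L[OF Wc]] by simp
    also have "\<bar>\<dots>\<bar> \<le> L2_sphere_norm (\<lambda>y. psum c y - ?h y) * L2_sphere_norm W"
      by (rule sip_Cauchy_Schwarz[OF L[OF tc] L[OF Wc]])
    also have "\<dots> \<le> ?E l * L2_sphere_norm W"
    proof (rule mult_right_mono)
      show "L2_sphere_norm (\<lambda>y. psum c y - ?h y) \<le> ?E l"
        by (rule L2_sphere_norm_le_sup[OF tc psum_tail_le[OF x c B]])
           (use B x tail_const_nonneg in \<open>auto intro!: mult_nonneg_nonneg\<close>)
    qed simp
    finally show "\<bar>sip (psum c) W\<bar> \<le> ?E l * L2_sphere_norm W" .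
  qed
  define D where "D = (B * tail_const)\<^sup>2 * ?S"
  have le: "Z_term s x (psum c) l \<le> D * ?g l" for l
  proof -
    have "(L2_sphere_norm (sph_proj l (psum c)))\<^sup>2 \<le> (?E l)\<^sup>2" by (intro power_mono E) simp
    also have "\<dots> = D * x ^ (2 * l) * (1/4) ^ l"
    proof -
      have "(x ^ l)\<^sup>2 = x ^ (2 * l)" by (simp only: power_mult[symmetric] mult.commute)
      moreover have "(((1/2) ^ l)\<^sup>2 :: real) = ((1/2)\<^sup>2) ^ l" by (simp only: power_mult[symmetric] mult.commute)
      moreover have "((1/2)\<^sup>2 :: real) = 1/4" by (simp add: power2_eq_square)
      moreover have "(sqrt ?S)\<^sup>2 = ?S" by simp
      ultimately show ?thesis by (simp only: D_def power_mult_distrib ac_simps)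
    qed
    finally have "Z_term s x (psum c) l \<le> sqrt (1 + (real l)\<^sup>2) powr (2 * s) / x ^ (2 * l) * (D * x ^ (2 * l) * (1/4) ^ l)"
      unfolding Z_term_def using x by (intro mult_left_mono) auto
    also have "\<dots> = D * ?g l" using x by simp
    finally show ?thesis .
  qed
  have sg: "summable (\<lambda>l. D * ?g l)" by (intro summable_mult summable_bracket_geometric)
  show sm: "summable (Z_term s x (psum c))"
    by (rule summable_comparison_test'[OF sg, of 0]) (use le x in \<open>auto simp: Z_term_nonneg\<close>)
  have "(\<Sum>l. Z_term s x (psum c) l) \<le> D * (\<Sum>l. ?g l)"
    using suminf_le[OF le sm sg] suminf_mult[OF summable_bracket_geometric] by simp
  then have "Z_norm s x (psum c) \<le> sqrt (D * (\<Sum>l. ?g l))" unfolding Z_norm_def by (rule real_sqrt_le_mono)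
  also have "\<dots> = B * Z_const TYPE('n) s"
    using B tail_const_nonneg by (simp add: D_def Z_const_def real_sqrt_mult)
  finally show "Z_norm s x (psum c) \<le> B * Z_const TYPE('n) s" .
qed

lemma partial_sum_harmonic_combination:
  fixes c :: "('n::finite \<Rightarrow> nat) \<Rightarrow> real"
  shows "\<exists>Y\<in>harmonic_combinations. \<forall>y\<in>sphere 0 1. (\<Sum>k\<le>N. hom c k y) = Y y"
proof -
  have "\<forall>k. \<exists>H. (\<forall>l. H l \<in> spherical_harmonics l) \<and> (\<forall>l>k. H l = (\<lambda>x. 0)) \<and> (\<forall>y\<in>sphere 0 1. hom c k y = (\<Sum>l\<le>k. H l y))"
  proof
    fix k
    obtain H :: "nat \<Rightarrow> real^'n \<Rightarrow> real" where "\<And>l. H l \<in> spherical_harmonics l" "\<And>l. l > k \<Longrightarrow> H l = (\<lambda>x. 0)"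
      "\<And>y. y \<in> sphere 0 1 \<Longrightarrow> hom c k y = (\<Sum>l\<le>k. H l y)"
      by (rule fischer_decomposition[of k c]) (rule that; assumption)
    then show "\<exists>H. (\<forall>l. H l \<in> spherical_harmonics l) \<and> (\<forall>l>k. H l = (\<lambda>x. 0)) \<and> (\<forall>y\<in>sphere 0 1. hom c k y = (\<Sum>l\<le>k. H l y))"
      by blast
  qed
  from choice[OF this] obtain H where H: "\<And>k l. H k l \<in> spherical_harmonics l" "\<And>k l. l > k \<Longrightarrow> H k l = (\<lambda>x. 0)"
      "\<And>k y. y \<in> sphere 0 1 \<Longrightarrow> hom c k y = (\<Sum>l\<le>k. H k l y)"
    by blast
  define G where "G l = (\<lambda>y. \<Sum>k\<le>N. 1 * H k l y)" for l
  have "G l \<in> spherical_harmonics l" for l unfolding G_def by (rule spherical_harmonics_sum) (auto simp: H(1))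
  then have "(\<lambda>y. \<Sum>l\<le>N. G l y) \<in> harmonic_combinations" unfolding harmonic_combinations_def by blast
  moreover have "(\<Sum>k\<le>N. hom c k y) = (\<Sum>l\<le>N. G l y)" if "y \<in> sphere 0 1" for y
  proof -
    have "(\<Sum>k\<le>N. hom c k y) = (\<Sum>k\<le>N. \<Sum>l\<le>N. H k l y)"
    proof (rule sum.cong[OF refl])
      fix k assume "k \<in> {..N}"
      then show "hom c k y = (\<Sum>l\<le>N. H k l y)"
        unfolding H(3)[OF that] by (intro sum.mono_neutral_left) (auto simp: H(2))
    qed
    also have "\<dots> = (\<Sum>l\<le>N. \<Sum>k\<le>N. H k l y)" by (rule sum.swap)
    finally show ?thesis by (simp add: G_def)
  qed
  ultimately show ?thesis by (intro bexI[of _ "\<lambda>y. \<Sum>l\<le>N. G l y"] ballI)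
qed

text \<open>On the sphere the partial sums are harmonic combinations. The bound is assumed with a
  square while \<open>Z_bound\<close> tolerates a cube; beyond degree N the spare factor k + 1 is at
  least N + 1 and becomes the rate of convergence.\<close>

lemma psum_mem_Z_space:
  fixes c :: "('n::finite \<Rightarrow> nat) \<Rightarrow> real"
  assumes n: "CARD('n) \<ge> 2" and x: "0 < x" "x \<le> 1" and c: "\<And>k. A1 k c \<le> B * (real (Suc k))\<^sup>2 * (x/4) ^ k" and B: "B \<ge> 0"
  shows "psum c \<in> Z_space s x"
proof -
  have c3: "A1 k c \<le> B * real (Suc k) ^ 3 * (x/4) ^ k" for k
    by (rule order_trans[OF c]) (use B x in \<open>auto intro!: mult_mono power_increasing\<close>)
  have a2: "aconv c 2" by (rule aconv_2_if_cubic[OF x c3 B])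
  have "\<exists>Y\<in>harmonic_combinations. \<forall>y\<in>sphere 0 1. (\<Sum>k\<le>N. hom c k y) = Y y" for N
    by (rule partial_sum_harmonic_combination)
  then obtain Y where Y: "\<And>N. Y N \<in> harmonic_combinations" "\<And>N y. y \<in> sphere 0 1 \<Longrightarrow> (\<Sum>k\<le>N. hom c k y) = Y N y"
    by metis
  define d where "d N = (\<lambda>\<alpha>. if mdeg \<alpha> \<le> N then 0 else c \<alpha>)" for N
  have hd: "hom (d N) k y = (if k \<le> N then 0 else hom c k y)" for N k y
    by (auto simp: hom_def d_def idx_def)
  have A1d: "A1 k (d N) \<le> B / real (Suc N) * real (Suc k) ^ 3 * (x/4) ^ k" for k N
  proof (cases "k \<le> N")
    case True
    then have "A1 k (d N) = 0" by (auto simp: A1_def d_def idx_def)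
    then show ?thesis using B x by simp
  next
    case False
    then have "A1 k (d N) = A1 k c" by (auto simp: A1_def d_def idx_def)
    also have "\<dots> \<le> B * (real (Suc k))\<^sup>2 * (x/4) ^ k" by (rule c)
    also have "\<dots> \<le> (B / real (Suc N) * real (Suc k) ^ 3) * (x/4) ^ k"
    proof (rule mult_right_mono)
      have "real (Suc N) * (real (Suc k))\<^sup>2 \<le> real (Suc k) ^ 3"
        using False by (simp add: power3_eq_cube power2_eq_square mult_right_mono mult.assoc)
      then have "(real (Suc k))\<^sup>2 \<le> real (Suc k) ^ 3 / real (Suc N)"
        by (subst pos_le_divide_eq) (simp_all only: mult.commute of_nat_0_less_iff zero_less_Suc)
      from mult_left_mono[OF this B] show "B * (real (Suc k))\<^sup>2 \<le> B / real (Suc N) * real (Suc k) ^ 3"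
        by (simp only: times_divide_eq_left times_divide_eq_right)
    qed (use x in simp)
    finally show ?thesis .
  qed
  have BN: "B / real (Suc N) \<ge> 0" for N using B by simp
  have diff: "psum c y - Y N y = psum (d N) y" if "y \<in> sphere 0 1" for y N
  proof -
    have le2: "\<bar>y $ i\<bar> \<le> 2" for i using component_le_1_sphere[OF that, of i] by linarith
    have "(\<lambda>k. if k \<in> {..N} then hom c k y else 0) sums (\<Sum>k\<le>N. hom c k y)" by (rule sums_If_finite_set) simp
    from sums_diff[OF psum_sums[OF a2 le2] this]
    have "(\<lambda>k. hom (d N) k y) sums (psum c y - (\<Sum>k\<le>N. hom c k y))"
      by (rule sums_cong[THEN iffD1, rotated]) (simp add: hd)
    then show ?thesis using Y(2)[OF that] by (simp add: psum_def[of "d N"] sums_iff)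
  qed
  have tm: "Z_term s x (\<lambda>y. psum c y - Y N y) = Z_term s x (psum (d N))" for N by (rule Z_term_cong) (rule diff)
  have nm: "Z_norm s x (\<lambda>y. psum c y - Y N y) = Z_norm s x (psum (d N))" for N by (rule Z_norm_cong) (rule diff)
  note bd = Z_bound[OF n x A1d BN]
  have "(\<lambda>N. Z_norm s x (\<lambda>y. psum c y - Y N y)) \<longlonglongrightarrow> 0"
  proof (rule tendsto_sandwich[OF _ _ tendsto_const])
    show "\<forall>\<^sub>F N in sequentially. 0 \<le> Z_norm s x (\<lambda>y. psum c y - Y N y)"
      unfolding nm using x bd(1) by (intro always_eventually allI Z_norm_nonneg) auto
    show "\<forall>\<^sub>F N in sequentially. Z_norm s x (\<lambda>y. psum c y - Y N y) \<le> B / real (Suc N) * Z_const TYPE('n) s"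
      unfolding nm by (intro always_eventually allI bd(2))
    show "(\<lambda>N. B / real (Suc N) * Z_const TYPE('n) s) \<longlonglongrightarrow> 0"
      using tendsto_mult_right[OF LIMSEQ_inverse_real_of_nat, of "B * Z_const TYPE('n) s"]
      by (simp add: field_simps)
  qed
  then show ?thesis
    unfolding Z_space_def using continuous_L2_sphere[OF continuous_on_psum_sphere[OF a2]] Y(1) bd(1) tm
    by (intro CollectI conjI exI[of _ Y]) auto
qed

subsection \<open>Radial slices of a power series\<close>

lemma L2_sphere_cong:
  assumes "\<And>y. y \<in> sphere 0 1 \<Longrightarrow> v y = w y"
  shows "v \<in> L2_sphere \<longleftrightarrow> w \<in> L2_sphere"
proof -
  have "v \<in> borel_measurable sphere_measure \<longleftrightarrow> w \<in> borel_measurable sphere_measure"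
    by (rule measurable_cong) (simp add: space_sphere_measure assms)
  moreover have "integrable sphere_measure (\<lambda>y. (v y)\<^sup>2) \<longleftrightarrow> integrable sphere_measure (\<lambda>y. (w y)\<^sup>2)"
    by (rule Bochner_Integration.integrable_cong) (simp_all add: space_sphere_measure assms)
  ultimately show ?thesis by (simp add: L2_sphere_def)
qed

lemma Z_space_cong:
  assumes "\<And>y. y \<in> sphere 0 1 \<Longrightarrow> v y = w y"
  shows "v \<in> Z_space s r \<longleftrightarrow> w \<in> Z_space s r"
proof -
  have eq: "Z_term s r (\<lambda>y. v y - Y y) = Z_term s r (\<lambda>y. w y - Y y)"
    "Z_norm s r (\<lambda>y. v y - Y y) = Z_norm s r (\<lambda>y. w y - Y y)" for Y
    by (rule Z_term_cong Z_norm_cong, simp add: assms)+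
  show ?thesis unfolding Z_space_def mem_Collect_eq eq by (simp only: L2_sphere_cong[of v w, OF assms])
qed

text \<open>Radial slices, radial derivatives and their difference quotients all arise from one
  series by multiplying its degree k part by a number b k, so they can be estimated
  uniformly.\<close>

definition degscale :: "(nat \<Rightarrow> real) \<Rightarrow> (('n::finite \<Rightarrow> nat) \<Rightarrow> real) \<Rightarrow> ('n \<Rightarrow> nat) \<Rightarrow> real" where
  "degscale b c \<alpha> = b (mdeg \<alpha>) * c \<alpha>"

lemma hom_degscale: "hom (degscale b c) k y = b k * hom c k y"
  by (simp add: hom_def degscale_def idx_def sum_distrib_left mult.assoc)

lemma A1_degscale: "A1 k (degscale b c) = \<bar>b k\<bar> * A1 k c"
  by (simp add: A1_def degscale_def idx_def sum_distrib_left abs_mult)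

lemma A1_le_l1:
  assumes "aconv c \<rho>" "\<rho> \<ge> 0"
  shows "A1 k c * \<rho> ^ k \<le> l1 c \<rho>"
proof -
  have "(\<Sum>j\<in>{k}. A1 j c * \<rho> ^ j) \<le> (\<Sum>j. A1 j c * \<rho> ^ j)"
    using assms unfolding aconv_def by (intro sum_le_suminf) auto
  then show ?thesis by (simp add: l1_def)
qed

text \<open>On a ball of radius \<rho>/4 the weight parameter of the slice at radius r is x =
  r/(\<rho>/4), so the natural ratio r/\<rho> is the x/4 that \<open>Z_bound\<close>
  expects.\<close>

lemma A1_degscale_le:
  assumes c: "aconv c \<rho>" "\<rho> > 0" and r: "0 < r" and \<beta>: "\<beta> \<ge> 0"
    and b: "\<bar>b k\<bar> \<le> \<beta> * (real (Suc k))\<^sup>2 * r ^ k"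
  shows "A1 k (degscale b c) \<le> \<beta> * l1 c \<rho> * (real (Suc k))\<^sup>2 * (r / (\<rho>/4) / 4) ^ k"
proof -
  have "A1 k (degscale b c) \<le> (\<beta> * (real (Suc k))\<^sup>2 * r ^ k) * A1 k c"
    unfolding A1_degscale by (intro mult_right_mono b) simp
  also have "\<dots> = (\<beta> * (real (Suc k))\<^sup>2 * (r / \<rho>) ^ k) * (A1 k c * \<rho> ^ k)"
    using c(2) by (simp add: power_divide)
  also have "\<dots> \<le> (\<beta> * (real (Suc k))\<^sup>2 * (r / \<rho>) ^ k) * l1 c \<rho>"
  proof (rule mult_left_mono[OF A1_le_l1])
    show "0 \<le> \<beta> * (real (Suc k))\<^sup>2 * (r / \<rho>) ^ k"
      using r c \<beta> by (intro mult_nonneg_nonneg zero_le_power) auto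
  qed (use c in auto)
  also have "\<dots> = \<beta> * l1 c \<rho> * (real (Suc k))\<^sup>2 * (r / \<rho>) ^ k" by (simp only: ac_simps)
  finally show ?thesis by simp
qed

lemma degscale_slice:
  fixes c :: "('n::finite \<Rightarrow> nat) \<Rightarrow> real"
  assumes n: "CARD('n) \<ge> 2" and c: "aconv c \<rho>" "\<rho> > 0" and r: "0 < r" "r \<le> \<rho>/4"
    and beta: "\<beta> \<ge> 0" and b: "\<And>k. \<bar>b k\<bar> \<le> \<beta> * (real (Suc k))\<^sup>2 * r ^ k"
  shows "psum (degscale b c) \<in> Z_space s (r / (\<rho>/4))"
    and "summable (Z_term s (r / (\<rho>/4)) (psum (degscale b c)))"
    and "Z_norm s (r / (\<rho>/4)) (psum (degscale b c)) \<le> \<beta> * (l1 c \<rho> * Z_const TYPE('n) s)"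
    and "\<And>y. y \<in> sphere 0 1 \<Longrightarrow> (\<lambda>k. b k * hom c k y) sums psum (degscale b c) y"
proof -
  have B: "\<beta> * l1 c \<rho> \<ge> 0" using beta l1_nonneg[OF c(1)] c(2) by simp
  have x: "0 < r / (\<rho>/4)" "r / (\<rho>/4) \<le> 1" using r c(2) by (simp_all add: field_simps)
  have A2: "A1 k (degscale b c) \<le> \<beta> * l1 c \<rho> * (real (Suc k))\<^sup>2 * (r / (\<rho>/4) / 4) ^ k" for k
    by (rule A1_degscale_le[OF c r(1) beta b])
  have A3: "A1 k (degscale b c) \<le> \<beta> * l1 c \<rho> * real (Suc k) ^ 3 * (r / (\<rho>/4) / 4) ^ k" for k
  proof (rule order_trans[OF A2])
    have "(real (Suc k))\<^sup>2 \<le> real (Suc k) ^ 3" by (intro power_increasing) auto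
    moreover have "0 \<le> (r / (\<rho>/4) / 4) ^ k" by (rule zero_le_power) (use r c(2) in simp)
    ultimately show "\<beta> * l1 c \<rho> * (real (Suc k))\<^sup>2 * (r / (\<rho>/4) / 4) ^ k \<le> \<beta> * l1 c \<rho> * real (Suc k) ^ 3 * (r / (\<rho>/4) / 4) ^ k"
      using mult_right_mono[OF mult_left_mono[OF _ B]] by blast
  qed
  show "psum (degscale b c) \<in> Z_space s (r / (\<rho>/4))" by (rule psum_mem_Z_space[OF n x A2 B])
  show "summable (Z_term s (r / (\<rho>/4)) (psum (degscale b c)))" by (rule Z_bound(1)[OF n x A3 B])
  show "Z_norm s (r / (\<rho>/4)) (psum (degscale b c)) \<le> \<beta> * (l1 c \<rho> * Z_const TYPE('n) s)"
    using Z_bound(2)[OF n x A3 B] by (simp add: mult.assoc)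
  fix y :: "real^'n" assume y: "y \<in> sphere 0 1"
  have "\<bar>y $ i\<bar> \<le> 2" for i using component_le_1_sphere[OF y, of i] by linarith
  from psum_sums[OF aconv_2_if_cubic[OF x A3 B] this]
  show "(\<lambda>k. b k * hom c k y) sums psum (degscale b c) y" by (simp add: hom_degscale)
qed

lemma psum_scaleR: "psum c (t *\<^sub>R y) = psum (degscale (\<lambda>k. t ^ k) c) y"
  by (simp add: psum_def hom_scaleR hom_degscale)

lemma at_within_Ioc_neq_bot:
  fixes t R :: real
  assumes "0 < t" "t \<le> R"
  shows "at t within {0<..R} \<noteq> bot"
proof -
  have "t islimpt {0<..R}"
  proof (rule connected_imp_perfect)
    show "{0<..R} \<noteq> {z}" for z
    proof
      assume "{0<..R} = {z}"
      moreover have "R \<in> {0<..R}" "R/2 \<in> {0<..R}" using assms by auto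
      ultimately have "R = z" "R/2 = z" by blast+
      then show False using assms by simp
    qed
  qed (use assms in auto)
  then show ?thesis by (simp add: trivial_limit_within)
qed

text \<open>The series converges beyond \<rho>/4, so it has a two-sided derivative even at the
  boundary radius, and the one-sided derivative in \<open>radial_deriv\<close> agrees with
  it.\<close>

lemma radial_deriv_psum:
  fixes c :: "('n::finite \<Rightarrow> nat) \<Rightarrow> real"
  assumes c: "aconv c \<rho>" "\<rho> > 0" and t: "0 < t" "t \<le> \<rho>/4" and y: "y \<in> sphere 0 1"
  shows "radial_deriv (\<rho>/4) (psum c) (t *\<^sub>R y) = psum (degscale (\<lambda>k. real k * t ^ (k - 1)) c) y"
proof -
  define a where "a k = hom c k y" for k
  have sgn: "sgn (t *\<^sub>R y) = y" and nrm: "norm (t *\<^sub>R y) = t" using t y by (simp_all add: sgn_scaleR sgn_div_norm)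
  have sm: "summable (\<lambda>k. a k * \<rho> ^ k)"
  proof (rule summable_comparison_test'[OF c(1)[unfolded aconv_def]])
    show "norm (a k * \<rho> ^ k) \<le> A1 k c * \<rho> ^ k" for k
      using abs_hom_le[OF component_le_1_sphere[OF y], of c k] c(2) by (simp add: a_def abs_mult mult_right_mono)
  qed
  have f: "(\<lambda>\<tau>. psum c (\<tau> *\<^sub>R y)) = (\<lambda>\<tau>. \<Sum>k. a k * \<tau> ^ k)"
    by (simp add: psum_def hom_scaleR a_def mult.commute)
  have "norm t < norm \<rho>" using t c(2) by simp
  from termdiffs_strong[OF sm this]
  have "((\<lambda>\<tau>. psum c (\<tau> *\<^sub>R y)) has_vector_derivative (\<Sum>k. diffs a k * t ^ k)) (at t)"
    unfolding f by (simp only: has_real_derivative_iff_has_vector_derivative)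
  then have "((\<lambda>\<tau>. psum c (\<tau> *\<^sub>R y)) has_vector_derivative (\<Sum>k. diffs a k * t ^ k)) (at t within {0<..\<rho>/4})"
    by (rule has_vector_derivative_at_within)
  moreover have "at t within {0<..\<rho>/4} \<noteq> bot" by (rule at_within_Ioc_neq_bot[OF t])
  ultimately have "radial_deriv (\<rho>/4) (psum c) (t *\<^sub>R y) = (\<Sum>k. diffs a k * t ^ k)"
    unfolding radial_deriv_def sgn nrm by (intro vector_derivative_within[rotated])
  also have "\<dots> = psum (degscale (\<lambda>k. real k * t ^ (k - 1)) c) y"
  proof -
    have "summable (\<lambda>k. diffs a k * t ^ k)" by (rule termdiff_converges[of t "\<rho>"]) (use t c(2) in simp, rule powser_inside[OF sm], simp)
    then have "(\<lambda>k. real (Suc k) * t ^ (Suc k - 1) * a (Suc k)) sums (\<Sum>k. diffs a k * t ^ k)"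
      by (simp add: diffs_def summable_sums mult.assoc mult.commute[of "a _"])
    then have "(\<lambda>k. real k * t ^ (k - 1) * a k) sums (\<Sum>k. diffs a k * t ^ k)"
      by (subst (asm) sums_Suc_iff) simp
    then show ?thesis by (simp add: psum_def hom_degscale a_def sums_iff)
  qed
  finally show ?thesis .
qed

text \<open>The extra factor \<open>r\<close> on the left avoids \<open>r ^ (k - 1)\<close>, whose
  exponent is truncated at k = 0.\<close>

lemma abs_power_diff_le:
  fixes a b :: real
  assumes "\<bar>a\<bar> \<le> r" "\<bar>b\<bar> \<le> r"
  shows "\<bar>a ^ k - b ^ k\<bar> * r \<le> real k * r ^ k * \<bar>a - b\<bar>"
proof (induction k)
  case (Suc k)
  have r: "r \<ge> 0" using assms(1) by linarith
  have "a ^ Suc k - b ^ Suc k = a * (a ^ k - b ^ k) + (a - b) * b ^ k" by (simp add: algebra_simps)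
  then have "\<bar>a ^ Suc k - b ^ Suc k\<bar> * r \<le> \<bar>a\<bar> * (\<bar>a ^ k - b ^ k\<bar> * r) + \<bar>a - b\<bar> * \<bar>b\<bar> ^ k * r"
    using abs_triangle_ineq[of "a * (a ^ k - b ^ k)" "(a - b) * b ^ k"] r
    by (simp add: abs_mult power_abs mult_right_mono flip: distrib_right mult.assoc)
  also have "\<dots> \<le> r * (real k * r ^ k * \<bar>a - b\<bar>) + \<bar>a - b\<bar> * r ^ k * r"
  proof (rule add_mono)
    show "\<bar>a\<bar> * (\<bar>a ^ k - b ^ k\<bar> * r) \<le> r * (real k * r ^ k * \<bar>a - b\<bar>)"
      by (rule mult_mono[OF assms(1) Suc r]) (use r in simp)
    show "\<bar>a - b\<bar> * \<bar>b\<bar> ^ k * r \<le> \<bar>a - b\<bar> * r ^ k * r"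
      using assms(2) by (intro mult_right_mono[OF mult_left_mono[OF power_mono]] r) auto
  qed
  also have "\<dots> = real (Suc k) * r ^ Suc k * \<bar>a - b\<bar>" by (simp add: algebra_simps)
  finally show ?case .
qed simp

lemma tendsto_0_at_within_linear:
  fixes g :: "real \<Rightarrow> real"
  assumes "\<And>\<tau>. \<tau> \<in> I \<Longrightarrow> \<tau> \<noteq> t \<Longrightarrow> 0 \<le> g \<tau> \<and> g \<tau> \<le> \<bar>\<tau> - t\<bar> * K"
  shows "(g \<longlongrightarrow> 0) (at t within I)"
proof (rule tendsto_sandwich[OF _ _ tendsto_const])
  show "\<forall>\<^sub>F \<tau> in at t within I. 0 \<le> g \<tau>" "\<forall>\<^sub>F \<tau> in at t within I. g \<tau> \<le> \<bar>\<tau> - t\<bar> * K"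
    using assms by (auto simp: eventually_at_filter)
  have "((\<lambda>\<tau>. \<bar>\<tau> - t\<bar> * K) \<longlongrightarrow> \<bar>t - t\<bar> * K) (at t within I)" by (intro tendsto_intros)
  then show "((\<lambda>\<tau>. \<bar>\<tau> - t\<bar> * K) \<longlongrightarrow> 0) (at t within I)" by simp
qed

lemma slice_of_coeffs:
  fixes c :: "('n::finite \<Rightarrow> nat) \<Rightarrow> real"
  assumes n: "CARD('n) \<ge> 2" and c: "aconv c \<rho>" "\<rho> > 0" and r: "0 < r" "r \<le> \<rho>/4"
    and beta: "\<beta> \<ge> 0" and b: "\<And>k. \<bar>b k\<bar> \<le> \<beta> * (real (Suc k))\<^sup>2 * r ^ k"
    and v: "\<And>y. y \<in> sphere 0 1 \<Longrightarrow> (\<lambda>k. b k * hom c k y) sums v y"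
  shows "v \<in> Z_space s (r / (\<rho>/4))" and "Z_norm s (r / (\<rho>/4)) v \<ge> 0"
    and "Z_norm s (r / (\<rho>/4)) v \<le> \<beta> * (l1 c \<rho> * Z_const TYPE('n) s)"
proof -
  note D = degscale_slice[OF n c r beta b]
  have eq: "v y = psum (degscale b c) y" if "y \<in> sphere 0 1" for y
    using sums_unique2[OF v[OF that] D(4)[OF that]] .
  have N: "Z_norm s (r / (\<rho>/4)) v = Z_norm s (r / (\<rho>/4)) (psum (degscale b c))"
    by (rule Z_norm_cong) (rule eq)
  show "v \<in> Z_space s (r / (\<rho>/4))" using D(1) Z_space_cong[of v, OF eq] by simp
  show "Z_norm s (r / (\<rho>/4)) v \<ge> 0" unfolding N by (rule Z_norm_nonneg) (use r c D(2) in auto)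
  show "Z_norm s (r / (\<rho>/4)) v \<le> \<beta> * (l1 c \<rho> * Z_const TYPE('n) s)" unfolding N by (rule D(3))
qed

lemma le_Suc_power2: "real k \<le> (real (Suc k))\<^sup>2" "1 \<le> (real (Suc k))\<^sup>2" "real k * real (k - 1) \<le> (real (Suc k))\<^sup>2"
proof -
  have "k * (k - 1) \<le> Suc k * Suc k" by (rule mult_le_mono) auto
  then have "k \<le> Suc k ^ 2" "1 \<le> Suc k ^ 2" "k * (k - 1) \<le> Suc k ^ 2"
    by (simp_all add: power2_eq_square)
  from this[THEN of_nat_mono[where 'a = real]]
  show "real k \<le> (real (Suc k))\<^sup>2" "1 \<le> (real (Suc k))\<^sup>2" "real k * real (k - 1) \<le> (real (Suc k))\<^sup>2"
    by (simp_all only: of_nat_power of_nat_mult of_nat_1)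
qed

text \<open>The multipliers that occur: slice, radial derivative, the increments of both, and the
  error of the difference quotient. Each is bounded by a quadratic factor in the degree times r^k;
  the last three carry a factor |\<tau> - t|, from which continuity and differentiability
  follow.\<close>

lemma coeff_bounds:
  fixes t \<tau> r :: real
  assumes t: "0 < t" "t \<le> r" and \<tau>: "0 < \<tau>" "\<tau> \<le> r"
  shows "\<bar>t ^ k\<bar> \<le> 1 * (real (Suc k))\<^sup>2 * r ^ k"
    and "\<bar>real k * t ^ (k - 1)\<bar> \<le> 1 / r * (real (Suc k))\<^sup>2 * r ^ k"
    and "\<bar>\<tau> ^ k - t ^ k\<bar> \<le> \<bar>\<tau> - t\<bar> / r * (real (Suc k))\<^sup>2 * r ^ k"
    and "\<bar>real k * \<tau> ^ (k - 1) - real k * t ^ (k - 1)\<bar> \<le> \<bar>\<tau> - t\<bar> / r\<^sup>2 * (real (Suc k))\<^sup>2 * r ^ k"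
    and "\<tau> \<noteq> t \<Longrightarrow> \<bar>(\<tau> ^ k - t ^ k) / (\<tau> - t) - real k * t ^ (k - 1)\<bar> \<le> \<bar>\<tau> - t\<bar> / r\<^sup>2 * (real (Suc k))\<^sup>2 * r ^ k"
proof -
  have r: "r > 0" using t by linarith
  have tk: "t ^ m \<le> r ^ m" for m using t by (intro power_mono) auto
  show "\<bar>t ^ k\<bar> \<le> 1 * (real (Suc k))\<^sup>2 * r ^ k"
    using mult_mono[OF le_Suc_power2(2) tk, of k k] t by simp
  show "\<bar>real k * t ^ (k - 1)\<bar> \<le> 1 / r * (real (Suc k))\<^sup>2 * r ^ k"
  proof (cases k)
    case (Suc m)
    have "real k * t ^ m \<le> (real (Suc k))\<^sup>2 * r ^ m"
      by (rule mult_mono[OF le_Suc_power2(1) tk]) (use t in auto)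
    then show ?thesis using Suc r t by (simp add: abs_mult)
  qed (use r in simp)
  have pd: "\<bar>\<tau> ^ m - t ^ m\<bar> * r \<le> real m * r ^ m * \<bar>\<tau> - t\<bar>" for m
    by (rule abs_power_diff_le) (use t \<tau> in auto)
  show "\<bar>\<tau> ^ k - t ^ k\<bar> \<le> \<bar>\<tau> - t\<bar> / r * (real (Suc k))\<^sup>2 * r ^ k"
  proof -
    have "real k * (r ^ k * \<bar>\<tau> - t\<bar>) \<le> (real (Suc k))\<^sup>2 * (r ^ k * \<bar>\<tau> - t\<bar>)"
      using r by (intro mult_right_mono le_Suc_power2) auto
    then have "\<bar>\<tau> ^ k - t ^ k\<bar> * r \<le> (real (Suc k))\<^sup>2 * (r ^ k * \<bar>\<tau> - t\<bar>)" using pd[of k] by (simp add: mult.assoc)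
    then have "\<bar>\<tau> ^ k - t ^ k\<bar> \<le> ((real (Suc k))\<^sup>2 * (r ^ k * \<bar>\<tau> - t\<bar>)) / r" by (simp only: pos_le_divide_eq[OF r])
    also have "\<dots> = \<bar>\<tau> - t\<bar> / r * (real (Suc k))\<^sup>2 * r ^ k" by simp
    finally show ?thesis .
  qed
  have quad: "real k * real (k - 1) * r ^ k * \<bar>\<tau> - t\<bar> / r\<^sup>2 \<le> \<bar>\<tau> - t\<bar> / r\<^sup>2 * (real (Suc k))\<^sup>2 * r ^ k"
  proof -
    have "real k * real (k - 1) * (\<bar>\<tau> - t\<bar> / r\<^sup>2 * r ^ k) \<le> (real (Suc k))\<^sup>2 * (\<bar>\<tau> - t\<bar> / r\<^sup>2 * r ^ k)"
      using r by (intro mult_right_mono le_Suc_power2) auto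
    then show ?thesis by (simp only: mult_ac times_divide_eq_left times_divide_eq_right)
  qed
  have red: "real k * real (k - 1) * r ^ (k - 2) * h = real k * real (k - 1) * r ^ k * h / r\<^sup>2" for h
  proof (cases "k < 2")
    case True
    then have "k = 0 \<or> k = 1" by linarith
    then show ?thesis by auto
  next
    case False
    then have "r ^ k = r ^ (k - 2) * r\<^sup>2" by (simp only: power_add[symmetric] le_add_diff_inverse2 not_less)
    then show ?thesis using r by simp
  qed
  show "\<bar>real k * \<tau> ^ (k - 1) - real k * t ^ (k - 1)\<bar> \<le> \<bar>\<tau> - t\<bar> / r\<^sup>2 * (real (Suc k))\<^sup>2 * r ^ k"
  proof (cases k)
    case (Suc m)
    have "\<bar>\<tau> ^ m - t ^ m\<bar> \<le> real m * r ^ m * \<bar>\<tau> - t\<bar> / r"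
      using pd[of m] by (simp only: pos_le_divide_eq[OF r])
    then have "real k * \<bar>\<tau> ^ m - t ^ m\<bar> \<le> real k * (real m * r ^ m * \<bar>\<tau> - t\<bar> / r)" by (intro mult_left_mono) auto
    also have "\<dots> = real k * real (k - 1) * r ^ k * \<bar>\<tau> - t\<bar> / r\<^sup>2" using Suc r by (simp add: power2_eq_square)
    also note quad
    finally have "real k * \<bar>\<tau> ^ m - t ^ m\<bar> \<le> \<bar>\<tau> - t\<bar> / r\<^sup>2 * (real (Suc k))\<^sup>2 * r ^ k" .
    moreover have "\<bar>real k * \<tau> ^ (k - 1) - real k * t ^ (k - 1)\<bar> = real k * \<bar>\<tau> ^ m - t ^ m\<bar>"
      unfolding right_diff_distrib[symmetric] abs_mult using Suc by simp
    ultimately show ?thesis by simp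
  qed (use r in simp)
  assume "\<tau> \<noteq> t"
  then have "norm (((t + (\<tau> - t)) ^ k - t ^ k) / (\<tau> - t) - of_nat k * t ^ (k - Suc 0)) \<le>
      of_nat k * of_nat (k - Suc 0) * r ^ (k - 2) * norm (\<tau> - t)"
    by (intro lemma_termdiff3) (use t \<tau> in auto)
  then have "\<bar>(\<tau> ^ k - t ^ k) / (\<tau> - t) - real k * t ^ (k - 1)\<bar> \<le> real k * real (k - 1) * r ^ (k - 2) * \<bar>\<tau> - t\<bar>" by simp
  also note red
  also note quad
  finally show "\<bar>(\<tau> ^ k - t ^ k) / (\<tau> - t) - real k * t ^ (k - 1)\<bar> \<le> \<bar>\<tau> - t\<bar> / r\<^sup>2 * (real (Suc k))\<^sup>2 * r ^ k" .
qed

text \<open>The spare room between \<rho>/4 and \<rho> makes the slices and their radial derivatives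
  Lipschitz in the radius on each (0, r], in the norm with any exponent \<open>s\<close>.\<close>

lemma psum_mem_Zball_space:
  fixes c :: "('n::finite \<Rightarrow> nat) \<Rightarrow> real"
  assumes n: "CARD('n) \<ge> 2" and c: "aconv c \<rho>" "\<rho> > 0"
  shows "psum c \<in> Zball_space s (\<rho>/4)"
proof -
  let ?R = "\<rho>/4"
  let ?u = "\<lambda>t y. psum c (t *\<^sub>R y)"
  let ?d = "\<lambda>t y. radial_deriv ?R (psum c) (t *\<^sub>R y)"
  let ?C = "\<lambda>s. l1 c \<rho> * Z_const TYPE('n) s"
  have S1: "(\<lambda>k. t ^ k * hom c k y) sums ?u t y" if "0 < t" "t \<le> ?R" "y \<in> sphere 0 1" for t y
    unfolding psum_scaleR by (rule degscale_slice(4)[OF n c that(1,2) _ coeff_bounds(1) that(3)]) (use that in auto)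
  have S2: "(\<lambda>k. (real k * t ^ (k - 1)) * hom c k y) sums ?d t y" if "0 < t" "t \<le> ?R" "y \<in> sphere 0 1" for t y
    unfolding radial_deriv_psum[OF c that]
    by (rule degscale_slice(4)[OF n c that(1,2) _ coeff_bounds(2) that(3)]) (use that in auto)
  have mem: "?u t \<in> Z_space s (r / ?R)" "?d t \<in> Z_space s (r / ?R)" if "0 < t" "t \<le> r" "0 < r" "r \<le> ?R" for t r s
  proof -
    have tR: "t \<le> ?R" using that by linarith
    show "?u t \<in> Z_space s (r / ?R)"
      by (rule slice_of_coeffs(1)[OF n c that(3,4) _ coeff_bounds(1) S1]) (use that tR in auto)
    show "?d t \<in> Z_space s (r / ?R)"
      by (rule slice_of_coeffs(1)[OF n c that(3,4) _ coeff_bounds(2) S2]) (use that tR in auto)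
  qed
  have cont: "Z_continuous_on s (r / ?R) {0<..r} ?u" "Z_continuous_on s (r / ?R) {0<..r} ?d"
    and C1: "Z_C1_on s (r / ?R) {0<..r} ?u ?d" if r: "0 < r" "r \<le> ?R" for r s
  proof -
    have lim: "((\<lambda>\<tau>. Z_norm s (r / ?R) (\<lambda>y. ?u \<tau> y - ?u t y)) \<longlongrightarrow> 0) (at t within {0<..r})"
        "((\<lambda>\<tau>. Z_norm s (r / ?R) (\<lambda>y. ?d \<tau> y - ?d t y)) \<longlongrightarrow> 0) (at t within {0<..r})"
        "((\<lambda>\<tau>. Z_norm s (r / ?R) (\<lambda>y. (?u \<tau> y - ?u t y) / (\<tau> - t) - ?d t y)) \<longlongrightarrow> 0) (at t within {0<..r})"
      if t: "t \<in> {0<..r}" for t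
    proof -
      have tR: "0 < t" "t \<le> r" "t \<le> ?R" using t r by auto
      have "0 \<le> Z_norm s (r / ?R) (\<lambda>y. ?u \<tau> y - ?u t y) \<and>
          Z_norm s (r / ?R) (\<lambda>y. ?u \<tau> y - ?u t y) \<le> \<bar>\<tau> - t\<bar> * (?C s / r)"
        "0 \<le> Z_norm s (r / ?R) (\<lambda>y. ?d \<tau> y - ?d t y) \<and>
          Z_norm s (r / ?R) (\<lambda>y. ?d \<tau> y - ?d t y) \<le> \<bar>\<tau> - t\<bar> * (?C s / r\<^sup>2)"
        "0 \<le> Z_norm s (r / ?R) (\<lambda>y. (?u \<tau> y - ?u t y) / (\<tau> - t) - ?d t y) \<and>
          Z_norm s (r / ?R) (\<lambda>y. (?u \<tau> y - ?u t y) / (\<tau> - t) - ?d t y) \<le> \<bar>\<tau> - t\<bar> * (?C s / r\<^sup>2)"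
        if "\<tau> \<in> {0<..r}" "\<tau> \<noteq> t" for \<tau>
      proof -
        have \<tau>: "0 < \<tau>" "\<tau> \<le> r" "\<tau> \<le> ?R" using that r by auto
        note T = tR(1,2) \<tau>(1,2)
        have b0: "\<bar>\<tau> - t\<bar> / r \<ge> 0" "\<bar>\<tau> - t\<bar> / r\<^sup>2 \<ge> 0" using r by auto
        have s1: "(\<lambda>k. (\<tau> ^ k - t ^ k) * hom c k y) sums (?u \<tau> y - ?u t y)" if "y \<in> sphere 0 1" for y
          using sums_diff[OF S1[OF \<tau>(1,3) that] S1[OF tR(1,3) that]] by (simp add: left_diff_distrib)
        have s2: "(\<lambda>k. (real k * \<tau> ^ (k - 1) - real k * t ^ (k - 1)) * hom c k y) sums (?d \<tau> y - ?d t y)" if "y \<in> sphere 0 1" for y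
          using sums_diff[OF S2[OF \<tau>(1,3) that] S2[OF tR(1,3) that]] by (simp only: left_diff_distrib)
        have s3: "(\<lambda>k. ((\<tau> ^ k - t ^ k) / (\<tau> - t) - real k * t ^ (k - 1)) * hom c k y) sums ((?u \<tau> y - ?u t y) / (\<tau> - t) - ?d t y)"
          if "y \<in> sphere 0 1" for y
          using sums_diff[OF sums_divide[OF s1[OF that], of "\<tau> - t"] S2[OF tR(1,3) that]]
          by (simp only: left_diff_distrib times_divide_eq_left)
        note R1 = slice_of_coeffs(2,3)[OF n c r b0(1) coeff_bounds(3)[OF T] s1]
        note R2 = slice_of_coeffs(2,3)[OF n c r b0(2) coeff_bounds(4)[OF T] s2]
        note R3 = slice_of_coeffs(2,3)[OF n c r b0(2) coeff_bounds(5)[OF T \<open>\<tau> \<noteq> t\<close>] s3]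
        show "0 \<le> Z_norm s (r / ?R) (\<lambda>y. ?u \<tau> y - ?u t y) \<and>
          Z_norm s (r / ?R) (\<lambda>y. ?u \<tau> y - ?u t y) \<le> \<bar>\<tau> - t\<bar> * (?C s / r)"
          using R1[of s] by (simp only: times_divide_eq_left times_divide_eq_right)
        show "0 \<le> Z_norm s (r / ?R) (\<lambda>y. ?d \<tau> y - ?d t y) \<and>
          Z_norm s (r / ?R) (\<lambda>y. ?d \<tau> y - ?d t y) \<le> \<bar>\<tau> - t\<bar> * (?C s / r\<^sup>2)"
          using R2[of s] by (simp only: times_divide_eq_left times_divide_eq_right)
        show "0 \<le> Z_norm s (r / ?R) (\<lambda>y. (?u \<tau> y - ?u t y) / (\<tau> - t) - ?d t y) \<and>
          Z_norm s (r / ?R) (\<lambda>y. (?u \<tau> y - ?u t y) / (\<tau> - t) - ?d t y) \<le> \<bar>\<tau> - t\<bar> * (?C s / r\<^sup>2)"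
          using R3[of s] by (simp only: times_divide_eq_left times_divide_eq_right)
      qed
      note bounds = this
      show "((\<lambda>\<tau>. Z_norm s (r / ?R) (\<lambda>y. ?u \<tau> y - ?u t y)) \<longlongrightarrow> 0) (at t within {0<..r})"
        by (rule tendsto_0_at_within_linear) (rule bounds(1))
      show "((\<lambda>\<tau>. Z_norm s (r / ?R) (\<lambda>y. ?d \<tau> y - ?d t y)) \<longlongrightarrow> 0) (at t within {0<..r})"
        by (rule tendsto_0_at_within_linear) (rule bounds(2))
      show "((\<lambda>\<tau>. Z_norm s (r / ?R) (\<lambda>y. (?u \<tau> y - ?u t y) / (\<tau> - t) - ?d t y)) \<longlongrightarrow> 0) (at t within {0<..r})"
        by (rule tendsto_0_at_within_linear) (rule bounds(3))
    qed
    show c1: "Z_continuous_on s (r / ?R) {0<..r} ?u"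
      unfolding Z_continuous_on_def using lim(1) mem(1)[OF _ _ r] by auto
    show c2: "Z_continuous_on s (r / ?R) {0<..r} ?d"
      unfolding Z_continuous_on_def using lim(2) mem(2)[OF _ _ r] by auto
    show "Z_C1_on s (r / ?R) {0<..r} ?u ?d"
      unfolding Z_C1_on_def using c1 c2 lim(3) by blast
  qed
  \<comment> \<open>In degree k the multiplier is (n - 2)/2 + k; the first summand of \<beta> bounds
    the constant and the 1 bounds k.\<close>
  define \<beta> where "\<beta> = \<bar>(real CARD('n) - 2) / 2\<bar> + 1"
  have "Zball_slice_norm s ?R (psum c) r \<le> 1 * ?C s + \<beta> * ?C (s - 1)" if "r \<in> {0<..?R}" for r
  proof -
    have r: "0 < r" "r \<le> ?R" using that by auto
    have "Z_norm s (r / ?R) (?u r) \<le> 1 * ?C s"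
      by (rule slice_of_coeffs(3)[OF n c r _ coeff_bounds(1) S1]) (use r in auto)
    moreover have "Z_norm (s - 1) (r / ?R) (\<lambda>y. (real CARD('n) - 2) / 2 * ?u r y + r * ?d r y) \<le> \<beta> * ?C (s - 1)"
    proof (rule slice_of_coeffs(3)[OF n c r])
      show "\<beta> \<ge> 0" by (simp add: \<beta>_def)
      fix k
      show "\<bar>((real CARD('n) - 2) / 2 + real k) * r ^ k\<bar> \<le> \<beta> * (real (Suc k))\<^sup>2 * r ^ k"
      proof -
        have "\<bar>(real CARD('n) - 2) / 2 + real k\<bar> \<le> \<bar>(real CARD('n) - 2) / 2\<bar> * 1 + 1 * real k" by linarith
        also have "\<dots> \<le> \<bar>(real CARD('n) - 2) / 2\<bar> * (real (Suc k))\<^sup>2 + 1 * (real (Suc k))\<^sup>2"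
          by (intro add_mono mult_left_mono le_Suc_power2) auto
        also have "\<dots> = \<beta> * (real (Suc k))\<^sup>2" by (simp only: \<beta>_def distrib_right)
        finally show ?thesis unfolding abs_mult using r by (simp add: mult_right_mono)
      qed
    next
      fix y :: "real^'n" assume y: "y \<in> sphere 0 1"
      have "((real CARD('n) - 2) / 2) * (r ^ k * h) + r * ((real k * r ^ (k - 1)) * h) = ((real CARD('n) - 2) / 2 + real k) * r ^ k * h" for k h
        by (cases k) (simp_all add: algebra_simps)
      with sums_add[OF sums_mult[OF S1[OF r y], of "(real CARD('n) - 2) / 2"] sums_mult[OF S2[OF r y], of r]]
      show "(\<lambda>k. ((real CARD('n) - 2) / 2 + real k) * r ^ k * hom c k y) sums ((real CARD('n) - 2) / 2 * ?u r y + r * ?d r y)"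
        by (simp only:)
    qed
    ultimately show ?thesis unfolding Zball_slice_norm_def by linarith
  qed
  then have "bdd_above (Zball_slice_norm s ?R (psum c) ` {0<..?R})" by (intro bdd_aboveI2)
  moreover have "?u r \<in> Z_space s (r / ?R) \<and> ?d r \<in> Z_space (s - 1) (r / ?R) \<and>
      Z_continuous_on s (r / ?R) {0<..r} ?u \<and> Z_C1_on (s - 1) (r / ?R) {0<..r} ?u ?d" if "r \<in> {0<..?R}" for r
    using that mem[of r r] cont(1)[of r] C1[of r] by auto
  ultimately show ?thesis unfolding Zball_space_def by blast
qed

section \<open>Uniqueness on the boundary\<close>

lemma L2_sphere_norm_diff_power2_le:
  assumes f: "f \<in> L2_sphere" and g: "g \<in> L2_sphere"
  shows "(L2_sphere_norm (\<lambda>y. f y - g y))\<^sup>2 \<le> 2 * (L2_sphere_norm f)\<^sup>2 + 2 * (L2_sphere_norm g)\<^sup>2"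
proof -
  note I = L2_sphere_integrable_mult
  have "sip (\<lambda>y. f y - g y) (\<lambda>y. f y - g y) \<le> (\<integral>y. 2 * (f y * f y) + 2 * (g y * g y) \<partial>sphere_measure)"
  proof (rule integral_mono)
    show "(f y - g y) * (f y - g y) \<le> 2 * (f y * f y) + 2 * (g y * g y)" for y
      using zero_le_square[of "f y + g y"] by (simp add: algebra_simps)
  qed (intro I L2_sphere_diff f g, intro Bochner_Integration.integrable_add integrable_mult_right I f g)
  also have "\<dots> = 2 * sip f f + 2 * sip g g" using I[OF f f] I[OF g g] by simp
  finally show ?thesis by (simp add: L2_sphere_norm_power2)
qed

lemma sph_proj_diff:
  assumes v: "v \<in> L2_sphere" and w: "w \<in> L2_sphere"
  shows "sph_proj l (\<lambda>y. v y - w y) = (\<lambda>y. sph_proj l v y - sph_proj l w y)"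
proof (rule sph_proj_eqI[OF L2_sphere_diff[OF v w]])
  show "(\<lambda>y. sph_proj l v y - sph_proj l w y) \<in> spherical_harmonics l"
    using spherical_harmonics_linear[OF sph_proj(1)[OF v] sph_proj(1)[OF w], where a = 1 and b = "-1"] by simp
  fix W :: "real^'a \<Rightarrow> real" assume W: "W \<in> spherical_harmonics l"
  note L = continuous_L2_sphere[OF spherical_harmonics_continuous]
  show "sip (\<lambda>y. v y - w y) W = sip (\<lambda>y. sph_proj l v y - sph_proj l w y) W"
    unfolding sip_diff_left[OF v w L[OF W]] sip_diff_left[OF L[OF sph_proj(1)[OF v]] L[OF sph_proj(1)[OF w]] L[OF W]]
    by (simp only: sph_proj(2)[OF v W] sph_proj(2)[OF w W])
qed

lemma summable_Z_term_diff:
  assumes v: "v \<in> L2_sphere" and w: "w \<in> L2_sphere" and r: "0 < r"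
    and "summable (Z_term s r v)" "summable (Z_term s r w)"
  shows "summable (Z_term s r (\<lambda>y. v y - w y))"
proof (rule summable_comparison_test')
  show "summable (\<lambda>l. 2 * Z_term s r v l + 2 * Z_term s r w l)"
    by (intro summable_add summable_mult assms)
  note L = continuous_L2_sphere[OF spherical_harmonics_continuous[OF sph_proj(1)]]
  fix l
  let ?a = "sqrt (1 + (real l)\<^sup>2) powr (2 * s) / r ^ (2 * l)"
  have "Z_term s r (\<lambda>y. v y - w y) l \<le> ?a * (2 * (L2_sphere_norm (sph_proj l v))\<^sup>2 + 2 * (L2_sphere_norm (sph_proj l w))\<^sup>2)"
    unfolding Z_term_def sph_proj_diff[OF v w]
    by (rule mult_left_mono[OF L2_sphere_norm_diff_power2_le[OF L[OF v] L[OF w]]]) (use r in simp)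
  also have "\<dots> = 2 * Z_term s r v l + 2 * Z_term s r w l" by (simp only: Z_term_def distrib_left mult.left_commute[of _ 2])
  finally show "norm (Z_term s r (\<lambda>y. v y - w y) l) \<le> 2 * Z_term s r v l + 2 * Z_term s r w l"
    using r by (simp add: Z_term_nonneg)
qed

lemma Z_space_L2: "v \<in> Z_space s r \<Longrightarrow> v \<in> L2_sphere"
  by (simp add: Z_space_def)

text \<open>Membership says that v - Y has finite norm for some harmonic combination
  \<open>Y\<close>. By orthogonality, subtracting \<open>Y\<close> does not change the projections
  above its degree, so \<open>v\<close> itself has finite norm.\<close>

lemma summable_Z_term:
  fixes v :: "real^'n::finite \<Rightarrow> real"
  assumes n: "CARD('n) \<ge> 2" and v: "v \<in> Z_space s r"
  shows "summable (Z_term s r v)"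
proof -
  have vL: "v \<in> L2_sphere" by (rule Z_space_L2[OF v])
  obtain Y where Y: "Y \<in> harmonic_combinations" "summable (Z_term s r (\<lambda>y. v y - Y y))"
    using v by (auto simp: Z_space_def)
  obtain N H where H: "\<And>l. H l \<in> spherical_harmonics l" and Y_eq: "Y = (\<lambda>y. \<Sum>l\<le>N. H l y)"
    using Y(1) by (auto simp: harmonic_combinations_def)
  note Hc = spherical_harmonics_continuous[OF H]
  have YL: "Y \<in> L2_sphere" unfolding Y_eq by (intro continuous_L2_sphere continuous_intros Hc)
  have "Z_term s r (\<lambda>y. v y - Y y) l = Z_term s r v l" if "l > N" for l
  proof -
    have "sip (\<lambda>y. v y - Y y) W = sip (sph_proj l v) W" if W: "W \<in> spherical_harmonics l" for W
    proof -
      note Wc = spherical_harmonics_continuous[OF W]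
      have "sip Y W = (\<Sum>j\<le>N. sip (H j) W)"
        unfolding Y_eq sum_distrib_right
        by (intro Bochner_Integration.integral_sum integrable_sphere_measure continuous_intros Hc Wc)
      also have "\<dots> = 0" using \<open>l > N\<close> by (intro sum.neutral ballI spherical_harmonics_orthogonal[OF n H W]) auto
      finally show ?thesis using sip_diff_left[OF vL YL continuous_L2_sphere[OF Wc]] sph_proj(2)[OF vL W] by simp
    qed
    then have "sph_proj l (\<lambda>y. v y - Y y) = sph_proj l v"
      by (intro sph_proj_eqI L2_sphere_diff vL YL sph_proj(1))
    then show ?thesis by (simp add: Z_term_def)
  qed
  then have "\<forall>\<^sub>F l in sequentially. Z_term s r (\<lambda>y. v y - Y y) l = Z_term s r v l"
    by (auto simp: eventually_sequentially intro!: exI[of _ "Suc N"])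
  then show ?thesis using Y(2) summable_cong by blast
qed

text \<open>A single term of the series already bounds the projection of degree l, so pairing with a
  fixed harmonic is continuous for the norm.\<close>

lemma abs_sip_le_Z_norm:
  assumes v: "v \<in> L2_sphere" and r: "0 < r" and sm: "summable (Z_term s r v)" and W: "W \<in> spherical_harmonics l"
  defines "a \<equiv> sqrt (1 + (real l)\<^sup>2) powr (2 * s) / r ^ (2 * l)"
  shows "\<bar>sip v W\<bar> \<le> Z_norm s r v * (L2_sphere_norm W / sqrt a)"
proof -
  have a: "a > 0" 
  proof -
    have "1 + (real l)\<^sup>2 \<noteq> 0" by (smt (verit) zero_le_power2)
    then show ?thesis unfolding a_def using r by simp
  qed
  have "(\<Sum>j\<in>{l}. Z_term s r v j) \<le> (\<Sum>j. Z_term s r v j)"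
    by (intro sum_le_suminf sm) (use r in \<open>auto simp: Z_term_nonneg\<close>)
  then have "sqrt (Z_term s r v l) \<le> Z_norm s r v" unfolding Z_norm_def by simp
  moreover have "sqrt (Z_term s r v l) = sqrt a * L2_sphere_norm (sph_proj l v)"
  proof -
    have "Z_term s r v l = a * (L2_sphere_norm (sph_proj l v))\<^sup>2" by (simp only: Z_term_def a_def)
    then show ?thesis by (simp add: real_sqrt_mult)
  qed
  ultimately have "L2_sphere_norm (sph_proj l v) \<le> Z_norm s r v / sqrt a" using a by (simp add: field_simps)
  then have "L2_sphere_norm (sph_proj l v) * L2_sphere_norm W \<le> Z_norm s r v / sqrt a * L2_sphere_norm W"
    by (rule mult_right_mono) simp
  with abs_sip_le_sph_proj[OF v W] show ?thesis by simp
qed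

lemma sip_tendsto_0:
  fixes F :: "real \<Rightarrow> real^'n::finite \<Rightarrow> real"
  assumes n: "CARD('n) \<ge> 2" and F: "Z_continuous_on s r {0<..R} F" and r: "0 < r" and t: "t \<in> {0<..R}"
    and W: "W \<in> spherical_harmonics l"
  shows "((\<lambda>\<tau>. sip (\<lambda>y. F \<tau> y - F t y) W) \<longlongrightarrow> 0) (at t within {0<..R})"
proof -
  define K where "K = L2_sphere_norm W / sqrt (sqrt (1 + (real l)\<^sup>2) powr (2 * s) / r ^ (2 * l))"
  have mem: "F \<tau> \<in> Z_space s r" if "\<tau> \<in> {0<..R}" for \<tau> using F that by (simp add: Z_continuous_on_def)
  have bd: "\<bar>sip (\<lambda>y. F \<tau> y - F t y) W\<bar> \<le> Z_norm s r (\<lambda>y. F \<tau> y - F t y) * K" if "\<tau> \<in> {0<..R}" for \<tau>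
  proof -
    note L = Z_space_L2[OF mem[OF that]] Z_space_L2[OF mem[OF t]]
    show ?thesis unfolding K_def
      by (rule abs_sip_le_Z_norm[OF L2_sphere_diff[OF L] r summable_Z_term_diff[OF L r] W])
         (rule summable_Z_term[OF n mem], fact)+
  qed
  have "((\<lambda>\<tau>. Z_norm s r (\<lambda>y. F \<tau> y - F t y)) \<longlongrightarrow> 0) (at t within {0<..R})"
    using F t by (simp add: Z_continuous_on_def)
  then have "((\<lambda>\<tau>. Z_norm s r (\<lambda>y. F \<tau> y - F t y) * K) \<longlongrightarrow> 0) (at t within {0<..R})"
    by (rule tendsto_mult_left_zero)
  moreover have "\<forall>\<^sub>F \<tau> in at t within {0<..R}. norm (sip (\<lambda>y. F \<tau> y - F t y) W) \<le> Z_norm s r (\<lambda>y. F \<tau> y - F t y) * K"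
    using bd by (auto simp: eventually_at_filter)
  ultimately show ?thesis by (rule Lim_null_comparison[rotated])
qed

text \<open>Taking r = R in the definition of the space, the weight parameter is 1 and continuity
  reaches the boundary radius. For \<tau> < R the two slices agree, so the difference of the
  pairings is constant in \<tau> and equal to the boundary pairing, while it tends to 0.\<close>

lemma sip_boundary_zero:
  fixes u v :: "real^'n::finite \<Rightarrow> real"
  assumes n: "CARD('n) \<ge> 2" and R: "R > 0" and u: "u \<in> Zball_space s R" and v: "v \<in> Zball_space s R"
    and eq: "\<And>x. x \<in> ball 0 R \<Longrightarrow> v x = u x" and W: "W \<in> spherical_harmonics l"
  shows "sip (\<lambda>y. v (R *\<^sub>R y) - u (R *\<^sub>R y)) W = 0"
proof -
  have RR: "R \<in> {0<..R}" using R by simp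
  have cont: "Z_continuous_on s 1 {0<..R} (\<lambda>\<rho> y. z (\<rho> *\<^sub>R y))" if "z \<in> Zball_space s R" for z :: "real^'n \<Rightarrow> real"
    using that R unfolding Zball_space_def by (auto dest!: bspec[OF _ RR])
  note T = sip_tendsto_0[OF n cont zero_less_one RR W]
  have "((\<lambda>\<tau>. sip (\<lambda>y. u (\<tau> *\<^sub>R y) - u (R *\<^sub>R y)) W - sip (\<lambda>y. v (\<tau> *\<^sub>R y) - v (R *\<^sub>R y)) W) \<longlongrightarrow> 0 - 0) (at R within {0<..R})"
    by (rule tendsto_diff[OF T[OF u] T[OF v]])
  note lim = this
  have L: "(\<lambda>y. z (\<tau> *\<^sub>R y)) \<in> L2_sphere" if "z \<in> Zball_space s R" "\<tau> \<in> {0<..R}" for z :: "real^'n \<Rightarrow> real" and \<tau>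
  proof -
    have "\<forall>t\<in>{0<..R}. (\<lambda>y. z (t *\<^sub>R y)) \<in> Z_space s 1"
      using cont[OF that(1)] unfolding Z_continuous_on_def by (rule conjunct1)
    then show ?thesis using that(2) by (blast intro: Z_space_L2)
  qed
  have "sip (\<lambda>y. u (\<tau> *\<^sub>R y) - u (R *\<^sub>R y)) W - sip (\<lambda>y. v (\<tau> *\<^sub>R y) - v (R *\<^sub>R y)) W = sip (\<lambda>y. v (R *\<^sub>R y) - u (R *\<^sub>R y)) W"
    if \<tau>: "\<tau> \<in> {0<..R}" "\<tau> \<noteq> R" for \<tau>
  proof -
    note WL = continuous_L2_sphere[OF spherical_harmonics_continuous[OF W]]
    have "sip (\<lambda>y. v (\<tau> *\<^sub>R y)) W = sip (\<lambda>y. u (\<tau> *\<^sub>R y)) W"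
      by (rule sip_cong[OF _ refl], rule eq) (use \<tau> in auto)
    with sip_diff_left[OF L[OF u \<tau>(1)] L[OF u RR] WL] sip_diff_left[OF L[OF v \<tau>(1)] L[OF v RR] WL]
      sip_diff_left[OF L[OF v RR] L[OF u RR] WL]
    show ?thesis by linarith
  qed
  then have "\<forall>\<^sub>F \<tau> in at R within {0<..R}. sip (\<lambda>y. u (\<tau> *\<^sub>R y) - u (R *\<^sub>R y)) W - sip (\<lambda>y. v (\<tau> *\<^sub>R y) - v (R *\<^sub>R y)) W
      = sip (\<lambda>y. v (R *\<^sub>R y) - u (R *\<^sub>R y)) W"
    by (simp add: eventually_at_filter)
  from tendsto_cong[OF this] lim have "((\<lambda>\<tau>. sip (\<lambda>y. v (R *\<^sub>R y) - u (R *\<^sub>R y)) W) \<longlongrightarrow> 0 - 0) (at R within {0<..R})"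
    by (simp only:)
  then have "sip (\<lambda>y. v (R *\<^sub>R y) - u (R *\<^sub>R y)) W = 0 - 0"
    by (rule tendsto_unique[OF at_within_Ioc_neq_bot[OF R order_refl] tendsto_const])
  then show ?thesis by simp
qed

lemma sip_hom_zero:
  assumes w: "w \<in> L2_sphere" and orth: "\<And>l W. W \<in> spherical_harmonics l \<Longrightarrow> sip w W = 0"
  shows "sip w (hom c k) = 0"
proof -
  obtain H :: "nat \<Rightarrow> real^'a \<Rightarrow> real" where H: "\<And>l. H l \<in> spherical_harmonics l"
      "\<And>y. y \<in> sphere 0 1 \<Longrightarrow> hom c k y = (\<Sum>l\<le>k. H l y)"
    by (rule fischer_decomposition[of k c]) (rule that; assumption)
  have "sip w (hom c k) = sip w (\<lambda>y. \<Sum>l\<le>k. H l y)" by (rule sip_cong[OF refl H(2)])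
  also have "\<dots> = (\<Sum>l\<le>k. sip w (H l))"
    unfolding sum_distrib_left
    by (intro Bochner_Integration.integral_sum L2_sphere_integrable_mult[OF w] continuous_L2_sphere spherical_harmonics_continuous[OF H(1)])
  also have "\<dots> = 0" by (intro sum.neutral ballI orth[OF H(1)])
  finally show ?thesis .
qed

text \<open>Orthogonality passes from harmonics to forms by the Fischer decomposition, from forms to
  polynomials, and to continuous functions by uniform approximation.\<close>

lemma sip_continuous_zero:
  fixes w :: "real^'n::finite \<Rightarrow> real"
  assumes w: "w \<in> L2_sphere" and orth: "\<And>l W. W \<in> spherical_harmonics l \<Longrightarrow> sip w W = 0"
    and \<phi>: "continuous_on (sphere 0 1) \<phi>"
  shows "sip w \<phi> = 0"
proof -
  note I = L2_sphere_integrable_mult[OF w continuous_L2_sphere]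
  \<comment> \<open>Quantifying over all forms as a second factor makes the property stable under
    multiplication by a linear function, because a coordinate times a form is a form.\<close>
  define Q where "Q p \<longleftrightarrow> continuous_on (sphere 0 1) p \<and> (\<forall>c k. sip w (\<lambda>y. p y * hom c k y) = 0)" for p
  note hc = hpoly_continuous[OF hpolyI]
  have poly: "Q p \<Longrightarrow> Q (\<lambda>y. p y * g y)" if "real_polynomial_function g" for g p
    using that
  proof (induction g arbitrary: p)
    case (linear g)
    interpret bounded_linear g by fact
    have g: "g y = (\<Sum>i\<in>UNIV. g (axis i 1) * y $ i)" for y
    proof -
      have "g y = g (\<Sum>i\<in>UNIV. y $ i *\<^sub>R axis i 1)" using basis_expansion[of y] by (simp add: scalar_mult_eq_scaleR)
      then show ?thesis by (simp add: sum scaleR mult.commute)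
    qed
    have pc: "continuous_on (sphere 0 1) p" using linear.prems by (simp add: Q_def)
    have "sip w (\<lambda>y. p y * g y * hom c k y) = 0" for c k
    proof -
      have "w y * (p y * g y * hom c k y) = (\<Sum>i\<in>UNIV. g (axis i 1) * (w y * (p y * hom (xmul i c) (Suc k) y)))" for y
        by (subst g) (simp add: hom_xmul sum_distrib_left sum_distrib_right mult_ac)
      then have "sip w (\<lambda>y. p y * g y * hom c k y) = (\<integral>y. (\<Sum>i\<in>UNIV. g (axis i 1) * (w y * (p y * hom (xmul i c) (Suc k) y))) \<partial>sphere_measure)"
        by presburger
      also have "\<dots> = (\<Sum>i\<in>UNIV. (\<integral>y. g (axis i 1) * (w y * (p y * hom (xmul i c) (Suc k) y)) \<partial>sphere_measure))"
        by (intro Bochner_Integration.integral_sum integrable_mult_right I continuous_intros pc hc)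
      also have "\<dots> = 0" using linear.prems by (simp add: Q_def)
      finally show ?thesis .
    qed
    then show ?case using continuous_on_mult[OF pc linear_continuous_on[OF linear.hyps]] by (simp add: Q_def)
  next
    case (const a)
    have "w y * (p y * a * hom c k y) = a * (w y * (p y * hom c k y))" for c k y by simp
    then have "sip w (\<lambda>y. p y * a * hom c k y) = a * sip w (\<lambda>y. p y * hom c k y)" for c k
      by (simp only: integral_mult_right_zero)
    then show ?case using const by (simp add: Q_def continuous_on_mult_right)
  next
    case (add g1 g2)
    have Q: "Q (\<lambda>y. p y * g1 y)" "Q (\<lambda>y. p y * g2 y)" using add by blast+
    have "sip w (\<lambda>y. p y * (g1 y + g2 y) * hom c k y) = 0" for c k
    proof -
      have "sip w (\<lambda>y. p y * (g1 y + g2 y) * hom c k y) = (\<integral>y. w y * (p y * g1 y * hom c k y) + w y * (p y * g2 y * hom c k y) \<partial>sphere_measure)"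
        by (simp add: distrib_left distrib_right)
      also have "\<dots> = sip w (\<lambda>y. p y * g1 y * hom c k y) + sip w (\<lambda>y. p y * g2 y * hom c k y)"
        by (rule Bochner_Integration.integral_add; rule I; use Q hc in \<open>auto simp: Q_def intro!: continuous_on_mult\<close>)
      finally show ?thesis using Q by (simp add: Q_def)
    qed
    moreover have "continuous_on (sphere 0 1) (\<lambda>y. p y * (g1 y + g2 y))"
      using continuous_on_add[of "sphere 0 1" "\<lambda>y. p y * g1 y" "\<lambda>y. p y * g2 y"] Q by (simp add: Q_def distrib_left)
    ultimately show ?case by (simp add: Q_def)
  next
    case (mult g1 g2)
    have "Q (\<lambda>y. p y * g1 y)" using mult by blast
    then have "Q (\<lambda>y. (p y * g1 y) * g2 y)" using mult by blast
    then show ?case by (simp add: mult.assoc)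
  qed
  have "Q (\<lambda>y. 1)" 
  proof -
    have "sip w (hom c k) = 0" for c k by (rule sip_hom_zero[OF w]) (rule orth)
    then show ?thesis by (simp add: Q_def)
  qed
  have zero: "sip w g = 0" if "real_polynomial_function g" for g
  proof -
    have "Q (\<lambda>y. 1 * g y)" by (rule poly[OF that \<open>Q (\<lambda>y. 1)\<close>])
    then have "sip w (\<lambda>y. g y * hom (\<lambda>_. 1) 0 y) = 0" by (simp add: Q_def)
    then show ?thesis by (simp add: hom_0_eq)
  qed
  let ?S = "measure (sphere_measure :: (real^'n) measure) (space sphere_measure)"
  have "\<bar>sip w \<phi>\<bar> \<le> 0 + e" if "e > 0" for e
  proof -
    define \<delta> where "\<delta> = e / (L2_sphere_norm w * sqrt ?S + 1)"
    have pos: "L2_sphere_norm w * sqrt ?S + 1 > 0" by (intro add_nonneg_pos mult_nonneg_nonneg) auto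
    then have "\<delta> > 0" using that by (simp add: \<delta>_def)
    obtain g where g: "real_polynomial_function g" "\<And>y. y \<in> sphere 0 1 \<Longrightarrow> \<bar>\<phi> y - g y\<bar> < \<delta>"
      by (rule Stone_Weierstrass_real_polynomial_function[OF compact_sphere \<phi> \<open>\<delta> > 0\<close>]) (rule that; assumption)
    have gc: "continuous_on (sphere 0 1) g"
      by (intro continuous_on_polymonial_function) (simp add: g(1) real_polynomial_function_eq[symmetric])
    have dc: "continuous_on (sphere 0 1) (\<lambda>y. \<phi> y - g y)" by (intro continuous_intros \<phi> gc)
    have "sip w \<phi> = sip w (\<lambda>y. \<phi> y - g y)"
      using I[OF \<phi>] I[OF gc] zero[OF g(1)] by (simp add: right_diff_distrib)
    also have "\<bar>\<dots>\<bar> \<le> L2_sphere_norm w * L2_sphere_norm (\<lambda>y. \<phi> y - g y)"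
      by (rule sip_Cauchy_Schwarz[OF w continuous_L2_sphere[OF dc]])
    also have "\<dots> \<le> L2_sphere_norm w * (\<delta> * sqrt ?S)"
      by (intro mult_left_mono L2_sphere_norm_le_sup[OF dc]) (use g(2) \<open>\<delta> > 0\<close> in \<open>auto intro: less_imp_le\<close>)
    also have "\<dots> \<le> \<delta> * (L2_sphere_norm w * sqrt ?S + 1)" using \<open>\<delta> > 0\<close> by (simp add: algebra_simps)
    also have "\<dots> = e" using pos by (simp add: \<delta>_def)
    finally show ?thesis by simp
  qed
  then have "\<bar>sip w \<phi>\<bar> \<le> 0" by (rule field_le_epsilon)
  then show ?thesis by simp
qed

text \<open>For a compact subset K of the set where w > 0, the continuous cutoffs
  \<open>?\<phi> m\<close> converge to the indicator of K, so the integral of w over K is 0 and K is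
  null. Inner regularity then makes the whole set null.\<close>

lemma AE_nonpos_if_orthogonal:
  fixes w :: "real^'n::finite \<Rightarrow> real"
  assumes w: "w \<in> L2_sphere" and orth: "\<And>\<phi>. continuous_on (sphere 0 1) \<phi> \<Longrightarrow> sip w \<phi> = 0"
  shows "AE y in sphere_measure. w y \<le> 0"
proof -
  \<comment> \<open>Inner regularity is available for Borel measures on the whole space, whereas
    \<open>sphere_measure\<close> lives on the \<sigma>-algebra restricted to the sphere.\<close>
  let ?M = "distr (sphere_measure :: (real^'n) measure) borel (\<lambda>y. y)"
  have wm: "w \<in> borel_measurable sphere_measure" by (rule L2_sphere_measurable[OF w])
  have wi: "integrable sphere_measure w"
    using L2_sphere_integrable_mult[OF w continuous_L2_sphere[of "\<lambda>_. 1"]] by simp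
  have id: "(\<lambda>y. y) \<in> measurable (sphere_measure :: (real^'n) measure) borel"
    unfolding measurable_cong_sets[OF sets_sphere_measure refl] by (rule measurable_restrict_space1) simp
  define B where "B = {y \<in> space sphere_measure. w y > 0}"
  have Bs: "B \<in> sets sphere_measure" unfolding B_def using wm by measurable
  have "sphere 0 1 \<in> sets (borel :: (real^'n) measure)" by (intro borel_closed) simp
  then have sub: "A \<in> sets borel" if "A \<in> sets sphere_measure" for A :: "(real^'n) set"
    using that unfolding sets_sphere_measure by (auto simp: sets_restrict_space)
  have em: "emeasure ?M A = emeasure sphere_measure A" if "A \<in> sets borel" "A \<subseteq> sphere 0 1" for A
    using that by (simp add: emeasure_distr[OF id] space_sphere_measure Int_absorb2)
  have "emeasure sphere_measure K = 0" if K: "compact K" "K \<subseteq> B" for K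
  proof (cases "K = {}")
    case False
    have Ks: "K \<subseteq> sphere 0 1" using K(2) by (auto simp: B_def space_sphere_measure)
    have Kb: "K \<in> sets borel" using K(1) by (intro borel_closed compact_imp_closed)
    have Km: "K \<in> sets sphere_measure"
      unfolding sets_sphere_measure using Kb Ks by (auto simp: sets_restrict_space image_iff intro!: bexI[of _ K])
    let ?\<phi> = "\<lambda>m y. max 0 (1 - real m * infdist y K)"
    have "(\<lambda>m. sip w (?\<phi> m)) \<longlonglongrightarrow> (\<integral>y. w y * indicator K y \<partial>sphere_measure)"
    proof (rule integral_dominated_convergence[where w = "\<lambda>y. \<bar>w y\<bar>"])
      show "(\<lambda>y. w y * indicator K y) \<in> borel_measurable sphere_measure" using wm Km by measurable
      show "(\<lambda>y. w y * ?\<phi> m y) \<in> borel_measurable sphere_measure" for m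
        by (intro borel_measurable_times wm borel_measurable_sphere_measure continuous_intros)
      show "AE y in sphere_measure. (\<lambda>m. w y * ?\<phi> m y) \<longlonglongrightarrow> w y * indicator K y"
      proof (intro AE_I2 tendsto_mult tendsto_const)
        fix y :: "real^'n"
        show "(\<lambda>m. ?\<phi> m y) \<longlonglongrightarrow> indicator K y"
        proof (cases "y \<in> K")
          case True
          then show ?thesis by simp
        next
          case False
          then have "infdist y K > 0"
            using in_closed_iff_infdist_zero[OF compact_imp_closed[OF K(1)] \<open>K \<noteq> {}\<close>] infdist_nonneg[of y K] by fastforce
          then obtain m0 where m0: "1 < real m0 * infdist y K" using reals_Archimedean3 by blast
          have "?\<phi> m y = 0" if "m \<ge> m0" for m
          proof -
            have "real m0 * infdist y K \<le> real m * infdist y K" using that by (intro mult_right_mono infdist_nonneg) simp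
            then show ?thesis using m0 by simp
          qed
          then have "\<forall>\<^sub>F m in sequentially. ?\<phi> m y = 0" by (auto simp: eventually_sequentially)
          then show ?thesis using False by (simp add: tendsto_eventually)
        qed
      qed
      show "AE y in sphere_measure. norm (w y * ?\<phi> m y) \<le> \<bar>w y\<bar>" for m
        by (rule AE_I2) (simp add: abs_mult mult_left_le infdist_nonneg)
    qed (use wi in auto)
    moreover have "sip w (?\<phi> m) = 0" for m by (intro orth continuous_intros)
    ultimately have "(\<integral>y. w y * indicator K y \<partial>sphere_measure) = 0" using LIMSEQ_unique[OF _ tendsto_const] by force
    moreover have "integrable sphere_measure (\<lambda>y. w y * indicator K y)" by (rule integrable_real_mult_indicator[OF Km wi])
    moreover have "AE y in sphere_measure. 0 \<le> w y * indicator K y"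
      using K(2) by (intro AE_I2) (auto simp: indicator_def B_def)
    ultimately have "AE y in sphere_measure. w y * indicator K y = 0" by (simp add: integral_nonneg_eq_0_iff_AE)
    then have "AE y in sphere_measure. y \<notin> K"
      by (rule AE_mp) (intro AE_I2, use K(2) in \<open>auto simp: B_def indicator_def\<close>)
    then have "K \<in> null_sets sphere_measure" using AE_iff_null_sets[OF Km] by blast
    then show ?thesis by (rule null_setsD1)
  qed simp
  note Kzero = this
  have "emeasure ?M B = (SUP K\<in>{K. K \<subseteq> B \<and> compact K}. emeasure ?M K)"
  proof (rule inner_regular)
    show "emeasure ?M (space ?M) \<noteq> \<infinity>" by (simp add: emeasure_distr[OF id] sphere.emeasure_finite)
  qed (use sub[OF Bs] in auto)
  also have "\<dots> \<le> 0"
  proof (rule SUP_least)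
    fix K assume "K \<in> {K. K \<subseteq> B \<and> compact K}"
    then have K: "compact K" "K \<subseteq> B" by auto
    then have "emeasure ?M K = emeasure sphere_measure K"
      by (intro em borel_closed compact_imp_closed) (auto simp: B_def space_sphere_measure)
    then show "emeasure ?M K \<le> 0" using Kzero[OF K] by simp
  qed
  finally have "emeasure ?M B = 0" by simp
  then have "emeasure sphere_measure B = 0"
    using em[OF sub[OF Bs]] by (simp add: B_def space_sphere_measure subset_iff)
  then have "B \<in> null_sets sphere_measure" using Bs by (simp add: null_sets_def)
  then show ?thesis by (rule AE_I') (auto simp: B_def)
qed

lemma AE_zero_if_orthogonal:
  fixes w :: "real^'n::finite \<Rightarrow> real"
  assumes w: "w \<in> L2_sphere" and orth: "\<And>l W. W \<in> spherical_harmonics l \<Longrightarrow> sip w W = 0"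
  shows "AE y in sphere_measure. w y = 0"
proof -
  have z: "sip w \<phi> = 0" if "continuous_on (sphere 0 1) \<phi>" for \<phi>
    by (rule sip_continuous_zero[OF w _ that]) (rule orth)
  have "AE y in sphere_measure. w y \<le> 0" by (rule AE_nonpos_if_orthogonal[OF w z])
  moreover have "AE y in sphere_measure. - w y \<le> 0"
  proof (rule AE_nonpos_if_orthogonal)
    show "(\<lambda>y. - w y) \<in> L2_sphere" using L2_sphere_linear[OF w w, of "-1" 0] by simp
    show "sip (\<lambda>y. - w y) \<phi> = 0" if "continuous_on (sphere 0 1) \<phi>" for \<phi> using z[OF that] by simp
  qed
  ultimately show ?thesis by eventually_elim simp
qed

lemma Zball_boundary_unique:
  fixes u v :: "real^'n::finite \<Rightarrow> real"
  assumes n: "CARD('n) \<ge> 2" and R: "R > 0" and u: "u \<in> Zball_space s R" and v: "v \<in> Zball_space s R"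
    and eq: "\<And>x. x \<in> ball 0 R \<Longrightarrow> v x = u x"
  shows "AE y in sphere_measure. v (R *\<^sub>R y) = u (R *\<^sub>R y)"
proof -
  have L: "(\<lambda>y. z (R *\<^sub>R y)) \<in> L2_sphere" if "z \<in> Zball_space s R" for z :: "real^'n \<Rightarrow> real"
    using that R unfolding Zball_space_def by (auto intro: Z_space_L2)
  have "AE y in sphere_measure. v (R *\<^sub>R y) - u (R *\<^sub>R y) = 0"
    by (rule AE_zero_if_orthogonal[OF L2_sphere_diff[OF L[OF v] L[OF u]] sip_boundary_zero[OF n R u v eq]])
  then show ?thesis by simp
qed

section \<open>The correspondence between harmonic functions and solutions\<close>

text \<open>Injectivity is expressed for solutions whose radii may differ: agreement on the smaller
  ball determines the harmonic part on the whole unit ball.\<close>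

theorem theorem1p11:
  fixes f :: "real \<Rightarrow> real" and s :: real
  assumes "CARD('n::finite) \<ge> 2"
    and "analytic_real f"
    and "f 0 = 0"
    and "s > real CARD('n) / 2 + 3 / 2"
  shows
    "(\<forall>u :: real^'n \<Rightarrow> real.
        smooth_on (ball 0 1) u \<and> (\<forall>x\<in>ball 0 1. laplacian u x = f (u x)) \<longrightarrow>
        (\<exists>r\<^sub>0 u\<^sub>L. 0 < r\<^sub>0 \<and> r\<^sub>0 < 1 \<and> harmonic_on (ball 0 r\<^sub>0) u\<^sub>L \<and> decomposes r\<^sub>0 u u\<^sub>L)) \<and>
     (\<forall>u\<^sub>L :: real^'n \<Rightarrow> real.
        harmonic_on (ball 0 1) u\<^sub>L \<and> bounded (u\<^sub>L ` ball 0 1) \<and> u\<^sub>L 0 = 0 \<longrightarrow>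
        (\<exists>r\<^sub>0 u. 0 < r\<^sub>0 \<and> r\<^sub>0 \<le> 1 \<and> unique_small_solution f s u\<^sub>L r\<^sub>0 u)) \<and>
     (\<forall>(u\<^sub>L :: real^'n \<Rightarrow> real) u\<^sub>L' r\<^sub>0 r\<^sub>0' u u'.
        harmonic_on (ball 0 1) u\<^sub>L \<and> bounded (u\<^sub>L ` ball 0 1) \<and> u\<^sub>L 0 = 0 \<and>
        harmonic_on (ball 0 1) u\<^sub>L' \<and> bounded (u\<^sub>L' ` ball 0 1) \<and> u\<^sub>L' 0 = 0 \<and>
        0 < r\<^sub>0 \<and> r\<^sub>0 \<le> 1 \<and> unique_small_solution f s u\<^sub>L r\<^sub>0 u \<and>
        0 < r\<^sub>0' \<and> r\<^sub>0' \<le> 1 \<and> unique_small_solution f s u\<^sub>L' r\<^sub>0' u' \<and>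
        (\<forall>x\<in>ball 0 (min r\<^sub>0 r\<^sub>0'). u x = u' x) \<longrightarrow>
        (\<forall>x\<in>ball 0 1. u\<^sub>L x = u\<^sub>L' x))"
proof (intro conjI allI impI)
  fix u :: "real^'n \<Rightarrow> real"
  assume "smooth_on (ball 0 1) u \<and> (\<forall>x\<in>ball 0 1. laplacian u x = f (u x))"
  then show "\<exists>r\<^sub>0 u\<^sub>L. 0 < r\<^sub>0 \<and> r\<^sub>0 < 1 \<and> harmonic_on (ball 0 r\<^sub>0) u\<^sub>L \<and> decomposes r\<^sub>0 u u\<^sub>L"
    using solution_decomposes[of u f] assms(2) by blast
next
  fix u\<^sub>L :: "real^'n \<Rightarrow> real"
  assume uL: "harmonic_on (ball 0 1) u\<^sub>L \<and> bounded (u\<^sub>L ` ball 0 1) \<and> u\<^sub>L 0 = 0"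
  obtain c \<rho> where c: "\<rho> > 0" "\<rho> < 1" "aconv c \<rho>"
      and sol: "\<And>r. 0 < r \<Longrightarrow> r \<le> \<rho> \<Longrightarrow> analytic_solution f u\<^sub>L r (psum c)"
      and uniq: "\<And>r v x. 0 < r \<Longrightarrow> r \<le> \<rho> \<Longrightarrow> analytic_solution f u\<^sub>L r v \<Longrightarrow> x \<in> ball 0 r \<Longrightarrow> v x = psum c x"
    by (rule local_solution[OF assms(2) conjunct1[OF uL] conjunct2[OF conjunct2[OF uL]]]) (rule that; assumption)
  have mem: "psum c \<in> Zball_space s (\<rho>/4)" by (rule psum_mem_Zball_space[OF assms(1) c(3,1)])
  have "unique_small_solution f s u\<^sub>L (\<rho>/4) (psum c)"
    unfolding unique_small_solution_def
  \<comment> \<open>Uniqueness is available for every analytic solution on this ball with the given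
    harmonic part, so any threshold above the norm of the constructed solution serves.\<close>
  proof (intro exI[of _ "\<bar>Zball_norm s (\<rho>/4) (psum c)\<bar> + 1"] conjI allI impI)
    show "analytic_solution f u\<^sub>L (\<rho>/4) (psum c)" using c by (intro sol) auto
    fix v assume v: "v \<in> Zball_space s (\<rho>/4) \<and> Zball_norm s (\<rho>/4) v < \<bar>Zball_norm s (\<rho>/4) (psum c)\<bar> + 1 \<and> analytic_solution f u\<^sub>L (\<rho>/4) v"
    have eq: "v x = psum c x" if "x \<in> ball 0 (\<rho>/4)" for x
      by (rule uniq[of "\<rho>/4"]) (use v c that in auto)
    then show "\<forall>x\<in>ball 0 (\<rho>/4). v x = psum c x" by blast
    show "AE y in sphere_measure. v ((\<rho>/4) *\<^sub>R y) = psum c ((\<rho>/4) *\<^sub>R y)"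
      by (rule Zball_boundary_unique[OF assms(1) _ mem _ eq]) (use v c in auto)
  qed (use mem in auto)
  then show "\<exists>r\<^sub>0 u. 0 < r\<^sub>0 \<and> r\<^sub>0 \<le> 1 \<and> unique_small_solution f s u\<^sub>L r\<^sub>0 u"
    using c by (intro exI[of _ "\<rho>/4"] exI[of _ "psum c"]) auto
next
  fix u\<^sub>L u\<^sub>L' :: "real^'n \<Rightarrow> real" and r\<^sub>0 r\<^sub>0' u u'
  assume H: "harmonic_on (ball 0 1) u\<^sub>L \<and> bounded (u\<^sub>L ` ball 0 1) \<and> u\<^sub>L 0 = 0 \<and>
        harmonic_on (ball 0 1) u\<^sub>L' \<and> bounded (u\<^sub>L' ` ball 0 1) \<and> u\<^sub>L' 0 = 0 \<and>
        0 < r\<^sub>0 \<and> r\<^sub>0 \<le> 1 \<and> unique_small_solution f s u\<^sub>L r\<^sub>0 u \<and>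
        0 < r\<^sub>0' \<and> r\<^sub>0' \<le> 1 \<and> unique_small_solution f s u\<^sub>L' r\<^sub>0' u' \<and>
        (\<forall>x\<in>ball 0 (min r\<^sub>0 r\<^sub>0'). u x = u' x)"
  then have "analytic_solution f u\<^sub>L r\<^sub>0 u" "analytic_solution f u\<^sub>L' r\<^sub>0' u'"
    by (auto simp: unique_small_solution_def)
  then have "real_analytic_on (ball 0 r\<^sub>0) u" "decomposes r\<^sub>0 u u\<^sub>L" "decomposes r\<^sub>0' u' u\<^sub>L'"
    by (auto simp: analytic_solution_def)
  then show "\<forall>x\<in>ball 0 1. u\<^sub>L x = u\<^sub>L' x"
    using H harmonic_part_unique[of u\<^sub>L u\<^sub>L' r\<^sub>0 r\<^sub>0' u u'] by blast
qed

end
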